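(* Let $a\ge 0$, $\sigma\ge 1$, $\alpha\ge\frac12$, $\beta\ge\frac12$, and set $$q_{\alpha,\beta}:=\max\Big\{1-2\alpha,\ \tfrac{\alpha(1-2\beta)}{\beta},\ \tfrac{\beta(1-2\alpha)}{\alpha}\Big\}.$$ Let $s\in[\max\{-1,q_{\alpha,\beta}\},0]$ and let $(u_0,\theta_0)\in\mathcal{X}_{a,\sigma}^s(\mathbb{R}^3)$ with $\operatorname{div}u_0=0$. In the case $s=q_{\alpha,\beta}$, assume in addition that $\|(u_0,\theta_0)\|_{\mathcal{X}_{a,\sigma}^s}$ is sufficiently small (smaller than a positive constant depending only on $a,\sigma,s,\alpha,\beta$). Then there exist $T>0$ and positive constants $C_1,C_2$ such that there is a unique (mild) solution $$(u,\theta)\in\big[C_T(\mathcal{X}_{a,\sigma}^s(\mathbb{R}^3))\cap L^1_T(\mathcal{X}_{a,\sigma}^{s+2\alpha}(\mathbb{R}^3))\big]\times\big[C_T(\mathcal{X}_{a,\sigma}^s(\mathbb{R}^3))\cap L^1_T(\mathcal{X}_{a,\sigma}^{s+2\beta}(\mathbb{R}^3))\big]$$ of the fractional Boussinesq equations with initial data $(u_0,\theta_0)$ satisfying $$\|u\|_{L^\infty_T(\mathcal{X}_{a,\sigma}^{s})}+\|u\|_{L^1_T(\mathcal{X}_{a,\sigma}^{s+2\alpha})}+\|\theta\|_{L^\infty_T(\mathcal{X}_{a,\sigma}^{s})}+\|\theta\|_{L^1_T(\mathcal{X}_{a,\sigma}^{s+2\beta})}<C_1 .$$ Moreover, $$\|u\|_{L^\infty_T(\mathcal{X}_{a,\sigma}^{s})}+\|u\|_{L^1_T(\mathcal{X}_{a,\sigma}^{s+2\alpha})}+\|\theta\|_{L^\infty_T(\mathcal{X}_{a,\sigma}^{s})}+\|\theta\|_{L^1_T(\mathcal{X}_{a,\sigma}^{s+2\beta})}\le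 C_2\,\|(u_0,\theta_0)\|_{\mathcal{X}_{a,\sigma}^{s}},$$ and, for every $p\ge 1$ (real), $$(u,\theta)\in L^p_T(\mathcal{X}_{a,\sigma}^{s+\frac{2\alpha}{p}}(\mathbb{R}^3))\times L^p_T(\mathcal{X}_{a,\sigma}^{s+\frac{2\beta}{p}}(\mathbb{R}^3)).$$
   Context: Equations. The fractional Boussinesq equations on $\mathbb{R}^3$ are $$u_t+(-\Delta)^\alpha u+u\cdot\nabla u+\nabla p=\theta e_3,\quad \theta_t+(-\Delta)^\beta\theta+u\cdot\nabla\theta=0,\quad \operatorname{div}u=0\quad (x\in\mathbb{R}^3,\ t>0),$$ with $u(x,0)=u_0(x)$, $\theta(x,0)=\theta_0(x)$, where $u(x,t)\in\mathbb{R}^3$, $p(x,t),\theta(x,t)\in\mathbb{R}$, $e_3=(0,0,1)$, and $\operatorname{div}u_0=0$. The Fourier transform is $\widehat f(\xi)=\mathcal{F}(f)(\xi)=\int_{\mathbb{R}^3}e^{-i\xi\cdot x}f(x)\,dx$, and $\mathcal{F}[(-\Delta)^\gamma f](\xi)=|\xi|^{2\gamma}\widehat f(\xi)$. Spaces. For $a\ge0$, $\sigma\ge1$, $s\in\mathbb{R}$, $$\mathcal{X}_{a,\sigma}^s(\mathbb{R}^3)=\Big\{f\in S'(\mathbb{R}^3):\widehat f\in L^1_{\mathrm{loc}}(\mathbb{R}^3),\ \|f\|_{\mathcal{X}_{a,\sigma}^s}:=\int_{\mathbb{R}^3}|\xi|^s e^{a|\xi|^{1/\sigma}}|\widehat f(\xi)|\,d\xi<\infty\Big\},$$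 with $S'$ the tempered distributions; for vector-valued $f$, $|\widehat f(\xi)|$ is the Euclidean norm. For a pair, $(f,g)\in\mathcal{X}_{a,\sigma}^s$ means that both entries belong to the space, and $\|(f,g)\|_{\mathcal{X}_{a,\sigma}^s}=\|f\|_{\mathcal{X}_{a,\sigma}^s}+\|g\|_{\mathcal{X}_{a,\sigma}^s}$. For a normed space $X$ and $T>0$: $C_T(X)=C([0,T];X)$ with norm $\|f\|_{L^\infty_T(X)}=\sup_{t\in[0,T]}\|f(t)\|_X$, and $L^p_T(X)=L^p([0,T];X)$ with its usual norm ($1\le p<\infty$). Solutions. Solutions are understood in the mild sense: with $\mathbb{P}$ the Leray projector onto divergence-free fields and $e^{-t(-\Delta)^\gamma}$ the Fourier multiplier $e^{-t|\xi|^{2\gamma}}$, $(u,\theta)$ satisfies $\operatorname{div}u=0$ and $$u(t)=e^{-t(-\Delta)^\alpha}u_0-\int_0^t e^{-(t-\tau)(-\Delta)^\alpha}\mathbb{P}(u\cdot\nabla u)\,d\tau+\int_0^t e^{-(t-\tau)(-\Delta)^\alpha}\mathbb{P}(\theta e_3)\,d\tau,$$ $$\theta(t)=e^{-t(-\Delta)^\beta}\theta_0-\int_0^t e^{-(t-\tau)(-\Delta)^\beta}(u\cdot\nabla\theta)\,d\tau .$$ *)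

theory Defs
  imports "HOL-Analysis.Analysis"
begin

section \<open>Schwartz functions and tempered distributions on three-dimensional space\<close>

definition pd :: "3 \<Rightarrow> (real^3 \<Rightarrow> complex) \<Rightarrow> real^3 \<Rightarrow> complex" where
  "pd j \<phi> = (\<lambda>x. frechet_derivative \<phi> (at x) (axis j 1))"

definition pds :: "3 list \<Rightarrow> (real^3 \<Rightarrow> complex) \<Rightarrow> real^3 \<Rightarrow> complex" where
  "pds js \<phi> = foldr pd js \<phi>"

definition smooth :: "(real^3 \<Rightarrow> complex) \<Rightarrow> bool" where
  "smooth \<phi> \<longleftrightarrow> (\<forall>js x. pds js \<phi> differentiable (at x))"

definition test_fun :: "(real^3 \<Rightarrow> complex) \<Rightarrow> bool" where
  "test_fun \<phi> \<longleftrightarrow> smooth \<phi> \<and> bounded {x. \<phi> x \<noteq> 0}"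

definition schwartz :: "(real^3 \<Rightarrow> complex) \<Rightarrow> bool" where
  "schwartz \<phi> \<longleftrightarrow> smooth \<phi> \<and>
     (\<forall>k js. bdd_above (range (\<lambda>x. (1 + norm x) ^ k * cmod (pds js \<phi> x))))"

definition schwartz_norm :: "nat \<Rightarrow> (real^3 \<Rightarrow> complex) \<Rightarrow> real" where
  "schwartz_norm k \<phi> =
     (\<Sum>js | length js \<le> k. SUP x. (1 + norm x) ^ k * cmod (pds js \<phi> x))"

text \<open>
  Tempered distributions are the continuous complex-linear functionals on the Schwartz space;
  they are extended by 0 to all functions so that equality of distributions is equality
  of functionals.
\<close>

definition tempered :: "((real^3 \<Rightarrow> complex) \<Rightarrow> complex) \<Rightarrow> bool" where
  "tempered L \<longleftrightarrow>
     (\<forall>\<phi>. \<not> schwartz \<phi> \<longrightarrow> L \<phi> = 0) \<and>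
     (\<forall>\<phi> \<psi>. schwartz \<phi> \<longrightarrow> schwartz \<psi> \<longrightarrow> L (\<lambda>x. \<phi> x + \<psi> x) = L \<phi> + L \<psi>) \<and>
     (\<forall>c \<phi>. schwartz \<phi> \<longrightarrow> L (\<lambda>x. c * \<phi> x) = c * L \<phi>) \<and>
     (\<exists>C k. \<forall>\<phi>. schwartz \<phi> \<longrightarrow> cmod (L \<phi>) \<le> C * schwartz_norm k \<phi>)"

lemma temperedI:
  assumes "\<And>\<phi>. \<not> schwartz \<phi> \<Longrightarrow> L \<phi> = 0"
    and "\<And>\<phi> \<psi>. schwartz \<phi> \<Longrightarrow> schwartz \<psi> \<Longrightarrow> L (\<lambda>x. \<phi> x + \<psi> x) = L \<phi> + L \<psi>"
    and "\<And>c \<phi>. schwartz \<phi> \<Longrightarrow> L (\<lambda>x. c * \<phi> x) = c * L \<phi>"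
    and "\<And>\<phi>. schwartz \<phi> \<Longrightarrow> cmod (L \<phi>) \<le> C * schwartz_norm k \<phi>"
  shows "tempered L"
  unfolding tempered_def using assms by blast

typedef tdist = "{L. tempered L}" morphisms pairing Abs_tdist
proof -
  have "tempered (\<lambda>_. 0)" by (rule temperedI[where C = 0 and k = 0]) auto
  then show ?thesis by blast
qed

setup_lifting type_definition_tdist

lemma finite_multi: "finite {js :: 3 list. length js \<le> k}"
  using finite_lists_length_le[of "UNIV :: 3 set" k] by simp

lemma schwartz_bdd:
  "schwartz \<phi> \<Longrightarrow> bdd_above (range (\<lambda>x. (1 + norm x) ^ k * cmod (pds js \<phi> x)))"
  by (simp add: schwartz_def)

lemma schwartz_term_nonneg:
  assumes "schwartz \<phi>"
  shows "0 \<le> (SUP x. (1 + norm x) ^ k * cmod (pds js \<phi> x))"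
  by (rule cSUP_upper2[OF schwartz_bdd[OF assms], of 0]) auto

lemma schwartz_term_mono:
  assumes "schwartz \<phi>" "k \<le> l"
  shows "(SUP x. (1 + norm x) ^ k * cmod (pds js \<phi> x)) \<le> (SUP x. (1 + norm x) ^ l * cmod (pds js \<phi> x))"
proof (rule cSUP_mono)
  show "\<exists>y\<in>UNIV. (1 + norm x) ^ k * cmod (pds js \<phi> x) \<le> (1 + norm y) ^ l * cmod (pds js \<phi> y)" for x
    using assms(2) by (intro bexI[of _ x] mult_right_mono power_increasing) auto
qed (use assms in \<open>auto intro: schwartz_bdd\<close>)

lemma schwartz_norm_nonneg: "schwartz \<phi> \<Longrightarrow> 0 \<le> schwartz_norm k \<phi>"
  unfolding schwartz_norm_def by (intro sum_nonneg schwartz_term_nonneg)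

lemma schwartz_norm_mono:
  assumes "schwartz \<phi>" "k \<le> l"
  shows "schwartz_norm k \<phi> \<le> schwartz_norm l \<phi>"
proof -
  have "schwartz_norm k \<phi> \<le> (\<Sum>js | length js \<le> k. SUP x. (1 + norm x) ^ l * cmod (pds js \<phi> x))"
    unfolding schwartz_norm_def by (intro sum_mono schwartz_term_mono assms)
  also have "\<dots> \<le> schwartz_norm l \<phi>"
    unfolding schwartz_norm_def using assms
    by (intro sum_mono2 finite_multi schwartz_term_nonneg) auto
  finally show ?thesis .
qed

instantiation tdist :: ab_group_add
begin

lift_definition zero_tdist :: tdist is "\<lambda>_. 0"
  by (rule temperedI[where C = 0 and k = 0]) auto

lift_definition uminus_tdist :: "tdist \<Rightarrow> tdist" is "\<lambda>L \<phi>. - L \<phi>"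
  unfolding tempered_def by auto

lift_definition plus_tdist :: "tdist \<Rightarrow> tdist \<Rightarrow> tdist" is "\<lambda>L M \<phi>. L \<phi> + M \<phi>"
proof -
  fix L M :: "(real^3 \<Rightarrow> complex) \<Rightarrow> complex"
  assume L: "tempered L" and M: "tempered M"
  obtain C k where Ck: "\<And>\<phi>. schwartz \<phi> \<Longrightarrow> cmod (L \<phi>) \<le> C * schwartz_norm k \<phi>"
    using L unfolding tempered_def by blast
  obtain D l where Dl: "\<And>\<phi>. schwartz \<phi> \<Longrightarrow> cmod (M \<phi>) \<le> D * schwartz_norm l \<phi>"
    using M unfolding tempered_def by blast
  show "tempered (\<lambda>\<phi>. L \<phi> + M \<phi>)"
  proof (rule temperedI[where C = "\<bar>C\<bar> + \<bar>D\<bar>" and k = "max k l"])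
    fix \<phi> assume \<phi>: "schwartz \<phi>"
    have "C * schwartz_norm k \<phi> \<le> \<bar>C\<bar> * schwartz_norm (max k l) \<phi>"
      using \<phi> by (intro mult_mono schwartz_norm_mono schwartz_norm_nonneg) auto
    moreover have "D * schwartz_norm l \<phi> \<le> \<bar>D\<bar> * schwartz_norm (max k l) \<phi>"
      using \<phi> by (intro mult_mono schwartz_norm_mono schwartz_norm_nonneg) auto
    ultimately show "cmod (L \<phi> + M \<phi>) \<le> (\<bar>C\<bar> + \<bar>D\<bar>) * schwartz_norm (max k l) \<phi>"
      using Ck[OF \<phi>] Dl[OF \<phi>] norm_triangle_ineq[of "L \<phi>" "M \<phi>"]
      by (simp add: distrib_right)
  qed (use L M in \<open>auto simp: tempered_def algebra_simps\<close>)
qed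

definition minus_tdist :: "tdist \<Rightarrow> tdist \<Rightarrow> tdist" where
  "minus_tdist f g = f + - g"

instance
proof
  fix f g h :: tdist
  show "f + g + h = f + (g + h)" by transfer (simp add: add.assoc)
  show "f + g = g + f" by transfer (simp add: add.commute)
  show "0 + f = f" by transfer simp
  show "- f + f = 0" by transfer simp
  show "f - g = f + - g" by (rule minus_tdist_def)
qed

end

lemma pds_add:
  assumes "smooth \<phi>" "smooth \<psi>"
  shows "pds js (\<lambda>x. \<phi> x + \<psi> x) = (\<lambda>x. pds js \<phi> x + pds js \<psi> x)"
proof (induction js)
  case Nil
  then show ?case by (simp add: pds_def)
next
  case (Cons j js)
  have "frechet_derivative (\<lambda>x. pds js \<phi> x + pds js \<psi> x) (at x) =
      (\<lambda>h. frechet_derivative (pds js \<phi>) (at x) h + frechet_derivative (pds js \<psi>) (at x) h)" for x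
    using assms unfolding smooth_def
    by (intro frechet_derivative_at[symmetric] has_derivative_add)
       (auto simp: frechet_derivative_works[symmetric])
  then show ?case using Cons by (simp add: pds_def pd_def)
qed

lemma pds_cmul:
  assumes "smooth \<phi>"
  shows "pds js (\<lambda>x. c * \<phi> x) = (\<lambda>x. c * pds js \<phi> x)"
proof (induction js)
  case Nil
  then show ?case by (simp add: pds_def)
next
  case (Cons j js)
  have "frechet_derivative (\<lambda>x. c * pds js \<phi> x) (at x) =
      (\<lambda>h. c * frechet_derivative (pds js \<phi>) (at x) h)" for x
    using assms unfolding smooth_def
    by (intro frechet_derivative_at[symmetric] has_derivative_mult_right)
       (auto simp: frechet_derivative_works[symmetric])
  then show ?case using Cons by (simp add: pds_def pd_def)
qed

lemma pds_pd: "pds js (pd j \<phi>) = pds (js @ [j]) \<phi>"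
  by (simp add: pds_def)

lemma schwartz_add:
  assumes "schwartz \<phi>" "schwartz \<psi>"
  shows "schwartz (\<lambda>x. \<phi> x + \<psi> x)"
proof -
  have s: "smooth \<phi>" "smooth \<psi>" using assms by (auto simp: schwartz_def)
  have "bdd_above (range (\<lambda>x. (1 + norm x) ^ k * cmod (pds js \<phi> x + pds js \<psi> x)))" for k js
  proof -
    obtain A where A: "\<And>x. (1 + norm x) ^ k * cmod (pds js \<phi> x) \<le> A"
      using schwartz_bdd[OF assms(1), of k js] by (auto simp: bdd_above_def)
    obtain B where B: "\<And>x. (1 + norm x) ^ k * cmod (pds js \<psi> x) \<le> B"
      using schwartz_bdd[OF assms(2), of k js] by (auto simp: bdd_above_def)
    have "(1 + norm x) ^ k * cmod (pds js \<phi> x + pds js \<psi> x) \<le> A + B" for x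
    proof -
      have "(1 + norm x) ^ k * cmod (pds js \<phi> x + pds js \<psi> x)
          \<le> (1 + norm x) ^ k * (cmod (pds js \<phi> x) + cmod (pds js \<psi> x))"
        by (intro mult_left_mono norm_triangle_ineq) auto
      also have "\<dots> \<le> A + B" using A[of x] B[of x] by (simp add: distrib_left)
      finally show ?thesis .
    qed
    then show ?thesis by (auto intro!: bdd_aboveI)
  qed
  then show ?thesis
    using s by (auto simp: schwartz_def smooth_def pds_add)
qed

lemma schwartz_cmul:
  assumes "schwartz \<phi>"
  shows "schwartz (\<lambda>x. c * \<phi> x)"
proof -
  have s: "smooth \<phi>" using assms by (auto simp: schwartz_def)
  have "bdd_above (range (\<lambda>x. (1 + norm x) ^ k * cmod (c * pds js \<phi> x)))" for k js
  proof -
    obtain A where A: "\<And>x. (1 + norm x) ^ k * cmod (pds js \<phi> x) \<le> A"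
      using schwartz_bdd[OF assms(1), of k js] by (auto simp: bdd_above_def)
    have "(1 + norm x) ^ k * cmod (c * pds js \<phi> x) \<le> cmod c * A" for x
      using mult_left_mono[OF A[of x], of "cmod c"] by (simp add: norm_mult mult_ac)
    then show ?thesis by (auto intro!: bdd_aboveI)
  qed
  then show ?thesis
    using s by (auto simp: schwartz_def smooth_def pds_cmul)
qed

lemma schwartz_pd: "schwartz \<phi> \<Longrightarrow> schwartz (pd j \<phi>)"
  by (auto simp: schwartz_def smooth_def pds_pd)

lemma schwartz_norm_pd:
  assumes "schwartz \<phi>"
  shows "schwartz_norm k (pd j \<phi>) \<le> schwartz_norm (Suc k) \<phi>"
proof -
  have "schwartz_norm k (pd j \<phi>) \<le>
      (\<Sum>js | length js \<le> k. SUP x. (1 + norm x) ^ Suc k * cmod (pds (js @ [j]) \<phi> x))"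
    unfolding schwartz_norm_def pds_pd by (intro sum_mono schwartz_term_mono assms) auto
  also have "\<dots> = (\<Sum>js \<in> (\<lambda>js. js @ [j]) ` {js. length js \<le> k}.
      SUP x. (1 + norm x) ^ Suc k * cmod (pds js \<phi> x))"
    by (subst sum.reindex) (auto simp: inj_on_def)
  also have "\<dots> \<le> schwartz_norm (Suc k) \<phi>"
    unfolding schwartz_norm_def
    by (intro sum_mono2 finite_multi schwartz_term_nonneg assms) auto
  finally show ?thesis .
qed

lift_definition tderiv :: "3 \<Rightarrow> tdist \<Rightarrow> tdist"
  is "\<lambda>j L \<phi>. if schwartz \<phi> then - L (pd j \<phi>) else 0"
proof -
  fix j :: 3 and L assume L: "tempered L"
  obtain C k where Ck: "\<And>\<phi>. schwartz \<phi> \<Longrightarrow> cmod (L \<phi>) \<le> C * schwartz_norm k \<phi>"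
    using L unfolding tempered_def by blast
  show "tempered (\<lambda>\<phi>. if schwartz \<phi> then - L (pd j \<phi>) else 0)"
  proof (rule temperedI[where C = "\<bar>C\<bar>" and k = "Suc k"])
    fix \<phi> \<psi> assume s: "schwartz \<phi>" "schwartz \<psi>"
    then have "pd j (\<lambda>x. \<phi> x + \<psi> x) = (\<lambda>x. pd j \<phi> x + pd j \<psi> x)"
      using pds_add[of \<phi> \<psi> "[j]"] by (simp add: pds_def schwartz_def)
    moreover have "L (\<lambda>x. pd j \<phi> x + pd j \<psi> x) = L (pd j \<phi>) + L (pd j \<psi>)"
      using L s schwartz_pd unfolding tempered_def by blast
    ultimately show "(if schwartz (\<lambda>x. \<phi> x + \<psi> x) then - L (pd j (\<lambda>x. \<phi> x + \<psi> x)) else 0) =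
        (if schwartz \<phi> then - L (pd j \<phi>) else 0) + (if schwartz \<psi> then - L (pd j \<psi>) else 0)"
      using s schwartz_add[OF s] by simp
  next
    fix c \<phi> assume s: "schwartz \<phi>"
    then have "pd j (\<lambda>x. c * \<phi> x) = (\<lambda>x. c * pd j \<phi> x)"
      using pds_cmul[of \<phi> "[j]" c] by (simp add: pds_def schwartz_def)
    moreover have "L (\<lambda>x. c * pd j \<phi> x) = c * L (pd j \<phi>)"
      using L s schwartz_pd unfolding tempered_def by blast
    ultimately show "(if schwartz (\<lambda>x. c * \<phi> x) then - L (pd j (\<lambda>x. c * \<phi> x)) else 0) =
        c * (if schwartz \<phi> then - L (pd j \<phi>) else 0)"
      using s schwartz_cmul[OF s] by simp
  next
    fix \<phi> assume s: "schwartz \<phi>"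
    have "cmod (L (pd j \<phi>)) \<le> C * schwartz_norm k (pd j \<phi>)"
      using Ck schwartz_pd[OF s] by blast
    also have "\<dots> \<le> \<bar>C\<bar> * schwartz_norm (Suc k) \<phi>"
      using s schwartz_pd[OF s] schwartz_norm_pd[OF s]
      by (intro mult_mono schwartz_norm_nonneg) auto
    finally show "cmod (if schwartz \<phi> then - L (pd j \<phi>) else 0) \<le> \<bar>C\<bar> * schwartz_norm (Suc k) \<phi>"
      using s by simp
  qed auto
qed

definition real_dist :: "tdist \<Rightarrow> bool" where
  "real_dist f \<longleftrightarrow> (\<forall>\<phi>. schwartz \<phi> \<longrightarrow> pairing f (\<lambda>x. cnj (\<phi> x)) = cnj (pairing f \<phi>))"

definition div_free :: "tdist^3 \<Rightarrow> bool" where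
  "div_free u \<longleftrightarrow> (\<Sum>j\<in>UNIV. tderiv j (u $ j)) = 0"


section \<open>Fourier transform\<close>

definition fourier_fun :: "(real^3 \<Rightarrow> complex) \<Rightarrow> real^3 \<Rightarrow> complex" where
  "fourier_fun \<phi> \<xi> = (LINT x|lborel. cis (- (\<xi> \<bullet> x)) * \<phi> x)"

definition loc_integrable :: "(real^3 \<Rightarrow> complex) \<Rightarrow> bool" where
  "loc_integrable g \<longleftrightarrow> (\<forall>K. compact K \<longrightarrow> set_integrable lborel K g)"

text \<open>
  \<open>has_ft f g\<close>: the Fourier transform of \<open>f\<close>, defined by duality, is the locally integrable
  function \<open>g\<close>. It is tested against compactly supported functions only, since for Schwartz
  functions \<open>\<phi>\<close> the product \<open>g \<phi>\<close> need not be absolutely integrable.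
  Such a \<open>g\<close> is determined by \<open>f\<close> up to null sets, and determines \<open>f\<close>.
\<close>

definition has_ft :: "tdist \<Rightarrow> (real^3 \<Rightarrow> complex) \<Rightarrow> bool" where
  "has_ft f g \<longleftrightarrow> loc_integrable g \<and>
     (\<forall>\<phi>. test_fun \<phi> \<longrightarrow> pairing f (fourier_fun \<phi>) = (LINT \<xi>|lborel. g \<xi> * \<phi> \<xi>))"

definition ft :: "tdist \<Rightarrow> real^3 \<Rightarrow> complex" where
  "ft f = (SOME g. has_ft f g)"

definition inv_ft :: "(real^3 \<Rightarrow> complex) \<Rightarrow> tdist" where
  "inv_ft g = (THE f. has_ft f g)"


section \<open>The spaces\<close>

definition weight :: "real \<Rightarrow> real \<Rightarrow> real \<Rightarrow> real^3 \<Rightarrow> real" where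
  "weight a \<sigma> s \<xi> = norm \<xi> powr s * exp (a * norm \<xi> powr (1 / \<sigma>))"

text \<open>
  Norms take values in the extended nonnegative reals, and membership in a space means
  finite norm; the norm is infinite if the Fourier transform is not locally integrable.
\<close>

definition X_norm :: "real \<Rightarrow> real \<Rightarrow> real \<Rightarrow> tdist \<Rightarrow> ennreal" where
  "X_norm a \<sigma> s f =
     (if \<exists>g. has_ft f g
      then \<integral>\<^sup>+ \<xi>. ennreal (weight a \<sigma> s \<xi> * cmod (ft f \<xi>)) \<partial>lborel
      else \<infinity>)"

definition XV_norm :: "real \<Rightarrow> real \<Rightarrow> real \<Rightarrow> tdist^3 \<Rightarrow> ennreal" where
  "XV_norm a \<sigma> s u =
     (if \<forall>i. \<exists>g. has_ft (u $ i) g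
      then \<integral>\<^sup>+ \<xi>. ennreal (weight a \<sigma> s \<xi> * norm (\<chi> i. ft (u $ i) \<xi>)) \<partial>lborel
      else \<infinity>)"

definition X_space :: "real \<Rightarrow> real \<Rightarrow> real \<Rightarrow> tdist set" where
  "X_space a \<sigma> s = {f. X_norm a \<sigma> s f < \<infinity>}"

definition XV_space :: "real \<Rightarrow> real \<Rightarrow> real \<Rightarrow> (tdist^3) set" where
  "XV_space a \<sigma> s = {u. XV_norm a \<sigma> s u < \<infinity>}"

text \<open>
  Time-dependent spaces over \<open>[0,T]\<close>, for the normed space \<open>{v. N v < \<infinity>}\<close> with norm \<open>N\<close>.
\<close>

definition C_T :: "real \<Rightarrow> ('v::ab_group_add \<Rightarrow> ennreal) \<Rightarrow> (real \<Rightarrow> 'v) set" where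
  "C_T T N = {f. (\<forall>t\<in>{0..T}. N (f t) < \<infinity>) \<and>
     (\<forall>t\<in>{0..T}. ((\<lambda>\<tau>. N (f \<tau> - f t)) \<longlongrightarrow> 0) (at t within {0..T}))}"

definition Linf_norm :: "real \<Rightarrow> ('v \<Rightarrow> ennreal) \<Rightarrow> (real \<Rightarrow> 'v) \<Rightarrow> ennreal" where
  "Linf_norm T N f = (SUP t\<in>{0..T}. N (f t))"

definition strongly_measurable ::
    "real \<Rightarrow> ('v::ab_group_add \<Rightarrow> ennreal) \<Rightarrow> (real \<Rightarrow> 'v) \<Rightarrow> bool" where
  "strongly_measurable T N f \<longleftrightarrow>
     (\<exists>S :: nat \<Rightarrow> real \<Rightarrow> 'v.
        (\<forall>n. finite (S n ` {0..T}) \<and>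
             (\<forall>t\<in>{0..T}. N (S n t) < \<infinity>) \<and>
             (\<forall>v. {t\<in>{0..T}. S n t = v} \<in> sets lebesgue)) \<and>
        (AE t in lebesgue_on {0..T}. (\<lambda>n. N (S n t - f t)) \<longlonglongrightarrow> 0))"

definition Lp_T :: "real \<Rightarrow> real \<Rightarrow> ('v::ab_group_add \<Rightarrow> ennreal) \<Rightarrow> (real \<Rightarrow> 'v) set" where
  "Lp_T p T N = {f. strongly_measurable T N f \<and>
     (AE t in lebesgue_on {0..T}. N (f t) < \<infinity>) \<and>
     (\<integral>\<^sup>+ t. ennreal (enn2real (N (f t)) powr p) \<partial>lebesgue_on {0..T}) < \<infinity>}"

definition L1_norm :: "real \<Rightarrow> ('v \<Rightarrow> ennreal) \<Rightarrow> (real \<Rightarrow> 'v) \<Rightarrow> ennreal" where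
  "L1_norm T N f = (\<integral>\<^sup>+ t. N (f t) \<partial>lebesgue_on {0..T})"


section \<open>Mild solutions\<close>

text \<open>The semigroup \<open>exp (- t (- \<Delta>)\<^sup>\<gamma>)\<close>.\<close>

definition heat :: "real \<Rightarrow> real \<Rightarrow> tdist \<Rightarrow> tdist" where
  "heat \<gamma> t f = inv_ft (\<lambda>\<xi>. of_real (exp (- t * norm \<xi> powr (2 * \<gamma>))) * ft f \<xi>)"

definition heatV :: "real \<Rightarrow> real \<Rightarrow> tdist^3 \<Rightarrow> tdist^3" where
  "heatV \<gamma> t u = (\<chi> i. heat \<gamma> t (u $ i))"

definition leray :: "tdist^3 \<Rightarrow> tdist^3" where
  "leray u = (\<chi> i. inv_ft (\<lambda>\<xi>. ft (u $ i) \<xi> -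
     of_real (\<xi> $ i / (norm \<xi>)\<^sup>2) * (\<Sum>j\<in>UNIV. of_real (\<xi> $ j) * ft (u $ j) \<xi>)))"

text \<open>
  The product of two distributions with locally integrable Fourier transforms, by the convolution
  theorem with the normalisation of \<open>fourier_fun\<close>; the convolution is required to converge
  absolutely almost everywhere. This is needed rather than a pointwise product
  because \<open>\<nabla> \<theta>\<close> need not be a function in the class of solutions considered. If \<open>f\<close> and \<open>g\<close> have
  integrable Fourier transforms, it is the pointwise product of the corresponding functions.
\<close>

definition convolution :: "(real^3 \<Rightarrow> complex) \<Rightarrow> (real^3 \<Rightarrow> complex) \<Rightarrow> real^3 \<Rightarrow> complex" where
  "convolution g h \<xi> = (LINT \<eta>|lborel. g (\<xi> - \<eta>) * h \<eta>)"

definition tprod :: "tdist \<Rightarrow> tdist \<Rightarrow> tdist" where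
  "tprod f g = (THE h.
     (AE \<xi> in lborel. integrable lborel (\<lambda>\<eta>. ft f (\<xi> - \<eta>) * ft g \<eta>)) \<and>
     has_ft h (\<lambda>\<xi>. of_real (1 / (2 * pi) ^ 3) * convolution (ft f) (ft g) \<xi>))"

text \<open>\<open>u \<cdot> \<nabla> f\<close> for scalar and vector fields.\<close>

definition adv :: "tdist^3 \<Rightarrow> tdist \<Rightarrow> tdist" where
  "adv u f = (\<Sum>j\<in>UNIV. tprod (u $ j) (tderiv j f))"

definition advV :: "tdist^3 \<Rightarrow> tdist^3 \<Rightarrow> tdist^3" where
  "advV u v = (\<chi> i. adv u (v $ i))"

definition times_e3 :: "tdist \<Rightarrow> tdist^3" where
  "times_e3 f = (\<chi> i. if i = 3 then f else 0)"

text \<open>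
  \<open>I\<close> is the integral over \<open>[0,t]\<close> of the distribution-valued function \<open>F\<close>,
  in the weak sense of duality with Schwartz functions.
\<close>

definition has_tint :: "real \<Rightarrow> (real \<Rightarrow> tdist) \<Rightarrow> tdist \<Rightarrow> bool" where
  "has_tint t F I \<longleftrightarrow> (\<forall>\<phi>. schwartz \<phi> \<longrightarrow>
     integrable (lebesgue_on {0..t}) (\<lambda>\<tau>. pairing (F \<tau>) \<phi>) \<and>
     pairing I \<phi> = (LINT \<tau>|lebesgue_on {0..t}. pairing (F \<tau>) \<phi>))"

definition has_tintV :: "real \<Rightarrow> (real \<Rightarrow> tdist^3) \<Rightarrow> tdist^3 \<Rightarrow> bool" where
  "has_tintV t F I \<longleftrightarrow> (\<forall>i. has_tint t (\<lambda>\<tau>. F \<tau> $ i) (I $ i))"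

definition mild_solution ::
    "real \<Rightarrow> real \<Rightarrow> real \<Rightarrow> tdist^3 \<Rightarrow> tdist \<Rightarrow> (real \<Rightarrow> tdist^3) \<Rightarrow> (real \<Rightarrow> tdist) \<Rightarrow> bool" where
  "mild_solution \<alpha> \<beta> T u0 \<theta>0 u \<theta> \<longleftrightarrow> (\<forall>t\<in>{0..T}.
     (\<forall>i. real_dist (u t $ i)) \<and> real_dist (\<theta> t) \<and> div_free (u t) \<and>
     (\<exists>A B. has_tintV t (\<lambda>\<tau>. heatV \<alpha> (t - \<tau>) (leray (advV (u \<tau>) (u \<tau>)))) A \<and>
            has_tintV t (\<lambda>\<tau>. heatV \<alpha> (t - \<tau>) (leray (times_e3 (\<theta> \<tau>)))) B \<and>
            u t = heatV \<alpha> t u0 - A + B) \<and>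
     (\<exists>D. has_tint t (\<lambda>\<tau>. heat \<beta> (t - \<tau>) (adv (u \<tau>) (\<theta> \<tau>))) D \<and>
          \<theta> t = heat \<beta> t \<theta>0 - D))"

definition solution_class ::
    "real \<Rightarrow> real \<Rightarrow> real \<Rightarrow> real \<Rightarrow> real \<Rightarrow> real \<Rightarrow> ((real \<Rightarrow> tdist^3) \<times> (real \<Rightarrow> tdist)) set" where
  "solution_class a \<sigma> s \<alpha> \<beta> T =
     (C_T T (XV_norm a \<sigma> s) \<inter> Lp_T 1 T (XV_norm a \<sigma> (s + 2 * \<alpha>))) \<times>
     (C_T T (X_norm a \<sigma> s) \<inter> Lp_T 1 T (X_norm a \<sigma> (s + 2 * \<beta>)))"

definition solution_norm ::
    "real \<Rightarrow> real \<Rightarrow> real \<Rightarrow> real \<Rightarrow> real \<Rightarrow> real \<Rightarrow> (real \<Rightarrow> tdist^3) \<Rightarrow> (real \<Rightarrow> tdist) \<Rightarrow> ennreal" where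
  "solution_norm a \<sigma> s \<alpha> \<beta> T u \<theta> =
     Linf_norm T (XV_norm a \<sigma> s) u + L1_norm T (XV_norm a \<sigma> (s + 2 * \<alpha>)) u +
     Linf_norm T (X_norm a \<sigma> s) \<theta> + L1_norm T (X_norm a \<sigma> (s + 2 * \<beta>)) \<theta>"

definition q_crit :: "real \<Rightarrow> real \<Rightarrow> real" where
  "q_crit \<alpha> \<beta> = Max {1 - 2 * \<alpha>, \<alpha> * (1 - 2 * \<beta>) / \<beta>, \<beta> * (1 - 2 * \<alpha>) / \<alpha>}"

end

theory Submission
  imports Defs "HOL-Probability.Probability"
begin

text \<open>
  On the Fourier side the system is an integral equation for four functions \<open>U k t \<xi>\<close>, the
  transforms of the three velocity components (\<open>k = Some i\<close>) and of the temperature (\<open>k = None\<close>):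
  \<open>U k t \<xi> = exp (- t \<bar>\<xi>\<bar>\<^sup>2\<^sup>\<gamma>) d k \<xi> + \<integral> exp (- (t - \<tau>) \<bar>\<xi>\<bar>\<^sup>2\<^sup>\<gamma>) F U k \<tau> \<xi> d\<tau>\<close>. Here \<open>\<gamma>\<close> is
  \<open>\<alpha>\<close> or \<open>\<beta>\<close>, and \<open>F\<close> is a sum of convolutions \<open>U l * U m\<close> with symbols bounded by a multiple
  of \<open>\<bar>\<xi>\<bar>\<close> (advection and pressure) and of bounded multiples of \<open>U l\<close> (buoyancy).
  The norms of the theorem are weighted \<open>L\<^sup>1\<close> norms of \<open>U\<close>, so all estimates concern iterated integrals
  of nonnegative functions, for which Tonelli's theorem is available.
\<close>

text \<open>
  Three observations make the equation solvable.
  First, the weight is submultiplicative up to the Leibniz rule, since \<open>0 \<le> s + 1 \<le> 1\<close> and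
  \<open>1/\<sigma> \<le> 1\<close>; so \<open>\<bar>\<xi>\<bar> (f * g)\<close> has norm at most \<open>\<parallel>f\<parallel>\<^sub>s\<^sub>+\<^sub>1 \<parallel>g\<parallel>\<^sub>0 + \<parallel>f\<parallel>\<^sub>0 \<parallel>g\<parallel>\<^sub>s\<^sub>+\<^sub>1\<close> (\<open>X_bilinear\<close>).
  Secondly, both exponents \<open>0\<close> and \<open>s + 1\<close> lie between \<open>s\<close> and \<open>s + 2\<gamma>\<close>. Interpolation bounds each
  product by a power of the norms that are integrable in time, with total exponent
  \<open>1/(2\<gamma>\<^sub>1) - s/(2\<gamma>\<^sub>2)\<close>. For the pairs that occur these exponents are at most \<open>1 - \<delta>\<close> with
  \<open>\<delta> \<ge> 0\<close> precisely if \<open>s \<ge> q_crit \<alpha> \<beta>\<close>, and then the bilinear term gains a factor \<open>T\<^sup>\<delta>\<close>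
  (\<open>X_bilinear_time\<close>). Thirdly, \<open>\<integral> \<bar>\<xi>\<bar>\<^sup>2\<^sup>\<gamma> exp (- t \<bar>\<xi>\<bar>\<^sup>2\<^sup>\<gamma>) dt \<le> 1\<close>, so integrating against the heat
  kernel gains \<open>2\<gamma>\<close> derivatives in \<open>L\<^sup>1\<close> of time (\<open>bounded_by_duhamel\<close>).
  Hence a ball is preserved and differences are halved as soon as \<open>T\<close> is small and, for radius \<open>R\<close>,
  \<open>R T\<^sup>\<delta>\<close> is small. Above the critical exponent \<open>\<delta> > 0\<close> and a short time suffices; at the critical
  exponent \<open>\<delta> = 0\<close> and the data have to be small.
\<close>

text \<open>
  Existence comes from Picard iteration. The iterates are dominated pointwise by the iterates of the
  same scheme with absolute values, which increase; these stay in the ball, so their supremum is finite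
  almost everywhere and the Picard iterates converge pointwise by domination (\<open>picard_majorised\<close>,
  \<open>sol_exists\<close>). Uniqueness follows by iterating the halving of differences (\<open>solves_unique\<close>), and
  continuity in time from dominated convergence (\<open>solves_continuous\<close>). Uniqueness also makes the
  solution Hermitian, i.e. the fields real, because reflection and conjugation preserve the equation;
  the divergence vanishes because the range of the Leray symbol is orthogonal to \<open>\<xi>\<close>.

  The return to distributions rests on Fourier inversion for Schwartz functions. For
  \<open>-1 \<le> s \<le> 0\<close> every element of the space has a transform integrable against \<open>(1 + \<bar>\<xi>\<bar>)\<^sup>-\<^sup>2\<close>
  (\<open>tame_X\<close>). Such functions correspond to distributions by absolutely convergent duality with all Schwartz
  functions (\<open>has_tame_ft\<close>), and every operator of the equation is computed on this level; then
  mild solutions and solutions of the integral equation are the same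
  (\<open>mild_imp_solves\<close>, \<open>solves_imp_mild\<close>).
\<close>

section \<open>Smooth functions\<close>

lemma pd_eqI: "(f has_derivative f') (at x) \<Longrightarrow> pd j f x = f' (axis j 1)"
  unfolding pd_def by (metis frechet_derivative_at)

lemma smooth_differentiable: "smooth f \<Longrightarrow> f differentiable (at x)"
  unfolding smooth_def by (metis foldr.simps(1) id_apply pds_def)

lemma smooth_pd: "smooth f \<Longrightarrow> smooth (pd j f)"
  unfolding smooth_def by (simp add: pds_pd)

lemma smooth_pds: "smooth f \<Longrightarrow> smooth (pds js f)"
  unfolding smooth_def by (metis foldr_append pds_def)

lemma pds_Nil [simp]: "pds [] f = f"
  by (simp add: pds_def)

lemma pds_Cons: "pds (j # js) f = pd j (pds js f)"
  by (simp add: pds_def)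

text \<open>
  Smoothness is stated through all iterated partial derivatives, so the way to prove it is to exhibit a set of
  differentiable functions closed under partial derivatives.
\<close>

lemma smooth_coinduct:
  assumes "f \<in> S" "\<And>f x. f \<in> S \<Longrightarrow> f differentiable (at x)" "\<And>f j. f \<in> S \<Longrightarrow> pd j f \<in> S"
  shows "smooth f"
proof -
  have "pds js f \<in> S" for js by (induction js) (use assms in \<open>auto simp: pds_Cons\<close>)
  then show ?thesis using assms by (auto simp: smooth_def)
qed

lemma pd_const [simp]: "pd j (\<lambda>x. c) = (\<lambda>x. 0)"
  by (rule ext, subst pd_eqI[OF has_derivative_const]) auto

lemma smooth_const: "smooth (\<lambda>x. c)"
  by (rule smooth_coinduct[of _ "range (\<lambda>c x. c)"]) auto

lemma smooth_add: "smooth f \<Longrightarrow> smooth g \<Longrightarrow> smooth (\<lambda>x. f x + g x)"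
  unfolding smooth_def using pds_add[unfolded smooth_def] by (auto intro!: differentiable_add)

lemma smooth_cmul: "smooth f \<Longrightarrow> smooth (\<lambda>x. c * f x)"
  unfolding smooth_def using pds_cmul[unfolded smooth_def] by (auto intro!: differentiable_mult)

lemma pd_mult:
  assumes "f differentiable (at x)" "g differentiable (at x)"
  shows "pd j (\<lambda>x. f x * g x) x = pd j f x * g x + f x * pd j g x"
proof -
  have "((\<lambda>x. f x * g x) has_derivative
     (\<lambda>h. f x * frechet_derivative g (at x) h + frechet_derivative f (at x) h * g x)) (at x)"
    using assms by (intro has_derivative_mult) (auto simp: frechet_derivative_works[symmetric])
  from pd_eqI[OF this] show ?thesis by (simp add: pd_def)
qed

lemma pd_add: "f differentiable (at x) \<Longrightarrow> g differentiable (at x) \<Longrightarrow>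
   pd j (\<lambda>x. f x + g x) x = pd j f x + pd j g x"
  by (subst pd_eqI[OF has_derivative_add])
    (auto simp: frechet_derivative_works[symmetric] pd_def)

text \<open>
  The terms of the Leibniz rule for iterated derivatives of a product. Estimates use only the
  form of these terms; the index \<open>n\<close> makes them uniform over sequences.
\<close>

inductive leibniz_span ::
  "(nat \<Rightarrow> real^3 \<Rightarrow> complex) \<Rightarrow> (nat \<Rightarrow> real^3 \<Rightarrow> complex) \<Rightarrow> (nat \<Rightarrow> real^3 \<Rightarrow> complex) \<Rightarrow> bool"
  for \<Phi> \<Psi> where
  prod: "leibniz_span \<Phi> \<Psi> (\<lambda>n x. pds a (\<Phi> n) x * pds b (\<Psi> n) x)"
| add: "leibniz_span \<Phi> \<Psi> f \<Longrightarrow> leibniz_span \<Phi> \<Psi> g \<Longrightarrow> leibniz_span \<Phi> \<Psi> (\<lambda>n x. f n x + g n x)"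

lemma leibniz_span_differentiable:
  assumes "leibniz_span \<Phi> \<Psi> h" "\<And>n. smooth (\<Phi> n)" "\<And>n. smooth (\<Psi> n)"
  shows "h n differentiable (at x)"
  using assms by (induction) (auto intro!: differentiable_mult differentiable_add
      simp: smooth_differentiable smooth_pds)

lemma leibniz_span_pd:
  assumes "leibniz_span \<Phi> \<Psi> h" "\<And>n. smooth (\<Phi> n)" "\<And>n. smooth (\<Psi> n)"
  shows "leibniz_span \<Phi> \<Psi> (\<lambda>n. pd j (h n))"
  using assms(1)
proof induction
  case (prod a b)
  have "(\<lambda>n. pd j (\<lambda>x. pds a (\<Phi> n) x * pds b (\<Psi> n) x)) =
    (\<lambda>n x. pds (j # a) (\<Phi> n) x * pds b (\<Psi> n) x + pds a (\<Phi> n) x * pds (j # b) (\<Psi> n) x)"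
    using assms by (intro ext) (simp add: pd_mult pds_Cons smooth_differentiable smooth_pds)
  then show ?case by (auto intro: leibniz_span.intros)
next
  case (add f g)
  have "(\<lambda>n. pd j (\<lambda>x. f n x + g n x)) = (\<lambda>n x. pd j (f n) x + pd j (g n) x)"
    using add assms by (intro ext) (simp add: pd_add leibniz_span_differentiable)
  then show ?case using add by (auto intro: leibniz_span.intros)
qed

lemma leibniz_span_pds:
  assumes "\<And>n. smooth (\<Phi> n)" "\<And>n. smooth (\<Psi> n)"
  shows "leibniz_span \<Phi> \<Psi> (\<lambda>n. pds js (\<lambda>x. \<Phi> n x * \<Psi> n x))"
proof (induction js)
  case Nil
  show ?case using leibniz_span.prod[of \<Phi> \<Psi> "[]" "[]"] by simp
next
  case (Cons j js)
  show ?case using leibniz_span_pd[OF Cons assms] by (simp add: pds_Cons)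
qed

lemma smooth_mult:
  assumes "smooth f" "smooth g"
  shows "smooth (\<lambda>x. f x * g x)"
  unfolding smooth_def
  using leibniz_span_differentiable[OF leibniz_span_pds[of "\<lambda>_. f" "\<lambda>_. g"]] assms by blast

lemma smooth_prod: "finite I \<Longrightarrow> (\<And>i. i \<in> I \<Longrightarrow> smooth (f i)) \<Longrightarrow> smooth (\<lambda>x. \<Prod>i\<in>I. f i x)"
  by (induction rule: finite_induct) (auto intro!: smooth_mult smooth_const)

section \<open>Smooth bumps\<close>

text \<open>
  The family is closed under differentiation: this is what makes \<open>e\<^sup>-\<^sup>c\<^sup>/\<^sup>t\<close>, extended by zero, smooth.
  The parameter \<open>c\<close> will tend to zero, so that products of such functions increase to indicators of boxes.
\<close>

definition flat_exp :: "real poly \<Rightarrow> real \<Rightarrow> real \<Rightarrow> real" where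
  "flat_exp p c t = (if t > 0 then poly p (1 / t) * exp (- (c / t)) else 0)"

lemma poly_times_exp_tendsto_0:
  assumes "(c::real) > 0"
  shows "((\<lambda>u. poly p u * exp (- (c * u))) \<longlongrightarrow> 0) at_top"
proof -
  have mono: "((\<lambda>u. u ^ k * exp (- (c * u))) \<longlongrightarrow> 0) at_top" for k
  proof -
    have "filterlim (\<lambda>u. c * u) at_top at_top"
      using assms by (intro filterlim_tendsto_pos_mult_at_top[OF tendsto_const]) (auto intro: filterlim_ident)
    then have "((\<lambda>u. (c * u) ^ k / exp (c * u)) \<longlongrightarrow> 0) at_top"
      by (rule filterlim_compose[OF tendsto_power_div_exp_0])
    then have "((\<lambda>u. (1 / c ^ k) * ((c * u) ^ k / exp (c * u))) \<longlongrightarrow> 0) at_top"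
      by (rule tendsto_mult_right_zero)
    then show ?thesis using assms by (simp add: power_mult_distrib exp_minus field_simps)
  qed
  have "(\<lambda>u. poly p u * exp (- (c * u))) =
      (\<lambda>u. \<Sum>i\<le>degree p. coeff p i * (u ^ i * exp (- (c * u))))"
    by (simp add: poly_altdef sum_distrib_right mult.assoc)
  then show ?thesis
    by (auto intro!: tendsto_null_sum tendsto_mult_right_zero mono)
qed

lemma flat_exp_derivative:
  assumes c: "c > 0"
  shows "(flat_exp p c has_real_derivative flat_exp ([:0, 0, 1:] * (smult c p - pderiv p)) c t) (at t)"
proof (cases t "0 :: real" rule: linorder_cases)
  case less
  have "((\<lambda>_. 0) has_real_derivative 0) (at t)" by simp
  from this open_lessThan[of 0] have "(flat_exp p c has_real_derivative 0) (at t)"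
    by (rule has_field_derivative_transform_within_open) (use less in \<open>auto simp: flat_exp_def\<close>)
  then show ?thesis using less by (simp add: flat_exp_def)
next
  case greater
  have "((\<lambda>t. poly p (1 / t) * exp (- (c / t))) has_real_derivative
      (poly p (1 / t) * (exp (- (c / t)) * (c / t^2)) + poly (pderiv p) (1 / t) * (- (1 / t^2)) * exp (- (c / t)))) (at t)"
    using greater
    by (auto intro!: derivative_eq_intros DERIV_chain2[OF poly_DERIV] simp: power2_eq_square field_simps)
  from this open_greaterThan[of 0] have "(flat_exp p c has_real_derivative
      (poly p (1 / t) * (exp (- (c / t)) * (c / t^2)) + poly (pderiv p) (1 / t) * (- (1 / t^2)) * exp (- (c / t)))) (at t)"
    by (rule has_field_derivative_transform_within_open) (use greater in \<open>auto simp: flat_exp_def\<close>)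
  moreover have "flat_exp ([:0, 0, 1:] * (smult c p - pderiv p)) c t =
      (poly p (1 / t) * (exp (- (c / t)) * (c / t^2)) + poly (pderiv p) (1 / t) * (- (1 / t^2)) * exp (- (c / t)))"
    using greater by (simp add: flat_exp_def power2_eq_square algebra_simps)
  ultimately show ?thesis by simp
next
  case equal
  have "((\<lambda>h. flat_exp p c h / h) \<longlongrightarrow> 0) (at_right 0)"
  proof -
    have "((\<lambda>u. poly ([:0, 1:] * p) u * exp (- (c * u))) \<longlongrightarrow> 0) at_top"
      by (rule poly_times_exp_tendsto_0[OF c])
    from filterlim_compose[OF this filterlim_inverse_at_top_right]
    have "((\<lambda>h. poly ([:0, 1:] * p) (inverse h) * exp (- (c * inverse h))) \<longlongrightarrow> 0) (at_right 0)" .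
    then show ?thesis
      by (rule Lim_transform_eventually)
        (rule eventually_at_rightI[of 0 1], simp_all add: flat_exp_def divide_inverse mult_ac)
  qed
  moreover have "((\<lambda>h. flat_exp p c h / h) \<longlongrightarrow> 0) (at_left 0)"
    by (rule Lim_transform_eventually[OF tendsto_const])
      (auto simp: flat_exp_def intro!: eventually_at_leftI[of "-1"])
  ultimately have "((\<lambda>h. flat_exp p c h / h) \<longlongrightarrow> 0) (at 0)"
    by (simp add: filterlim_split_at_real)
  then show ?thesis using equal by (simp add: DERIV_def flat_exp_def)
qed

lemma smooth_flat_exp:
  assumes c: "c > 0"
  shows "smooth (\<lambda>x. of_real (flat_exp p c (v \<bullet> x + d)))"
proof -
  let ?S = "range (\<lambda>p x. complex_of_real (flat_exp p c (v \<bullet> x + d)))"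
  have D: "((\<lambda>x. complex_of_real (flat_exp p c (v \<bullet> x + d))) has_derivative
     (\<lambda>h. of_real (flat_exp ([:0, 0, 1:] * (smult c p - pderiv p)) c (v \<bullet> x + d) * (v \<bullet> h)))) (at x)" for p x
  proof -
    have "((\<lambda>x. v \<bullet> x + d) has_derivative (\<lambda>h. v \<bullet> h)) (at x)"
      by (auto intro!: derivative_eq_intros)
    from has_derivative_of_real[OF has_derivative_compose[OF this
        flat_exp_derivative[OF c, of p, unfolded has_field_derivative_def]], where 'a = complex]
    show ?thesis by (simp only: of_real_mult)
  qed
  have smult: "flat_exp (smult r p) c t = r * flat_exp p c t" for r p t by (simp add: flat_exp_def)
  show ?thesis
  proof (rule smooth_coinduct[of _ ?S])
    show "pd j f \<in> ?S" if "f \<in> ?S" for f j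
    proof -
      from that obtain p where p: "f = (\<lambda>x. complex_of_real (flat_exp p c (v \<bullet> x + d)))" by auto
      have "pd j f = (\<lambda>x. complex_of_real (flat_exp (smult (v \<bullet> axis j 1) ([:0, 0, 1:] * (smult c p - pderiv p))) c (v \<bullet> x + d)))"
        unfolding smult by (rule ext) (simp only: p pd_eqI[OF D] mult.commute)
      then show ?thesis by blast
    qed
  qed (auto intro: D differentiableI)
qed

definition box_bump :: "real \<Rightarrow> real^3 \<Rightarrow> real^3 \<Rightarrow> real^3 \<Rightarrow> complex" where
  "box_bump c l r x = (\<Prod>i\<in>UNIV. of_real (flat_exp 1 c (x $ i - l $ i)) * of_real (flat_exp 1 c (r $ i - x $ i)))"

lemma smooth_box_bump:
  assumes "c > 0" shows "smooth (box_bump c l r)"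
proof -
  have 1: "smooth (\<lambda>x::real^3. of_real (flat_exp 1 c (x $ i - l $ i)))" for i
    using smooth_flat_exp[OF assms, of 1 "axis i 1" "- l $ i"]
    by (simp add: inner_axis' )
  have 2: "smooth (\<lambda>x::real^3. of_real (flat_exp 1 c (r $ i - x $ i)))" for i
    using smooth_flat_exp[OF assms, of 1 "- axis i 1" "r $ i"]
    by (simp add: inner_axis' )
  show ?thesis
    unfolding box_bump_def[abs_def] by (intro smooth_prod smooth_mult 1 2) auto
qed

lemma box_bump_outside: "x \<notin> box l r \<Longrightarrow> box_bump c l r x = 0"
  unfolding box_bump_def by (subst prod_zero_iff) (auto simp: mem_box_cart flat_exp_def)

lemma test_fun_box_bump: "c > 0 \<Longrightarrow> test_fun (box_bump c l r)"
  unfolding test_fun_def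
  using box_bump_outside[of _ l r c]
  by (auto intro!: smooth_box_bump bounded_subset[OF bounded_box[of l r]])

lemma norm_box_bump_le_1: "c > 0 \<Longrightarrow> cmod (box_bump c l r x) \<le> 1"
proof -
  assume "c > 0"
  then have "\<bar>flat_exp 1 c t\<bar> \<le> 1" for t by (simp add: flat_exp_def)
  then show ?thesis
    unfolding box_bump_def prod_norm[symmetric] norm_mult norm_of_real
    by (intro prod_le_1) (auto intro: mult_le_one)
qed

text \<open>
  As \<open>c\<close> decreases to zero, \<open>e\<^sup>-\<^sup>c\<^sup>/\<^sup>t\<close> tends to the indicator of the half line, and a product of six such
  factors cuts out the box.
\<close>

lemma box_bump_tendsto_indicator:
  "(\<lambda>n. box_bump (1 / real (Suc n)) l r x) \<longlonglongrightarrow> indicator (box l r) x"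
proof (cases "x \<in> box l r")
  case True
  have "(\<lambda>n. complex_of_real (flat_exp 1 (1 / real (Suc n)) t)) \<longlonglongrightarrow> of_real 1" if "t > 0" for t
  proof (rule tendsto_of_real)
    have "(\<lambda>n. 1 / real (Suc n)) \<longlonglongrightarrow> 0"
      using LIMSEQ_Suc[OF lim_1_over_n] by simp
    then have "(\<lambda>n. - (1 / real (Suc n) / t)) \<longlonglongrightarrow> - (0 / t)"
      by (rule tendsto_minus[OF tendsto_divide[OF _ tendsto_const]]) (use that in auto)
    from tendsto_exp[OF this] show "(\<lambda>n. flat_exp 1 (1 / real (Suc n)) t) \<longlonglongrightarrow> 1"
      using that by (simp add: flat_exp_def)
  qed
  then have "(\<lambda>n. box_bump (1 / real (Suc n)) l r x) \<longlonglongrightarrow> (\<Prod>i\<in>(UNIV::3 set). of_real 1 * of_real 1)"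
    unfolding box_bump_def using True by (intro tendsto_prod tendsto_mult) (auto simp: mem_box_cart)
  then show ?thesis using True by simp
next
  case False
  then show ?thesis by (simp add: box_bump_outside)
qed

section \<open>The fundamental lemma of the calculus of variations\<close>

text \<open>
  Boxes form an intersection-stable generator of the Borel sets, and the sets over which the integral vanishes
  are a Dynkin system, so the integral vanishes over every Borel set.
\<close>

lemma AE_zero_if_box_integrals_zero:
  fixes h :: "real^3 \<Rightarrow> complex"
  assumes h: "integrable lborel h" and 0: "\<And>l r. (LINT x|lborel. indicator (box l r) x * h x) = 0"
  shows "AE x in lborel. h x = 0"
proof -
  note [measurable] = borel_measurable_integrable[OF h]
  have int: "integrable lborel (\<lambda>x. indicator A x * h x)" if "A \<in> sets borel" for A
    using that h by (intro Bochner_Integration.integrable_bound[OF h]) (auto simp: indicator_def)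
  have bb: "box l r \<inter> box l' r' = box (\<chi> i. max (l$i) (l'$i)) (\<chi> i. min (r$i) (r'$i))" for l r l' r' :: "real^3"
    by (auto simp: mem_box_cart set_eq_iff)
  have "Int_stable (range (\<lambda>(l, r). box l r :: (real^3) set))"
    unfolding Int_stable_def by (auto simp: bb)
  moreover have "range (\<lambda>(l, r). box l r :: (real^3) set) \<subseteq> Pow UNIV" by simp
  ultimately have main: "(LINT x|lborel. indicator A x * h x) = 0"
    if "A \<in> sigma_sets UNIV (range (\<lambda>(l, r). box l r))" for A :: "(real^3) set"
    using that
  proof (induction A rule: sigma_sets_induct_disjoint)
    have borel: "B \<in> sets borel" if "B \<in> sigma_sets UNIV (range (\<lambda>(l, r). box l r :: (real^3) set))" for B
    proof -
      have "B \<in> sets (sigma UNIV (range (\<lambda>(l, r). box l r :: (real^3) set)))" using that by simp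
      then show ?thesis using borel_eq_box[where 'a = "real^3"] by simp
    qed
    {
      case (basic A)
      then show ?case using 0 by auto
    next
      case empty
      show ?case by simp
    next
      case (compl A)
      have *: "indicator (UNIV - A) x * h x = h x - indicator A x * h x" for x
        by (simp add: indicator_def)
      have lim: "(\<lambda>n. LINT x|lborel. indicator (box (\<chi> i. - real n) (\<chi> i. real n)) x * h x) \<longlonglongrightarrow> (LINT x|lborel. h x)"
      proof (rule integral_dominated_convergence[where w = "\<lambda>x. norm (h x)"])
        show "AE x in lborel. (\<lambda>n. indicator (box (\<chi> i. - real n) (\<chi> i. real n)) x * h x) \<longlonglongrightarrow> h x"
        proof (rule AE_I2, rule tendsto_eventually)
          fix x :: "real^3"
          obtain N where N: "norm x < real N" using reals_Archimedean2 by blast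
          show "eventually (\<lambda>n. indicator (box (\<chi> i. - real n) (\<chi> i. real n)) x * h x = h x) sequentially"
          proof (rule eventually_sequentiallyI[of N])
            fix n assume "n \<ge> N"
            then have "norm x < real n" using N by simp
            then have "\<bar>x $ i\<bar> < real n" for i using component_le_norm_cart[of x i] by linarith
            then have "x \<in> box (\<chi> i. - real n) (\<chi> i. real n)"
              by (auto simp: mem_box_cart abs_less_iff) (metis add.inverse_inverse neg_less_iff_less)
            then show "indicator (box (\<chi> i. - real n) (\<chi> i. real n)) x * h x = h x" by simp
          qed
        qed
      qed (use h in \<open>auto simp: indicator_def\<close>)
      have tot: "(LINT x|lborel. h x) = 0" using LIMSEQ_unique[OF lim] by (simp add: 0)
      show ?case unfolding * using compl
        by (subst Bochner_Integration.integral_diff[OF h int[OF borel]]) (auto simp: tot)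
    next
      case (union A)
      have b: "A i \<in> sets borel" for i using union borel by auto
      have "(\<lambda>n. LINT x|lborel. (\<Sum>i<n. indicator (A i) x * h x)) \<longlonglongrightarrow> (LINT x|lborel. indicator (\<Union>i. A i) x * h x)"
      proof (rule integral_dominated_convergence[where w = "\<lambda>x. norm (h x)"])
        have ind: "(\<Sum>i<n. indicator (A i) x) = (indicator (\<Union>i<n. A i) x :: complex)" for n x
          using union(1) by (subst indicator_UN_disjoint) (auto simp: disjoint_family_on_def)
        show "AE x in lborel. (\<lambda>n. \<Sum>i<n. indicator (A i) x * h x) \<longlonglongrightarrow> indicator (\<Union>i. A i) x * h x"
          unfolding sum_distrib_right[symmetric] ind
          by (intro AE_I2 tendsto_mult tendsto_const LIMSEQ_indicator_UN)
        show "AE x in lborel. norm (\<Sum>i<n. indicator (A i) x * h x) \<le> norm (h x)" for n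
          unfolding sum_distrib_right[symmetric] ind by (auto simp: indicator_def)
        show "(\<lambda>x. indicator (\<Union>i. A i) x * h x) \<in> borel_measurable lborel" using b by auto
        show "(\<lambda>x. \<Sum>i<n. indicator (A i) x * h x) \<in> borel_measurable lborel" for n using b by auto
      qed (use h in auto)
      moreover have "(LINT x|lborel. (\<Sum>i<n. indicator (A i) x * h x)) = 0" for n
        by (subst Bochner_Integration.integral_sum) (use union int[OF b] in auto)
      ultimately show ?case by (auto dest: LIMSEQ_unique)
    }
  qed
  have eq: "sigma_sets UNIV (range (\<lambda>(l, r). box l r :: (real^3) set)) = sets borel"
    by (subst borel_eq_box) (simp add: case_prod_unfold)
  have zero: "(LINT x|lborel. indicator A x * h x) = 0" if "A \<in> sets borel" for A
    by (rule main, subst eq, rule that)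
  show ?thesis
    by (rule sigma_finite_measure.density_zero[OF sigma_finite_lborel h])
      (simp add: set_lebesgue_integral_def scaleR_conv_of_real of_real_indicator zero)
qed

lemma loc_integrable_measurable:
  assumes "loc_integrable g" shows "g \<in> borel_measurable borel"
proof (rule borel_measurable_LIMSEQ_metric)
  show "(\<lambda>x. indicator (cball 0 (real n)) x *\<^sub>R g x) \<in> borel_measurable borel" for n
    using borel_measurable_integrable[of lborel "\<lambda>x. indicator (cball 0 (real n)) x *\<^sub>R g x"] assms
    using compact_cball[of 0 "real n"] unfolding loc_integrable_def set_integrable_def by fastforce
  show "(\<lambda>n. indicator (cball 0 (real n)) x *\<^sub>R g x) \<longlonglongrightarrow> g x" if "x \<in> space borel" for x
  proof (rule tendsto_eventually)
    obtain N where N: "norm x < real N" using reals_Archimedean2 by blast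
    show "eventually (\<lambda>n. indicator (cball 0 (real n)) x *\<^sub>R g x = g x) sequentially"
      by (rule eventually_sequentiallyI[of N]) (use N in \<open>auto simp: indicator_def\<close>)
  qed
qed

lemma test_fun_fundamental_lemma:
  assumes g: "loc_integrable g" and 0: "\<And>\<phi>. test_fun \<phi> \<Longrightarrow> (LINT x|lborel. g x * \<phi> x) = 0"
  shows "AE x in lborel. g x = 0"
proof -
  note [measurable] = loc_integrable_measurable[OF g]
  have int: "integrable lborel (\<lambda>x. indicator (box l r) x * g x)" for l r
  proof -
    have "set_integrable lborel (cbox l r) g" using g by (auto simp: loc_integrable_def)
    then have "set_integrable lborel (box l r) g"
      by (rule set_integrable_subset) (auto simp: box_subset_cbox)
    then show ?thesis by (simp add: set_integrable_def scaleR_conv_of_real of_real_indicator)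
  qed
  have box0: "(LINT x|lborel. indicator (box l r) x * g x) = 0" for l r
  proof -
    have "(\<lambda>n. LINT x|lborel. g x * box_bump (1 / real (Suc n)) l r x) \<longlonglongrightarrow> (LINT x|lborel. indicator (box l r) x * g x)"
    proof (rule integral_dominated_convergence[where w = "\<lambda>x. norm (indicator (box l r) x * g x)"])
      show "AE x in lborel. (\<lambda>n. g x * box_bump (1 / real (Suc n)) l r x) \<longlonglongrightarrow> indicator (box l r) x * g x"
        by (subst mult.commute) (intro AE_I2 tendsto_mult tendsto_const box_bump_tendsto_indicator)
      show "AE x in lborel. norm (g x * box_bump (1 / real (Suc n)) l r x) \<le> norm (indicator (box l r) x * g x)" for n
      proof (rule AE_I2)
        fix x
        show "norm (g x * box_bump (1 / real (Suc n)) l r x) \<le> norm (indicator (box l r) x * g x)"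
          using norm_box_bump_le_1[of "1 / real (Suc n)" l r x] box_bump_outside[of x l r "1 / real (Suc n)"]
          by (cases "x \<in> box l r") (auto simp: norm_mult intro!: mult_left_le)
      qed
      have "box_bump (1 / real (Suc n)) l r \<in> borel_measurable borel" for n
        by (intro borel_measurable_continuous_onI continuous_at_imp_continuous_on ballI
            differentiable_imp_continuous_within smooth_differentiable smooth_box_bump) auto
      then show "(\<lambda>x. g x * box_bump (1 / real (Suc n)) l r x) \<in> borel_measurable lborel" for n by simp
    qed (use int in auto)
    moreover have "(LINT x|lborel. g x * box_bump (1 / real (Suc n)) l r x) = 0" for n
      by (rule 0[OF test_fun_box_bump]) simp
    ultimately show ?thesis by (auto dest: LIMSEQ_unique)
  qed
  have "AE x in lborel. indicator (box (\<chi> i. - real n) (\<chi> i. real n)) x * g x = 0" for n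
  proof (rule AE_zero_if_box_integrals_zero[OF int])
    fix l r :: "real^3"
    have bb: "box l r \<inter> box l' r' = box (\<chi> i. max (l$i) (l'$i)) (\<chi> i. min (r$i) (r'$i))" for l' r' :: "real^3"
      by (auto simp: mem_box_cart set_eq_iff)
    show "(LINT x|lborel. indicator (box l r) x * (indicator (box (\<chi> i. - real n) (\<chi> i. real n)) x * g x)) = 0"
      using box0 by (simp add: mult.assoc[symmetric] indicator_inter_arith[symmetric] bb)
  qed
  then have "AE x in lborel. \<forall>n. indicator (box (\<chi> i. - real n) (\<chi> i. real n)) x * g x = 0"
    by (subst AE_all_countable) blast
  then show ?thesis
  proof eventually_elim
    fix x :: "real^3" assume *: "\<forall>n. indicator (box (\<chi> i. - real n) (\<chi> i. real n)) x * g x = 0"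
    obtain n where n: "norm x < real n" using reals_Archimedean2 by blast
    then have "\<bar>x $ i\<bar> < real n" for i using component_le_norm_cart[of x i] by linarith
    then have "x \<in> box (\<chi> i. - real n) (\<chi> i. real n)"
      by (auto simp: mem_box_cart abs_less_iff) (metis add.inverse_inverse neg_less_iff_less)
    with *[rule_format, of n] show "g x = 0" by simp
  qed
qed

section \<open>Affine changes of variables\<close>

lemma lborel_integrable_affine:
  fixes f :: "'a::euclidean_space \<Rightarrow> 'b::{banach, second_countable_topology}"
  assumes c: "c \<noteq> 0" and f: "integrable lborel f"
  shows "integrable lborel (\<lambda>x. f (t + c *\<^sub>R x))"
proof -
  have [measurable]: "f \<in> borel_measurable borel" using f by auto
  have "integrable (density (distr lborel borel (\<lambda>x. t + c *\<^sub>R x)) (\<lambda>_. ennreal (\<bar>c\<bar>^DIM('a)))) f"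
    using f lborel_affine[OF c, of t] by (simp add: ennreal_power)
  then have "integrable lborel (\<lambda>x. \<bar>c\<bar>^DIM('a) *\<^sub>R f (t + c *\<^sub>R x))"
    by (subst (asm) integrable_density) (auto simp: integrable_distr_eq)
  then have "integrable lborel (\<lambda>x. inverse (\<bar>c\<bar>^DIM('a)) *\<^sub>R \<bar>c\<bar>^DIM('a) *\<^sub>R f (t + c *\<^sub>R x))"
    by (rule integrable_scaleR_right)
  then show ?thesis using c by simp
qed

lemma lborel_integral_affine:
  fixes f :: "'a::euclidean_space \<Rightarrow> 'b::{banach, second_countable_topology}"
  assumes c: "c \<noteq> 0" and [measurable]: "f \<in> borel_measurable borel"
  shows "(LINT x|lborel. f x) = \<bar>c\<bar>^DIM('a) *\<^sub>R (LINT x|lborel. f (t + c *\<^sub>R x))"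
proof -
  have "(LINT x|lborel. f x) = (LINT x|density (distr lborel borel (\<lambda>x. t + c *\<^sub>R x)) (\<lambda>_. ennreal (\<bar>c\<bar>^DIM('a))). f x)"
    using lborel_affine[OF c, of t] by (simp add: ennreal_power)
  also have "\<dots> = (LINT x|lborel. \<bar>c\<bar>^DIM('a) *\<^sub>R f (t + c *\<^sub>R x))"
    by (subst integral_density) (auto simp: integral_distr)
  finally show ?thesis by simp
qed

lemma lborel_nn_integral_affine:
  fixes f :: "'a::euclidean_space \<Rightarrow> ennreal"
  assumes c: "c \<noteq> 0" and [measurable]: "f \<in> borel_measurable borel"
  shows "(\<integral>\<^sup>+x. f x \<partial>lborel) = ennreal (\<bar>c\<bar>^DIM('a)) * (\<integral>\<^sup>+x. f (t + c *\<^sub>R x) \<partial>lborel)"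
proof -
  have "(\<integral>\<^sup>+x. f x \<partial>lborel) = (\<integral>\<^sup>+x. f x \<partial>density (distr lborel borel (\<lambda>x. t + c *\<^sub>R x)) (\<lambda>_. ennreal (\<bar>c\<bar>^DIM('a))))"
    using lborel_affine[OF c, of t] by (simp add: ennreal_power)
  also have "\<dots> = (\<integral>\<^sup>+x. ennreal (\<bar>c\<bar>^DIM('a)) * f (t + c *\<^sub>R x) \<partial>lborel)"
    by (subst nn_integral_density) (auto simp: nn_integral_distr)
  finally show ?thesis by (simp add: nn_integral_cmult)
qed

lemma lborel_AE_affine:
  fixes P :: "'a::euclidean_space \<Rightarrow> bool"
  assumes c: "c \<noteq> 0" and "AE x in lborel. P x"
  shows "AE x in lborel. P (t + c *\<^sub>R x)"
proof -
  obtain N where N: "N \<in> null_sets lborel" "{x. \<not> P x} \<subseteq> N" using assms(2) by (auto simp: eventually_ae_filter)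
  then have [measurable]: "N \<in> sets borel" by auto
  have "0 = (\<integral>\<^sup>+x. indicator N x \<partial>lborel)" using N by auto
  also have "\<dots> = ennreal (\<bar>c\<bar>^DIM('a)) * (\<integral>\<^sup>+x. indicator N (t + c *\<^sub>R x) \<partial>lborel)"
    by (rule lborel_nn_integral_affine[OF c]) simp
  finally have "(\<integral>\<^sup>+x. indicator N (t + c *\<^sub>R x) \<partial>lborel) = 0" using c by simp
  then have "AE x in lborel. (indicator N (t + c *\<^sub>R x) :: ennreal) = 0"
    by (subst (asm) nn_integral_0_iff_AE) auto
  then show ?thesis by eventually_elim (use N(2) in \<open>auto simp: indicator_def split: if_splits\<close>)
qed

lemma lborel_integral_reflect:
  fixes f :: "'a::euclidean_space \<Rightarrow> 'b::{banach, second_countable_topology}"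
  assumes "f \<in> borel_measurable borel"
  shows "(LINT x|lborel. f (t - x)) = (LINT x|lborel. f x)"
  using lborel_integral_affine[of "-1" f t] assms by simp

lemma lborel_nn_integral_reflect:
  fixes f :: "'a::euclidean_space \<Rightarrow> ennreal"
  assumes "f \<in> borel_measurable borel"
  shows "(\<integral>\<^sup>+x. f (t - x) \<partial>lborel) = (\<integral>\<^sup>+x. f x \<partial>lborel)"
  using lborel_nn_integral_affine[of "-1" f t] assms by simp

lemma lborel_nn_integral_translate:
  fixes f :: "'a::euclidean_space \<Rightarrow> ennreal"
  assumes "f \<in> borel_measurable borel"
  shows "(\<integral>\<^sup>+x. f (x - t) \<partial>lborel) = (\<integral>\<^sup>+x. f x \<partial>lborel)"
  using lborel_nn_integral_affine[of 1 f "-t"] assms by simp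

text \<open>
  The sixth power is chosen since \<open>(1 + \<bar>x\<bar>)\<^sup>6\<close> dominates \<open>\<Prod>(1 + x\<^sub>i\<^sup>2)\<close>, whose reciprocal is a product of
  one-dimensional integrable functions.
\<close>

lemma integrable_inverse_power_decay: "integrable lborel (\<lambda>x::real^3. 1 / (1 + norm x) ^ 6)"
proof (rule integrableI_bounded)
  have 1: "(\<integral>\<^sup>+x. ennreal (inverse (1 + x\<^sup>2)) \<partial>lborel) < \<infinity>"
  proof -
    have "integrable lborel (\<lambda>x::real. inverse (1 + x\<^sup>2))"
      using integrable_inverse_1_plus_square by (simp add: set_integrable_def)
    then show ?thesis by (subst (asm) integrable_iff_bounded) (auto simp: abs_of_pos add_pos_nonneg)
  qed
  have "ennreal (norm (1 / (1 + norm x) ^ 6)) \<le> (\<Prod>b\<in>Basis. ennreal (inverse (1 + (x \<bullet> b)\<^sup>2)))" for x :: "real^3"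
  proof -
    have "(\<Prod>b\<in>Basis. (1 + (x \<bullet> b)\<^sup>2)) \<le> (\<Prod>b\<in>(Basis::(real^3) set). (1 + norm x)\<^sup>2)"
    proof (rule prod_mono)
      fix b :: "real^3" assume "b \<in> Basis"
      then have "(x \<bullet> b)\<^sup>2 \<le> (norm x)\<^sup>2" using Basis_le_norm[of b x] by (simp add: abs_le_square_iff[symmetric])
      then show "0 \<le> 1 + (x \<bullet> b)\<^sup>2 \<and> 1 + (x \<bullet> b)\<^sup>2 \<le> (1 + norm x)\<^sup>2"
        using norm_ge_zero[of x] zero_le_power2[of "x \<bullet> b"] power2_sum[of 1 "norm x"]
        by (intro conjI; simp only: one_power2; linarith)
    qed
    also have "\<dots> = (1 + norm x) ^ 6" by (simp add: power_mult[symmetric])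
    finally have le: "(\<Prod>b\<in>Basis. (1 + (x \<bullet> b)\<^sup>2)) \<le> (1 + norm x) ^ 6" .
    have pos: "0 < (\<Prod>b\<in>Basis. (1 + (x \<bullet> b)\<^sup>2))" by (intro prod_pos) (auto intro: add_pos_nonneg)
    have "norm (1 / (1 + norm x) ^ 6) \<le> (\<Prod>b\<in>Basis. inverse (1 + (x \<bullet> b)\<^sup>2))"
      using le_imp_inverse_le[OF le pos] by (simp add: prod_inversef[symmetric] divide_inverse)
    then have "ennreal (norm (1 / (1 + norm x) ^ 6)) \<le> ennreal (\<Prod>b\<in>Basis. inverse (1 + (x \<bullet> b)\<^sup>2))"
      by (rule ennreal_leI)
    also have "\<dots> = (\<Prod>b\<in>Basis. ennreal (inverse (1 + (x \<bullet> b)\<^sup>2)))"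
      by (subst prod_ennreal) (auto intro: add_nonneg_nonneg)
    finally show ?thesis .
  qed
  then have "(\<integral>\<^sup>+(x::real^3). ennreal (norm (1 / (1 + norm x) ^ 6)) \<partial>lborel)
      \<le> (\<integral>\<^sup>+(x::real^3). (\<Prod>b\<in>Basis. ennreal (inverse (1 + (x \<bullet> b)\<^sup>2))) \<partial>lborel)"
    by (intro nn_integral_mono) auto
  also have "\<dots> = (\<Prod>b\<in>(Basis::(real^3) set). (\<integral>\<^sup>+x. ennreal (inverse (1 + x\<^sup>2)) \<partial>lborel))"
    by (rule nn_integral_lborel_prod) auto
  also have "\<dots> < \<infinity>" using 1 by (simp add: power_less_top_ennreal)
  finally show "(\<integral>\<^sup>+(x::real^3). ennreal (norm (1 / (1 + norm x) ^ 6)) \<partial>lborel) < \<infinity>" .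
qed simp

section \<open>Families of Schwartz functions\<close>

text \<open>
  Schwartz seminorm bounds uniform in a sequence: every seminorm of the \<open>n\<close>-th function is at most
  a constant times \<open>c n\<close>. The constant sequence gives Schwartz functions, and \<open>c\<close> tending to zero gives convergence to zero in the
  Schwartz space. Working with sequences makes each operation both well defined and
  continuous on the Schwartz space in one proof.
\<close>

definition schwartz_fam :: "(nat \<Rightarrow> real) \<Rightarrow> (nat \<Rightarrow> real^3 \<Rightarrow> complex) \<Rightarrow> bool" where
  "schwartz_fam c \<Phi> \<longleftrightarrow> (\<forall>n. smooth (\<Phi> n)) \<and>
     (\<forall>k js. \<exists>C. \<forall>n x. (1 + norm x) ^ k * cmod (pds js (\<Phi> n) x) \<le> C * c n)"

text \<open>
  The multipliers of the Schwartz space, with the corresponding uniformity: derivatives grow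
  at most polynomially.
\<close>

definition moderate_fam :: "(nat \<Rightarrow> real) \<Rightarrow> (nat \<Rightarrow> real^3 \<Rightarrow> complex) \<Rightarrow> bool" where
  "moderate_fam d \<Psi> \<longleftrightarrow> (\<forall>n. smooth (\<Psi> n)) \<and>
     (\<forall>js. \<exists>k C. \<forall>n x. cmod (pds js (\<Psi> n) x) \<le> C * d n * (1 + norm x) ^ k)"

lemma schwartz_iff_fam: "schwartz \<phi> \<longleftrightarrow> schwartz_fam (\<lambda>_. 1) (\<lambda>_. \<phi>)"
  unfolding schwartz_def schwartz_fam_def bdd_above_def by auto

lemma schwartz_fam_schwartz: "schwartz_fam c \<Phi> \<Longrightarrow> schwartz (\<Phi> n)"
  unfolding schwartz_def schwartz_fam_def bdd_above_def by (auto, metis)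

lemma schwartz_fam_decay:
  assumes "schwartz_fam c \<Phi>"
  obtains C where "\<And>n x. cmod (\<Phi> n x) \<le> C * c n / (1 + norm x) ^ k"
proof -
  obtain C where C: "\<And>n x. (1 + norm x) ^ k * cmod (pds [] (\<Phi> n) x) \<le> C * c n"
    using assms unfolding schwartz_fam_def by blast
  have "cmod (\<Phi> n x) \<le> C * c n / (1 + norm x) ^ k" for n x
  proof -
    have "(1 + norm x) ^ k > 0" by (intro zero_less_power add_pos_nonneg) auto
    then show ?thesis using C[of x n] by (simp add: pos_le_divide_eq mult.commute)
  qed
  then show ?thesis using that by blast
qed

lemma schwartz_decay:
  assumes "schwartz \<phi>"
  obtains C where "C \<ge> 0" "\<And>x. cmod (\<phi> x) \<le> C / (1 + norm x) ^ k"
proof -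
  obtain C where C: "\<And>x. cmod (\<phi> x) \<le> C * 1 / (1 + norm x) ^ k"
    using schwartz_fam_decay[of "\<lambda>_. 1" "\<lambda>_. \<phi>" k] assms schwartz_iff_fam by metis
  have "C \<ge> 0" using norm_ge_zero[of "\<phi> 0"] C[of 0] by (simp del: norm_ge_zero)
  then show ?thesis using that C by simp
qed

lemma schwartz_smooth: "schwartz \<phi> \<Longrightarrow> smooth \<phi>"
  by (simp add: schwartz_def)

lemma smooth_measurable: "smooth \<phi> \<Longrightarrow> \<phi> \<in> borel_measurable borel"
  by (intro borel_measurable_continuous_onI continuous_at_imp_continuous_on ballI
            differentiable_imp_continuous_within smooth_differentiable)

lemma schwartz_measurable [measurable_dest]: "schwartz \<phi> \<Longrightarrow> \<phi> \<in> borel_measurable borel"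
  by (intro smooth_measurable schwartz_smooth)

lemma integrable_decay:
  fixes f :: "real^3 \<Rightarrow> 'b::{banach, second_countable_topology}"
  assumes "f \<in> borel_measurable borel" "\<And>x. norm (f x) \<le> C / (1 + norm x) ^ 6"
  shows "integrable lborel f"
  using integrable_mult_right[OF integrable_inverse_power_decay, of C]
  by (rule Bochner_Integration.integrable_bound)
    (use assms in \<open>auto intro!: AE_I2 order_trans[OF assms(2)] divide_right_mono\<close>)

lemma schwartz_integrable: "schwartz \<phi> \<Longrightarrow> integrable lborel \<phi>"
  by (metis integrable_decay schwartz_decay schwartz_measurable)

lemma schwartz_fam_const:
  assumes "schwartz \<phi>" shows "schwartz_fam (\<lambda>_. 1) (\<lambda>_. \<phi>)"
  using assms schwartz_iff_fam by blast

lemma schwartz_fam_cmul: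
  assumes "schwartz_fam c \<Phi>" shows "schwartz_fam c (\<lambda>n x. a * \<Phi> n x)"
proof -
  have "\<exists>C. \<forall>n x. (1 + norm x) ^ k * cmod (a * pds js (\<Phi> n) x) \<le> C * c n" for k js
  proof -
    obtain C where C: "\<And>n x. (1 + norm x) ^ k * cmod (pds js (\<Phi> n) x) \<le> C * c n"
      using assms unfolding schwartz_fam_def by blast
    have "(1 + norm x) ^ k * cmod (a * pds js (\<Phi> n) x) \<le> cmod a * C * c n" for n x
      using mult_left_mono[OF C[of x n], of "cmod a"] by (simp add: norm_mult mult_ac)
    then show ?thesis by blast
  qed
  then show ?thesis using assms unfolding schwartz_fam_def
    by (auto simp: pds_cmul smooth_cmul)
qed

lemma schwartz_fam_pd:
  assumes "schwartz_fam c \<Phi>" shows "schwartz_fam c (\<lambda>n. pd j (\<Phi> n))"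
  using assms unfolding schwartz_fam_def by (auto simp: pds_pd smooth_pd)

lemma schwartz_fam_mult:
  assumes \<Phi>: "schwartz_fam c \<Phi>" and \<Psi>: "moderate_fam d \<Psi>"
  shows "schwartz_fam (\<lambda>n. c n * d n) (\<lambda>n x. \<Phi> n x * \<Psi> n x)"
proof -
  have s: "smooth (\<Phi> n)" "smooth (\<Psi> n)" for n using assms by (auto simp: schwartz_fam_def moderate_fam_def)
  have bound: "\<exists>C. \<forall>n x. (1 + norm x) ^ k * cmod (h n x) \<le> C * (c n * d n)" if "leibniz_span \<Phi> \<Psi> h" for h k
    using that
  proof induction
    case (prod a b)
    obtain l C where C: "\<And>n x. cmod (pds b (\<Psi> n) x) \<le> C * d n * (1 + norm x) ^ l"
      using \<Psi> unfolding moderate_fam_def by blast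
    obtain D where D: "\<And>n x. (1 + norm x) ^ (k + l) * cmod (pds a (\<Phi> n) x) \<le> D * c n"
      using \<Phi> unfolding schwartz_fam_def by blast
    have "(1 + norm x) ^ k * cmod (pds a (\<Phi> n) x * pds b (\<Psi> n) x) \<le> (D * C) * (c n * d n)" for n x
    proof -
      have pos: "0 < (1 + norm x) ^ l" by (intro zero_less_power add_pos_nonneg) auto
      have "0 \<le> C * d n * (1 + norm x) ^ l" using C[of n x] norm_ge_zero order_trans by blast
      then have Cd: "0 \<le> C * d n" using pos by (simp add: zero_le_mult_iff)
      have "(1 + norm x) ^ k * cmod (pds a (\<Phi> n) x * pds b (\<Psi> n) x)
         \<le> (1 + norm x) ^ k * cmod (pds a (\<Phi> n) x) * (C * d n * (1 + norm x) ^ l)"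
        unfolding norm_mult mult.assoc[symmetric] by (rule order_trans[OF mult_left_mono[OF C]]) (auto simp: mult.assoc)
      also have "\<dots> = ((1 + norm x) ^ (k + l) * cmod (pds a (\<Phi> n) x)) * (C * d n)" by (simp add: power_add mult_ac)
      also have "\<dots> \<le> D * c n * (C * d n)" by (rule mult_right_mono[OF D Cd])
      finally show ?thesis by (simp add: mult_ac)
    qed
    then show ?case by blast
  next
    case (add f g)
    obtain C where C: "\<And>n x. (1 + norm x) ^ k * cmod (f n x) \<le> C * (c n * d n)" using add by blast
    obtain D where D: "\<And>n x. (1 + norm x) ^ k * cmod (g n x) \<le> D * (c n * d n)" using add by blast
    have "(1 + norm x) ^ k * cmod (f n x + g n x) \<le> (C + D) * (c n * d n)" for n x
    proof -
      have "(1 + norm x) ^ k * cmod (f n x + g n x) \<le> (1 + norm x) ^ k * (cmod (f n x) + cmod (g n x))"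
        by (intro mult_left_mono norm_triangle_ineq) auto
      then show ?thesis using C[of x n] D[of x n] by (simp add: algebra_simps)
    qed
    then show ?case by blast
  qed
  show ?thesis unfolding schwartz_fam_def
    using bound[OF leibniz_span_pds[OF s, of _ _]] s by (auto intro: smooth_mult)
qed

lemma pds_const: "pds js (\<lambda>x. a) = (\<lambda>x. if js = [] then a else 0)"
  by (induction js) (auto simp: pds_Cons)

lemma has_derivative_component: "((\<lambda>x. complex_of_real (x $ j)) has_derivative (\<lambda>h. of_real (h $ j))) (at x)"
  by (intro has_derivative_of_real bounded_linear_imp_has_derivative bounded_linear_vec_nth)

lemma pd_component: "pd i (\<lambda>x. complex_of_real (x $ j)) = (\<lambda>x. of_real (axis i 1 $ j))"
  by (rule ext) (rule pd_eqI[OF has_derivative_component])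

lemma moderate_component: "moderate_fam (\<lambda>_. 1) (\<lambda>_ x. of_real (x $ j))"
proof -
  have sm: "smooth (\<lambda>x. complex_of_real (x $ j))"
    by (rule smooth_coinduct[of _ "insert (\<lambda>x. complex_of_real (x $ j)) (range (\<lambda>a x. a))"])
      (auto simp: pd_component intro: differentiableI[OF has_derivative_component])
  have "\<exists>k C. \<forall>(n::nat) x. cmod (pds js (\<lambda>x. complex_of_real (x $ j)) x) \<le> C * 1 * (1 + norm x) ^ k" for js
  proof (cases js rule: rev_cases)
    case Nil
    have "cmod (of_real (x $ j)) \<le> 1 * 1 * (1 + norm x) ^ 1" for x :: "real^3"
      using component_le_norm_cart[of x j] by simp
    then show ?thesis using Nil by (auto intro!: exI[of _ 1] simp del: norm_of_real)
  next
    case (snoc ys i)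
    then show ?thesis
      by (intro exI[of _ 0] exI[of _ 1]) (auto simp: pds_pd[symmetric] pd_component pds_const axis_def)
  qed
  then show ?thesis using sm by (simp add: moderate_fam_def)
qed

lemma schwartz_fam_component:
  assumes "schwartz_fam c \<Phi>" shows "schwartz_fam c (\<lambda>n x. of_real (x $ j) * \<Phi> n x)"
  using schwartz_fam_mult[OF assms moderate_component[of j]] by (simp add: mult.commute)

lemma schwartz_component: "schwartz \<phi> \<Longrightarrow> schwartz (\<lambda>x. of_real (x $ j) * \<phi> x)"
  using schwartz_fam_component[of "\<lambda>_. 1" "\<lambda>_. \<phi>"] by (simp add: schwartz_iff_fam)

lemma pds_dilate:
  assumes "smooth f"
  shows "pds js (\<lambda>x. f (r *\<^sub>R x)) = (\<lambda>x. of_real (r ^ length js) * pds js f (r *\<^sub>R x))"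
    and "smooth (\<lambda>x. f (r *\<^sub>R x))"
proof -
  have D: "((\<lambda>x. of_real a * pds js f (r *\<^sub>R x)) has_derivative
      (\<lambda>h. of_real a * frechet_derivative (pds js f) (at (r *\<^sub>R x)) (r *\<^sub>R h))) (at x)" for js x and a :: real
  proof -
    have "(pds js f has_derivative frechet_derivative (pds js f) (at (r *\<^sub>R x))) (at (r *\<^sub>R x))"
      using assms smooth_pds smooth_differentiable frechet_derivative_works by blast
    then show ?thesis
      by (intro has_derivative_mult_right has_derivative_compose[where g = "pds js f" and f = "\<lambda>x. r *\<^sub>R x"])
        (auto intro!: derivative_eq_intros)
  qed
  have pd: "pd j (\<lambda>x. of_real a * pds js f (r *\<^sub>R x)) = (\<lambda>x. of_real (r * a) * pds (j # js) f (r *\<^sub>R x))" for j js and a :: real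
  proof
    fix x
    have "linear (frechet_derivative (pds js f) (at (r *\<^sub>R x)))"
      using assms smooth_pds smooth_differentiable linear_frechet_derivative by blast
    then show "pd j (\<lambda>x. of_real a * pds js f (r *\<^sub>R x)) x = of_real (r * a) * pds (j # js) f (r *\<^sub>R x)"
      by (subst pd_eqI[OF D]) (simp add: pds_Cons pd_def linear_scale scaleR_conv_of_real[where 'a = complex])
  qed
  show "pds js (\<lambda>x. f (r *\<^sub>R x)) = (\<lambda>x. of_real (r ^ length js) * pds js f (r *\<^sub>R x))" for js
    by (induction js) (simp, simp only: pds_Cons[of _ _ "\<lambda>x. f (r *\<^sub>R x)"] pd list.size(4) power_Suc add_Suc_right add_0_right One_nat_def)
  show "smooth (\<lambda>x. f (r *\<^sub>R x))"
  proof (rule smooth_coinduct[of _ "{(\<lambda>x. of_real a * pds js f (r *\<^sub>R x)) | a js. True}"])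
    show "(\<lambda>x. f (r *\<^sub>R x)) \<in> {\<lambda>x. complex_of_real a * pds js f (r *\<^sub>R x) |a js. True}"
      by (auto intro!: exI[of _ 1] exI[of _ "[]"])
    show "pd j g \<in> {\<lambda>x. complex_of_real a * pds js f (r *\<^sub>R x) |a js. True}"
      if "g \<in> {\<lambda>x. complex_of_real a * pds js f (r *\<^sub>R x) |a js. True}" for g j
      using that pd[of j] by blast
  qed (auto intro: differentiableI[OF D])
qed

lemma schwartz_fam_reflect:
  assumes "schwartz_fam c \<Phi>" shows "schwartz_fam c (\<lambda>n x. \<Phi> n (- x))"
proof -
  have eq: "pds js (\<lambda>x. \<Phi> n (- x)) = (\<lambda>x. of_real ((- 1) ^ length js) * pds js (\<Phi> n) (- x))" and s: "smooth (\<lambda>x. \<Phi> n (- x))" for n js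
    using pds_dilate(1)[of "\<Phi> n" js "-1"] pds_dilate(2)[of "\<Phi> n" "-1"] assms by (auto simp: schwartz_fam_def)
  have "\<exists>C. \<forall>n x. (1 + norm x) ^ k * cmod (pds js (\<lambda>x. \<Phi> n (- x)) x) \<le> C * c n" for k js
  proof -
    obtain C where "\<And>n x. (1 + norm x) ^ k * cmod (pds js (\<Phi> n) x) \<le> C * c n"
      using assms unfolding schwartz_fam_def by blast
    from this[of "- _"] show ?thesis by (auto simp: eq norm_mult norm_power)
  qed
  then show ?thesis using s by (simp add: schwartz_fam_def)
qed

section \<open>Cutoffs\<close>

text \<open>
  Derivatives are local, so those of a test function have the same bounded support.
\<close>

lemma pds_zero_outside:
  assumes "open U" "\<And>x. x \<in> U \<Longrightarrow> f x = 0" shows "x \<in> U \<Longrightarrow> pds js f x = 0"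
proof (induction js arbitrary: x)
  case (Cons j js)
  have "(pds js f has_derivative (\<lambda>_. 0)) (at x)"
    by (rule has_derivative_transform_within_open[OF has_derivative_const assms(1) Cons.prems]) (use Cons.IH in auto)
  from pd_eqI[OF this] show ?case by (simp add: pds_Cons)
qed (use assms in auto)

lemma test_fun_schwartz:
  assumes "test_fun \<phi>" shows "schwartz \<phi>"
proof -
  have s: "smooth \<phi>" using assms by (simp add: test_fun_def)
  obtain R where R: "\<And>x. \<phi> x \<noteq> 0 \<Longrightarrow> norm x \<le> R"
    using assms unfolding test_fun_def bounded_iff by auto
  have "bdd_above (range (\<lambda>x. (1 + norm x) ^ k * cmod (pds js \<phi> x)))" for k js
  proof -
    have z: "pds js \<phi> x = 0" if "x \<notin> cball 0 R" for x
      by (rule pds_zero_outside[of "- cball 0 R"]) (use R that in auto)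
    have "continuous_on UNIV (pds js \<phi>)"
      by (intro continuous_at_imp_continuous_on ballI differentiable_imp_continuous_within
          smooth_differentiable smooth_pds s)
    then have "continuous_on (cball 0 R) (\<lambda>x. (1 + norm x) ^ k * cmod (pds js \<phi> x))"
      by (auto intro!: continuous_intros intro: continuous_on_subset)
    then have "bounded ((\<lambda>x. (1 + norm x) ^ k * cmod (pds js \<phi> x)) ` cball 0 R)"
      by (intro compact_imp_bounded compact_continuous_image) auto
    then obtain B where "\<forall>y\<in>(\<lambda>x. (1 + norm x) ^ k * cmod (pds js \<phi> x)) ` cball 0 R. norm y \<le> B"
      unfolding bounded_iff by blast
    then have B: "(1 + norm x) ^ k * cmod (pds js \<phi> x) \<le> B" if "x \<in> cball 0 R" for x
      using that by (auto simp: abs_mult)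
    have "(1 + norm x) ^ k * cmod (pds js \<phi> x) \<le> max B 0" for x
      using B[of x] z[of x] by (cases "x \<in> cball 0 R") auto
    then show ?thesis by (auto intro!: bdd_aboveI)
  qed
  then show ?thesis using s by (simp add: schwartz_def)
qed

lemma frechet_derivative_pd:
  assumes "f differentiable (at x)"
  shows "frechet_derivative f (at x) h = (\<Sum>j\<in>UNIV. of_real (h $ j) * pd j f x)"
proof -
  have lin: "linear (frechet_derivative f (at x))" by (rule linear_frechet_derivative[OF assms])
  have "h = (\<Sum>j\<in>UNIV. (h $ j) *\<^sub>R axis j 1)"
    using basis_expansion[of h] by (simp add: scalar_mult_eq_scaleR)
  then have "frechet_derivative f (at x) h = frechet_derivative f (at x) (\<Sum>j\<in>UNIV. (h $ j) *\<^sub>R axis j 1)" by simp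
  also have "\<dots> = (\<Sum>j\<in>UNIV. of_real (h $ j) * pd j f x)"
    by (simp add: linear_sum[OF lin] linear_scale[OF lin] pd_def scaleR_conv_of_real[where 'a = complex])
  finally show ?thesis .
qed

lemma cutoff_exists: "\<exists>\<rho>. test_fun \<rho> \<and> \<rho> 0 = 1"
proof -
  let ?b = "box_bump 1 (\<chi> i. - 1) (\<chi> i. 1)"
  have "?b 0 \<noteq> 0" by (simp add: box_bump_def flat_exp_def)
  then have "(\<lambda>x. inverse (?b 0) * ?b x) 0 = 1" by simp
  moreover have "test_fun ?b" by (rule test_fun_box_bump) simp
  then have "test_fun (\<lambda>x. inverse (?b 0) * ?b x)"
    unfolding test_fun_def by (auto intro: smooth_cmul elim: bounded_subset)
  ultimately show ?thesis by blast
qed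

text \<open>
  Multiplying a Schwartz function by dilated cutoffs converges to it in the Schwartz space, at rate
  \<open>1/n\<close>: a derivative of the dilated cutoff carries a factor \<open>1/n\<close>, and the cutoff itself differs from one by at
  most \<open>C \<bar>x\<bar> / n\<close>, a growth that Schwartz functions absorb. So test functions are dense.
\<close>

lemma moderate_cutoff:
  assumes "test_fun \<rho>" "\<rho> 0 = 1"
  shows "moderate_fam (\<lambda>n. 1 / real (Suc n)) (\<lambda>n x. \<rho> ((1 / real (Suc n)) *\<^sub>R x) - 1)"
proof -
  have \<rho>: "schwartz \<rho>" and s: "smooth \<rho>" using assms test_fun_schwartz schwartz_smooth by auto
  have bdd: "\<exists>B\<ge>0. \<forall>x. cmod (pds js \<rho> x) \<le> B" for js
  proof -
    obtain B where "\<And>x. (1 + norm x) ^ 0 * cmod (pds js \<rho> x) \<le> B"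
      using schwartz_bdd[OF \<rho>, of 0 js] unfolding bdd_above_def by auto
    then show ?thesis by (intro exI[of _ B]) (auto intro: order_trans[OF norm_ge_zero])
  qed
  have sm: "smooth (\<lambda>x. \<rho> ((1 / real (Suc n)) *\<^sub>R x) - 1)" for n
    using smooth_add[OF pds_dilate(2)[OF s] smooth_const[of "-1"]] by simp
  have ps: "pds js (\<lambda>x. \<rho> ((1 / real (Suc n)) *\<^sub>R x) - 1) =
     (\<lambda>x. of_real ((1 / real (Suc n)) ^ length js) * pds js \<rho> ((1 / real (Suc n)) *\<^sub>R x))" if "js \<noteq> []" for n js
    using pds_add[OF pds_dilate(2)[OF s] smooth_const[of "-1"], of js "1 / real (Suc n)"] that
    by (simp add: pds_const pds_dilate(1)[OF s])
  have "\<exists>k C. \<forall>n x. cmod (pds js (\<lambda>x. \<rho> ((1 / real (Suc n)) *\<^sub>R x) - 1) x) \<le> C * (1 / real (Suc n)) * (1 + norm x) ^ k" for js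
  proof (cases "js = []")
    case False
    obtain B where B: "B \<ge> 0" "\<And>x. cmod (pds js \<rho> x) \<le> B" using bdd by blast
    have "cmod (pds js (\<lambda>x. \<rho> ((1 / real (Suc n)) *\<^sub>R x) - 1) x) \<le> B * (1 / real (Suc n)) * (1 + norm x) ^ 0" for n x
    proof -
      have "(1 / real (Suc n)) ^ length js \<le> (1 / real (Suc n)) ^ 1"
        using False by (intro power_decreasing) (auto simp: Suc_le_eq)
      then have "(1 / real (Suc n)) ^ length js * cmod (pds js \<rho> ((1 / real (Suc n)) *\<^sub>R x)) \<le> 1 / real (Suc n) * B"
        using B by (intro mult_mono) auto
      then show ?thesis unfolding ps[OF False] by (simp add: norm_mult norm_power norm_divide mult.commute del: of_nat_Suc)
    qed
    then show ?thesis by blast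
  next
    case True
    have "\<forall>j. \<exists>B. \<forall>x. cmod (pd j \<rho> x) \<le> B" using bdd[of "[_]"] by (auto simp: pds_def)
    then obtain B where B: "\<And>j x. cmod (pd j \<rho> x) \<le> B j" by metis
    have L: "cmod (\<rho> y - \<rho> 0) \<le> (\<Sum>j\<in>UNIV. B j) * norm (y - 0)" for y
    proof (rule differentiable_bound[of UNIV \<rho> "\<lambda>x. frechet_derivative \<rho> (at x)"])
      show "(\<rho> has_derivative frechet_derivative \<rho> (at x)) (at x within UNIV)" for x
        using smooth_differentiable[OF s] frechet_derivative_works by auto
      show "onorm (frechet_derivative \<rho> (at x)) \<le> (\<Sum>j\<in>UNIV. B j)" for x
      proof (rule onorm_le)
        fix h
        have "cmod (frechet_derivative \<rho> (at x) h) \<le> (\<Sum>j\<in>UNIV. norm h * B j)"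
          unfolding frechet_derivative_pd[OF smooth_differentiable[OF s]]
          by (intro sum_norm_le) (auto simp: norm_mult intro!: mult_mono component_le_norm_cart B)
        then show "cmod (frechet_derivative \<rho> (at x) h) \<le> (\<Sum>j\<in>UNIV. B j) * norm h"
          by (simp add: sum_distrib_left mult.commute)
      qed
    qed auto
    have B0: "0 \<le> (\<Sum>j\<in>UNIV. B j)" by (intro sum_nonneg) (metis B norm_ge_zero order_trans)
    have "cmod (\<rho> ((1 / real (Suc n)) *\<^sub>R x) - 1) \<le> (\<Sum>j\<in>UNIV. B j) * (1 / real (Suc n)) * (1 + norm x) ^ 1" for n x
    proof -
      have "cmod (\<rho> ((1 / real (Suc n)) *\<^sub>R x) - 1) \<le> (\<Sum>j\<in>UNIV. B j) * (1 / real (Suc n) * norm x)"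
        using L[of "(1 / real (Suc n)) *\<^sub>R x"] assms(2) by simp
      also have "\<dots> \<le> (\<Sum>j\<in>UNIV. B j) * (1 / real (Suc n) * (1 + norm x))"
        using B0 by (intro mult_left_mono) auto
      finally show ?thesis by simp
    qed
    then show ?thesis unfolding True pds_Nil by blast
  qed
  then show ?thesis using sm by (simp add: moderate_fam_def)
qed

section \<open>The Fourier transform on Schwartz functions\<close>

lemma cis_measurable [measurable]: "cis \<in> borel_measurable borel"
  by (intro borel_measurable_continuous_onI continuous_intros)

text \<open>
  A function that is not integrable has integral zero by convention, so only the bound has to be integrable.
\<close>

lemma norm_integral_le:
  fixes f :: "'a \<Rightarrow> 'b::{banach, second_countable_topology}"
  assumes "integrable M g" "\<And>x. norm (f x) \<le> g x"
  shows "norm (\<integral>x. f x \<partial>M) \<le> (\<integral>x. g x \<partial>M)"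
proof (cases "integrable M f")
  case True
  then show ?thesis using assms
    by (intro order_trans[OF integral_norm_bound integral_mono]) auto
next
  case False
  have "0 \<le> g x" for x using assms(2)[of x] norm_ge_zero order_trans by blast
  then show ?thesis using False by (simp add: not_integrable_integral_eq integral_nonneg_AE)
qed

lemma fourier_integrable:
  assumes "integrable lborel \<phi>" shows "integrable lborel (\<lambda>x. cis (- (\<xi> \<bullet> x)) * \<phi> x)"
  by (rule Bochner_Integration.integrable_bound[OF assms]) (use assms in \<open>auto simp: norm_mult\<close>)

lemma fourier_fun_add:
  assumes "integrable lborel \<phi>" "integrable lborel \<psi>"
  shows "fourier_fun (\<lambda>x. \<phi> x + \<psi> x) \<xi> = fourier_fun \<phi> \<xi> + fourier_fun \<psi> \<xi>"
  unfolding fourier_fun_def using assms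
  by (simp add: distrib_left Bochner_Integration.integral_add fourier_integrable)

lemma fourier_fun_diff:
  assumes "integrable lborel \<phi>" "integrable lborel \<psi>"
  shows "fourier_fun (\<lambda>x. \<phi> x - \<psi> x) \<xi> = fourier_fun \<phi> \<xi> - fourier_fun \<psi> \<xi>"
  unfolding fourier_fun_def using assms
  by (simp add: right_diff_distrib Bochner_Integration.integral_diff fourier_integrable)

lemma fourier_fun_cmul: "fourier_fun (\<lambda>x. c * \<phi> x) \<xi> = c * fourier_fun \<phi> \<xi>"
  unfolding fourier_fun_def by (simp add: mult.left_commute[of _ c])

lemma fourier_fun_bound:
  assumes "\<And>x. cmod (\<phi> x) \<le> C / (1 + norm x) ^ 6"
  shows "cmod (fourier_fun \<phi> \<xi>) \<le> C * (LINT x::real^3|lborel. 1 / (1 + norm x) ^ 6)"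
proof -
  have "integrable lborel (\<lambda>x::real^3. C * (1 / (1 + norm x) ^ 6))"
    by (intro integrable_mult_right integrable_inverse_power_decay)
  then have "cmod (fourier_fun \<phi> \<xi>) \<le> (LINT x::real^3|lborel. C * (1 / (1 + norm x) ^ 6))"
    unfolding fourier_fun_def by (rule norm_integral_le) (use assms in \<open>auto simp: norm_mult\<close>)
  then show ?thesis by (simp only: integral_mult_right_zero)
qed

lemma cis_taylor: "cmod (cis t - 1 - \<i> * of_real t) \<le> t\<^sup>2 / 2"
  using iexp_approx1[of t 1] by (simp add: cis_conv_exp diff_diff_eq power2_eq_square)

text \<open>
  Differentiation under the integral sign. The second-order Taylor bound for \<open>cis\<close> gives a remainder of size
  \<open>\<bar>h\<bar>\<^sup>2 \<bar>x\<bar>\<^sup>2 \<bar>\<phi> x\<bar>\<close>, which is integrable in \<open>x\<close>.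
\<close>

lemma fourier_fun_has_derivative:
  assumes \<phi>: "schwartz \<phi>"
  shows "(fourier_fun \<phi> has_derivative
     (\<lambda>h. \<Sum>j\<in>UNIV. of_real (h $ j) * fourier_fun (\<lambda>x. - \<i> * (of_real (x $ j) * \<phi> x)) \<xi>)) (at \<xi>)"
    (is "(_ has_derivative ?D) _")
proof -
  \<comment> \<open>two powers are spent on the second moment, six on integrability\<close>
  obtain C where C: "C \<ge> 0" "\<And>x. cmod (\<phi> x) \<le> C / (1 + norm x) ^ 8" using schwartz_decay[OF \<phi>] by blast
  define K where "K = C / 2 * (LINT x::real^3|lborel. 1 / (1 + norm x) ^ 6)"
  have int: "integrable lborel \<phi>" "\<And>j. integrable lborel (\<lambda>x. - \<i> * (of_real (x $ j) * \<phi> x))"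
    using \<phi> schwartz_integrable schwartz_component by (auto intro!: integrable_mult_right)
  have dec: "(norm x)\<^sup>2 * cmod (\<phi> x) \<le> C / (1 + norm x) ^ 6" for x :: "real^3"
  proof -
    have p: "0 < 1 + norm x" by (rule add_pos_nonneg) auto
    have "(norm x)\<^sup>2 * cmod (\<phi> x) \<le> (1 + norm x)\<^sup>2 * (C / (1 + norm x) ^ 8)"
      using C by (intro mult_mono power_mono) auto
    also have "\<dots> = C / (1 + norm x) ^ 6"
      using p by (simp add: field_simps power_add[symmetric])
    finally show ?thesis .
  qed
  have rem: "cmod (fourier_fun \<phi> (\<xi> + h) - fourier_fun \<phi> \<xi> - ?D h) \<le> K * (norm h)\<^sup>2" for h
  proof -
    have D: "?D h = (LINT x|lborel. cis (- (\<xi> \<bullet> x)) * (- \<i> * of_real (h \<bullet> x) * \<phi> x))"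
      (is "_ = integral\<^sup>L lborel ?d")
    proof -
      have "?D h = (\<Sum>j\<in>UNIV. (LINT x|lborel. of_real (h $ j) * (cis (- (\<xi> \<bullet> x)) * (- \<i> * (of_real (x $ j) * \<phi> x)))))"
        unfolding fourier_fun_def by (simp only: integral_mult_right_zero)
      also have "\<dots> = (LINT x|lborel. (\<Sum>j\<in>UNIV. of_real (h $ j) * (cis (- (\<xi> \<bullet> x)) * (- \<i> * (of_real (x $ j) * \<phi> x)))))"
        by (rule Bochner_Integration.integral_sum[symmetric]) (intro integrable_mult_right fourier_integrable int)
      also have "\<dots> = integral\<^sup>L lborel ?d"
        by (intro Bochner_Integration.integral_cong)
          (simp_all add: inner_vec_def sum_distrib_left sum_distrib_right sum_negf mult_ac)
      finally show ?thesis .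
    qed
    have intd: "integrable lborel ?d"
    proof -
      have "integrable lborel (\<lambda>x. \<Sum>j\<in>UNIV. of_real (h $ j) * (cis (- (\<xi> \<bullet> x)) * (- \<i> * (of_real (x $ j) * \<phi> x))))"
        by (intro Bochner_Integration.integrable_sum integrable_mult_right fourier_integrable int)
      then show ?thesis
        by (rule Bochner_Integration.integrable_cong[THEN iffD1, rotated 2])
          (simp_all add: inner_vec_def sum_distrib_left sum_distrib_right sum_negf mult_ac)
    qed
    have "fourier_fun \<phi> (\<xi> + h) - fourier_fun \<phi> \<xi> - ?D h =
       (LINT x|lborel. cis (- ((\<xi> + h) \<bullet> x)) * \<phi> x - cis (- (\<xi> \<bullet> x)) * \<phi> x - ?d x)"
      unfolding D unfolding fourier_fun_def
      by (subst Bochner_Integration.integral_diff[OF Bochner_Integration.integrable_diff[OF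
            fourier_integrable[OF int(1)] fourier_integrable[OF int(1)]] intd],
          subst Bochner_Integration.integral_diff[OF fourier_integrable[OF int(1)] fourier_integrable[OF int(1)]]) (rule refl)
    also have "cmod \<dots> \<le> (LINT x::real^3|lborel. (norm h)\<^sup>2 * (C / 2) * (1 / (1 + norm x) ^ 6))"
    proof (rule norm_integral_le)
      show "integrable lborel (\<lambda>x::real^3. (norm h)\<^sup>2 * (C / 2) * (1 / (1 + norm x) ^ 6))"
        by (intro integrable_mult_right integrable_inverse_power_decay)
      fix x :: "real^3"
      have "cis (- ((\<xi> + h) \<bullet> x)) = cis (- (\<xi> \<bullet> x)) * cis (- (h \<bullet> x))"
        by (simp add: cis_mult inner_add_left)
      then have "cis (- ((\<xi> + h) \<bullet> x)) * \<phi> x - cis (- (\<xi> \<bullet> x)) * \<phi> x - ?d x =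
          cis (- (\<xi> \<bullet> x)) * ((cis (- (h \<bullet> x)) - 1 - \<i> * of_real (- (h \<bullet> x))) * \<phi> x)"
        by (simp add: algebra_simps)
      also have "cmod \<dots> \<le> (h \<bullet> x)\<^sup>2 / 2 * cmod (\<phi> x)"
        using mult_right_mono[OF cis_taylor[of "- (h \<bullet> x)"], of "cmod (\<phi> x)"] by (simp add: norm_mult)
      also have "\<dots> \<le> (norm h * norm x)\<^sup>2 / 2 * cmod (\<phi> x)"
        using Cauchy_Schwarz_ineq2[of h x]
        by (intro mult_right_mono divide_right_mono) (auto simp: abs_le_square_iff[symmetric])
      also have "\<dots> = (norm h)\<^sup>2 / 2 * ((norm x)\<^sup>2 * cmod (\<phi> x))" by (simp add: power_mult_distrib)
      also have "\<dots> \<le> (norm h)\<^sup>2 / 2 * (C / (1 + norm x) ^ 6)" by (intro mult_left_mono dec) auto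
      finally show "norm (cis (- ((\<xi> + h) \<bullet> x)) * \<phi> x - cis (- (\<xi> \<bullet> x)) * \<phi> x - ?d x)
         \<le> (norm h)\<^sup>2 * (C / 2) * (1 / (1 + norm x) ^ 6)" by simp
    qed
    also have "\<dots> = K * (norm h)\<^sup>2" unfolding K_def integral_mult_right_zero by simp
    finally show ?thesis .
  qed
  have lin: "bounded_linear ?D"
    by (intro bounded_linear_sum bounded_linear_mult_left[THEN bounded_linear_compose] bounded_linear_compose[OF bounded_linear_of_real]
       bounded_linear_vec_nth)
  show ?thesis
    unfolding has_derivative_at
  proof (intro conjI lin)
    have K0: "((\<lambda>h::real^3. K * norm h) \<longlongrightarrow> 0) (at 0)"
      by (intro tendsto_mult_right_zero tendsto_norm_zero tendsto_ident_at)
    show "(\<lambda>h. norm (fourier_fun \<phi> (\<xi> + h) - fourier_fun \<phi> \<xi> - ?D h) / norm h) \<midarrow>0\<rightarrow> 0"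
    proof (rule tendsto_sandwich[OF _ _ tendsto_const K0])
      show "\<forall>\<^sub>F h in at 0. norm (fourier_fun \<phi> (\<xi> + h) - fourier_fun \<phi> \<xi> - ?D h) / norm h \<le> K * norm h"
        unfolding eventually_at_filter
        by (rule always_eventually) (use rem in \<open>auto simp: divide_le_eq power2_eq_square mult.assoc\<close>)
    qed auto
  qed
qed

lemma pd_fourier_fun:
  assumes "schwartz \<phi>"
  shows "pd j (fourier_fun \<phi>) = fourier_fun (\<lambda>x. - \<i> * (of_real (x $ j) * \<phi> x))"
proof
  fix \<xi>
  have "(\<Sum>i\<in>UNIV. complex_of_real (axis j 1 $ i) * f i) = f j" for f
    by (subst sum.remove[of _ j]) (auto simp: axis_def intro: sum.neutral)
  then show "pd j (fourier_fun \<phi>) \<xi> = fourier_fun (\<lambda>x. - \<i> * (of_real (x $ j) * \<phi> x)) \<xi>"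
    by (subst pd_eqI[OF fourier_fun_has_derivative[OF assms]]) simp
qed

text \<open>
  Integration by parts without boundary terms. The integral of a difference quotient vanishes by
  translation invariance, and the difference quotients are dominated through the mean value
  inequality because the decay changes by a bounded factor over steps of length at most one.
\<close>

lemma integral_pd_zero:
  assumes d: "\<And>x. f differentiable (at x)"
    and f: "\<And>x. cmod (f x) \<le> C / (1 + norm x) ^ 6" and f': "\<And>x. cmod (pd j f x) \<le> C / (1 + norm x) ^ 6"
  shows "(LINT x|lborel. pd j f x) = 0"
proof -
  have C: "C \<ge> 0" using order_trans[OF norm_ge_zero f[of 0]] by simp
  have [measurable]: "f \<in> borel_measurable borel"
    by (intro borel_measurable_continuous_onI continuous_at_imp_continuous_on ballI
            differentiable_imp_continuous_within d)
  have int: "integrable lborel f" by (rule integrable_decay[OF _ f]) simp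
  define e where "e = (axis j 1 :: real^3)"
  have ne: "norm e = 1" by (simp add: e_def norm_axis_1)
  have vd: "((\<lambda>s. f (x + s *\<^sub>R e)) has_derivative (\<lambda>r. r *\<^sub>R pd j f (x + s *\<^sub>R e))) (at s)" for x s
  proof -
    have "((\<lambda>s. x + s *\<^sub>R e) has_derivative (\<lambda>r. r *\<^sub>R e)) (at s)"
      by (auto intro!: derivative_eq_intros)
    from has_derivative_compose[OF this d[of "x + s *\<^sub>R e", unfolded frechet_derivative_works]]
    have "((\<lambda>s. f (x + s *\<^sub>R e)) has_derivative (\<lambda>r. frechet_derivative f (at (x + s *\<^sub>R e)) (r *\<^sub>R e))) (at s)" .
    then show ?thesis
      using linear_scale[OF linear_frechet_derivative[OF d]] by (simp add: pd_def e_def)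
  qed
  define q where "q n x = real (Suc n) *\<^sub>R (f (x + (1 / real (Suc n)) *\<^sub>R e) - f x)" for n x
  have lim: "(\<lambda>n. q n x) \<longlonglongrightarrow> pd j f x" for x
  proof -
    have "((\<lambda>h. norm (f (x + (0 + h) *\<^sub>R e) - f (x + 0 *\<^sub>R e) - h *\<^sub>R pd j f (x + 0 *\<^sub>R e)) / norm h) \<longlongrightarrow> 0) (at 0)"
      using vd[of x 0] unfolding has_derivative_at by blast
    moreover have "filterlim (\<lambda>n. 1 / real (Suc n)) (at 0) sequentially"
      unfolding filterlim_at using LIMSEQ_Suc[OF lim_1_over_n] by (auto intro!: always_eventually)
    ultimately have "(\<lambda>n. norm (f (x + (0 + 1 / real (Suc n)) *\<^sub>R e) - f (x + 0 *\<^sub>R e)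
        - (1 / real (Suc n)) *\<^sub>R pd j f (x + 0 *\<^sub>R e)) / norm (1 / real (Suc n))) \<longlonglongrightarrow> 0"
      by (rule filterlim_compose)
    moreover have "norm (f (x + (0 + 1 / real (Suc n)) *\<^sub>R e) - f (x + 0 *\<^sub>R e)
        - (1 / real (Suc n)) *\<^sub>R pd j f (x + 0 *\<^sub>R e)) / norm (1 / real (Suc n)) = norm (q n x - pd j f x)" for n
    proof -
      have "q n x - pd j f x = real (Suc n) *\<^sub>R (f (x + (1 / real (Suc n)) *\<^sub>R e) - f x - (1 / real (Suc n)) *\<^sub>R pd j f x)"
        by (simp add: q_def scaleR_diff_right del: of_nat_Suc)
      then show ?thesis by (simp add: norm_divide)
    qed
    ultimately have "(\<lambda>n. norm (q n x - pd j f x)) \<longlonglongrightarrow> 0" by simp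
    then show ?thesis using Lim_null tendsto_norm_zero_iff by metis
  qed
  have bound: "cmod (q n x) \<le> C * 2 ^ 6 / (1 + norm x) ^ 6" for n x
  proof -
    define s where "s = 1 / real (Suc n)"
    have s: "0 < s" "s \<le> 1" by (auto simp: s_def)
    have "cmod (f (x + s *\<^sub>R e) - f (x + 0 *\<^sub>R e)) \<le> C * 2 ^ 6 / (1 + norm x) ^ 6 * norm (s - 0)"
    proof (rule differentiable_bound[of "{0..s}" "\<lambda>s. f (x + s *\<^sub>R e)" "\<lambda>s r. r *\<^sub>R pd j f (x + s *\<^sub>R e)"])
      show "((\<lambda>s. f (x + s *\<^sub>R e)) has_derivative (\<lambda>r. r *\<^sub>R pd j f (x + r' *\<^sub>R e))) (at r' within {0..s})" for r'
        by (rule has_derivative_at_withinI[OF vd])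
      fix r assume r: "r \<in> {0..s}"
      have p: "0 < 1 + norm x" "0 < 1 + norm (x + r *\<^sub>R e)" by (auto intro!: add_pos_nonneg)
      have "norm x = norm ((x + r *\<^sub>R e) - r *\<^sub>R e)" by simp
      also have "\<dots> \<le> norm (x + r *\<^sub>R e) + norm (r *\<^sub>R e)" by (rule norm_triangle_ineq4)
      also have "\<dots> \<le> norm (x + r *\<^sub>R e) + 1" using r s ne by simp
      finally have "1 + norm x \<le> 2 * (1 + norm (x + r *\<^sub>R e))" using norm_ge_zero[of "x + r *\<^sub>R e"] unfolding distrib_left by linarith
      then have "(1 + norm x) ^ 6 \<le> (2 * (1 + norm (x + r *\<^sub>R e))) ^ 6" using p by (intro power_mono) auto
      then have "C / (1 + norm (x + r *\<^sub>R e)) ^ 6 \<le> C * 2 ^ 6 / (1 + norm x) ^ 6"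
        using p C by (simp only: power_mult_distrib) (simp add: field_simps mult_left_mono)
      then have le: "cmod (pd j f (x + r *\<^sub>R e)) \<le> C * 2 ^ 6 / (1 + norm x) ^ 6"
        using f'[of "x + r *\<^sub>R e"] by linarith
      show "onorm (\<lambda>ra. ra *\<^sub>R pd j f (x + r *\<^sub>R e)) \<le> C * 2 ^ 6 / (1 + norm x) ^ 6"
      proof (rule onorm_le)
        fix a
        show "norm (a *\<^sub>R pd j f (x + r *\<^sub>R e)) \<le> C * 2 ^ 6 / (1 + norm x) ^ 6 * norm a"
          using mult_right_mono[OF le, of "norm a"] by (simp only: norm_scaleR real_norm_def mult.commute norm_ge_zero simp_thms abs_ge_zero)
      qed
    qed (use s in auto)
    then have "cmod (f (x + s *\<^sub>R e) - f x) \<le> C * 2 ^ 6 / (1 + norm x) ^ 6 * s" using s by simp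
    then have "real (Suc n) * cmod (f (x + s *\<^sub>R e) - f x) \<le> real (Suc n) * (C * 2 ^ 6 / (1 + norm x) ^ 6 * s)"
      by (intro mult_left_mono) auto
    moreover have "real (Suc n) * (C * 2 ^ 6 / (1 + norm x) ^ 6 * s) = C * 2 ^ 6 / (1 + norm x) ^ 6"
      by (simp add: s_def del: of_nat_Suc)
    moreover have "cmod (q n x) = real (Suc n) * cmod (f (x + s *\<^sub>R e) - f x)"
      by (simp add: q_def s_def del: of_nat_Suc)
    ultimately show ?thesis by linarith
  qed
  have "(\<lambda>n. LINT x|lborel. q n x) \<longlonglongrightarrow> (LINT x|lborel. pd j f x)"
  proof (rule integral_dominated_convergence[where w = "\<lambda>x. C * 2 ^ 6 * (1 / (1 + norm x) ^ 6)"])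
    show "(\<lambda>x. q n x) \<in> borel_measurable lborel" for n unfolding q_def by measurable
    have "(\<lambda>x. pd j f x) \<in> borel_measurable borel"
      by (rule borel_measurable_LIMSEQ_metric[OF _ lim]) (simp add: q_def)
    then show "(\<lambda>x. pd j f x) \<in> borel_measurable lborel" by simp
    show "integrable lborel (\<lambda>x::real^3. C * 2 ^ 6 * (1 / (1 + norm x) ^ 6))"
      by (intro integrable_mult_right integrable_inverse_power_decay)
  qed (use lim bound in auto)
  moreover have "(LINT x|lborel. q n x) = 0" for n
  proof -
    have "(LINT x|lborel. f (x + (1 / real (Suc n)) *\<^sub>R e)) = (LINT x|lborel. f x)"
      using lborel_integral_affine[of 1 f "(1 / real (Suc n)) *\<^sub>R e"] by (simp add: add.commute)
    moreover have "integrable lborel (\<lambda>x. f (x + (1 / real (Suc n)) *\<^sub>R e))"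
      using lborel_integrable_affine[OF _ int, of 1 "(1 / real (Suc n)) *\<^sub>R e"] by (simp add: add.commute)
    ultimately show ?thesis unfolding q_def
      by (simp only: integral_scaleR_right) (simp add: Bochner_Integration.integral_diff int)
  qed
  ultimately show ?thesis by (auto dest: LIMSEQ_unique)
qed

lemma schwartz_pd_decay:
  assumes "schwartz \<phi>" obtains C where "C \<ge> 0" "\<And>x. cmod (pd j \<phi> x) \<le> C / (1 + norm x) ^ k"
  using schwartz_decay[OF schwartz_pd[OF assms]] by blast

lemma fourier_fun_pd:
  assumes \<phi>: "schwartz \<phi>"
  shows "fourier_fun (pd j \<phi>) \<xi> = \<i> * of_real (\<xi> $ j) * fourier_fun \<phi> \<xi>"
proof -
  obtain C where C: "C \<ge> 0" "\<And>x. cmod (\<phi> x) \<le> C / (1 + norm x) ^ 6" using schwartz_decay[OF \<phi>] by blast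
  obtain D where D: "D \<ge> 0" "\<And>x. cmod (pd j \<phi> x) \<le> D / (1 + norm x) ^ 6" using schwartz_pd_decay[OF \<phi>] by blast
  have sd: "\<phi> differentiable (at x)" for x using \<phi> schwartz_smooth smooth_differentiable by blast
  have dcis: "((\<lambda>x. cis (- (\<xi> \<bullet> x))) has_derivative (\<lambda>h. - \<i> * of_real (\<xi> \<bullet> h) * cis (- (\<xi> \<bullet> x)))) (at x)" for x
  proof -
    have "((\<lambda>x. - \<i> * of_real (\<xi> \<bullet> x)) has_derivative (\<lambda>h. - \<i> * of_real (\<xi> \<bullet> h))) (at x)"
      by (intro has_derivative_mult_right has_derivative_of_real) (auto intro!: derivative_eq_intros)
    from has_derivative_compose[OF this DERIV_exp[unfolded has_field_derivative_def]]
    show ?thesis by (simp add: cis_conv_exp mult_ac)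
  qed
  let ?f = "\<lambda>x. cis (- (\<xi> \<bullet> x)) * \<phi> x"
  have pdf: "pd j ?f x = cis (- (\<xi> \<bullet> x)) * pd j \<phi> x - \<i> * of_real (\<xi> $ j) * ?f x" for x
    by (subst pd_mult[OF differentiableI[OF dcis] sd])
      (simp add: pd_eqI[OF dcis] inner_axis)
  have "(LINT x|lborel. pd j ?f x) = 0"
  proof (rule integral_pd_zero[where C = "C + D + \<bar>\<xi> $ j\<bar> * C"])
    show "?f differentiable at x" for x by (intro differentiable_mult differentiableI[OF dcis] sd)
    fix x :: "real^3"
    have p: "0 < 1 + norm x" by (auto intro!: add_pos_nonneg)
    have "C / (1 + norm x) ^ 6 \<le> (C + D + \<bar>\<xi> $ j\<bar> * C) / (1 + norm x) ^ 6"
      using C D p by (intro divide_right_mono) auto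
    then show "cmod (?f x) \<le> (C + D + \<bar>\<xi> $ j\<bar> * C) / (1 + norm x) ^ 6"
      using C(2)[of x] by (simp add: norm_mult)
    have "cmod (pd j ?f x) \<le> cmod (pd j \<phi> x) + \<bar>\<xi> $ j\<bar> * cmod (\<phi> x)"
      unfolding pdf by (rule order_trans[OF norm_triangle_ineq4]) (simp add: norm_mult)
    also have "\<dots> \<le> D / (1 + norm x) ^ 6 + \<bar>\<xi> $ j\<bar> * (C / (1 + norm x) ^ 6)"
      by (intro add_mono mult_left_mono C D) auto
    also have "\<dots> \<le> (C + D + \<bar>\<xi> $ j\<bar> * C) / (1 + norm x) ^ 6"
      using C p by (simp add: add_divide_distrib)
    finally show "cmod (pd j ?f x) \<le> (C + D + \<bar>\<xi> $ j\<bar> * C) / (1 + norm x) ^ 6" .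
  qed
  moreover have "(LINT x|lborel. pd j ?f x) = fourier_fun (pd j \<phi>) \<xi> - \<i> * of_real (\<xi> $ j) * fourier_fun \<phi> \<xi>"
    unfolding pdf fourier_fun_def
    using fourier_integrable[OF schwartz_integrable[OF \<phi>]] fourier_integrable[OF schwartz_integrable[OF schwartz_pd[OF \<phi>]]]
    by (simp add: Bochner_Integration.integral_diff integrable_mult_right)
  ultimately show ?thesis by simp
qed

lemma fourier_fun_pd_power:
  assumes "schwartz \<phi>"
  shows "fourier_fun ((pd j ^^ k) \<phi>) \<xi> = (\<i> * of_real (\<xi> $ j)) ^ k * fourier_fun \<phi> \<xi>"
    and "schwartz ((pd j ^^ k) \<phi>)"
proof (induction k)
  case (Suc k)
  { case 1 show ?case using Suc fourier_fun_pd[OF Suc(2)] by simp }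
  { case 2 show ?case using Suc schwartz_pd by simp }
qed (use assms in auto)

lemma japanese_power_le:
  "(1 + norm (x::real^3)) ^ k \<le> 4 ^ k * (1 + (\<Sum>j\<in>UNIV. \<bar>x $ j\<bar> ^ k))"
proof -
  define m where "m = Max (insert 1 (range (\<lambda>j. \<bar>x $ j\<bar>)))"
  have m: "1 \<le> m" "\<And>j. \<bar>x $ j\<bar> \<le> m" unfolding m_def by (auto intro!: Max_ge simp del: Max_insert)
  have "m \<in> insert 1 (range (\<lambda>j. \<bar>x $ j\<bar>))" unfolding m_def by (rule Max_in) auto
  then have mk: "m ^ k \<le> 1 + (\<Sum>j\<in>UNIV. \<bar>x $ j\<bar> ^ k)"
  proof
    assume "m \<in> range (\<lambda>j. \<bar>x $ j\<bar>)"
    then obtain j where "m = \<bar>x $ j\<bar>" by auto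
    then show ?thesis using member_le_sum[of j UNIV "\<lambda>j. \<bar>x $ j\<bar> ^ k"] by simp
  qed (simp add: sum_nonneg)
  have "norm x \<le> (\<Sum>j\<in>UNIV. \<bar>x $ j\<bar>)" by (rule norm_le_l1_cart)
  also have "\<dots> \<le> (\<Sum>j\<in>(UNIV::3 set). m)" by (intro sum_mono m)
  finally have "1 + norm x \<le> 4 * m" using m(1) by simp
  then have "(1 + norm x) ^ k \<le> (4 * m) ^ k" by (intro power_mono) auto
  also have "\<dots> \<le> 4 ^ k * (1 + (\<Sum>j\<in>UNIV. \<bar>x $ j\<bar> ^ k))" using mk by (simp add: power_mult_distrib)
  finally show ?thesis .
qed

text \<open>
  Derivatives of the transform are transforms of \<open>x\<^sub>j \<phi>\<close>, and multiplying the transform by \<open>\<xi>\<^sub>j\<close> amounts to transforming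
  \<open>\<partial>\<^sub>j \<phi>\<close>. Both operations preserve families of Schwartz functions, so it suffices to bound the transform itself.
\<close>

lemma schwartz_fam_fourier:
  assumes "schwartz_fam c \<Phi>" shows "schwartz_fam c (\<lambda>n. fourier_fun (\<Phi> n))"
proof -
  define S where "S = {\<lambda>n. fourier_fun (\<Psi> n) | \<Psi>. schwartz_fam c \<Psi>}"
  have diff: "f n differentiable at x" if "f \<in> S" for f n x
    using that schwartz_fam_schwartz differentiableI[OF fourier_fun_has_derivative] by (auto simp: S_def)
  have pdS: "(\<lambda>n. pd j (f n)) \<in> S" if "f \<in> S" for f j
  proof -
    from that obtain \<Psi> where \<Psi>: "schwartz_fam c \<Psi>" "f = (\<lambda>n. fourier_fun (\<Psi> n))" by (auto simp: S_def)
    have "(\<lambda>n. pd j (f n)) = (\<lambda>n. fourier_fun (\<lambda>x. - \<i> * (of_real (x $ j) * \<Psi> n x)))"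
      using \<Psi> pd_fourier_fun schwartz_fam_schwartz by blast
    then show ?thesis unfolding S_def
      by (intro CollectI exI conjI) (assumption, intro schwartz_fam_cmul schwartz_fam_component \<Psi>(1))
  qed
  have pds: "(\<lambda>n. pds js (f n)) \<in> S" if "f \<in> S" for f js
    by (induction js) (use that pdS in \<open>auto simp: pds_Cons\<close>)
  have bound: "\<exists>C. \<forall>n x. (1 + norm x) ^ k * cmod (f n x) \<le> C * c n" if "f \<in> S" for f k
  proof -
    define I where "I = (LINT x::real^3|lborel. 1 / (1 + norm x) ^ 6)"
    from that obtain \<Psi> where \<Psi>: "schwartz_fam c \<Psi>" "f = (\<lambda>n. fourier_fun (\<Psi> n))" by (auto simp: S_def)
    have fb: "\<exists>C. \<forall>n x. cmod (fourier_fun (\<Theta> n) x) \<le> C * c n" if fam: "schwartz_fam c \<Theta>" for \<Theta>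
    proof -
      obtain C where C: "\<And>n x. cmod (\<Theta> n x) \<le> C * c n / (1 + norm x) ^ 6" using schwartz_fam_decay[OF fam] by blast
      have "cmod (fourier_fun (\<Theta> n) x) \<le> (C * I) * c n" for n x
        using fourier_fun_bound[OF C, of n x] by (simp add: I_def mult_ac)
      then show ?thesis by blast
    qed
    have fam: "schwartz_fam c (\<lambda>n. (pd j ^^ k) (\<Psi> n))" for j
      by (induction k) (use \<Psi> in \<open>auto intro: schwartz_fam_pd\<close>)
    have "\<exists>C. \<forall>n x. \<bar>x $ j\<bar> ^ k * cmod (f n x) \<le> C * c n" for j
    proof -
      have eq: "cmod (fourier_fun ((pd j ^^ k) (\<Psi> n)) x) = \<bar>x $ j\<bar> ^ k * cmod (f n x)" for n x
        using fourier_fun_pd_power(1)[OF schwartz_fam_schwartz[OF \<Psi>(1)]] by (simp add: \<Psi>(2) norm_mult norm_power)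
      show ?thesis using fb[OF fam, of j] unfolding eq .
    qed
    then obtain D where D: "\<And>j n x. \<bar>x $ j\<bar> ^ k * cmod (f n x) \<le> D j * c n" by metis
    obtain D0 where D0: "\<And>n x. cmod (f n x) \<le> D0 * c n" using fb[OF \<Psi>(1)] \<Psi>(2) by auto
    have "(1 + norm x) ^ k * cmod (f n x) \<le> (4 ^ k * (D0 + (\<Sum>j\<in>UNIV. D j))) * c n" for n x
    proof -
      have "(1 + norm x) ^ k * cmod (f n x) \<le> (4 ^ k * (1 + (\<Sum>j\<in>UNIV. \<bar>x $ j\<bar> ^ k))) * cmod (f n x)"
        by (intro mult_right_mono japanese_power_le) auto
      also have "\<dots> = 4 ^ k * (cmod (f n x) + (\<Sum>j\<in>UNIV. \<bar>x $ j\<bar> ^ k * cmod (f n x)))"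
        by (simp add: algebra_simps sum_distrib_right sum_distrib_left)
      also have "\<dots> \<le> 4 ^ k * (D0 * c n + (\<Sum>j\<in>UNIV. D j * c n))"
        by (intro mult_left_mono add_mono sum_mono D D0) auto
      finally show ?thesis by (simp add: algebra_simps sum_distrib_right sum_distrib_left)
    qed
    then show ?thesis by blast
  qed
  have inS: "(\<lambda>n. fourier_fun (\<Phi> n)) \<in> S" using assms by (auto simp: S_def)
  show ?thesis
    unfolding schwartz_fam_def smooth_def
    using diff[OF pds[OF inS]] bound[OF pds[OF inS]] by auto
qed

lemma schwartz_fourier: "schwartz \<phi> \<Longrightarrow> schwartz (fourier_fun \<phi>)"
  using schwartz_fam_fourier[of "\<lambda>_. 1" "\<lambda>_. \<phi>"] by (simp add: schwartz_iff_fam)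

section \<open>Fourier inversion on Schwartz functions\<close>

lemma norm_sq_eq_sum_Basis: "(norm x)\<^sup>2 = (\<Sum>b\<in>Basis. (x \<bullet> b)\<^sup>2)"
  unfolding power2_norm_eq_inner by (subst euclidean_inner) (simp add: power2_eq_square)

definition gauss :: "real^3 \<Rightarrow> real" where
  "gauss x = (\<Prod>b\<in>Basis. std_normal_density (x \<bullet> b))"

lemma gauss_measurable [measurable]: "gauss \<in> borel_measurable borel"
  unfolding gauss_def[abs_def] by measurable

lemma gauss_nonneg: "0 \<le> gauss x"
  unfolding gauss_def by (intro prod_nonneg) auto

lemma gauss_eq: "gauss x = exp (- (norm x)\<^sup>2 / 2) / (sqrt (2 * pi)) ^ 3"
proof -
  have "gauss x = (\<Prod>b\<in>Basis. exp (- (x \<bullet> b)\<^sup>2 / 2) / sqrt (2 * pi))"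
    unfolding gauss_def by (simp add: std_normal_density_def)
  also have "\<dots> = exp (\<Sum>b\<in>Basis. - (x \<bullet> b)\<^sup>2 / 2) / (sqrt (2 * pi)) ^ 3"
    by (simp add: prod_dividef exp_sum)
  also have "(\<Sum>b\<in>Basis. - (x \<bullet> b)\<^sup>2 / 2) = - (norm x)\<^sup>2 / 2"
    by (simp add: norm_sq_eq_sum_Basis sum_negf sum_divide_distrib)
  finally show ?thesis .
qed

lemma std_normal_cis:
  "integrable lborel (\<lambda>x. cis (t * x) * of_real (std_normal_density x))"
  "(LINT x|lborel. cis (t * x) * of_real (std_normal_density x)) = of_real (exp (- t\<^sup>2 / 2))"
proof -
  have "integrable lborel (\<lambda>x. std_normal_density x)" by (rule integrable_normal_density) simp
  from integrable_of_real[OF this, where 'a = complex]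
  show "integrable lborel (\<lambda>x. cis (t * x) * of_real (std_normal_density x))"
    by (rule Bochner_Integration.integrable_bound) (auto simp: norm_mult)
  have "char std_normal_distribution t = (LINT x|lborel. std_normal_density x *\<^sub>R cis (t * x))"
    unfolding char_def by (subst integral_density) (auto simp: cis_conv_exp)
  then show "(LINT x|lborel. cis (t * x) * of_real (std_normal_density x)) = of_real (exp (- t\<^sup>2 / 2))"
    by (simp add: char_std_normal_distribution scaleR_conv_of_real mult.commute)
qed

text \<open>
  Up to normalisation the Gaussian is its own transform: this reduces to the characteristic function of the standard
  normal distribution in each coordinate.
\<close>

lemma gauss_cis:
  "integrable lborel (\<lambda>x. cis (t \<bullet> x) * of_real (gauss x))"
  "(LINT x|lborel. cis (t \<bullet> x) * of_real (gauss x)) = of_real (exp (- (norm t)\<^sup>2 / 2))"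
proof -
  interpret product_sigma_finite "\<lambda>b::real^3. lborel :: real measure"
    by (rule product_sigma_finite.intro) (rule sigma_finite_lborel)
  let ?f = "\<lambda>b x. cis ((t \<bullet> b) * x) * complex_of_real (std_normal_density x)"
  let ?P = "Pi\<^sub>M Basis (\<lambda>b::real^3. lborel :: real measure)"
  let ?s = "\<lambda>f::real^3 \<Rightarrow> real. (\<Sum>b\<in>Basis. f b *\<^sub>R b)"
  have lb: "(lborel :: (real^3) measure) = distr ?P borel ?s"
    by (subst lborel_def) (simp add: lborel_eq_real)
  have m: "?s \<in> measurable ?P borel" by measurable
  have eq: "cis (t \<bullet> ?s f) * of_real (gauss (?s f)) = (\<Prod>b\<in>Basis. ?f b (f b))" for f
  proof -
    have "?s f \<bullet> b = f b" if "b \<in> Basis" for b using that by simp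
    then have "gauss (?s f) = (\<Prod>b\<in>Basis. std_normal_density (f b))" by (simp add: gauss_def)
    moreover have "cis (t \<bullet> ?s f) = (\<Prod>b\<in>Basis. cis ((t \<bullet> b) * f b))"
      by (simp add: cis_conv_exp inner_sum_right sum_distrib_left exp_sum[symmetric] mult_ac)
    ultimately show ?thesis by (simp add: prod.distrib)
  qed
  have int: "integrable ?P (\<lambda>f. \<Prod>b\<in>Basis. ?f b (f b))"
    by (rule product_integrable_prod) (auto intro: std_normal_cis)
  show "integrable lborel (\<lambda>x. cis (t \<bullet> x) * of_real (gauss x))"
    unfolding lb using int by (subst integrable_distr_eq[OF m]) (auto simp: eq)
  have "(LINT x|lborel. cis (t \<bullet> x) * of_real (gauss x)) = (LINT f|?P. (\<Prod>b\<in>Basis. ?f b (f b)))"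
    unfolding lb by (subst integral_distr[OF m]) (auto simp: eq)
  also have "\<dots> = (\<Prod>b\<in>Basis. LINT x|lborel. ?f b x)"
    by (rule product_integral_prod) (auto intro: std_normal_cis)
  also have "\<dots> = of_real (\<Prod>b\<in>Basis. exp (- (t \<bullet> b)\<^sup>2 / 2))"
    by (simp add: std_normal_cis(2))
  also have "(\<Prod>b\<in>Basis. exp (- (t \<bullet> b)\<^sup>2 / 2)) = exp (- (norm t)\<^sup>2 / 2)"
    by (simp add: exp_sum[symmetric] sum_negf sum_divide_distrib[symmetric] norm_sq_eq_sum_Basis)
  finally show "(LINT x|lborel. cis (t \<bullet> x) * of_real (gauss x)) = of_real (exp (- (norm t)\<^sup>2 / 2))" .
qed

lemma gauss_integral: "integrable lborel gauss" "(LINT x|lborel. gauss x) = 1"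
proof -
  have "integrable lborel (\<lambda>x. complex_of_real (gauss x))" using gauss_cis(1)[of 0] by simp
  from integrable_Re[OF this] show "integrable lborel gauss" by simp
  have "complex_of_real (LINT x|lborel. gauss x) = 1" using gauss_cis(2)[of 0] by simp
  then show "(LINT x|lborel. gauss x) = 1" by (simp only: of_real_eq_1_iff)
qed

lemma integrable_pair_mult:
  fixes f :: "'a \<Rightarrow> 'c::{real_normed_field, banach, second_countable_topology}"
  assumes "sigma_finite_measure M1" "sigma_finite_measure M2" "integrable M1 f" "integrable M2 g"
  shows "integrable (M1 \<Otimes>\<^sub>M M2) (\<lambda>(x, y). f x * g y)"
proof -
  interpret pair_sigma_finite M1 M2 using assms by (simp add: pair_sigma_finite_def)
  note [measurable] = borel_measurable_integrable[OF assms(3)] borel_measurable_integrable[OF assms(4)]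
  show ?thesis
  proof (rule Fubini_integrable)
    show "integrable M1 (\<lambda>x. LINT y|M2. norm (case (x, y) of (x, y) \<Rightarrow> f x * g y))"
      using integrable_norm[OF assms(3)] by (simp add: norm_mult)
  qed (use assms in auto)
qed

text \<open>
  The inverse transform is regularised by a wide Gaussian and Fubini's theorem moves the
  Gaussian to the other side, where it is an approximate identity concentrating at \<open>x\<close>. Both limits exist by
  dominated convergence.
\<close>

lemma fourier_inversion_integrable:
  assumes "integrable lborel \<phi>" "continuous_on UNIV \<phi>" "\<And>x. cmod (\<phi> x) \<le> B" "integrable lborel (fourier_fun \<phi>)"
  shows "fourier_fun (fourier_fun \<phi>) (- x) = of_real ((2 * pi) ^ 3) * \<phi> x"
proof -
  note [measurable] = borel_measurable_integrable[OF assms(1)] borel_measurable_integrable[OF assms(4)]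
  define \<epsilon> where "\<epsilon> n = 1 / real (Suc n)" for n
  have \<epsilon>: "\<epsilon> n > 0" "\<epsilon> n \<noteq> 0" for n by (auto simp: \<epsilon>_def)
  have \<epsilon>0: "\<epsilon> \<longlonglongrightarrow> 0" using LIMSEQ_Suc[OF lim_1_over_n] by (simp add: \<epsilon>_def[abs_def])
  define K where "K = (sqrt (2 * pi)) ^ 3"
  have K: "K > 0" "K * K = (2 * pi) ^ 3"
    by (auto simp: K_def power_mult_distrib[symmetric])
  have G: "exp (- (norm z)\<^sup>2 / 2) = K * gauss z" for z using K(1) by (simp add: gauss_eq K_def)
  define J where "J n = (LINT \<xi>|lborel. cis (\<xi> \<bullet> x) * fourier_fun \<phi> \<xi> * of_real (K * gauss (\<epsilon> n *\<^sub>R \<xi>)))" for n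
  have gle: "K * gauss z \<le> 1" for z unfolding G[symmetric] by simp
  have lim1: "J \<longlonglongrightarrow> (LINT \<xi>|lborel. cis (\<xi> \<bullet> x) * fourier_fun \<phi> \<xi>)"
    unfolding J_def
  proof (rule integral_dominated_convergence[where w = "\<lambda>\<xi>. cmod (fourier_fun \<phi> \<xi>)"])
    show "AE \<xi> in lborel. (\<lambda>n. cis (\<xi> \<bullet> x) * fourier_fun \<phi> \<xi> * of_real (K * gauss (\<epsilon> n *\<^sub>R \<xi>))) \<longlonglongrightarrow> cis (\<xi> \<bullet> x) * fourier_fun \<phi> \<xi>"
    proof (rule AE_I2)
      fix \<xi> :: "real^3"
      have "(\<lambda>n. exp (- (norm (\<epsilon> n *\<^sub>R \<xi>))\<^sup>2 / 2)) \<longlonglongrightarrow> exp (- (norm (0 *\<^sub>R \<xi>))\<^sup>2 / 2)"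
        by (intro tendsto_intros \<epsilon>0) auto
      then have "(\<lambda>n. complex_of_real (K * gauss (\<epsilon> n *\<^sub>R \<xi>))) \<longlonglongrightarrow> of_real 1"
        unfolding G by (intro tendsto_of_real) (simp add: G[symmetric])
      from tendsto_mult[OF tendsto_const this, of "cis (\<xi> \<bullet> x) * fourier_fun \<phi> \<xi>"]
      show "(\<lambda>n. cis (\<xi> \<bullet> x) * fourier_fun \<phi> \<xi> * of_real (K * gauss (\<epsilon> n *\<^sub>R \<xi>))) \<longlonglongrightarrow> cis (\<xi> \<bullet> x) * fourier_fun \<phi> \<xi>"
        by simp
    qed
    show "AE \<xi> in lborel. cmod (cis (\<xi> \<bullet> x) * fourier_fun \<phi> \<xi> * of_real (K * gauss (\<epsilon> n *\<^sub>R \<xi>))) \<le> cmod (fourier_fun \<phi> \<xi>)" for n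
    proof (rule AE_I2)
      fix \<xi>
      have "\<bar>K * gauss (\<epsilon> n *\<^sub>R \<xi>)\<bar> \<le> 1" using gle K gauss_nonneg by (simp add: abs_of_nonneg)
      then show "cmod (cis (\<xi> \<bullet> x) * fourier_fun \<phi> \<xi> * of_real (K * gauss (\<epsilon> n *\<^sub>R \<xi>))) \<le> cmod (fourier_fun \<phi> \<xi>)"
        unfolding norm_mult norm_cis norm_of_real by (simp add: mult_left_le)
    qed
  qed (use assms in auto)
  have J2: "J n = of_real (K * K) * (LINT z|lborel. \<phi> (x + \<epsilon> n *\<^sub>R z) * of_real (gauss z))" for n
  proof -
    have "integrable lborel (\<lambda>\<xi>. gauss (\<epsilon> n *\<^sub>R \<xi>))"
      using lborel_integrable_affine[OF \<epsilon>(2)[of n] gauss_integral(1), of 0] by simp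
    then have int_g: "integrable lborel (\<lambda>\<xi>::real^3. complex_of_real (K * gauss (\<epsilon> n *\<^sub>R \<xi>)))"
      by (rule integrable_of_real[OF integrable_mult_right])
    have intp: "integrable (lborel \<Otimes>\<^sub>M lborel) (\<lambda>(\<xi>, y). cis (\<xi> \<bullet> x) * (cis (- (\<xi> \<bullet> y)) * \<phi> y) * of_real (K * gauss (\<epsilon> n *\<^sub>R \<xi>)))"
    proof (rule Bochner_Integration.integrable_bound)
      show "integrable (lborel \<Otimes>\<^sub>M lborel) (\<lambda>(\<xi>, y). complex_of_real (K * gauss (\<epsilon> n *\<^sub>R \<xi>)) * \<phi> y)"
        by (rule integrable_pair_mult[OF sigma_finite_lborel sigma_finite_lborel int_g assms(1)])
    qed (auto simp: norm_mult split: prod.split)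
    have "J n = (LINT \<xi>|lborel. LINT y|lborel. cis (\<xi> \<bullet> x) * (cis (- (\<xi> \<bullet> y)) * \<phi> y) * of_real (K * gauss (\<epsilon> n *\<^sub>R \<xi>)))"
      unfolding J_def fourier_fun_def by (simp only: integral_mult_right_zero integral_mult_left_zero)
    also have "\<dots> = (LINT y|lborel. LINT \<xi>|lborel. cis (\<xi> \<bullet> x) * (cis (- (\<xi> \<bullet> y)) * \<phi> y) * of_real (K * gauss (\<epsilon> n *\<^sub>R \<xi>)))"
      by (rule lborel_pair.Fubini_integral[symmetric]) (use intp in simp)
    also have "\<dots> = (LINT y|lborel. \<phi> y * of_real (K * K / \<epsilon> n ^ 3 * gauss ((1 / \<epsilon> n) *\<^sub>R (y - x))))"
    proof (rule Bochner_Integration.integral_cong[OF refl])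
      fix y
      let ?w = "(1 / \<epsilon> n) *\<^sub>R (x - y)"
      have "(LINT \<xi>|lborel. cis (\<xi> \<bullet> x) * (cis (- (\<xi> \<bullet> y)) * \<phi> y) * of_real (K * gauss (\<epsilon> n *\<^sub>R \<xi>))) =
         (LINT \<xi>|lborel. (\<phi> y * of_real K) * (cis (?w \<bullet> (\<epsilon> n *\<^sub>R \<xi>)) * of_real (gauss (\<epsilon> n *\<^sub>R \<xi>))))"
      proof (rule Bochner_Integration.integral_cong[OF refl])
        fix \<xi>
        have "?w \<bullet> (\<epsilon> n *\<^sub>R \<xi>) = \<xi> \<bullet> x + - (\<xi> \<bullet> y)"
          using \<epsilon>(2)[of n] by (simp add: inner_diff_left inner_diff_right inner_commute)
        then have "cis (?w \<bullet> (\<epsilon> n *\<^sub>R \<xi>)) = cis (\<xi> \<bullet> x) * cis (- (\<xi> \<bullet> y))"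
          by (simp only: cis_mult)
        then show "cis (\<xi> \<bullet> x) * (cis (- (\<xi> \<bullet> y)) * \<phi> y) * of_real (K * gauss (\<epsilon> n *\<^sub>R \<xi>)) =
            (\<phi> y * of_real K) * (cis (?w \<bullet> (\<epsilon> n *\<^sub>R \<xi>)) * of_real (gauss (\<epsilon> n *\<^sub>R \<xi>)))"
          by (simp only: of_real_mult mult_ac)
      qed
      also have "\<dots> = (\<phi> y * of_real K) * (LINT \<xi>|lborel. cis (?w \<bullet> (\<epsilon> n *\<^sub>R \<xi>)) * of_real (gauss (\<epsilon> n *\<^sub>R \<xi>)))"
        by (rule integral_mult_right_zero)
      also have "(LINT \<xi>|lborel. cis (?w \<bullet> (\<epsilon> n *\<^sub>R \<xi>)) * of_real (gauss (\<epsilon> n *\<^sub>R \<xi>))) =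
         of_real (1 / \<epsilon> n ^ 3) * (LINT \<zeta>|lborel. cis (?w \<bullet> \<zeta>) * of_real (gauss \<zeta>))"
        using lborel_integral_affine[OF \<epsilon>(2)[of n], of "\<lambda>\<zeta>. cis (?w \<bullet> \<zeta>) * of_real (gauss \<zeta>)" 0] \<epsilon>[of n]
        by (simp add: scaleR_conv_of_real[where 'a = complex] abs_of_pos)
      also have "(LINT \<zeta>|lborel. cis (?w \<bullet> \<zeta>) * of_real (gauss \<zeta>)) = of_real (K * gauss ((1 / \<epsilon> n) *\<^sub>R (y - x)))"
        unfolding gauss_cis(2) G[symmetric] by (simp add: norm_minus_commute)
      finally show "(LINT \<xi>|lborel. cis (\<xi> \<bullet> x) * (cis (- (\<xi> \<bullet> y)) * \<phi> y) * of_real (K * gauss (\<epsilon> n *\<^sub>R \<xi>))) =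
         \<phi> y * of_real (K * K / \<epsilon> n ^ 3 * gauss ((1 / \<epsilon> n) *\<^sub>R (y - x)))" by (simp add: mult_ac)
    qed
    also have "\<dots> = of_real (\<epsilon> n ^ 3) * (LINT z|lborel. \<phi> (x + \<epsilon> n *\<^sub>R z) * of_real (K * K / \<epsilon> n ^ 3 * gauss z))"
      using lborel_integral_affine[OF \<epsilon>(2)[of n], of "\<lambda>y. \<phi> y * of_real (K * K / \<epsilon> n ^ 3 * gauss ((1 / \<epsilon> n) *\<^sub>R (y - x)))" x] \<epsilon>[of n]
      by (simp add: scaleR_conv_of_real[where 'a = complex] abs_of_pos)
    also have "\<dots> = (LINT z|lborel. of_real (K * K) * (\<phi> (x + \<epsilon> n *\<^sub>R z) * of_real (gauss z)))"
      unfolding integral_mult_right_zero[symmetric]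
      by (rule Bochner_Integration.integral_cong) (use \<epsilon>[of n] in simp_all)
    finally show ?thesis by (simp only: integral_mult_right_zero)
  qed
  have "(\<lambda>n. LINT z|lborel. \<phi> (x + \<epsilon> n *\<^sub>R z) * of_real (gauss z)) \<longlonglongrightarrow> (LINT z|lborel. \<phi> x * of_real (gauss z))"
  proof (rule integral_dominated_convergence[where w = "\<lambda>z. B * gauss z"])
    show "AE z in lborel. (\<lambda>n. \<phi> (x + \<epsilon> n *\<^sub>R z) * of_real (gauss z)) \<longlonglongrightarrow> \<phi> x * of_real (gauss z)"
    proof (rule AE_I2)
      fix z :: "real^3"
      have "(\<lambda>n. x + \<epsilon> n *\<^sub>R z) \<longlonglongrightarrow> x + 0 *\<^sub>R z" by (intro tendsto_intros \<epsilon>0)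
      moreover have "isCont \<phi> x" using assms(2) by (simp add: continuous_on_eq_continuous_at)
      ultimately have "(\<lambda>n. \<phi> (x + \<epsilon> n *\<^sub>R z)) \<longlonglongrightarrow> \<phi> x" by (auto intro: isCont_tendsto_compose)
      then show "(\<lambda>n. \<phi> (x + \<epsilon> n *\<^sub>R z) * of_real (gauss z)) \<longlonglongrightarrow> \<phi> x * of_real (gauss z)"
        by (intro tendsto_intros)
    qed
    show "AE z in lborel. cmod (\<phi> (x + \<epsilon> n *\<^sub>R z) * of_real (gauss z)) \<le> B * gauss z" for n
      by (auto simp: norm_mult gauss_nonneg intro!: mult_right_mono assms)
    show "integrable lborel (\<lambda>z. B * gauss z)" by (intro integrable_mult_right gauss_integral)
  qed auto
  also have "(LINT z|lborel. \<phi> x * of_real (gauss z)) = \<phi> x"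
    using gauss_cis(2)[of 0] by simp
  finally have "(\<lambda>n. of_real (K * K) * (LINT z|lborel. \<phi> (x + \<epsilon> n *\<^sub>R z) * of_real (gauss z))) \<longlonglongrightarrow> of_real (K * K) * \<phi> x"
    by (intro tendsto_mult tendsto_const)
  then have lim2: "J \<longlonglongrightarrow> of_real (K * K) * \<phi> x" unfolding J2[symmetric] .
  have "fourier_fun (fourier_fun \<phi>) (- x) = (LINT \<xi>|lborel. cis (\<xi> \<bullet> x) * fourier_fun \<phi> \<xi>)"
    unfolding fourier_fun_def[of "fourier_fun \<phi>"] by (simp add: inner_commute)
  also have "\<dots> = of_real (K * K) * \<phi> x" by (rule LIMSEQ_unique[OF lim1 lim2])
  finally show ?thesis by (simp only: K(2))
qed

lemma fourier_inversion:
  assumes "schwartz \<phi>"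
  shows "fourier_fun (fourier_fun \<phi>) (- x) = of_real ((2 * pi) ^ 3) * \<phi> x"
proof -
  obtain B where B: "\<And>x. cmod (\<phi> x) \<le> B / (1 + norm x) ^ 0" using schwartz_decay[OF assms] by blast
  show ?thesis
    by (rule fourier_inversion_integrable[where B = B])
      (use B assms in \<open>auto intro!: schwartz_integrable schwartz_fourier continuous_at_imp_continuous_on
        differentiable_imp_continuous_within smooth_differentiable schwartz_smooth\<close>)
qed

definition invF :: "(real^3 \<Rightarrow> complex) \<Rightarrow> real^3 \<Rightarrow> complex" where
  "invF \<psi> x = of_real (1 / (2 * pi) ^ 3) * fourier_fun \<psi> (- x)"

lemma invF_fourier: "schwartz \<phi> \<Longrightarrow> invF (fourier_fun \<phi>) = \<phi>"
  unfolding invF_def by (rule ext) (simp add: fourier_inversion del: of_real_power of_real_mult)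

lemma schwartz_fam_invF: "schwartz_fam c \<Phi> \<Longrightarrow> schwartz_fam c (\<lambda>n. invF (\<Phi> n))"
  unfolding invF_def[abs_def] by (intro schwartz_fam_cmul schwartz_fam_reflect schwartz_fam_fourier)

lemma schwartz_invF: "schwartz \<phi> \<Longrightarrow> schwartz (invF \<phi>)"
  using schwartz_fam_invF[of "\<lambda>_. 1" "\<lambda>_. \<phi>"] by (simp add: schwartz_iff_fam)

lemma fourier_invF:
  assumes "schwartz \<psi>" shows "fourier_fun (invF \<psi>) = \<psi>"
proof
  fix \<xi>
  have "fourier_fun (invF \<psi>) \<xi> = of_real (1 / (2 * pi) ^ 3) * fourier_fun (\<lambda>x. fourier_fun \<psi> (- x)) \<xi>"
    unfolding invF_def[abs_def] by (rule fourier_fun_cmul)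
  also have "fourier_fun (\<lambda>x. fourier_fun \<psi> (- x)) \<xi> = fourier_fun (fourier_fun \<psi>) (- \<xi>)"
    unfolding fourier_fun_def[of _ \<xi>] fourier_fun_def[of _ "- \<xi>"]
    using lborel_integral_reflect[of "\<lambda>x. cis (\<xi> \<bullet> x) * fourier_fun \<psi> x" 0] schwartz_measurable[OF schwartz_fourier[OF assms]]
    by simp
  finally show "fourier_fun (invF \<psi>) \<xi> = \<psi> \<xi>"
    by (simp add: fourier_inversion[OF assms] del: of_real_power of_real_mult)
qed

section \<open>Tempered distributions and their Fourier transforms\<close>

lemma tempered_nonschwartz: "tempered L \<Longrightarrow> \<not> schwartz \<phi> \<Longrightarrow> L \<phi> = 0"
  unfolding tempered_def by blast

lemma tempered_cmul: "tempered L \<Longrightarrow> schwartz \<phi> \<Longrightarrow> L (\<lambda>x. c * \<phi> x) = c * L \<phi>"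
  unfolding tempered_def by blast

lemma tempered_add: "tempered L \<Longrightarrow> schwartz \<phi> \<Longrightarrow> schwartz \<psi> \<Longrightarrow> L (\<lambda>x. \<phi> x + \<psi> x) = L \<phi> + L \<psi>"
  unfolding tempered_def by blast

lemma tempered_pairing: "tempered (pairing f)"
  using pairing by auto

lemma schwartz_fam_norm_bound:
  assumes "schwartz_fam c \<Phi>" "\<And>n. c n \<ge> 0"
  obtains C where "\<And>n. schwartz_norm k (\<Phi> n) \<le> C * c n"
proof -
  have "\<forall>js. \<exists>C. \<forall>n x. (1 + norm x) ^ k * cmod (pds js (\<Phi> n) x) \<le> C * c n"
    using assms unfolding schwartz_fam_def by blast
  then obtain C where C: "\<And>js n x. (1 + norm x) ^ k * cmod (pds js (\<Phi> n) x) \<le> C js * c n" by metis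
  have "schwartz_norm k (\<Phi> n) \<le> (\<Sum>js | length js \<le> k. C js) * c n" for n
    unfolding schwartz_norm_def sum_distrib_right
    by (intro sum_mono cSUP_least C) auto
  then show ?thesis using that by blast
qed

lemma tempered_seq_continuous:
  assumes L: "tempered L" and \<Phi>: "schwartz_fam (\<lambda>n. 1 / real (Suc n)) \<Phi>"
  shows "(\<lambda>n. L (\<Phi> n)) \<longlonglongrightarrow> 0"
proof -
  obtain C k where Ck: "\<And>\<phi>. schwartz \<phi> \<Longrightarrow> cmod (L \<phi>) \<le> C * schwartz_norm k \<phi>"
    using L unfolding tempered_def by blast
  obtain D where D: "\<And>n. schwartz_norm k (\<Phi> n) \<le> D * (1 / real (Suc n))"
    using schwartz_fam_norm_bound[OF \<Phi>, of k] by auto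
  have sw: "schwartz (\<Phi> n)" for n using \<Phi> by (rule schwartz_fam_schwartz)
  have b: "norm (L (\<Phi> n)) \<le> (\<bar>C\<bar> * D) * (1 / real (Suc n))" for n
  proof -
    have "cmod (L (\<Phi> n)) \<le> \<bar>C\<bar> * schwartz_norm k (\<Phi> n)"
      using Ck[OF sw, of n] mult_right_mono[OF abs_ge_self[of C] schwartz_norm_nonneg[OF sw, of k n]] by linarith
    also have "\<dots> \<le> \<bar>C\<bar> * (D * (1 / real (Suc n)))" by (intro mult_left_mono D) auto
    finally show ?thesis by simp
  qed
  have "(\<lambda>n. (\<bar>C\<bar> * D) * (1 / real (Suc n))) \<longlonglongrightarrow> 0"
    using LIMSEQ_Suc[OF lim_1_over_n] by (intro tendsto_mult_right_zero) simp
  then show ?thesis by (rule Lim_null_comparison[OF always_eventually[OF allI[OF b]]])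
qed

text \<open>
  If no seminorm bounds the functional, then for every \<open>n\<close> it exceeds \<open>n\<close> times the \<open>n\<close>-th seminorm on some
  \<open>\<phi> n\<close>. Normalised to the value one, these functions converge to zero in the Schwartz space, which
  contradicts sequential continuity.
\<close>

lemma tempered_seqI:
  assumes "\<And>\<phi>. \<not> schwartz \<phi> \<Longrightarrow> L \<phi> = 0"
    and "\<And>\<phi> \<psi>. schwartz \<phi> \<Longrightarrow> schwartz \<psi> \<Longrightarrow> L (\<lambda>x. \<phi> x + \<psi> x) = L \<phi> + L \<psi>"
    and cmul: "\<And>c \<phi>. schwartz \<phi> \<Longrightarrow> L (\<lambda>x. c * \<phi> x) = c * L \<phi>"
    and cont: "\<And>\<Phi>. schwartz_fam (\<lambda>n. 1 / real (Suc n)) \<Phi> \<Longrightarrow> (\<lambda>n. L (\<Phi> n)) \<longlonglongrightarrow> 0"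
  shows "tempered L"
proof -
  have "\<exists>C k. \<forall>\<phi>. schwartz \<phi> \<longrightarrow> cmod (L \<phi>) \<le> C * schwartz_norm k \<phi>"
  proof (rule ccontr)
    assume "\<not> ?thesis"
    then have "\<forall>n. \<exists>\<phi>. schwartz \<phi> \<and> cmod (L \<phi>) > real (Suc n) * schwartz_norm n \<phi>"
      by (metis not_le)
    then obtain \<phi> where \<phi>: "\<And>n. schwartz (\<phi> n)" "\<And>n. cmod (L (\<phi> n)) > real (Suc n) * schwartz_norm n (\<phi> n)" by metis
    have pos: "cmod (L (\<phi> n)) > 0" for n
      using \<phi>(2)[of n] schwartz_norm_nonneg[OF \<phi>(1), of n n] by (smt (verit) mult_nonneg_nonneg of_nat_0_le_iff)
    define \<Phi> where "\<Phi> n = (\<lambda>x. inverse (L (\<phi> n)) * \<phi> n x)" for n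
    have sm: "smooth (\<Phi> n)" for n unfolding \<Phi>_def by (intro smooth_cmul schwartz_smooth \<phi>)
    have ps: "pds js (\<Phi> n) = (\<lambda>x. inverse (L (\<phi> n)) * pds js (\<phi> n) x)" for js n
      unfolding \<Phi>_def by (intro pds_cmul schwartz_smooth \<phi>)
    have LPhi: "L (\<Phi> n) = 1" for n
      unfolding \<Phi>_def cmul[OF \<phi>(1)] using pos[of n] by simp
    have "\<exists>C. \<forall>n x. (1 + norm x) ^ k * cmod (pds js (\<Phi> n) x) \<le> C * (1 / real (Suc n))" for k js
    proof -
      define m where "m = max k (length js)"
      have big: "(1 + norm x) ^ k * cmod (pds js (\<Phi> n) x) \<le> 1 / real (Suc n)" if n: "n \<ge> m" for n x
      proof -
        have "(1 + norm x) ^ k * cmod (pds js (\<phi> n) x) \<le> (1 + norm x) ^ n * cmod (pds js (\<phi> n) x)"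
          using n by (intro mult_right_mono power_increasing) (auto simp: m_def)
        also have "\<dots> \<le> (SUP x. (1 + norm x) ^ n * cmod (pds js (\<phi> n) x))"
          by (rule cSUP_upper[OF _ schwartz_bdd[OF \<phi>(1)]]) auto
        also have "\<dots> \<le> schwartz_norm n (\<phi> n)"
          unfolding schwartz_norm_def
          by (rule member_le_sum[OF _ schwartz_term_nonneg[OF \<phi>(1)] finite_multi]) (use n in \<open>auto simp: m_def\<close>)
        also have "\<dots> \<le> cmod (L (\<phi> n)) / real (Suc n)" using \<phi>(2)[of n] by (simp add: field_simps)
        finally have "(1 + norm x) ^ k * cmod (pds js (\<phi> n) x) / cmod (L (\<phi> n)) \<le> cmod (L (\<phi> n)) / real (Suc n) / cmod (L (\<phi> n))"
          using pos[of n] by (intro divide_right_mono) auto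
        also have "\<dots> = 1 / real (Suc n)" using pos[of n] by simp
        finally show ?thesis by (simp add: ps norm_mult norm_inverse divide_inverse mult_ac)
      qed
      have "\<forall>n. \<exists>B. \<forall>x. (1 + norm x) ^ k * cmod (pds js (\<Phi> n) x) \<le> B"
        using schwartz_bdd[OF schwartz_cmul[OF \<phi>(1)], of k js] unfolding \<Phi>_def bdd_above_def by auto
      then obtain B where B: "\<And>n x. (1 + norm x) ^ k * cmod (pds js (\<Phi> n) x) \<le> B n" by metis
      define C where "C = 1 + (\<Sum>n<m. \<bar>B n\<bar> * real (Suc n))"
      have Cn: "0 \<le> (\<Sum>n<m. \<bar>B n\<bar> * real (Suc n))" by (intro sum_nonneg) auto
      have "(1 + norm x) ^ k * cmod (pds js (\<Phi> n) x) \<le> C * (1 / real (Suc n))" for n x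
      proof (cases "n \<ge> m")
        case True
        have "1 / real (Suc n) \<le> C * (1 / real (Suc n))" using Cn by (simp add: C_def divide_right_mono)
        then show ?thesis using big[OF True, of x] by linarith
      next
        case False
        have "\<bar>B n\<bar> * real (Suc n) \<le> C" unfolding C_def using False
          member_le_sum[of n "{..<m}" "\<lambda>n. \<bar>B n\<bar> * real (Suc n)"] by simp
        then have "\<bar>B n\<bar> \<le> C * (1 / real (Suc n))" by (simp add: field_simps)
        then show ?thesis using B[of x n] by linarith
      qed
      then show ?thesis by blast
    qed
    then have "schwartz_fam (\<lambda>n. 1 / real (Suc n)) \<Phi>" using sm by (simp add: schwartz_fam_def)
    from cont[OF this] show False unfolding LPhi by (simp add: LIMSEQ_const_iff)
  qed
  then show ?thesis using assms unfolding tempered_def by blast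
qed

text \<open>
  Test functions are dense in the Schwartz space by cutoffs, and the Fourier transform maps the Schwartz space continuously
  onto itself. Hence a distribution is determined by its values on transforms of test functions, that is, by
  its Fourier transform.
\<close>

lemma tempered_zero_if_zero_on_fourier_test:
  assumes L: "tempered L" and 0: "\<And>\<phi>. test_fun \<phi> \<Longrightarrow> L (fourier_fun \<phi>) = 0"
  shows "L \<psi> = 0"
proof (cases "schwartz \<psi>")
  case True
  obtain \<rho> where \<rho>: "test_fun \<rho>" "\<rho> 0 = 1" using cutoff_exists by blast
  define \<phi> where "\<phi> = invF \<psi>"
  have \<phi>: "schwartz \<phi>" "fourier_fun \<phi> = \<psi>" using True by (auto simp: \<phi>_def schwartz_invF fourier_invF)
  define \<Phi> where "\<Phi> n = (\<lambda>x. \<phi> x * (\<rho> ((1 / real (Suc n)) *\<^sub>R x) - 1))" for n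
  have fam: "schwartz_fam (\<lambda>n. 1 / real (Suc n)) \<Phi>"
    using schwartz_fam_mult[OF schwartz_fam_const[OF \<phi>(1)] moderate_cutoff[OF \<rho>]] by (simp add: \<Phi>_def[abs_def])
  have test: "test_fun (\<lambda>x. \<phi> x * \<rho> ((1 / real (Suc n)) *\<^sub>R x))" for n
  proof -
    obtain R where R: "\<And>x. \<rho> x \<noteq> 0 \<Longrightarrow> norm x \<le> R" using \<rho> unfolding test_fun_def bounded_iff by auto
    have "norm x \<le> R * real (Suc n)" if "\<phi> x * \<rho> ((1 / real (Suc n)) *\<^sub>R x) \<noteq> 0" for x
      using R[of "(1 / real (Suc n)) *\<^sub>R x"] that by (simp add: field_simps)
    then have "bounded {x. \<phi> x * \<rho> ((1 / real (Suc n)) *\<^sub>R x) \<noteq> 0}" unfolding bounded_iff by blast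
    moreover have "smooth (\<lambda>x. \<phi> x * \<rho> ((1 / real (Suc n)) *\<^sub>R x))"
      using \<rho> by (intro smooth_mult[OF schwartz_smooth[OF \<phi>(1)] pds_dilate(2)]) (auto simp: test_fun_def)
    ultimately show ?thesis by (simp add: test_fun_def)
  qed
  have "L (fourier_fun (\<Phi> n)) = - L \<psi>" for n
  proof -
    have "fourier_fun (\<Phi> n) = (\<lambda>x. fourier_fun (\<lambda>x. \<phi> x * \<rho> ((1 / real (Suc n)) *\<^sub>R x)) x + (-1) * \<psi> x)"
      using fourier_fun_diff[OF schwartz_integrable[OF test_fun_schwartz[OF test]] schwartz_integrable[OF \<phi>(1)], of n]
      by (simp add: \<Phi>_def right_diff_distrib \<phi>(2) fun_eq_iff)
    then have "L (fourier_fun (\<Phi> n)) = L (fourier_fun (\<lambda>x. \<phi> x * \<rho> ((1 / real (Suc n)) *\<^sub>R x))) + L (\<lambda>x. (-1) * \<psi> x)"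
      using tempered_add[OF L schwartz_fourier[OF test_fun_schwartz[OF test]] schwartz_cmul[OF True, of "-1"]] by simp
    then show ?thesis using 0[OF test] tempered_cmul[OF L True, of "-1"] by simp
  qed
  moreover have "(\<lambda>n. L (fourier_fun (\<Phi> n))) \<longlonglongrightarrow> 0"
    by (intro tempered_seq_continuous L schwartz_fam_fourier fam)
  ultimately show ?thesis by (simp add: LIMSEQ_const_iff)
qed (use tempered_nonschwartz[OF L] in auto)

lemma pairing_eqI: "(\<And>\<phi>. schwartz \<phi> \<Longrightarrow> pairing f \<phi> = pairing g \<phi>) \<Longrightarrow> f = g"
  by (metis pairing_inject ext tempered_nonschwartz tempered_pairing)

lemma pairing_diff: "pairing (f - g) \<phi> = pairing f \<phi> - pairing g \<phi>"
  by (simp only: minus_tdist_def plus_tdist.rep_eq uminus_tdist.rep_eq) simp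

lemma has_ft_unique_dist:
  assumes "has_ft f g" "has_ft f' g" shows "f = f'"
proof -
  have "pairing (f - f') \<psi> = 0" for \<psi>
    by (rule tempered_zero_if_zero_on_fourier_test[OF tempered_pairing])
      (use assms in \<open>simp add: has_ft_def pairing_diff\<close>)
  then show ?thesis
    by (intro pairing_eqI) (simp add: pairing_diff)
qed

lemma loc_integrable_mult_test:
  assumes "loc_integrable g" "test_fun \<phi>" shows "integrable lborel (\<lambda>x. g x * \<phi> x)"
proof -
  obtain R where R: "\<And>x. \<phi> x \<noteq> 0 \<Longrightarrow> norm x \<le> R" using assms unfolding test_fun_def bounded_iff by auto
  obtain B where B: "\<And>x. cmod (\<phi> x) \<le> B / (1 + norm x) ^ 0" using schwartz_decay[OF test_fun_schwartz[OF assms(2)]] by blast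
  have "integrable lborel (\<lambda>x. indicator (cball 0 R) x *\<^sub>R g x)"
    using assms(1) unfolding loc_integrable_def set_integrable_def by auto
  then have "integrable lborel (\<lambda>x. B *\<^sub>R indicator (cball 0 R) x *\<^sub>R g x)" by (rule integrable_scaleR_right)
  then show ?thesis
  proof (rule Bochner_Integration.integrable_bound)
    show "(\<lambda>x. g x * \<phi> x) \<in> borel_measurable lborel"
      using loc_integrable_measurable[OF assms(1)] schwartz_measurable[OF test_fun_schwartz[OF assms(2)]] by simp
    show "AE x in lborel. norm (g x * \<phi> x) \<le> norm (B *\<^sub>R indicator (cball 0 R) x *\<^sub>R g x)"
    proof (rule AE_I2)
      fix x
      show "norm (g x * \<phi> x) \<le> norm (B *\<^sub>R indicator (cball 0 R) x *\<^sub>R g x)"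
        using R[of x] B[of x] mult_left_mono[of "cmod (\<phi> x)" "\<bar>B\<bar>" "cmod (g x)"]
        by (cases "\<phi> x = 0") (auto simp: norm_mult mult.commute)
    qed
  qed
qed

lemma has_ft_unique_fun:
  assumes "has_ft f g" "has_ft f h" shows "AE x in lborel. g x = h x"
proof -
  have l: "loc_integrable g" "loc_integrable h" using assms by (auto simp: has_ft_def)
  have "AE x in lborel. g x - h x = 0"
  proof (rule test_fun_fundamental_lemma[of "\<lambda>x. g x - h x"])
    show "loc_integrable (\<lambda>x. g x - h x)"
      using l unfolding loc_integrable_def by (auto intro: set_integral_diff(1))
    fix \<phi> assume \<phi>: "test_fun \<phi>"
    then have "(LINT x|lborel. g x * \<phi> x) = (LINT x|lborel. h x * \<phi> x)" using assms by (metis has_ft_def)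
    then show "(LINT x|lborel. (g x - h x) * \<phi> x) = 0"
      using loc_integrable_mult_test[OF l(1) \<phi>] loc_integrable_mult_test[OF l(2) \<phi>]
      by (simp add: left_diff_distrib Bochner_Integration.integral_diff)
  qed
  then show ?thesis by simp
qed

section \<open>Tame Fourier transforms\<close>

text \<open>
  The exponent two fits the spaces of the theorem: for \<open>-1 \<le> s \<le> 0\<close> the weight is at least
  \<open>1 / (1 + \<bar>\<xi>\<bar>)\<close>, so that both \<open>g\<close> and \<open>\<xi>\<^sub>j g\<close> are tame if \<open>g\<close> has finite norm.
\<close>

definition tame :: "(real^3 \<Rightarrow> complex) \<Rightarrow> bool" where
  "tame g \<longleftrightarrow> integrable lborel (\<lambda>x. g x /\<^sub>R (1 + norm x)\<^sup>2)"

lemma one_plus_norm_pos: "0 < 1 + norm x"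
  by (rule add_pos_nonneg) auto

lemma tame_measurable [measurable_dest]: assumes "tame g" shows "g \<in> borel_measurable borel"
proof -
  define h where "h x = g x /\<^sub>R (1 + norm x)\<^sup>2" for x
  have [measurable]: "h \<in> borel_measurable borel"
    using borel_measurable_integrable[OF assms[unfolded tame_def]] by (simp add: h_def[abs_def])
  have "g = (\<lambda>x. (1 + norm x)\<^sup>2 *\<^sub>R h x)"
  proof
    fix x show "g x = (1 + norm x)\<^sup>2 *\<^sub>R h x" using one_plus_norm_pos[of x] by (simp add: h_def)
  qed
  moreover have "(\<lambda>x. (1 + norm x)\<^sup>2 *\<^sub>R h x) \<in> borel_measurable borel" by measurable
  ultimately show ?thesis by simp
qed

lemma tameI_nn:
  assumes "g \<in> borel_measurable borel" "(\<integral>\<^sup>+x. ennreal (cmod (g x) / (1 + norm x)\<^sup>2) \<partial>lborel) < \<infinity>"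
  shows "tame g"
  unfolding tame_def
  by (rule integrableI_bounded) (use assms in \<open>auto simp: divide_inverse mult.commute abs_of_pos\<close>)

lemma tame_bound:
  assumes "tame g" "h \<in> borel_measurable borel" "AE x in lborel. cmod (h x) \<le> C * cmod (g x)"
  shows "tame h"
  unfolding tame_def
proof (rule Bochner_Integration.integrable_bound)
  show "integrable lborel (\<lambda>x. C *\<^sub>R (g x /\<^sub>R (1 + norm x)\<^sup>2))" using assms(1) unfolding tame_def by (rule integrable_scaleR_right)
  show "AE x in lborel. norm (h x /\<^sub>R (1 + norm x)\<^sup>2) \<le> norm (C *\<^sub>R (g x /\<^sub>R (1 + norm x)\<^sup>2))"
    using assms(3)
  proof eventually_elim
    fix x assume *: "cmod (h x) \<le> C * cmod (g x)"
    then have "cmod (h x) \<le> \<bar>C\<bar> * cmod (g x)" using mult_right_mono[OF abs_ge_self[of C], of "cmod (g x)"] by simp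
    then show "norm (h x /\<^sub>R (1 + norm x)\<^sup>2) \<le> norm (C *\<^sub>R (g x /\<^sub>R (1 + norm x)\<^sup>2))"
      using mult_left_mono[of "cmod (h x)" "\<bar>C\<bar> * cmod (g x)" "inverse ((1 + norm x)\<^sup>2)"] by (simp add: abs_mult mult_ac)
  qed
qed (use assms(2) in simp)

lemma tame_AE:
  assumes "tame g" "h \<in> borel_measurable borel" "AE x in lborel. g x = h x" shows "tame h"
  by (rule tame_bound[OF assms(1,2), of 1]) (use assms(3) in \<open>eventually_elim, auto\<close>)

lemma tame_add: "tame g \<Longrightarrow> tame h \<Longrightarrow> tame (\<lambda>x. g x + h x)"
  unfolding tame_def scaleR_add_right by (rule Bochner_Integration.integrable_add)

lemma tame_minus: "tame g \<Longrightarrow> tame (\<lambda>x. - g x)"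
  unfolding tame_def by simp

lemma tame_cmul: "tame g \<Longrightarrow> tame (\<lambda>x. c * g x)"
  by (rule tame_bound[where C = "cmod c" and g = g]) (auto simp: norm_mult)

lemma tame_zero: "tame (\<lambda>x. 0)"
  by (simp add: tame_def)

lemma tame_mult_schwartz_bound:
  assumes g: "tame g" and C: "\<And>x. cmod (\<psi> x) \<le> C / (1 + norm x)\<^sup>2"
  shows "cmod (g x * \<psi> x) \<le> C * norm (g x /\<^sub>R (1 + norm x)\<^sup>2)"
proof -
  have "cmod (g x) * cmod (\<psi> x) \<le> cmod (g x) * (C / (1 + norm x)\<^sup>2)" by (intro mult_left_mono C) auto
  then show ?thesis by (simp add: norm_mult divide_inverse mult_ac)
qed

lemma tame_mult_schwartz:
  assumes g: "tame g" and \<psi>: "schwartz \<psi>"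
  shows "integrable lborel (\<lambda>x. g x * \<psi> x)"
proof -
  obtain C where C: "C \<ge> 0" "\<And>x. cmod (\<psi> x) \<le> C / (1 + norm x)\<^sup>2" using schwartz_decay[OF \<psi>] by blast
  have "integrable lborel (\<lambda>x. C * norm (g x /\<^sub>R (1 + norm x)\<^sup>2))"
    using g unfolding tame_def by (intro integrable_mult_right integrable_norm)
  then show ?thesis
  proof (rule Bochner_Integration.integrable_bound)
    show "(\<lambda>x. g x * \<psi> x) \<in> borel_measurable lborel"
      using tame_measurable[OF g] schwartz_measurable[OF \<psi>] by simp
    show "AE x in lborel. norm (g x * \<psi> x) \<le> norm (C * norm (g x /\<^sub>R (1 + norm x)\<^sup>2))"
      using order_trans[OF tame_mult_schwartz_bound[OF g C(2)] abs_ge_self] by (intro AE_I2) (simp only: real_norm_def)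
  qed
qed

lemma tame_loc_integrable:
  assumes g: "tame g" shows "loc_integrable g"
  unfolding loc_integrable_def
proof (intro allI impI)
  fix K :: "(real^3) set" assume K: "compact K"
  then obtain R where R: "R > 0" "\<And>x. x \<in> K \<Longrightarrow> norm x \<le> R" using compact_imp_bounded bounded_pos by metis
  have [measurable]: "K \<in> sets borel" using K by (simp add: borel_compact)
  have "integrable lborel (\<lambda>x. (1 + R)\<^sup>2 *\<^sub>R (g x /\<^sub>R (1 + norm x)\<^sup>2))" using g unfolding tame_def by (rule integrable_scaleR_right)
  then show "set_integrable lborel K g"
    unfolding set_integrable_def
  proof (rule Bochner_Integration.integrable_bound)
    show "AE x in lborel. norm (indicator K x *\<^sub>R g x) \<le> norm ((1 + R)\<^sup>2 *\<^sub>R (g x /\<^sub>R (1 + norm x)\<^sup>2))"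
    proof (rule AE_I2)
      fix x
      show "norm (indicator K x *\<^sub>R g x) \<le> norm ((1 + R)\<^sup>2 *\<^sub>R (g x /\<^sub>R (1 + norm x)\<^sup>2))"
      proof (cases "x \<in> K")
        case True
        have "(1 + norm x)\<^sup>2 \<le> (1 + R)\<^sup>2" using R(2)[OF True] by (intro power_mono) auto
        then have "cmod (g x) * (1 + norm x)\<^sup>2 \<le> cmod (g x) * (1 + R)\<^sup>2" by (intro mult_left_mono) auto
        then have "cmod (g x) \<le> cmod (g x) * (1 + R)\<^sup>2 / (1 + norm x)\<^sup>2"
          using one_plus_norm_pos[of x] by (simp add: pos_le_divide_eq)
        then show ?thesis using True by (simp add: divide_inverse mult_ac abs_mult)
      qed simp
    qed
  qed (use tame_measurable[OF g] in simp)
qed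

text \<open>
  For a tame \<open>g\<close> the products with Schwartz functions are absolutely integrable, so the duality that
  defines the Fourier transform can be tested against all Schwartz functions. This gives a
  formula for the distribution itself.
\<close>

definition has_tame_ft :: "tdist \<Rightarrow> (real^3 \<Rightarrow> complex) \<Rightarrow> bool" where
  "has_tame_ft f g \<longleftrightarrow> tame g \<and> (\<forall>\<psi>. schwartz \<psi> \<longrightarrow> pairing f \<psi> = (LINT \<xi>|lborel. g \<xi> * invF \<psi> \<xi>))"

lemma has_tame_ft_tame: "has_tame_ft f g \<Longrightarrow> tame g"
  by (simp add: has_tame_ft_def)

lemma has_tame_ft_has_ft: "has_tame_ft f g \<Longrightarrow> has_ft f g"
  unfolding has_tame_ft_def has_ft_def
  by (simp add: tame_loc_integrable test_fun_schwartz schwartz_fourier invF_fourier)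

lemma invF_add: "schwartz \<phi> \<Longrightarrow> schwartz \<psi> \<Longrightarrow> invF (\<lambda>x. \<phi> x + \<psi> x) = (\<lambda>x. invF \<phi> x + invF \<psi> x)"
  unfolding invF_def by (simp add: fourier_fun_add schwartz_integrable distrib_left)

lemma invF_cmul: "invF (\<lambda>x. c * \<phi> x) = (\<lambda>x. c * invF \<phi> x)"
  unfolding invF_def by (simp add: fourier_fun_cmul mult_ac)

lemma tame_has_dist:
  assumes g: "tame g" shows "\<exists>f. has_tame_ft f g"
proof -
  define L where "L \<psi> = (if schwartz \<psi> then (LINT \<xi>|lborel. g \<xi> * invF \<psi> \<xi>) else 0)" for \<psi>
  have "tempered L"
  proof (rule tempered_seqI)
    show "L (\<lambda>x. \<phi> x + \<psi> x) = L \<phi> + L \<psi>" if "schwartz \<phi>" "schwartz \<psi>" for \<phi> \<psi>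
      using that by (simp add: L_def schwartz_add invF_add distrib_left Bochner_Integration.integral_add
          tame_mult_schwartz[OF g schwartz_invF])
    show "L (\<lambda>x. c * \<phi> x) = c * L \<phi>" if "schwartz \<phi>" for c \<phi>
      using that by (simp add: L_def schwartz_cmul invF_cmul mult.left_commute[of _ c])
    fix \<Phi> assume \<Phi>: "schwartz_fam (\<lambda>n. 1 / real (Suc n)) \<Phi>"
    obtain C where C: "\<And>n x. cmod (invF (\<Phi> n) x) \<le> C * (1 / real (Suc n)) / (1 + norm x)\<^sup>2"
      using schwartz_fam_decay[OF schwartz_fam_invF[OF \<Phi>], of 2] by blast
    have b: "norm (L (\<Phi> n)) \<le> C * (LINT x|lborel. norm (g x /\<^sub>R (1 + norm x)\<^sup>2)) * (1 / real (Suc n))" for n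
    proof -
      have "cmod (L (\<Phi> n)) \<le> (LINT x|lborel. (C * (1 / real (Suc n))) * norm (g x /\<^sub>R (1 + norm x)\<^sup>2))"
        unfolding L_def if_P[OF schwartz_fam_schwartz[OF \<Phi>]]
        by (rule norm_integral_le[OF _ tame_mult_schwartz_bound[OF g C]])
          (use g[unfolded tame_def] in \<open>intro integrable_mult_right integrable_norm\<close>)
      then show ?thesis by (simp only: integral_mult_right_zero mult_ac)
    qed
    have "(\<lambda>n. C * (LINT x|lborel. norm (g x /\<^sub>R (1 + norm x)\<^sup>2)) * (1 / real (Suc n))) \<longlonglongrightarrow> 0"
      using LIMSEQ_Suc[OF lim_1_over_n] by (intro tendsto_mult_right_zero) simp
    then show "(\<lambda>n. L (\<Phi> n)) \<longlonglongrightarrow> 0"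
      by (rule Lim_null_comparison[OF always_eventually[OF allI[OF b]]])
  qed (simp add: L_def)
  then have "pairing (Abs_tdist L) = L" by (simp add: Abs_tdist_inverse)
  then have "has_tame_ft (Abs_tdist L) g" using g by (simp add: has_tame_ft_def L_def)
  then show ?thesis by blast
qed

lemma has_tame_ft_inv_ft:
  assumes "tame g" shows "has_tame_ft (inv_ft g) g"
proof -
  obtain f where f: "has_tame_ft f g" using tame_has_dist[OF assms] by blast
  have "inv_ft g = f" unfolding inv_ft_def
    by (rule the_equality) (use f has_tame_ft_has_ft has_ft_unique_dist in blast)+
  then show ?thesis using f by simp
qed

lemma has_tame_ftI:
  assumes "has_ft f g" "tame g" shows "has_tame_ft f g"
  using has_tame_ft_inv_ft[OF assms(2)] has_tame_ft_has_ft has_ft_unique_dist assms by metis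

lemma has_tame_ft_unique: "has_tame_ft f g \<Longrightarrow> has_tame_ft f' g \<Longrightarrow> f = f'"
  using has_tame_ft_has_ft has_ft_unique_dist by blast

lemma has_tame_ft_AE:
  assumes "has_tame_ft f g" "h \<in> borel_measurable borel" "AE x in lborel. g x = h x"
  shows "has_tame_ft f h"
proof -
  have [measurable]: "g \<in> borel_measurable borel" using assms has_tame_ft_tame tame_measurable by blast
  have "(LINT \<xi>|lborel. g \<xi> * invF \<psi> \<xi>) = (LINT \<xi>|lborel. h \<xi> * invF \<psi> \<xi>)" if "schwartz \<psi>" for \<psi>
    using schwartz_measurable[OF schwartz_invF[OF that]] assms(2,3)
    by (intro integral_cong_AE) auto
  then show ?thesis using assms(1) tame_AE[OF _ assms(2,3)] by (simp add: has_tame_ft_def)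
qed

lemma has_ft_ft: "has_ft f g \<Longrightarrow> has_ft f (ft f)"
  unfolding ft_def by (rule someI[where P = "has_ft f"])

lemma has_tame_ft_ft:
  assumes "has_tame_ft f g"
  shows "has_tame_ft f (ft f)" and "AE x in lborel. g x = ft f x"
proof -
  have f: "has_ft f (ft f)" using has_ft_ft[OF has_tame_ft_has_ft[OF assms]] .
  then have m: "ft f \<in> borel_measurable borel" using loc_integrable_measurable by (simp add: has_ft_def)
  show ae: "AE x in lborel. g x = ft f x" using has_ft_unique_fun[OF has_tame_ft_has_ft[OF assms] f] .
  show "has_tame_ft f (ft f)" by (rule has_tame_ft_AE[OF assms m ae])
qed

lemma has_tame_ft_unique_fun:
  assumes "has_tame_ft f g" "has_tame_ft f h" shows "AE x in lborel. g x = h x"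
  using assms has_tame_ft_has_ft has_ft_unique_fun by blast

lemma has_tame_ft_add:
  assumes "has_tame_ft f g" "has_tame_ft f' g'" shows "has_tame_ft (f + f') (\<lambda>x. g x + g' x)"
  using assms unfolding has_tame_ft_def
  by (auto simp: tame_add plus_tdist.rep_eq distrib_right Bochner_Integration.integral_add tame_mult_schwartz schwartz_invF)

lemma has_tame_ft_minus:
  assumes "has_tame_ft f g" shows "has_tame_ft (- f) (\<lambda>x. - g x)"
  using assms unfolding has_tame_ft_def by (auto simp: tame_minus uminus_tdist.rep_eq)

lemma has_tame_ft_diff:
  assumes "has_tame_ft f g" "has_tame_ft f' g'" shows "has_tame_ft (f - f') (\<lambda>x. g x - g' x)"
  using has_tame_ft_add[OF assms(1) has_tame_ft_minus[OF assms(2)]]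
  unfolding minus_tdist_def diff_conv_add_uminus .

lemma has_tame_ft_zero: "has_tame_ft 0 (\<lambda>x. 0)"
  unfolding has_tame_ft_def by (simp add: tame_zero zero_tdist.rep_eq)

lemma has_tame_ft_sum:
  assumes "finite I" "\<And>i. i \<in> I \<Longrightarrow> has_tame_ft (f i) (g i)"
  shows "has_tame_ft (\<Sum>i\<in>I. f i) (\<lambda>x. \<Sum>i\<in>I. g i x)"
  using assms by (induction I rule: finite_induct) (auto intro: has_tame_ft_add has_tame_ft_zero)

lemma invF_pd: "schwartz \<phi> \<Longrightarrow> invF (pd j \<phi>) \<xi> = - \<i> * of_real (\<xi> $ j) * invF \<phi> \<xi>"
  unfolding invF_def by (simp add: fourier_fun_pd)

lemma has_tame_ft_tderiv:
  assumes f: "has_tame_ft f g" and t: "tame (\<lambda>\<xi>. \<i> * of_real (\<xi> $ j) * g \<xi>)"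
  shows "has_tame_ft (tderiv j f) (\<lambda>\<xi>. \<i> * of_real (\<xi> $ j) * g \<xi>)"
  unfolding has_tame_ft_def
proof (intro conjI t allI impI)
  fix \<psi> assume \<psi>: "schwartz \<psi>"
  have "pairing (tderiv j f) \<psi> = - (LINT \<xi>|lborel. g \<xi> * invF (pd j \<psi>) \<xi>)"
    using \<psi> f by (simp add: tderiv.rep_eq schwartz_pd has_tame_ft_def)
  then show "pairing (tderiv j f) \<psi> = (LINT \<xi>|lborel. \<i> * of_real (\<xi> $ j) * g \<xi> * invF \<psi> \<xi>)"
    using \<psi> by (simp add: invF_pd mult_ac)
qed

section \<open>Weighted norms and the bilinear estimate\<close>

lemma powr_subadditive:
  fixes x y p :: real
  assumes "0 \<le> p" "p \<le> 1" "0 \<le> x" "0 \<le> y"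
  shows "(x + y) powr p \<le> x powr p + y powr p"
proof (cases "x + y = 0")
  case False
  then have pos: "x + y > 0" using assms by simp
  have le: "t \<le> t powr p" if "0 \<le> t" "t \<le> 1" for t
    using powr_mono'[of p 1 t] that assms by (cases "t = 0") auto
  have "1 = x / (x + y) + y / (x + y)" using pos by (simp add: add_divide_distrib[symmetric])
  also have "\<dots> \<le> (x / (x + y)) powr p + (y / (x + y)) powr p"
    using assms pos by (intro add_mono le) auto
  also have "\<dots> = (x powr p + y powr p) / (x + y) powr p"
    using assms pos by (simp add: powr_divide add_divide_distrib)
  finally show ?thesis using pos by (simp add: pos_le_divide_eq)
qed simp

lemma weight_nonneg: "0 \<le> weight a \<sigma> s \<xi>"
  by (simp add: weight_def)

lemma weight_pos: "\<xi> \<noteq> 0 \<Longrightarrow> 0 < weight a \<sigma> s \<xi>"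
  by (simp add: weight_def)

lemma weight_measurable [measurable]: "weight a \<sigma> s \<in> borel_measurable borel"
  unfolding weight_def[abs_def] by measurable

lemma weight_add: "weight a \<sigma> (s + r) \<xi> = weight a \<sigma> s \<xi> * norm \<xi> powr r"
  by (simp add: weight_def powr_add)

text \<open>
  The map \<open>x \<mapsto> x\<^sup>p\<close> is subadditive for \<open>0 \<le> p \<le> 1\<close>. For \<open>p = 1/\<sigma>\<close> this makes the exponential factor
  submultiplicative, and for \<open>p = r\<close> it distributes \<open>\<bar>x + y\<bar>\<^sup>r\<close> over the two summands. The origin is excluded because
  \<open>0 powr 0 = 0\<close>.
\<close>

lemma weight_subadditive:
  assumes "0 \<le> a" "1 \<le> \<sigma>" "0 \<le> r" "r \<le> 1" "x \<noteq> 0" "y \<noteq> 0"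
  shows "weight a \<sigma> r (x + y) \<le> weight a \<sigma> r x * weight a \<sigma> 0 y + weight a \<sigma> 0 x * weight a \<sigma> r y"
proof -
  let ?e = "\<lambda>z::real^3. exp (a * norm z powr (1 / \<sigma>))"
  have "norm (x + y) powr (1 / \<sigma>) \<le> (norm x + norm y) powr (1 / \<sigma>)"
    using assms by (intro powr_mono2 norm_triangle_ineq) auto
  also have "\<dots> \<le> norm x powr (1 / \<sigma>) + norm y powr (1 / \<sigma>)"
    using assms by (intro powr_subadditive) auto
  finally have "a * norm (x + y) powr (1 / \<sigma>) \<le> a * (norm x powr (1 / \<sigma>) + norm y powr (1 / \<sigma>))"
    using assms by (intro mult_left_mono) auto
  then have e: "?e (x + y) \<le> ?e x * ?e y" by (simp add: exp_add[symmetric] distrib_left)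
  have "norm (x + y) powr r \<le> (norm x + norm y) powr r"
    using assms by (intro powr_mono2 norm_triangle_ineq) auto
  also have "\<dots> \<le> norm x powr r + norm y powr r" using assms by (intro powr_subadditive) auto
  finally have "norm (x + y) powr r * ?e (x + y) \<le> (norm x powr r + norm y powr r) * (?e x * ?e y)"
    using e by (intro mult_mono) auto
  then show ?thesis using assms by (simp add: weight_def algebra_simps)
qed

lemma AE_neq: "AE x in (lborel :: (real^3) measure). x \<noteq> c"
  by (rule AE_lborel_singleton)

text \<open>
  Convolution of nonnegative functions with values in the extended reals. It is defined
  everywhere and dominates the complex convolution, so absolute convergence is its finiteness.
\<close>

definition nconv :: "(real^3 \<Rightarrow> ennreal) \<Rightarrow> (real^3 \<Rightarrow> ennreal) \<Rightarrow> real^3 \<Rightarrow> ennreal" where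
  "nconv f g \<xi> = (\<integral>\<^sup>+\<eta>. f (\<xi> - \<eta>) * g \<eta> \<partial>lborel)"

lemma nn_integral_nconv:
  assumes [measurable]: "f \<in> borel_measurable borel" "g \<in> borel_measurable borel"
  shows "(\<integral>\<^sup>+\<xi>. nconv f g \<xi> \<partial>lborel) = (\<integral>\<^sup>+\<xi>. f \<xi> \<partial>lborel) * (\<integral>\<^sup>+\<eta>. g \<eta> \<partial>lborel)"
proof -
  have "(\<integral>\<^sup>+\<xi>. nconv f g \<xi> \<partial>lborel) = (\<integral>\<^sup>+\<eta>. (\<integral>\<^sup>+\<xi>. f (\<xi> - \<eta>) * g \<eta> \<partial>lborel) \<partial>lborel)"
    unfolding nconv_def by (rule lborel_pair.Fubini') measurable
  also have "\<dots> = (\<integral>\<^sup>+\<eta>. (\<integral>\<^sup>+\<xi>. f \<xi> \<partial>lborel) * g \<eta> \<partial>lborel)"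
    by (simp add: nn_integral_multc lborel_nn_integral_translate)
  also have "\<dots> = (\<integral>\<^sup>+\<xi>. f \<xi> \<partial>lborel) * (\<integral>\<^sup>+\<eta>. g \<eta> \<partial>lborel)"
    by (rule nn_integral_cmult) measurable
  finally show ?thesis .
qed

lemma nconv_mono: "(\<And>x. f x \<le> f' x) \<Longrightarrow> (\<And>x. g x \<le> g' x) \<Longrightarrow> nconv f g \<xi> \<le> nconv f' g' \<xi>"
  unfolding nconv_def by (intro nn_integral_mono mult_mono) auto

locale weighted =
  fixes a \<sigma> :: real
  assumes a: "0 \<le> a" and \<sigma>: "1 \<le> \<sigma>"
begin

definition W :: "real \<Rightarrow> real^3 \<Rightarrow> ennreal" where "W s \<xi> = ennreal (weight a \<sigma> s \<xi>)"

definition X :: "real \<Rightarrow> (real^3 \<Rightarrow> ennreal) \<Rightarrow> ennreal" where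
  "X s f = (\<integral>\<^sup>+\<xi>. W s \<xi> * f \<xi> \<partial>lborel)"

text \<open>
  The norm of \<open>L\<^sup>1([0,T]; X\<^sup>r)\<close>, for nonnegative functions of time and frequency.
\<close>

abbreviation L1X :: "real \<Rightarrow> real \<Rightarrow> (real \<Rightarrow> real^3 \<Rightarrow> ennreal) \<Rightarrow> ennreal" where
  "L1X T r f \<equiv> \<integral>\<^sup>+t. indicator {0..T} t * X r (f t) \<partial>(lborel :: real measure)"

lemma W_measurable [measurable]: "W s \<in> borel_measurable borel"
  unfolding W_def[abs_def] by measurable

lemma W_add: "W (s + r) \<xi> = W s \<xi> * ennreal (norm \<xi> powr r)"
  by (simp add: W_def weight_add ennreal_mult weight_nonneg)

lemma W_pos: "\<xi> \<noteq> 0 \<Longrightarrow> W s \<xi> \<noteq> 0"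
  using weight_pos[of \<xi> a \<sigma> s] by (simp add: W_def ennreal_eq_0_iff)

lemma X_mono: "(\<And>\<xi>. f \<xi> \<le> g \<xi>) \<Longrightarrow> X s f \<le> X s g"
  unfolding X_def by (intro nn_integral_mono mult_left_mono) auto

lemma X_mono_AE: "AE \<xi> in lborel. f \<xi> \<le> g \<xi> \<Longrightarrow> X s f \<le> X s g"
  unfolding X_def by (rule nn_integral_mono_AE, elim eventually_mono) (auto intro: mult_left_mono)

lemma X_add: "f \<in> borel_measurable borel \<Longrightarrow> g \<in> borel_measurable borel \<Longrightarrow>
   X s (\<lambda>\<xi>. f \<xi> + g \<xi>) = X s f + X s g"
  unfolding X_def by (simp add: distrib_left nn_integral_add)

lemma X_cmult: "f \<in> borel_measurable borel \<Longrightarrow> X s (\<lambda>\<xi>. c * f \<xi>) = c * X s f"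
  unfolding X_def by (simp add: mult.left_commute[of _ c] nn_integral_cmult)

lemma X_sum: "finite I \<Longrightarrow> (\<And>i. i \<in> I \<Longrightarrow> f i \<in> borel_measurable borel) \<Longrightarrow>
   X s (\<lambda>\<xi>. \<Sum>i\<in>I. f i \<xi>) = (\<Sum>i\<in>I. X s (f i))"
  unfolding X_def by (simp add: sum_distrib_left nn_integral_sum)

lemma X_finite_AE:
  assumes "f \<in> borel_measurable borel" "X s f < \<infinity>"
  shows "AE \<xi> in lborel. f \<xi> < \<infinity>"
proof -
  have "AE \<xi> in lborel. W s \<xi> * f \<xi> \<noteq> \<infinity>"
    using assms unfolding X_def by (intro nn_integral_PInf_AE) auto
  then show ?thesis using AE_neq[of 0]
  proof eventually_elim
    fix \<xi> :: "real^3" assume "W s \<xi> * f \<xi> \<noteq> \<infinity>" "\<xi> \<noteq> 0"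
    then show "f \<xi> < \<infinity>" using W_pos[of \<xi> s] by (auto simp: ennreal_mult_eq_top_iff less_top)
  qed
qed

lemma X_zero_AE:
  assumes "f \<in> borel_measurable borel" "X s f = 0"
  shows "AE \<xi> in lborel. f \<xi> = 0"
proof -
  have "AE \<xi> in lborel. W s \<xi> * f \<xi> = 0"
    using assms unfolding X_def by (subst (asm) nn_integral_0_iff_AE) auto
  then show ?thesis using AE_neq[of 0] by eventually_elim (use W_pos in auto)
qed

lemma X_measurable [measurable]:
  assumes [measurable]: "(\<lambda>(t, \<xi>). f t \<xi>) \<in> borel_measurable (lborel \<Otimes>\<^sub>M lborel)"
  shows "(\<lambda>t. X s (f t)) \<in> borel_measurable (borel :: real measure)"
proof -
  have "(\<lambda>t. X s (f t)) \<in> borel_measurable (lborel :: real measure)" unfolding X_def by measurable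
  then show ?thesis by simp
qed

lemma X_bilinear:
  assumes s: "-1 \<le> s" "s \<le> 0" and [measurable]: "f \<in> borel_measurable borel" "g \<in> borel_measurable borel"
  shows "X s (\<lambda>\<xi>. ennreal (norm \<xi>) * nconv f g \<xi>) \<le> X (s + 1) f * X 0 g + X 0 f * X (s + 1) g"
proof -
  let ?F = "\<lambda>r \<xi>. W r \<xi> * f \<xi>" and ?G = "\<lambda>r \<xi>. W r \<xi> * g \<xi>"
  have W1: "W s \<xi> * ennreal (norm \<xi>) = W (s + 1) \<xi>" for \<xi> by (simp add: W_add)
  have "X s (\<lambda>\<xi>. ennreal (norm \<xi>) * nconv f g \<xi>) = (\<integral>\<^sup>+\<xi>. (\<integral>\<^sup>+\<eta>. W (s + 1) \<xi> * (f (\<xi> - \<eta>) * g \<eta>) \<partial>lborel) \<partial>lborel)"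
    unfolding X_def nconv_def mult.assoc[symmetric] W1 by (subst nn_integral_cmult[symmetric]) (auto simp: mult.assoc)
  also have "\<dots> \<le> (\<integral>\<^sup>+\<xi>. (\<integral>\<^sup>+\<eta>. ?F (s + 1) (\<xi> - \<eta>) * ?G 0 \<eta> + ?F 0 (\<xi> - \<eta>) * ?G (s + 1) \<eta> \<partial>lborel) \<partial>lborel)"
  proof (rule nn_integral_mono, rule nn_integral_mono_AE)
    fix \<xi> :: "real^3"
    show "AE \<eta> in lborel. W (s + 1) \<xi> * (f (\<xi> - \<eta>) * g \<eta>) \<le> ?F (s + 1) (\<xi> - \<eta>) * ?G 0 \<eta> + ?F 0 (\<xi> - \<eta>) * ?G (s + 1) \<eta>"
      using AE_neq[of 0] AE_neq[of \<xi>]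
    proof eventually_elim
      fix \<eta> assume "\<eta> \<noteq> 0" "\<eta> \<noteq> \<xi>"
      then have "weight a \<sigma> (s + 1) (\<xi> - \<eta> + \<eta>) \<le> weight a \<sigma> (s + 1) (\<xi> - \<eta>) * weight a \<sigma> 0 \<eta> + weight a \<sigma> 0 (\<xi> - \<eta>) * weight a \<sigma> (s + 1) \<eta>"
        using s a \<sigma> by (intro weight_subadditive) auto
      then have "W (s + 1) \<xi> \<le> W (s + 1) (\<xi> - \<eta>) * W 0 \<eta> + W 0 (\<xi> - \<eta>) * W (s + 1) \<eta>"
        unfolding W_def by (simp add: ennreal_mult[symmetric] ennreal_plus[symmetric] weight_nonneg ennreal_leI del: ennreal_plus)
      from mult_right_mono[OF this, of "f (\<xi> - \<eta>) * g \<eta>"]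
      show "W (s + 1) \<xi> * (f (\<xi> - \<eta>) * g \<eta>) \<le> ?F (s + 1) (\<xi> - \<eta>) * ?G 0 \<eta> + ?F 0 (\<xi> - \<eta>) * ?G (s + 1) \<eta>"
        by (simp add: distrib_left distrib_right mult_ac)
    qed
  qed
  also have "\<dots> = (\<integral>\<^sup>+\<xi>. nconv (?F (s + 1)) (?G 0) \<xi> + nconv (?F 0) (?G (s + 1)) \<xi> \<partial>lborel)"
    unfolding nconv_def by (intro nn_integral_cong nn_integral_add) measurable
  also have "\<dots> = (\<integral>\<^sup>+\<xi>. nconv (?F (s + 1)) (?G 0) \<xi> \<partial>lborel) + (\<integral>\<^sup>+\<xi>. nconv (?F 0) (?G (s + 1)) \<xi> \<partial>lborel)"
    unfolding nconv_def by (rule nn_integral_add) measurable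
  also have "\<dots> = X (s + 1) f * X 0 g + X 0 f * X (s + 1) g"
    by (simp add: nn_integral_nconv X_def)
  finally show ?thesis .
qed

text \<open>
  Interpolation in an additive form, from \<open>z\<^sup>\<mu> \<le> 1 + z\<close> with \<open>z = \<bar>\<xi>\<bar>\<^sup>2\<^sup>\<gamma> / l\<close>. The free parameter \<open>l\<close> replaces optimisation:
  two factors can be interpolated with the same \<open>l\<close>, after which their powers of \<open>l\<close> combine.
\<close>

lemma X_interpolation:
  assumes [measurable]: "f \<in> borel_measurable borel" and \<mu>: "0 \<le> \<mu>" "\<mu> \<le> 1" and l: "0 < l" and \<gamma>: "0 < \<gamma>"
  shows "X (s + 2 * \<gamma> * \<mu>) f \<le> ennreal (l powr \<mu>) * (X s f + X (s + 2 * \<gamma>) f * ennreal (1 / l))"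
proof -
  have "W (s + 2 * \<gamma> * \<mu>) \<xi> * f \<xi> \<le> ennreal (l powr \<mu>) * (W s \<xi> * f \<xi>) + ennreal (l powr \<mu>) * ennreal (1 / l) * (W (s + 2 * \<gamma>) \<xi> * f \<xi>)" for \<xi>
  proof -
    define y where "y = norm \<xi> powr (2 * \<gamma>)"
    have y0: "0 \<le> y" by (simp add: y_def)
    have "(y / l) powr \<mu> \<le> 1 + y / l"
    proof (cases "y / l \<le> 1")
      case True
      have "(y / l) powr \<mu> \<le> 1" using True y0 l \<mu> by (intro powr_le1) auto
      then show ?thesis using y0 l by (smt (verit) divide_nonneg_pos)
    next
      case False
      then have "(y / l) powr \<mu> \<le> (y / l) powr 1" using \<mu> by (intro powr_mono) auto
      then show ?thesis using False by simp
    qed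
    then have "l powr \<mu> * (y / l) powr \<mu> \<le> l powr \<mu> * (1 + y / l)" by (intro mult_left_mono) auto
    then have "y powr \<mu> \<le> l powr \<mu> + l powr \<mu> * (1 / l) * y"
      using l y0 by (simp add: powr_divide distrib_left)
    moreover have "norm \<xi> powr (2 * \<gamma> * \<mu>) = y powr \<mu>" by (simp add: y_def powr_powr)
    ultimately have "ennreal (norm \<xi> powr (2 * \<gamma> * \<mu>)) \<le> ennreal (l powr \<mu> + l powr \<mu> * (1 / l) * y)"
      by (intro ennreal_leI) simp
    also have "\<dots> = ennreal (l powr \<mu>) + ennreal (l powr \<mu>) * ennreal (1 / l) * ennreal y"
      using l y0 by (simp add: ennreal_mult[symmetric] del: ennreal_plus) (simp add: ennreal_plus)
    finally have "(W s \<xi> * f \<xi>) * ennreal (norm \<xi> powr (2 * \<gamma> * \<mu>)) \<le> (W s \<xi> * f \<xi>) * (ennreal (l powr \<mu>) + ennreal (l powr \<mu>) * ennreal (1 / l) * ennreal y)"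
      by (intro mult_left_mono) auto
    then show ?thesis by (simp add: W_add y_def distrib_left mult_ac)
  qed
  then have "X (s + 2 * \<gamma> * \<mu>) f \<le> (\<integral>\<^sup>+\<xi>. ennreal (l powr \<mu>) * (W s \<xi> * f \<xi>) + ennreal (l powr \<mu>) * ennreal (1 / l) * (W (s + 2 * \<gamma>) \<xi> * f \<xi>) \<partial>lborel)"
    unfolding X_def by (intro nn_integral_mono)
  also have "\<dots> = ennreal (l powr \<mu>) * X s f + ennreal (l powr \<mu>) * ennreal (1 / l) * X (s + 2 * \<gamma>) f"
    unfolding X_def by (simp add: nn_integral_add nn_integral_cmult)
  also have "\<dots> = ennreal (l powr \<mu>) * (X s f + X (s + 2 * \<gamma>) f * ennreal (1 / l))"
    by (simp add: distrib_left mult_ac)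
  finally show ?thesis .
qed

text \<open>
  With \<open>l = \<parallel>f\<parallel>\<^sub>s\<^sub>+\<^sub>2\<^sub>\<gamma>\<^sub>1 / R1 + \<parallel>g\<parallel>\<^sub>s\<^sub>+\<^sub>2\<^sub>\<gamma>\<^sub>2 / R2 + 1/T\<close> both interpolated norms are at most \<open>2 R l\<^sup>\<mu>\<close>, and
  \<open>l\<^sup>\<mu>\<^sup>+\<^sup>\<nu> \<le> l\<^sup>1\<^sup>-\<^sup>\<delta> \<le> T\<^sup>\<delta> l\<close> because \<open>l \<ge> 1/T \<ge> 1\<close>. The right-hand side is linear in
  quantities that are integrable in time, so it can be integrated over \<open>[0,T]\<close> term by term;
  the summand \<open>1/T\<close> integrates to one.
\<close>

lemma X_product_estimate:
  assumes [measurable]: "f \<in> borel_measurable borel" "g \<in> borel_measurable borel"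
    and R: "0 < R1" "0 < R2" and f: "X s f \<le> ennreal R1" and g: "X s g \<le> ennreal R2"
    and T: "0 < T" "T \<le> 1" and \<gamma>: "0 < \<gamma>1" "0 < \<gamma>2"
    and \<mu>: "0 \<le> \<mu>" "\<mu> \<le> 1" "0 \<le> \<nu>" "\<nu> \<le> 1" "\<mu> + \<nu> \<le> 1 - \<delta>" "0 \<le> \<delta>"
  shows "X (s + 2 * \<gamma>1 * \<mu>) f * X (s + 2 * \<gamma>2 * \<nu>) g \<le> ennreal (4 * R1 * R2 * T powr \<delta>) *
    (X (s + 2 * \<gamma>1) f * ennreal (1 / R1) + X (s + 2 * \<gamma>2) g * ennreal (1 / R2) + ennreal (1 / T))"
proof (cases "X (s + 2 * \<gamma>1) f = \<infinity> \<or> X (s + 2 * \<gamma>2) g = \<infinity>")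
  case True
  then have top: "X (s + 2 * \<gamma>1) f * ennreal (1 / R1) + X (s + 2 * \<gamma>2) g * ennreal (1 / R2) + ennreal (1 / T) = top"
    using R by (auto simp: ennreal_top_mult ennreal_eq_0_iff)
  have "ennreal (4 * R1 * R2 * T powr \<delta>) \<noteq> 0" using R T by (simp add: ennreal_eq_0_iff not_le)
  then show ?thesis unfolding top by (simp add: ennreal_mult_top)
next
  case False
  then obtain x y where xy: "X (s + 2 * \<gamma>1) f = ennreal x" "X (s + 2 * \<gamma>2) g = ennreal y" "0 \<le> x" "0 \<le> y"
    by (metis ennreal_cases infinity_ennreal_def)
  \<comment> \<open>the common interpolation parameter of both factors\<close>
  define l where "l = x / R1 + y / R2 + 1 / T"
  have l1: "1 / T \<le> l" "x \<le> R1 * l" "y \<le> R2 * l" using R T xy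
    by (auto simp: l_def distrib_left)
  have l0: "0 < l" "1 \<le> l" using l1(1) T by (auto intro: less_le_trans[of 0 "1/T"] order_trans[of 1 "1/T"])
  have half: "X (s + 2 * \<gamma> * \<mu>) h \<le> ennreal (l powr \<mu> * (2 * R))"
    if "h \<in> borel_measurable borel" "X s h \<le> ennreal R" "X (s + 2 * \<gamma>) h = ennreal z" "z \<le> R * l" "0 \<le> z" "0 < R" "0 \<le> \<mu>" "\<mu> \<le> 1" "0 < \<gamma>"
    for h R z \<mu> \<gamma>
  proof -
    have "X (s + 2 * \<gamma> * \<mu>) h \<le> ennreal (l powr \<mu>) * (X s h + X (s + 2 * \<gamma>) h * ennreal (1 / l))"
      using that l0 by (intro X_interpolation) auto
    also have "\<dots> \<le> ennreal (l powr \<mu>) * (ennreal R + ennreal R)"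
    proof (intro mult_left_mono add_mono that(2))
      show "X (s + 2 * \<gamma>) h * ennreal (1 / l) \<le> ennreal R"
        using that l0 by (simp add: ennreal_mult[symmetric] divide_le_eq)
    qed auto
    also have "\<dots> = ennreal (l powr \<mu> * (2 * R))" using that by (simp add: ennreal_mult[symmetric] ennreal_plus[symmetric] del: ennreal_plus)
    finally show ?thesis .
  qed
  have "X (s + 2 * \<gamma>1 * \<mu>) f * X (s + 2 * \<gamma>2 * \<nu>) g \<le> ennreal (l powr \<mu> * (2 * R1)) * ennreal (l powr \<nu> * (2 * R2))"
    using half[OF assms(1) f xy(1) l1(2) xy(3) R(1) \<mu>(1,2) \<gamma>(1)] half[OF assms(2) g xy(2) l1(3) xy(4) R(2) \<mu>(3,4) \<gamma>(2)]
    by (intro mult_mono) auto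
  also have "\<dots> = ennreal (4 * R1 * R2 * (l powr (\<mu> + \<nu>)))"
    using R by (simp add: ennreal_mult[symmetric] powr_add mult_ac)
  also have "\<dots> \<le> ennreal (4 * R1 * R2 * (T powr \<delta> * l))"
  proof (intro ennreal_leI mult_left_mono)
    have "l powr (\<mu> + \<nu>) \<le> l powr (1 - \<delta>)" using \<mu> l0 by (intro powr_mono) auto
    also have "\<dots> = l * l powr (- \<delta>)" using l0 by (simp add: powr_diff powr_minus divide_inverse)
    also have "l powr (- \<delta>) \<le> (1 / T) powr (- \<delta>)" using l1(1) T \<mu> by (intro powr_mono2') auto
    also have "(1 / T) powr (- \<delta>) = T powr \<delta>" using T by (simp add: powr_minus powr_divide field_simps)
    finally show "l powr (\<mu> + \<nu>) \<le> T powr \<delta> * l" using l0 by (simp add: mult.commute)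
  qed (use R in auto)
  also have "\<dots> = ennreal (4 * R1 * R2 * T powr \<delta>) * ennreal l"
    using R l0 by (simp add: ennreal_mult[symmetric] mult_ac)
  also have "ennreal l = X (s + 2 * \<gamma>1) f * ennreal (1 / R1) + X (s + 2 * \<gamma>2) g * ennreal (1 / R2) + ennreal (1 / T)"
    unfolding l_def xy using R T xy by (simp add: ennreal_mult[symmetric] ennreal_plus[symmetric] del: ennreal_plus)
  finally show ?thesis .
qed

text \<open>
  The ball of radius \<open>R\<close> in \<open>L\<^sup>\<infinity>([0,T]; X\<^sup>s) \<inter> L\<^sup>1([0,T]; X\<^sup>s\<^sup>+\<^sup>2\<^sup>\<gamma>)\<close>.
\<close>

definition bounded_by :: "real \<Rightarrow> real \<Rightarrow> real \<Rightarrow> (real \<Rightarrow> real^3 \<Rightarrow> ennreal) \<Rightarrow> ennreal \<Rightarrow> bool" where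
  "bounded_by T s \<gamma> f R \<longleftrightarrow> (\<forall>t\<in>{0..T}. X s (f t) \<le> R) \<and>
     L1X T (s + 2 * \<gamma>) f \<le> R"

text \<open>
  \<open>X_bilinear\<close> leaves the products of norms of orders \<open>s + 1 = s + 2\<gamma>\<^sub>1 \<mu>\<close> and \<open>0 = s + 2\<gamma>\<^sub>2 \<nu>\<close>, that is,
  \<open>\<mu> = 1/(2\<gamma>\<^sub>1)\<close> and \<open>\<nu> = -s/(2\<gamma>\<^sub>2)\<close>, and the same with the roles exchanged. Each is bounded by
  \<open>X_product_estimate\<close>, whose right-hand side integrates to \<open>3 \<sqdot> 4 R1 R2 T\<^sup>\<delta>\<close>.
\<close>

lemma X_bilinear_time:
  assumes s: "-1 \<le> s" "s \<le> 0"
    and [measurable]: "(\<lambda>(t, \<xi>). f t \<xi>) \<in> borel_measurable (lborel \<Otimes>\<^sub>M lborel)"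
      "(\<lambda>(t, \<xi>). g t \<xi>) \<in> borel_measurable (lborel \<Otimes>\<^sub>M lborel)"
    and R: "0 < R1" "0 < R2" and f: "bounded_by T s \<gamma>1 f (ennreal R1)" and g: "bounded_by T s \<gamma>2 g (ennreal R2)"
    and T: "0 < T" "T \<le> 1" and \<gamma>: "1/2 \<le> \<gamma>1" "1/2 \<le> \<gamma>2" and \<delta>: "0 \<le> \<delta>"
    and k: "1 / (2 * \<gamma>1) - s / (2 * \<gamma>2) \<le> 1 - \<delta>" "1 / (2 * \<gamma>2) - s / (2 * \<gamma>1) \<le> 1 - \<delta>"
  shows "L1X T s (\<lambda>t \<xi>. ennreal (norm \<xi>) * nconv (f t) (g t) \<xi>) \<le> ennreal (24 * R1 * R2 * T powr \<delta>)"
proof -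
  let ?K = "4 * R1 * R2 * T powr \<delta>"
  let ?l = "\<lambda>t. X (s + 2 * \<gamma>1) (f t) * ennreal (1 / R1) + X (s + 2 * \<gamma>2) (g t) * ennreal (1 / R2) + ennreal (1 / T)"
  have m: "f t \<in> borel_measurable borel" "g t \<in> borel_measurable borel" for t
  proof -
    have "(\<lambda>\<xi>. (\<lambda>(t, \<xi>). f t \<xi>) (t, \<xi>)) \<in> borel_measurable lborel" "(\<lambda>\<xi>. (\<lambda>(t, \<xi>). g t \<xi>) (t, \<xi>)) \<in> borel_measurable lborel"
      by measurable
    then show "f t \<in> borel_measurable borel" "g t \<in> borel_measurable borel" by simp_all
  qed
  have exps: "s + 2 * \<gamma> * (1 / (2 * \<gamma>)) = s + 1" "s + 2 * \<gamma> * (- s / (2 * \<gamma>)) = 0"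
     "0 \<le> 1 / (2 * \<gamma>)" "1 / (2 * \<gamma>) \<le> 1" "0 \<le> - s / (2 * \<gamma>)" "- s / (2 * \<gamma>) \<le> 1" if "1/2 \<le> \<gamma>" for \<gamma>
    using that s by (auto simp: field_simps)
  have pw: "X s (\<lambda>\<xi>. ennreal (norm \<xi>) * nconv (f t) (g t) \<xi>) \<le> ennreal (2 * ?K) * ?l t" if t: "t \<in> {0..T}" for t
  proof -
    have fg: "X s (f t) \<le> ennreal R1" "X s (g t) \<le> ennreal R2" using f g t by (auto simp: bounded_by_def)
    have p: "0 < \<gamma>1" "0 < \<gamma>2" using \<gamma> by auto
    have 1: "X (s + 1) (f t) * X 0 (g t) \<le> ennreal ?K * ?l t"
      using X_product_estimate[OF m R fg T p exps(3,4)[OF \<gamma>(1)] exps(5,6)[OF \<gamma>(2)] _ \<delta>] k(1)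
      unfolding exps(1)[OF \<gamma>(1)] exps(2)[OF \<gamma>(2)] by simp
    have 2: "X 0 (f t) * X (s + 1) (g t) \<le> ennreal ?K * ?l t"
      using X_product_estimate[OF m R fg T p exps(5,6)[OF \<gamma>(1)] exps(3,4)[OF \<gamma>(2)] _ \<delta>] k(2)
      unfolding exps(1)[OF \<gamma>(2)] exps(2)[OF \<gamma>(1)] by simp
    have "X s (\<lambda>\<xi>. ennreal (norm \<xi>) * nconv (f t) (g t) \<xi>) \<le> ennreal ?K * ?l t + ennreal ?K * ?l t"
      by (rule order_trans[OF X_bilinear[OF s m] add_mono[OF 1 2]])
    also have "\<dots> = ennreal (2 * ?K) * ?l t"
      using R by (simp add: distrib_right[symmetric] ennreal_plus[symmetric] mult.assoc del: ennreal_plus)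
    finally show ?thesis .
  qed
  have "L1X T s (\<lambda>t \<xi>. ennreal (norm \<xi>) * nconv (f t) (g t) \<xi>)
     \<le> (\<integral>\<^sup>+t. ennreal (2 * ?K) * (indicator {0..T} t * X (s + 2 * \<gamma>1) (f t) * ennreal (1 / R1) + indicator {0..T} t * X (s + 2 * \<gamma>2) (g t) * ennreal (1 / R2) + indicator {0..T} t * ennreal (1 / T)) \<partial>lborel)"
    by (rule nn_integral_mono) (use pw in \<open>auto simp: indicator_def\<close>)
  also have "\<dots> = ennreal (2 * ?K) * (L1X T (s + 2 * \<gamma>1) f * ennreal (1 / R1) +
      L1X T (s + 2 * \<gamma>2) g * ennreal (1 / R2) + (\<integral>\<^sup>+t. indicator {0..T} t * ennreal (1 / T) \<partial>lborel))"
    by (simp add: nn_integral_cmult nn_integral_add nn_integral_multc)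
  also have "\<dots> \<le> ennreal (2 * ?K) * (ennreal R1 * ennreal (1 / R1) + ennreal R2 * ennreal (1 / R2) + ennreal T * ennreal (1 / T))"
    using f g T by (intro mult_left_mono add_mono mult_right_mono) (auto simp: bounded_by_def nn_integral_multc)
  also have "\<dots> = ennreal (24 * R1 * R2 * T powr \<delta>)"
  proof -
    have "ennreal R * ennreal (1 / R) = 1" if "0 < R" for R using that by (simp add: ennreal_mult[symmetric])
    then have "ennreal R1 * ennreal (1 / R1) + ennreal R2 * ennreal (1 / R2) + ennreal T * ennreal (1 / T) = ennreal 3"
      using R T by simp
    then show ?thesis using R by (simp only:) (simp add: ennreal_mult[symmetric] mult_ac del: ennreal_numeral)
  qed
  finally show ?thesis .
qed

end

section \<open>Joint measurability\<close>

type_synonym 'c path = "real \<Rightarrow> real^3 \<Rightarrow> 'c"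

abbreviation jmeas :: "(real \<Rightarrow> real^3 \<Rightarrow> 'c::topological_space) \<Rightarrow> bool" where
  "jmeas f \<equiv> (\<lambda>(t, \<xi>). f t \<xi>) \<in> borel_measurable (lborel \<Otimes>\<^sub>M lborel)"

lemma jmeas_compose:
  assumes f: "jmeas f" and g: "g \<in> borel_measurable M" and h: "h \<in> borel_measurable M"
  shows "(\<lambda>x. f (g x) (h x)) \<in> borel_measurable M"
proof -
  have "(\<lambda>x. (g x, h x)) \<in> measurable M (lborel \<Otimes>\<^sub>M lborel)" using g h by simp
  from measurable_compose[OF this f] show ?thesis by simp
qed

lemma jmeas_section: "jmeas f \<Longrightarrow> f t \<in> borel_measurable borel"
  using jmeas_compose[of f "\<lambda>_. t" borel "\<lambda>x. x"] by simp

lemma jmeas_section2: "jmeas f \<Longrightarrow> (\<lambda>t. f t \<xi>) \<in> borel_measurable borel"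
  using jmeas_compose[of f "\<lambda>x. x" borel "\<lambda>_. \<xi>"] by simp

lemma jmeas_nconv:
  assumes "jmeas f" "jmeas g" shows "jmeas (\<lambda>t. nconv (f t) (g t))"
proof -
  have [measurable]: "(\<lambda>z. f (fst (fst z)) (snd (fst z) - snd z)) \<in> borel_measurable ((lborel \<Otimes>\<^sub>M lborel) \<Otimes>\<^sub>M lborel)"
      "(\<lambda>z. g (fst (fst z)) (snd z)) \<in> borel_measurable ((lborel \<Otimes>\<^sub>M lborel) \<Otimes>\<^sub>M lborel)"
    by (rule jmeas_compose[OF assms(1)] jmeas_compose[OF assms(2)]; measurable)+
  show ?thesis unfolding nconv_def by measurable
qed

lemma jmeas_convolution:
  assumes "jmeas f" "jmeas g" shows "jmeas (\<lambda>t. Defs.convolution (f t) (g t))"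
proof -
  have [measurable]: "(\<lambda>z. f (fst (fst z)) (snd (fst z) - snd z)) \<in> borel_measurable ((lborel \<Otimes>\<^sub>M lborel) \<Otimes>\<^sub>M lborel)"
      "(\<lambda>z. g (fst (fst z)) (snd z)) \<in> borel_measurable ((lborel \<Otimes>\<^sub>M lborel) \<Otimes>\<^sub>M lborel)"
    by (rule jmeas_compose[OF assms(1)] jmeas_compose[OF assms(2)]; measurable)+
  show ?thesis unfolding Defs.convolution_def by measurable
qed

lemma ennreal_norm_integral_le:
  fixes f :: "'a \<Rightarrow> 'b::{banach, second_countable_topology}"
  shows "ennreal (norm (\<integral>x. f x \<partial>M)) \<le> (\<integral>\<^sup>+x. ennreal (norm (f x)) \<partial>M)"
  by (cases "integrable M f") (auto simp: integral_norm_bound_ennreal not_integrable_integral_eq)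

lemma ennreal_norm_integral_diff_le:
  fixes f :: "'a \<Rightarrow> 'b::{banach, second_countable_topology}"
  assumes "integrable M f" "integrable M g"
  shows "ennreal (norm ((\<integral>x. f x \<partial>M) - (\<integral>x. g x \<partial>M))) \<le> (\<integral>\<^sup>+x. ennreal (norm (f x - g x)) \<partial>M)"
  using ennreal_norm_integral_le[of M "\<lambda>x. f x - g x"] assms by simp

lemma ennreal_norm_sum_le:
  fixes f :: "'i \<Rightarrow> 'b::real_normed_vector"
  shows "ennreal (norm (\<Sum>i\<in>I. f i)) \<le> (\<Sum>i\<in>I. ennreal (norm (f i)))"
  by (subst sum_ennreal) (auto intro!: ennreal_leI norm_sum)

lemma ennreal_norm_add_le:
  fixes x :: "'b::real_normed_vector"
  shows "ennreal (norm (x + y)) \<le> ennreal (norm x) + ennreal (norm y)"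
  by (metis ennreal_leI ennreal_plus norm_ge_zero norm_triangle_ineq)

lemma ennreal_norm_mult: "ennreal (cmod (x * y)) = ennreal (cmod x) * ennreal (cmod y)"
  by (simp add: norm_mult ennreal_mult)

lemma convolution_le: "ennreal (cmod (Defs.convolution f g \<xi>)) \<le> nconv (\<lambda>x. ennreal (cmod (f x))) (\<lambda>x. ennreal (cmod (g x))) \<xi>"
  unfolding Defs.convolution_def nconv_def
  by (rule order_trans[OF ennreal_norm_integral_le]) (simp add: ennreal_norm_mult)

lemma convolution_integrable:
  assumes "f \<in> borel_measurable borel" "g \<in> borel_measurable borel"
    and "nconv (\<lambda>x. ennreal (cmod (f x))) (\<lambda>x. ennreal (cmod (g x))) \<xi> < \<infinity>"
  shows "integrable lborel (\<lambda>\<eta>. f (\<xi> - \<eta>) * g \<eta>)"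
  by (rule integrableI_bounded) (use assms in \<open>auto simp: nconv_def ennreal_norm_mult\<close>)

lemma convolution_diff_le:
  assumes "f \<in> borel_measurable borel" "g \<in> borel_measurable borel" "f' \<in> borel_measurable borel" "g' \<in> borel_measurable borel"
    and "nconv (\<lambda>x. ennreal (cmod (f x))) (\<lambda>x. ennreal (cmod (g x))) \<xi> < \<infinity>"
    and "nconv (\<lambda>x. ennreal (cmod (f' x))) (\<lambda>x. ennreal (cmod (g' x))) \<xi> < \<infinity>"
  shows "ennreal (cmod (Defs.convolution f g \<xi> - Defs.convolution f' g' \<xi>)) \<le>
     (\<integral>\<^sup>+\<eta>. ennreal (cmod (f (\<xi> - \<eta>) * g \<eta> - f' (\<xi> - \<eta>) * g' \<eta>)) \<partial>lborel)"
  unfolding Defs.convolution_def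
  by (rule ennreal_norm_integral_diff_le) (intro convolution_integrable assms)+

text \<open>
  The parabolic smoothing effect at a fixed frequency, with \<open>x = \<bar>\<xi>\<bar>\<^sup>2\<^sup>\<gamma>\<close>.
\<close>

lemma nn_integral_exp_le_1:
  assumes "0 \<le> x"
  shows "(\<integral>\<^sup>+t. ennreal (x * exp (- (t - \<tau>) * x)) * indicator {\<tau>..T} t \<partial>lborel) \<le> 1"
proof (cases "\<tau> \<le> T")
  case True
  have "(\<integral>\<^sup>+t. ennreal (x * exp (- (t - \<tau>) * x)) * indicator {\<tau>..T} t \<partial>lborel) =
      ennreal (- exp (- (T - \<tau>) * x) - (- exp (- (\<tau> - \<tau>) * x)))"
    by (rule nn_integral_FTC_Icc)
      (use assms True in \<open>auto intro!: derivative_eq_intros simp: algebra_simps\<close>)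
  also have "\<dots> \<le> 1" by (simp add: ennreal_le_1)
  finally show ?thesis .
qed simp

section \<open>Semilinear systems on the Fourier side\<close>

text \<open>
  A finite system of semilinear heat equations on the Fourier side. Component \<open>k\<close> has dissipation \<open>\<bar>\<xi>\<bar>\<^sup>2\<^sup>\<gamma>\<^sup>k\<close>,
  quadratic terms with symbols \<open>A\<close> of order one, and linear terms with bounded symbols \<open>B\<close>.
  The condition on the exponents is imposed only on the pairs that interact: for the
  Boussinesq system the temperature does not interact with itself.
\<close>

locale duhamel_system = weighted a \<sigma> for a \<sigma> +
  fixes s T \<delta> C :: real and \<gamma> :: "'i::finite \<Rightarrow> real"
    and A :: "'i \<Rightarrow> 'i \<Rightarrow> 'i \<Rightarrow> real^3 \<Rightarrow> complex" and B :: "'i \<Rightarrow> 'i \<Rightarrow> real^3 \<Rightarrow> complex"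
  assumes s: "-1 \<le> s" "s \<le> 0" and T: "0 < T" "T \<le> 1" and \<gamma>: "\<And>k. 1/2 \<le> \<gamma> k" and \<delta>: "0 \<le> \<delta>" and C: "0 \<le> C"
    and A_meas [measurable]: "\<And>k l m. A k l m \<in> borel_measurable borel"
    and B_meas [measurable]: "\<And>k l. B k l \<in> borel_measurable borel"
    and A_bound: "\<And>k l m \<xi>. cmod (A k l m \<xi>) \<le> C * norm \<xi>"
    and B_bound: "\<And>k l \<xi>. cmod (B k l \<xi>) \<le> C"
    and A_exponents: "\<And>k l m \<xi>. A k l m \<xi> \<noteq> 0 \<Longrightarrow>
       1 / (2 * \<gamma> l) - s / (2 * \<gamma> m) \<le> 1 - \<delta> \<and> 1 / (2 * \<gamma> m) - s / (2 * \<gamma> l) \<le> 1 - \<delta>"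
begin

text \<open>
  The heat kernel is extended by zero to \<open>\<tau> \<notin> [0,t]\<close>, so that Duhamel integrals run over the whole line and
  Tonelli's theorem applies without splitting domains.
\<close>

definition E :: "'i \<Rightarrow> real \<Rightarrow> real \<Rightarrow> real^3 \<Rightarrow> real" where
  "E k t \<tau> \<xi> = (if 0 \<le> \<tau> \<and> \<tau> \<le> t then exp (- (t - \<tau>) * norm \<xi> powr (2 * \<gamma> k)) else 0)"

definition duhamel :: "'i \<Rightarrow> complex path \<Rightarrow> complex path" where
  "duhamel k h t \<xi> = (LINT \<tau>|lborel. of_real (E k t \<tau> \<xi>) * h \<tau> \<xi>)"

definition duhamel_abs :: "'i \<Rightarrow> ennreal path \<Rightarrow> ennreal path" where
  "duhamel_abs k h t \<xi> = (\<integral>\<^sup>+\<tau>. ennreal (E k t \<tau> \<xi>) * h \<tau> \<xi> \<partial>lborel)"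

definition G :: "('i \<Rightarrow> ennreal path) \<Rightarrow> ('i \<Rightarrow> ennreal path) \<Rightarrow> 'i \<Rightarrow> ennreal path" where
  "G P Q k \<tau> \<xi> = (\<Sum>l\<in>UNIV. \<Sum>m\<in>UNIV. ennreal (cmod (A k l m \<xi>)) * nconv (P l \<tau>) (Q m \<tau>) \<xi>)"

definition L :: "('i \<Rightarrow> ennreal path) \<Rightarrow> 'i \<Rightarrow> ennreal path" where
  "L P k \<tau> \<xi> = (\<Sum>l\<in>UNIV. ennreal (cmod (B k l \<xi>)) * P l \<tau> \<xi>)"

text \<open>
  The nonlinearity with absolute values inside all sums and integrals: a positive, monotone map that
  dominates \<open>F\<close>.
\<close>

definition Fm :: "('i \<Rightarrow> ennreal path) \<Rightarrow> 'i \<Rightarrow> ennreal path" where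
  "Fm P k \<tau> \<xi> = G P P k \<tau> \<xi> + L P k \<tau> \<xi>"

definition F :: "('i \<Rightarrow> complex path) \<Rightarrow> 'i \<Rightarrow> complex path" where
  "F U k \<tau> \<xi> = (\<Sum>l\<in>UNIV. \<Sum>m\<in>UNIV. A k l m \<xi> * Defs.convolution (U l \<tau>) (U m \<tau>) \<xi>) + (\<Sum>l\<in>UNIV. B k l \<xi> * U l \<tau> \<xi>)"

abbreviation dconv :: "('i \<Rightarrow> complex path) \<Rightarrow> ('i \<Rightarrow> complex path) \<Rightarrow> 'i \<Rightarrow> 'i \<Rightarrow> ennreal path" where
  "dconv U V l m \<tau> \<xi> \<equiv> \<integral>\<^sup>+\<eta>. ennreal (cmod (U l \<tau> (\<xi> - \<eta>) * U m \<tau> \<eta> - V l \<tau> (\<xi> - \<eta>) * V m \<tau> \<eta>)) \<partial>lborel"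

text \<open>
  A majorant of \<open>F U - F V\<close> in which the difference of products is kept inside the integral; the
  convergence proof needs this sharper form.
\<close>

definition Fd :: "('i \<Rightarrow> complex path) \<Rightarrow> ('i \<Rightarrow> complex path) \<Rightarrow> 'i \<Rightarrow> ennreal path" where
  "Fd U V k \<tau> \<xi> = (\<Sum>l\<in>UNIV. \<Sum>m\<in>UNIV. ennreal (cmod (A k l m \<xi>)) *
      dconv U V l m \<tau> \<xi>)
     + (\<Sum>l\<in>UNIV. ennreal (cmod (B k l \<xi>)) * ennreal (cmod (U l \<tau> \<xi> - V l \<tau> \<xi>)))"

definition nrm :: "('i \<Rightarrow> complex path) \<Rightarrow> 'i \<Rightarrow> ennreal path" where
  "nrm U k t \<xi> = ennreal (cmod (U k t \<xi>))"

lemma E_nonneg: "0 \<le> E k t \<tau> \<xi>" by (simp add: E_def)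

lemma E_le_1: "E k t \<tau> \<xi> \<le> 1" by (simp add: E_def mult_nonpos_nonneg)

lemma E_measurable:
  assumes [measurable]: "f \<in> borel_measurable M" "g \<in> borel_measurable M" "h \<in> borel_measurable M"
  shows "(\<lambda>x. E k (f x) (g x) (h x)) \<in> borel_measurable M"
  unfolding E_def by measurable

lemma jmeas_duhamel:
  assumes "jmeas h" shows "jmeas (duhamel k h)"
proof -
  have [measurable]: "(\<lambda>z. h (snd z) (snd (fst z))) \<in> borel_measurable ((lborel \<Otimes>\<^sub>M lborel) \<Otimes>\<^sub>M lborel)"
    "(\<lambda>z. E k (fst (fst z)) (snd z) (snd (fst z))) \<in> borel_measurable ((lborel \<Otimes>\<^sub>M lborel) \<Otimes>\<^sub>M lborel)"
    by (rule jmeas_compose[OF assms] E_measurable; measurable)+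
  show ?thesis unfolding duhamel_def by measurable
qed

lemma jmeas_duhamel_abs:
  assumes "jmeas h" shows "jmeas (duhamel_abs k h)"
proof -
  have [measurable]: "(\<lambda>z. h (snd z) (snd (fst z))) \<in> borel_measurable ((lborel \<Otimes>\<^sub>M lborel) \<Otimes>\<^sub>M lborel)"
    "(\<lambda>z. E k (fst (fst z)) (snd z) (snd (fst z))) \<in> borel_measurable ((lborel \<Otimes>\<^sub>M lborel) \<Otimes>\<^sub>M lborel)"
    by (rule jmeas_compose[OF assms] E_measurable; measurable)+
  show ?thesis unfolding duhamel_abs_def by measurable
qed

lemma jmeas_nrm:
  assumes [measurable]: "jmeas (U k)" shows "jmeas (nrm U k)"
  unfolding nrm_def by measurable

lemma jmeas_G:
  assumes "\<And>l. jmeas (P l)" "\<And>l. jmeas (Q l)" shows "jmeas (G P Q k)"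
proof -
  have [measurable]: "jmeas (\<lambda>\<tau>. nconv (P l \<tau>) (Q m \<tau>))" for l m by (intro jmeas_nconv assms)
  show ?thesis unfolding G_def by measurable
qed

lemma jmeas_L:
  assumes [measurable]: "\<And>l. jmeas (P l)" shows "jmeas (L P k)"
  unfolding L_def by measurable

lemma jmeas_Fm:
  assumes "\<And>l. jmeas (P l)" shows "jmeas (Fm P k)"
proof -
  have [measurable]: "jmeas (G P P k)" "jmeas (L P k)" by (intro jmeas_G jmeas_L assms)+
  show ?thesis unfolding Fm_def by measurable
qed

lemma jmeas_F:
  assumes [measurable]: "\<And>l. jmeas (U l)" shows "jmeas (F U k)"
proof -
  have [measurable]: "jmeas (\<lambda>\<tau>. Defs.convolution (U l \<tau>) (U m \<tau>))" for l m by (intro jmeas_convolution assms)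
  show ?thesis unfolding F_def by measurable
qed

lemma jmeas_Fd:
  assumes U: "\<And>l. jmeas (U l)" and V: "\<And>l. jmeas (V l)" shows "jmeas (Fd U V k)"
proof -
  note [measurable] = U V
  have [measurable]: "(\<lambda>z. U l (fst (fst z)) (snd (fst z) - snd z)) \<in> borel_measurable ((lborel \<Otimes>\<^sub>M lborel) \<Otimes>\<^sub>M lborel)"
      "(\<lambda>z. U l (fst (fst z)) (snd z)) \<in> borel_measurable ((lborel \<Otimes>\<^sub>M lborel) \<Otimes>\<^sub>M lborel)"
      "(\<lambda>z. V l (fst (fst z)) (snd (fst z) - snd z)) \<in> borel_measurable ((lborel \<Otimes>\<^sub>M lborel) \<Otimes>\<^sub>M lborel)"
      "(\<lambda>z. V l (fst (fst z)) (snd z)) \<in> borel_measurable ((lborel \<Otimes>\<^sub>M lborel) \<Otimes>\<^sub>M lborel)" for l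
    by (rule jmeas_compose[OF U] jmeas_compose[OF V]; measurable)+
  show ?thesis unfolding Fd_def by measurable
qed

lemma duhamel_abs_mono:
  assumes "\<And>\<tau>. \<tau> \<in> {0..t} \<Longrightarrow> h \<tau> \<xi> \<le> h' \<tau> \<xi>" shows "duhamel_abs k h t \<xi> \<le> duhamel_abs k h' t \<xi>"
  unfolding duhamel_abs_def
proof (rule nn_integral_mono)
  fix \<tau> show "ennreal (E k t \<tau> \<xi>) * h \<tau> \<xi> \<le> ennreal (E k t \<tau> \<xi>) * h' \<tau> \<xi>"
    using assms[of \<tau>] by (cases "\<tau> \<in> {0..t}") (auto simp: E_def intro: mult_left_mono)
qed

lemma duhamel_abs_mono_AE:
  assumes "AE \<tau> in lborel. \<tau> \<in> {0..T} \<longrightarrow> h \<tau> \<xi> \<le> h' \<tau> \<xi>" "t \<le> T" shows "duhamel_abs k h t \<xi> \<le> duhamel_abs k h' t \<xi>"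
  unfolding duhamel_abs_def
proof (rule nn_integral_mono_AE, use assms(1) in eventually_elim)
  fix \<tau> assume "\<tau> \<in> {0..T} \<longrightarrow> h \<tau> \<xi> \<le> h' \<tau> \<xi>"
  then show "ennreal (E k t \<tau> \<xi>) * h \<tau> \<xi> \<le> ennreal (E k t \<tau> \<xi>) * h' \<tau> \<xi>"
    using assms(2) by (cases "\<tau> \<in> {0..T}") (auto simp: E_def intro: mult_left_mono)
qed

lemma duhamel_abs_add:
  assumes "jmeas h" "jmeas h'" shows "duhamel_abs k (\<lambda>t \<xi>. h t \<xi> + h' t \<xi>) t \<xi> = duhamel_abs k h t \<xi> + duhamel_abs k h' t \<xi>"
proof -
  have [measurable]: "(\<lambda>\<tau>. h \<tau> \<xi>) \<in> borel_measurable borel" "(\<lambda>\<tau>. h' \<tau> \<xi>) \<in> borel_measurable borel"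
    "(\<lambda>\<tau>. E k t \<tau> \<xi>) \<in> borel_measurable borel"
    by (rule jmeas_section2[OF assms(1)] jmeas_section2[OF assms(2)] E_measurable; measurable?)+
  show ?thesis unfolding duhamel_abs_def by (simp add: distrib_left nn_integral_add)
qed

definition tot :: "ennreal path \<Rightarrow> real^3 \<Rightarrow> ennreal" where
  "tot h \<xi> = (\<integral>\<^sup>+\<tau>. indicator {0..T} \<tau> * h \<tau> \<xi> \<partial>lborel)"

lemma tot_measurable:
  assumes "jmeas h" shows "tot h \<in> borel_measurable borel"
proof -
  have [measurable]: "(\<lambda>z. h (snd z) (fst z)) \<in> borel_measurable (lborel \<Otimes>\<^sub>M lborel)"
    by (rule jmeas_compose[OF assms]; measurable)
  have "tot h \<in> borel_measurable lborel" unfolding tot_def[abs_def] by measurable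
  then show ?thesis by simp
qed

lemma tot_mono: "(\<And>\<tau>. \<tau> \<in> {0..T} \<Longrightarrow> h \<tau> \<xi> \<le> h' \<tau> \<xi>) \<Longrightarrow> tot h \<xi> \<le> tot h' \<xi>"
  unfolding tot_def by (intro nn_integral_mono) (auto simp: indicator_def)

lemma X_tot:
  assumes h: "jmeas h" shows "X s (tot h) = L1X T s h"
proof -
  have [measurable]: "(\<lambda>z. h (snd z) (fst z)) \<in> borel_measurable (lborel \<Otimes>\<^sub>M lborel)"
    "(\<lambda>\<tau>. h \<tau> \<xi>) \<in> borel_measurable borel" "h t \<in> borel_measurable borel" for \<xi> t
    by (rule jmeas_section[OF h] jmeas_section2[OF h] jmeas_compose[OF h]; measurable?)+
  have "X s (tot h) = (\<integral>\<^sup>+\<xi>. (\<integral>\<^sup>+\<tau>. W s \<xi> * (indicator {0..T} \<tau> * h \<tau> \<xi>) \<partial>lborel) \<partial>lborel)"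
    unfolding X_def tot_def by (simp add: nn_integral_cmult)
  also have "\<dots> = (\<integral>\<^sup>+\<tau>. (\<integral>\<^sup>+\<xi>. W s \<xi> * (indicator {0..T} \<tau> * h \<tau> \<xi>) \<partial>lborel) \<partial>lborel)"
    by (rule lborel_pair.Fubini'[symmetric]) measurable
  also have "\<dots> = (\<integral>\<^sup>+\<tau>. (\<integral>\<^sup>+\<xi>. indicator {0..T} \<tau> * (W s \<xi> * h \<tau> \<xi>) \<partial>lborel) \<partial>lborel)"
    by (simp add: mult.left_commute)
  also have "\<dots> = L1X T s h"
    unfolding X_def by (simp add: nn_integral_cmult)
  finally show ?thesis .
qed

lemma duhamel_abs_le_tot: "t \<le> T \<Longrightarrow> duhamel_abs k h t \<xi> \<le> tot h \<xi>"
  unfolding duhamel_abs_def tot_def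
  by (intro nn_integral_mono mult_right_mono)
    (auto simp: E_def indicator_def ennreal_le_1 mult_nonpos_nonneg)

lemma time_integral_E:
  "(\<integral>\<^sup>+t. indicator {0..T} t * (ennreal (norm \<xi> powr (2 * \<gamma> k)) * ennreal (E k t \<tau> \<xi>)) \<partial>lborel) \<le> indicator {0..T} \<tau>"
proof -
  let ?x = "norm \<xi> powr (2 * \<gamma> k)"
  have "(\<integral>\<^sup>+t. indicator {0..T} t * (ennreal ?x * ennreal (E k t \<tau> \<xi>)) \<partial>lborel)
     \<le> (\<integral>\<^sup>+t. indicator {0..T} \<tau> * (ennreal (?x * exp (- (t - \<tau>) * ?x)) * indicator {\<tau>..T} t) \<partial>lborel)"
    by (rule nn_integral_mono) (auto simp: E_def indicator_def ennreal_mult[symmetric])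
  also have "\<dots> = indicator {0..T} \<tau> * (\<integral>\<^sup>+t. ennreal (?x * exp (- (t - \<tau>) * ?x)) * indicator {\<tau>..T} t \<partial>lborel)"
    by (rule nn_integral_cmult) measurable
  also have "\<dots> \<le> indicator {0..T} \<tau> * 1" by (intro mult_left_mono nn_integral_exp_le_1) auto
  finally show ?thesis by simp
qed

lemma bounded_by_mono:
  assumes "\<And>t. t \<in> {0..T} \<Longrightarrow> AE \<xi> in lborel. f t \<xi> \<le> g t \<xi>" "bounded_by T s r g R" "R \<le> R'"
  shows "bounded_by T s r f R'"
  unfolding bounded_by_def
proof (intro conjI ballI)
  show "X s (f t) \<le> R'" if "t \<in> {0..T}" for t
    using X_mono_AE[OF assms(1)[OF that], of s] assms(2,3) that unfolding bounded_by_def by (meson order_trans)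
  have "L1X T (s + 2 * r) f \<le> L1X T (s + 2 * r) g"
    by (rule nn_integral_mono) (use X_mono_AE[OF assms(1)] in \<open>auto simp: indicator_def\<close>)
  then show "L1X T (s + 2 * r) f \<le> R'"
    using assms(2,3) unfolding bounded_by_def by (meson order_trans)
qed

text \<open>
  The bound in \<open>X\<^sup>s\<close> holds because the kernel is at most one; the bound in \<open>L\<^sup>1 X\<^sup>s\<^sup>+\<^sup>2\<^sup>\<gamma>\<close> follows from Tonelli's theorem,
  integrating first over \<open>t\<close>, where the smoothing effect gives at most one at every frequency.
\<close>

lemma bounded_by_duhamel:
  assumes d: "d \<in> borel_measurable borel" and h: "jmeas h"
  shows "bounded_by T s (\<gamma> k) (\<lambda>t \<xi>. ennreal (E k t 0 \<xi>) * d \<xi> + duhamel_abs k h t \<xi>)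
     (X s d + L1X T s h)"
proof -
  note [measurable] = d tot_measurable[OF h]
  have [measurable]: "(\<lambda>\<tau>. h \<tau> \<xi>) \<in> borel_measurable borel" "h t \<in> borel_measurable borel" for \<xi> t
    by (rule jmeas_section[OF h] jmeas_section2[OF h])+
  have [measurable]: "(\<lambda>z. E k (fst z) (snd z) \<xi>) \<in> borel_measurable (lborel \<Otimes>\<^sub>M lborel)"
     "(\<lambda>z. E k (snd z) (fst z) \<xi>) \<in> borel_measurable (lborel \<Otimes>\<^sub>M lborel)"
     "(\<lambda>z. E k (snd z) 0 (fst z)) \<in> borel_measurable (lborel \<Otimes>\<^sub>M lborel)"
     "(\<lambda>\<tau>. E k t \<tau> \<xi>) \<in> borel_measurable borel" "(\<lambda>t. E k t \<tau> \<xi>) \<in> borel_measurable borel" "E k t \<tau> \<in> borel_measurable borel" for \<xi> t \<tau>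
    by (rule E_measurable; measurable)+
  have [measurable]: "(\<lambda>z. duhamel_abs k h (snd z) (fst z)) \<in> borel_measurable (lborel \<Otimes>\<^sub>M lborel)"
      "(\<lambda>t. duhamel_abs k h t \<xi>) \<in> borel_measurable borel" "duhamel_abs k h t \<in> borel_measurable borel" for \<xi> t
    by (rule jmeas_section[OF jmeas_duhamel_abs[OF h]] jmeas_section2[OF jmeas_duhamel_abs[OF h]] jmeas_compose[OF jmeas_duhamel_abs[OF h]]; measurable?)+
  let ?V = "\<lambda>t \<xi>. ennreal (E k t 0 \<xi>) * d \<xi> + duhamel_abs k h t \<xi>"
  let ?H = "\<lambda>\<xi>. d \<xi> + tot h \<xi>"
  have XH: "X s ?H = X s d + L1X T s h"
    by (simp add: X_add X_tot[OF h])
  have 1: "X s (?V t) \<le> X s ?H" if "t \<in> {0..T}" for t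
  proof (rule X_mono)
    fix \<xi>
    have "ennreal (E k t 0 \<xi>) * d \<xi> \<le> 1 * d \<xi>" by (intro mult_right_mono) (auto simp: ennreal_le_1 E_le_1)
    then show "?V t \<xi> \<le> ?H \<xi>" using duhamel_abs_le_tot[of t k h \<xi>] that by (intro add_mono) auto
  qed
  have 2: "L1X T (s + 2 * \<gamma> k) ?V \<le> X s ?H"
  proof -
    let ?x = "\<lambda>\<xi>::real^3. ennreal (norm \<xi> powr (2 * \<gamma> k))"
    have inner: "(\<integral>\<^sup>+t. indicator {0..T} t * (?x \<xi> * ?V t \<xi>) \<partial>lborel) \<le> ?H \<xi>" for \<xi>
    proof -
      have "(\<integral>\<^sup>+t. indicator {0..T} t * (?x \<xi> * ?V t \<xi>) \<partial>lborel) =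
         (\<integral>\<^sup>+t. indicator {0..T} t * (?x \<xi> * ennreal (E k t 0 \<xi>)) * d \<xi> + indicator {0..T} t * (?x \<xi> * duhamel_abs k h t \<xi>) \<partial>lborel)"
        by (intro nn_integral_cong) (simp add: distrib_left mult_ac)
      also have "\<dots> = (\<integral>\<^sup>+t. indicator {0..T} t * (?x \<xi> * ennreal (E k t 0 \<xi>)) \<partial>lborel) * d \<xi>
          + (\<integral>\<^sup>+t. indicator {0..T} t * (?x \<xi> * duhamel_abs k h t \<xi>) \<partial>lborel)"
        by (subst nn_integral_add) (simp_all add: nn_integral_multc)
      also have "\<dots> \<le> ?H \<xi>"
      proof (rule add_mono)
        have "(\<integral>\<^sup>+t. indicator {0..T} t * (?x \<xi> * ennreal (E k t 0 \<xi>)) \<partial>lborel) \<le> 1"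
          using time_integral_E[of \<xi> k 0] T by simp
        from mult_right_mono[OF this, of "d \<xi>"]
        show "(\<integral>\<^sup>+t. indicator {0..T} t * (?x \<xi> * ennreal (E k t 0 \<xi>)) \<partial>lborel) * d \<xi> \<le> d \<xi>" by simp
        have "(\<integral>\<^sup>+t. indicator {0..T} t * (?x \<xi> * duhamel_abs k h t \<xi>) \<partial>lborel) =
            (\<integral>\<^sup>+t. (\<integral>\<^sup>+\<tau>. indicator {0..T} t * (?x \<xi> * ennreal (E k t \<tau> \<xi>)) * h \<tau> \<xi> \<partial>lborel) \<partial>lborel)"
          unfolding duhamel_abs_def by (simp add: nn_integral_cmult[symmetric] mult.assoc)
        also have "\<dots> = (\<integral>\<^sup>+\<tau>. (\<integral>\<^sup>+t. indicator {0..T} t * (?x \<xi> * ennreal (E k t \<tau> \<xi>)) * h \<tau> \<xi> \<partial>lborel) \<partial>lborel)"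
          by (rule lborel_pair.Fubini'[symmetric]) measurable
        also have "\<dots> = (\<integral>\<^sup>+\<tau>. (\<integral>\<^sup>+t. indicator {0..T} t * (?x \<xi> * ennreal (E k t \<tau> \<xi>)) \<partial>lborel) * h \<tau> \<xi> \<partial>lborel)"
          by (intro nn_integral_cong nn_integral_multc) measurable
        also have "\<dots> \<le> tot h \<xi>"
          unfolding tot_def by (intro nn_integral_mono mult_right_mono time_integral_E) auto
        finally show "(\<integral>\<^sup>+t. indicator {0..T} t * (?x \<xi> * duhamel_abs k h t \<xi>) \<partial>lborel) \<le> tot h \<xi>" .
      qed
      finally show ?thesis .
    qed
    have "L1X T (s + 2 * \<gamma> k) ?V =
       (\<integral>\<^sup>+t. (\<integral>\<^sup>+\<xi>. W s \<xi> * (indicator {0..T} t * (?x \<xi> * ?V t \<xi>)) \<partial>lborel) \<partial>lborel)"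
      unfolding X_def W_add
      by (subst nn_integral_cmult[symmetric]) (auto intro!: nn_integral_cong simp: mult_ac)
    also have "\<dots> = (\<integral>\<^sup>+\<xi>. (\<integral>\<^sup>+t. W s \<xi> * (indicator {0..T} t * (?x \<xi> * ?V t \<xi>)) \<partial>lborel) \<partial>lborel)"
      by (rule lborel_pair.Fubini') measurable
    also have "\<dots> = (\<integral>\<^sup>+\<xi>. W s \<xi> * (\<integral>\<^sup>+t. indicator {0..T} t * (?x \<xi> * ?V t \<xi>) \<partial>lborel) \<partial>lborel)"
      by (intro nn_integral_cong nn_integral_cmult) measurable
    also have "\<dots> \<le> X s ?H" unfolding X_def by (intro nn_integral_mono mult_left_mono inner) auto
    finally show ?thesis .
  qed
  show ?thesis unfolding bounded_by_def using 1 2 unfolding XH by blast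
qed

lemma integral_X_G:
  assumes P: "\<And>l. jmeas (P l)" and Q: "\<And>l. jmeas (Q l)" and R: "0 < R1" "0 < R2"
    and bP: "\<And>l. bounded_by T s (\<gamma> l) (P l) (ennreal R1)" and bQ: "\<And>l. bounded_by T s (\<gamma> l) (Q l) (ennreal R2)"
  shows "L1X T s (G P Q k)
    \<le> ennreal (real CARD('i) ^ 2 * C * (24 * R1 * R2 * T powr \<delta>))"
proof -
  note [measurable] = P Q
  have jn[measurable]: "jmeas (\<lambda>\<tau>. nconv (P l \<tau>) (Q m \<tau>))" for l m by (intro jmeas_nconv assms)
  have [measurable]: "nconv (P l t) (Q m t) \<in> borel_measurable borel" for l m t
    using jmeas_section[OF jn[of l m], of t] by simp
  have trm: "L1X T s (\<lambda>t \<xi>. ennreal (cmod (A k l m \<xi>)) * nconv (P l t) (Q m t) \<xi>)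
     \<le> ennreal (C * (24 * R1 * R2 * T powr \<delta>))" for l m
  proof (cases "\<exists>\<xi>. A k l m \<xi> \<noteq> 0")
    case True
    then have ex: "1 / (2 * \<gamma> l) - s / (2 * \<gamma> m) \<le> 1 - \<delta>" "1 / (2 * \<gamma> m) - s / (2 * \<gamma> l) \<le> 1 - \<delta>"
      using A_exponents by blast+
    have le: "X s (\<lambda>\<xi>. ennreal (cmod (A k l m \<xi>)) * nconv (P l t) (Q m t) \<xi>) \<le> ennreal C * X s (\<lambda>\<xi>. ennreal (norm \<xi>) * nconv (P l t) (Q m t) \<xi>)" for t
    proof -
      have "X s (\<lambda>\<xi>. ennreal (cmod (A k l m \<xi>)) * nconv (P l t) (Q m t) \<xi>) \<le> X s (\<lambda>\<xi>. ennreal C * (ennreal (norm \<xi>) * nconv (P l t) (Q m t) \<xi>))"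
        unfolding mult.assoc[symmetric] using A_bound C
        by (intro X_mono mult_right_mono) (auto simp: ennreal_mult[symmetric] intro: ennreal_leI)
      also have "\<dots> = ennreal C * X s (\<lambda>\<xi>. ennreal (norm \<xi>) * nconv (P l t) (Q m t) \<xi>)"
        by (rule X_cmult) measurable
      finally show ?thesis .
    qed
    have "L1X T s (\<lambda>t \<xi>. ennreal (cmod (A k l m \<xi>)) * nconv (P l t) (Q m t) \<xi>)
      \<le> (\<integral>\<^sup>+t. ennreal C * (indicator {0..T} t * X s (\<lambda>\<xi>. ennreal (norm \<xi>) * nconv (P l t) (Q m t) \<xi>)) \<partial>lborel)"
      by (rule nn_integral_mono) (use le in \<open>auto simp: indicator_def\<close>)
    also have "\<dots> = ennreal C * L1X T s (\<lambda>t \<xi>. ennreal (norm \<xi>) * nconv (P l t) (Q m t) \<xi>)"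
      by (rule nn_integral_cmult) measurable
    also have "\<dots> \<le> ennreal C * ennreal (24 * R1 * R2 * T powr \<delta>)"
      by (intro mult_left_mono X_bilinear_time[OF s P Q R bP bQ T \<gamma> \<gamma> \<delta> ex]) auto
    finally show ?thesis using C by (simp add: ennreal_mult')
  next
    case False
    then show ?thesis by (simp add: X_def)
  qed
  have "X s (G P Q k t) = (\<Sum>l\<in>UNIV. \<Sum>m\<in>UNIV. X s (\<lambda>\<xi>. ennreal (cmod (A k l m \<xi>)) * nconv (P l t) (Q m t) \<xi>))" for t
    unfolding G_def by (simp add: X_sum)
  then have "L1X T s (G P Q k) =
    (\<integral>\<^sup>+t. (\<Sum>l\<in>UNIV. \<Sum>m\<in>UNIV. indicator {0..T} t * X s (\<lambda>\<xi>. ennreal (cmod (A k l m \<xi>)) * nconv (P l t) (Q m t) \<xi>)) \<partial>lborel)"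
    by (intro nn_integral_cong) (simp only: sum_distrib_left)
  also have "\<dots> = (\<Sum>l\<in>UNIV. \<integral>\<^sup>+t. (\<Sum>m\<in>UNIV. indicator {0..T} t * X s (\<lambda>\<xi>. ennreal (cmod (A k l m \<xi>)) * nconv (P l t) (Q m t) \<xi>)) \<partial>lborel)"
    by (rule nn_integral_sum) measurable
  also have "\<dots> = (\<Sum>l\<in>UNIV. \<Sum>m\<in>UNIV. L1X T s (\<lambda>t \<xi>. ennreal (cmod (A k l m \<xi>)) * nconv (P l t) (Q m t) \<xi>))"
    by (intro sum.cong refl nn_integral_sum) measurable
  also have "\<dots> \<le> (\<Sum>l\<in>(UNIV::'i set). \<Sum>m\<in>(UNIV::'i set). ennreal (C * (24 * R1 * R2 * T powr \<delta>)))"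
    by (intro sum_mono trm)
  also have "\<dots> = ennreal (\<Sum>l\<in>(UNIV::'i set). \<Sum>m\<in>(UNIV::'i set). C * (24 * R1 * R2 * T powr \<delta>))"
    using C R by (subst sum_ennreal, simp)+ (auto intro: sum_nonneg)
  also have "\<dots> = ennreal (real CARD('i) ^ 2 * C * (24 * R1 * R2 * T powr \<delta>))"
    by (simp add: power2_eq_square mult_ac)
  finally show ?thesis .
qed

lemma integral_X_L:
  assumes P: "\<And>l. jmeas (P l)" and R: "0 < R" and bP: "\<And>l. bounded_by T s (\<gamma> l) (P l) (ennreal R)"
  shows "L1X T s (L P k) \<le> ennreal (real CARD('i) * C * T * R)"
proof -
  note [measurable] = P
  have [measurable]: "P l t \<in> borel_measurable borel" for l t by (rule jmeas_section[OF P])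
  have le: "X s (L P k t) \<le> ennreal (real CARD('i) * C * R)" if "t \<in> {0..T}" for t
  proof -
    have "X s (L P k t) = (\<Sum>l\<in>UNIV. X s (\<lambda>\<xi>. ennreal (cmod (B k l \<xi>)) * P l t \<xi>))"
      unfolding L_def by (simp add: X_sum)
    also have "\<dots> \<le> (\<Sum>l\<in>(UNIV::'i set). ennreal (C * R))"
    proof (rule sum_mono)
      fix l
      have "X s (\<lambda>\<xi>. ennreal (cmod (B k l \<xi>)) * P l t \<xi>) \<le> X s (\<lambda>\<xi>. ennreal C * P l t \<xi>)"
        by (intro X_mono mult_right_mono ennreal_leI B_bound) auto
      also have "\<dots> = ennreal C * X s (P l t)" by (rule X_cmult) measurable
      also have "\<dots> \<le> ennreal C * ennreal R" using bP that by (intro mult_left_mono) (auto simp: bounded_by_def)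
      finally show "X s (\<lambda>\<xi>. ennreal (cmod (B k l \<xi>)) * P l t \<xi>) \<le> ennreal (C * R)" using C by (simp add: ennreal_mult')
    qed
    also have "\<dots> = ennreal (real CARD('i) * C * R)" using C R by (subst sum_ennreal) (auto simp: mult_ac)
    finally show ?thesis .
  qed
  have "L1X T s (L P k) \<le> (\<integral>\<^sup>+t. ennreal (real CARD('i) * C * R) * indicator {0..T} t \<partial>lborel)"
    by (rule nn_integral_mono) (use le in \<open>auto simp: indicator_def\<close>)
  also have "\<dots> = ennreal (real CARD('i) * C * R) * ennreal T"
    using T by (subst nn_integral_cmult) auto
  also have "\<dots> = ennreal (real CARD('i) * C * T * R)" using C R T by (simp add: ennreal_mult[symmetric] mult_ac)
  finally show ?thesis .
qed

lemma integral_X_Fm: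
  assumes P: "\<And>l. jmeas (P l)" and R: "0 < R" and bP: "\<And>l. bounded_by T s (\<gamma> l) (P l) (ennreal R)"
  shows "L1X T s (Fm P k)
     \<le> ennreal (real CARD('i) ^ 2 * C * (24 * R * R * T powr \<delta>) + real CARD('i) * C * T * R)"
proof -
  have jm[measurable]: "jmeas (G P P k)" "jmeas (L P k)" by (intro jmeas_G jmeas_L P)+
  have "L1X T s (Fm P k) =
     (\<integral>\<^sup>+t. indicator {0..T} t * X s (G P P k t) + indicator {0..T} t * X s (L P k t) \<partial>lborel)"
    unfolding Fm_def by (simp add: X_add jmeas_section jm distrib_left)
  also have "\<dots> = L1X T s (G P P k) + L1X T s (L P k)"
    by (rule nn_integral_add) measurable
  also have "\<dots> \<le> ennreal (real CARD('i) ^ 2 * C * (24 * R * R * T powr \<delta>)) + ennreal (real CARD('i) * C * T * R)"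
    by (intro add_mono integral_X_G integral_X_L P R bP)
  finally show ?thesis using C R T by (subst ennreal_plus) auto
qed

end

section \<open>Uniqueness for the integral equation\<close>

lemma dominated_convergence_ennreal:
  fixes f :: "nat \<Rightarrow> 'a \<Rightarrow> 'b::{banach, second_countable_topology}"
  assumes [measurable]: "\<And>n. f n \<in> borel_measurable M" "g \<in> borel_measurable M" "w \<in> borel_measurable M"
    and lim: "AE x in M. (\<lambda>n. f n x) \<longlonglongrightarrow> g x"
    and bound: "\<And>n. AE x in M. ennreal (norm (f n x)) \<le> w x" and fin: "(\<integral>\<^sup>+x. w x \<partial>M) < \<infinity>"
  shows "(\<lambda>n. \<integral>x. f n x \<partial>M) \<longlonglongrightarrow> (\<integral>x. g x \<partial>M)"
proof (rule integral_dominated_convergence[where w = "\<lambda>x. enn2real (w x)"])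
  have wfin: "AE x in M. w x \<noteq> \<infinity>" using fin by (intro nn_integral_PInf_AE) auto
  show "AE x in M. norm (f n x) \<le> enn2real (w x)" for n
    using bound[of n] wfin
  proof eventually_elim
    fix x assume "ennreal (norm (f n x)) \<le> w x" "w x \<noteq> \<infinity>"
    then show "norm (f n x) \<le> enn2real (w x)" using enn2real_mono[of "ennreal (norm (f n x))" "w x"]
      by (simp add: less_top)
  qed
  show "integrable M (\<lambda>x. enn2real (w x))"
  proof (rule integrableI_bounded)
    have "(\<integral>\<^sup>+x. ennreal (norm (enn2real (w x))) \<partial>M) \<le> (\<integral>\<^sup>+x. w x \<partial>M)"
      by (intro nn_integral_mono) (simp add: ennreal_enn2real_if)
    then show "(\<integral>\<^sup>+x. ennreal (norm (enn2real (w x))) \<partial>M) < \<infinity>" using fin by (rule le_less_trans)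
  qed simp
qed (use lim in auto)

context duhamel_system
begin

lemma Fm_mono:
  assumes "\<And>l \<tau> \<xi>. P l \<tau> \<xi> \<le> Q l \<tau> \<xi>" shows "Fm P k \<tau> \<xi> \<le> Fm Q k \<tau> \<xi>"
  unfolding Fm_def G_def L_def by (intro add_mono sum_mono mult_left_mono nconv_mono assms) auto

lemma F_le_Fm: "ennreal (cmod (F U k \<tau> \<xi>)) \<le> Fm (nrm U) k \<tau> \<xi>"
proof -
  have "ennreal (cmod (F U k \<tau> \<xi>)) \<le> ennreal (cmod (\<Sum>l\<in>UNIV. \<Sum>m\<in>UNIV. A k l m \<xi> * Defs.convolution (U l \<tau>) (U m \<tau>) \<xi>)) + ennreal (cmod (\<Sum>l\<in>UNIV. B k l \<xi> * U l \<tau> \<xi>))"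
    unfolding F_def by (rule ennreal_norm_add_le)
  also have "\<dots> \<le> Fm (nrm U) k \<tau> \<xi>"
    unfolding Fm_def G_def L_def
  proof (intro add_mono)
    show "ennreal (cmod (\<Sum>l\<in>UNIV. \<Sum>m\<in>UNIV. A k l m \<xi> * Defs.convolution (U l \<tau>) (U m \<tau>) \<xi>))
      \<le> (\<Sum>l\<in>UNIV. \<Sum>m\<in>UNIV. ennreal (cmod (A k l m \<xi>)) * nconv (nrm U l \<tau>) (nrm U m \<tau>) \<xi>)"
      by (intro order_trans[OF ennreal_norm_sum_le] sum_mono)
        (auto simp: ennreal_norm_mult nrm_def[abs_def] intro!: mult_left_mono convolution_le)
    show "ennreal (cmod (\<Sum>l\<in>UNIV. B k l \<xi> * U l \<tau> \<xi>)) \<le> (\<Sum>l\<in>UNIV. ennreal (cmod (B k l \<xi>)) * nrm U l \<tau> \<xi>)"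
      by (intro order_trans[OF ennreal_norm_sum_le] sum_mono) (simp add: ennreal_norm_mult nrm_def)
  qed
  finally show ?thesis .
qed

lemma Fm_finite_nconv:
  assumes "Fm P k \<tau> \<xi> < \<infinity>" "A k l m \<xi> \<noteq> 0" shows "nconv (P l \<tau>) (P m \<tau>) \<xi> < \<infinity>"
proof -
  have "ennreal (cmod (A k l m \<xi>)) * nconv (P l \<tau>) (P m \<tau>) \<xi> \<le> (\<Sum>m\<in>UNIV. ennreal (cmod (A k l m \<xi>)) * nconv (P l \<tau>) (P m \<tau>) \<xi>)"
    by (rule member_le_sum) auto
  also have "\<dots> \<le> G P P k \<tau> \<xi>" unfolding G_def
    by (rule member_le_sum[of l UNIV "\<lambda>l. \<Sum>m\<in>UNIV. ennreal (cmod (A k l m \<xi>)) * nconv (P l \<tau>) (P m \<tau>) \<xi>"]) auto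
  also have "\<dots> \<le> Fm P k \<tau> \<xi>" unfolding Fm_def by simp
  finally have "ennreal (cmod (A k l m \<xi>)) * nconv (P l \<tau>) (P m \<tau>) \<xi> < \<infinity>" using assms(1) by (rule le_less_trans)
  then show ?thesis using assms(2) by (auto simp: ennreal_mult_less_top)
qed

text \<open>
  The convolutions of \<open>U\<close> and \<open>V\<close> can be subtracted under the integral only if both converge
  absolutely, which the finiteness of the majorants ensures.
\<close>

lemma F_diff_le:
  assumes U: "\<And>l. jmeas (U l)" and V: "\<And>l. jmeas (V l)"
    and fin: "Fm (nrm U) k \<tau> \<xi> < \<infinity>" "Fm (nrm V) k \<tau> \<xi> < \<infinity>"
  shows "ennreal (cmod (F U k \<tau> \<xi> - F V k \<tau> \<xi>)) \<le> Fd U V k \<tau> \<xi>"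
proof -
  have eq: "F U k \<tau> \<xi> - F V k \<tau> \<xi> =
    (\<Sum>l\<in>UNIV. \<Sum>m\<in>UNIV. A k l m \<xi> * (Defs.convolution (U l \<tau>) (U m \<tau>) \<xi> - Defs.convolution (V l \<tau>) (V m \<tau>) \<xi>))
    + (\<Sum>l\<in>UNIV. B k l \<xi> * (U l \<tau> \<xi> - V l \<tau> \<xi>))"
    unfolding F_def by (simp add: right_diff_distrib sum_subtractf)
  show ?thesis
    unfolding eq Fd_def
  proof (intro order_trans[OF ennreal_norm_add_le] add_mono order_trans[OF ennreal_norm_sum_le] sum_mono)
    fix l m
    show "ennreal (cmod (A k l m \<xi> * (Defs.convolution (U l \<tau>) (U m \<tau>) \<xi> - Defs.convolution (V l \<tau>) (V m \<tau>) \<xi>)))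
      \<le> ennreal (cmod (A k l m \<xi>)) * dconv U V l m \<tau> \<xi>"
    proof (cases "A k l m \<xi> = 0")
      case False
      show ?thesis unfolding ennreal_norm_mult
        using Fm_finite_nconv[OF fin(1) False] Fm_finite_nconv[OF fin(2) False]
        by (intro mult_left_mono convolution_diff_le jmeas_section U V) (auto simp: nrm_def[abs_def])
    qed simp
  qed (simp add: ennreal_norm_mult)
qed

lemma Fm_finite_AE:
  assumes P: "\<And>l. jmeas (P l)" and fin: "tot (Fm P k) \<xi> < \<infinity>"
  shows "AE \<tau> in lborel. \<tau> \<in> {0..T} \<longrightarrow> Fm P k \<tau> \<xi> < \<infinity>"
proof -
  have [measurable]: "(\<lambda>\<tau>. Fm P k \<tau> \<xi>) \<in> borel_measurable borel"
    by (rule jmeas_section2[OF jmeas_Fm[OF P]])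
  have "AE \<tau> in lborel. indicator {0..T} \<tau> * Fm P k \<tau> \<xi> \<noteq> \<infinity>"
    using fin unfolding tot_def by (intro nn_integral_PInf_AE) auto
  then show ?thesis by eventually_elim (auto simp: indicator_def less_top)
qed

lemma duhamel_integrable:
  assumes U: "\<And>l. jmeas (U l)" and fin: "tot (Fm (nrm U) k) \<xi> < \<infinity>" and t: "t \<le> T"
  shows "integrable lborel (\<lambda>\<tau>. of_real (E k t \<tau> \<xi>) * F U k \<tau> \<xi>)"
proof (rule integrableI_bounded)
  have [measurable]: "(\<lambda>\<tau>. F U k \<tau> \<xi>) \<in> borel_measurable borel" "(\<lambda>\<tau>. E k t \<tau> \<xi>) \<in> borel_measurable borel"
    by (rule jmeas_section2[OF jmeas_F[OF U]] E_measurable; measurable?)+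
  show "(\<lambda>\<tau>. of_real (E k t \<tau> \<xi>) * F U k \<tau> \<xi>) \<in> borel_measurable lborel" by measurable
  have "(\<integral>\<^sup>+\<tau>. ennreal (norm (of_real (E k t \<tau> \<xi>) * F U k \<tau> \<xi>)) \<partial>lborel) \<le> duhamel_abs k (Fm (nrm U) k) t \<xi>"
    unfolding duhamel_abs_def
    by (intro nn_integral_mono) (auto simp: ennreal_norm_mult E_nonneg intro!: mult_left_mono F_le_Fm)
  also have "\<dots> \<le> tot (Fm (nrm U) k) \<xi>" by (rule duhamel_abs_le_tot[OF t])
  finally show "(\<integral>\<^sup>+\<tau>. ennreal (norm (of_real (E k t \<tau> \<xi>) * F U k \<tau> \<xi>)) \<partial>lborel) < \<infinity>" using fin by (rule le_less_trans)
qed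

lemma duhamel_diff_le:
  assumes U: "\<And>l. jmeas (U l)" and V: "\<And>l. jmeas (V l)"
    and fin: "tot (Fm (nrm U) k) \<xi> < \<infinity>" "tot (Fm (nrm V) k) \<xi> < \<infinity>" and t: "t \<le> T"
  shows "ennreal (cmod (duhamel k (F U k) t \<xi> - duhamel k (F V k) t \<xi>)) \<le> duhamel_abs k (Fd U V k) t \<xi>"
proof -
  have "ennreal (cmod (duhamel k (F U k) t \<xi> - duhamel k (F V k) t \<xi>)) \<le>
      (\<integral>\<^sup>+\<tau>. ennreal (cmod (of_real (E k t \<tau> \<xi>) * F U k \<tau> \<xi> - of_real (E k t \<tau> \<xi>) * F V k \<tau> \<xi>)) \<partial>lborel)"
    unfolding duhamel_def by (rule ennreal_norm_integral_diff_le) (intro duhamel_integrable assms)+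
  also have "\<dots> = duhamel_abs k (\<lambda>\<tau> \<xi>. ennreal (cmod (F U k \<tau> \<xi> - F V k \<tau> \<xi>))) t \<xi>"
    unfolding duhamel_abs_def right_diff_distrib[symmetric] ennreal_norm_mult by (simp add: E_nonneg)
  also have "\<dots> \<le> duhamel_abs k (Fd U V k) t \<xi>"
  proof (rule duhamel_abs_mono_AE[OF _ t])
    show "AE \<tau> in lborel. \<tau> \<in> {0..T} \<longrightarrow> ennreal (cmod (F U k \<tau> \<xi> - F V k \<tau> \<xi>)) \<le> Fd U V k \<tau> \<xi>"
      using Fm_finite_AE[OF jmeas_nrm[OF U] fin(1)] Fm_finite_AE[OF jmeas_nrm[OF V] fin(2)]
      by eventually_elim (blast intro: F_diff_le U V)
  qed
  finally show ?thesis .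
qed

abbreviation rhs :: "('i \<Rightarrow> complex path) \<Rightarrow> ('i \<Rightarrow> real^3 \<Rightarrow> complex) \<Rightarrow> 'i \<Rightarrow> complex path" where
  "rhs U d k t \<equiv> \<lambda>\<xi>. of_real (E k t 0 \<xi>) * d k \<xi> + duhamel k (F U k) t \<xi>"

definition solves :: "('i \<Rightarrow> complex path) \<Rightarrow> ('i \<Rightarrow> real^3 \<Rightarrow> complex) \<Rightarrow> bool" where
  "solves U d \<longleftrightarrow> (\<forall>t\<in>{0..T}. \<forall>k. AE \<xi> in lborel. U k t \<xi> = rhs U d k t \<xi>)"

lemma tot_Fm_finite_AE:
  assumes P: "\<And>l. jmeas (P l)" and R: "0 < R" and bP: "\<And>l. bounded_by T s (\<gamma> l) (P l) (ennreal R)"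
  shows "AE \<xi> in lborel. tot (Fm P k) \<xi> < \<infinity>"
proof (rule X_finite_AE)
  show "tot (Fm P k) \<in> borel_measurable borel" by (intro tot_measurable jmeas_Fm P)
  have "X s (tot (Fm P k)) \<le> ennreal (real CARD('i) ^ 2 * C * (24 * R * R * T powr \<delta>) + real CARD('i) * C * T * R)"
    unfolding X_tot[OF jmeas_Fm[OF P]] by (rule integral_X_Fm[OF P R bP])
  also have "\<dots> < \<infinity>" by simp
  finally show "X s (tot (Fm P k)) < \<infinity>" .
qed

lemma product_diff_le:
  fixes u u' v v' :: complex
  shows "ennreal (cmod (u * u' - v * v')) \<le> ennreal (cmod (u - v)) * ennreal (cmod u') + ennreal (cmod v) * ennreal (cmod (u' - v'))"
proof -
  have "u * u' - v * v' = (u - v) * u' + v * (u' - v')" by (simp add: algebra_simps)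
  then show ?thesis by (metis ennreal_norm_add_le ennreal_norm_mult)
qed

lemma Fd_le:
  assumes U: "\<And>l. jmeas (U l)" and V: "\<And>l. jmeas (V l)"
  defines "D \<equiv> nrm (\<lambda>k t \<xi>. U k t \<xi> - V k t \<xi>)"
  shows "Fd U V k \<tau> \<xi> \<le> G D (nrm U) k \<tau> \<xi> + G (nrm V) D k \<tau> \<xi> + L D k \<tau> \<xi>"
proof -
  have [measurable]: "U l \<tau> \<in> borel_measurable borel" "V l \<tau> \<in> borel_measurable borel" for l
    by (rule jmeas_section[OF U] jmeas_section[OF V])+
  have "dconv U V l m \<tau> \<xi>
     \<le> nconv (D l \<tau>) (nrm U m \<tau>) \<xi> + nconv (nrm V l \<tau>) (D m \<tau>) \<xi>" for l m
  proof -
    have "dconv U V l m \<tau> \<xi>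
      \<le> (\<integral>\<^sup>+\<eta>. D l \<tau> (\<xi> - \<eta>) * nrm U m \<tau> \<eta> + nrm V l \<tau> (\<xi> - \<eta>) * D m \<tau> \<eta> \<partial>lborel)"
      unfolding D_def nrm_def by (intro nn_integral_mono product_diff_le)
    also have "\<dots> = nconv (D l \<tau>) (nrm U m \<tau>) \<xi> + nconv (nrm V l \<tau>) (D m \<tau>) \<xi>"
      unfolding nconv_def D_def nrm_def by (rule nn_integral_add) measurable
    finally show ?thesis .
  qed
  then have "Fd U V k \<tau> \<xi> \<le> (\<Sum>l\<in>UNIV. \<Sum>m\<in>UNIV. ennreal (cmod (A k l m \<xi>)) * (nconv (D l \<tau>) (nrm U m \<tau>) \<xi> + nconv (nrm V l \<tau>) (D m \<tau>) \<xi>)) + L D k \<tau> \<xi>"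
    unfolding Fd_def L_def D_def nrm_def by (intro add_mono sum_mono mult_left_mono) auto
  also have "\<dots> = G D (nrm U) k \<tau> \<xi> + G (nrm V) D k \<tau> \<xi> + L D k \<tau> \<xi>"
    unfolding G_def by (simp add: distrib_left sum.distrib)
  finally show ?thesis .
qed

text \<open>
  \<open>F U - F V\<close> is bounded by \<open>D * U + V * D + D\<close>, with \<open>D = \<bar>U - V\<bar>\<close>. If \<open>D\<close> lies in the ball of radius
  \<open>N\<close>, the three terms contribute \<open>N/8\<close> each by the smallness conditions.
\<close>

lemma difference_halves:
  assumes U: "\<And>l. jmeas (U l)" and V: "\<And>l. jmeas (V l)" and R: "0 < R"
    and bU: "\<And>l. bounded_by T s (\<gamma> l) (nrm U l) (ennreal R)" and bV: "\<And>l. bounded_by T s (\<gamma> l) (nrm V l) (ennreal R)"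
    and sol: "solves U d" "solves V d"
    and small: "real CARD('i) ^ 2 * C * (24 * R * T powr \<delta>) \<le> 1 / 8" "real CARD('i) * C * T \<le> 1 / 8"
    and N: "0 < N" "\<And>l. bounded_by T s (\<gamma> l) (nrm (\<lambda>k t \<xi>. U k t \<xi> - V k t \<xi>) l) (ennreal N)"
  shows "bounded_by T s (\<gamma> k) (nrm (\<lambda>k t \<xi>. U k t \<xi> - V k t \<xi>) k) (ennreal (N / 2))"
proof -
  define D where "D = nrm (\<lambda>k t \<xi>. U k t \<xi> - V k t \<xi>)"
  have jUV: "jmeas (\<lambda>t \<xi>. U k t \<xi> - V k t \<xi>)" for k
  proof -
    note [measurable] = U V
    show ?thesis by measurable
  qed
  then have jD: "jmeas (D l)" for l unfolding D_def by (rule jmeas_nrm)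
  note jU = jmeas_nrm[where U = U, OF U] and jV = jmeas_nrm[where U = V, OF V]
  note jm [measurable] = jmeas_G[OF jD jU, where k = k] jmeas_G[OF jV jD, where k = k] jmeas_L[OF jD, where k = k]
  let ?h = "\<lambda>\<tau> \<xi>. G D (nrm U) k \<tau> \<xi> + G (nrm V) D k \<tau> \<xi> + L D k \<tau> \<xi>"
  have jh: "jmeas ?h" by measurable
  have pw: "AE \<xi> in lborel. D k t \<xi> \<le> ennreal (E k t 0 \<xi>) * 0 + duhamel_abs k ?h t \<xi>" if t: "t \<in> {0..T}" for t
  proof -
    have eU: "AE \<xi> in lborel. U k t \<xi> = rhs U d k t \<xi>"
      and eV: "AE \<xi> in lborel. V k t \<xi> = rhs V d k t \<xi>"
      using sol t by (auto simp: solves_def)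
    show ?thesis
      using eU eV tot_Fm_finite_AE[OF jU R bU, where k = k] tot_Fm_finite_AE[OF jV R bV, where k = k]
    proof eventually_elim
      fix \<xi> assume *: "U k t \<xi> = rhs U d k t \<xi>"
        "V k t \<xi> = rhs V d k t \<xi>"
        "tot (Fm (nrm U) k) \<xi> < \<infinity>" "tot (Fm (nrm V) k) \<xi> < \<infinity>"
      have "D k t \<xi> = ennreal (cmod (duhamel k (F U k) t \<xi> - duhamel k (F V k) t \<xi>))" using *(1,2) by (simp add: D_def nrm_def)
      also have "\<dots> \<le> duhamel_abs k (Fd U V k) t \<xi>" using t by (intro duhamel_diff_le U V *) auto
      also have "\<dots> \<le> duhamel_abs k ?h t \<xi>" unfolding D_def by (intro duhamel_abs_mono Fd_le U V)
      finally show "D k t \<xi> \<le> ennreal (E k t 0 \<xi>) * 0 + duhamel_abs k ?h t \<xi>" by simp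
    qed
  qed
  have ND: "bounded_by T s (\<gamma> l) (D l) (ennreal N)" for l using N(2) by (simp add: D_def)
  have "L1X T s ?h =
      (\<integral>\<^sup>+t. indicator {0..T} t * X s (G D (nrm U) k t) + indicator {0..T} t * X s (G (nrm V) D k t) + indicator {0..T} t * X s (L D k t) \<partial>lborel)"
    by (simp add: X_add jmeas_section jm distrib_left)
  also have "\<dots> = L1X T s (G D (nrm U) k) + L1X T s (G (nrm V) D k)
      + L1X T s (L D k)"
    by (subst nn_integral_add, measurable, subst nn_integral_add, measurable)
  also have "\<dots> \<le> ennreal (real CARD('i) ^ 2 * C * (24 * N * R * T powr \<delta>)) + ennreal (real CARD('i) ^ 2 * C * (24 * R * N * T powr \<delta>)) + ennreal (real CARD('i) * C * T * N)"
    by (intro add_mono integral_X_G integral_X_L jD jU jV N(1) R ND bU bV)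
  also have "\<dots> = ennreal (real CARD('i) ^ 2 * C * (24 * R * T powr \<delta>) * N + real CARD('i) ^ 2 * C * (24 * R * T powr \<delta>) * N + real CARD('i) * C * T * N)"
    using C R N T by (simp add: ennreal_plus[symmetric] mult_ac del: ennreal_plus)
  also have "\<dots> \<le> ennreal (N / 2)"
    using mult_right_mono[OF small(1), of N] mult_right_mono[OF small(2), of N] N by (intro ennreal_leI) linarith
  finally have est: "L1X T s ?h \<le> ennreal (N / 2)" .
  have "bounded_by T s (\<gamma> k) (D k) (ennreal (N / 2))"
    by (rule bounded_by_mono[OF pw bounded_by_duhamel[OF _ jh]]) (use est in \<open>auto simp: X_def\<close>)
  then show ?thesis by (simp add: D_def)
qed

theorem solves_unique:
  assumes U: "\<And>l. jmeas (U l)" and V: "\<And>l. jmeas (V l)" and R: "0 < R"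
    and bU: "\<And>l. bounded_by T s (\<gamma> l) (nrm U l) (ennreal R)" and bV: "\<And>l. bounded_by T s (\<gamma> l) (nrm V l) (ennreal R)"
    and sol: "solves U d" "solves V d"
    and small: "real CARD('i) ^ 2 * C * (24 * R * T powr \<delta>) \<le> 1 / 8" "real CARD('i) * C * T \<le> 1 / 8"
    and t: "t \<in> {0..T}"
  shows "AE \<xi> in lborel. U k t \<xi> = V k t \<xi>"
proof -
  define D where "D = nrm (\<lambda>k t \<xi>. U k t \<xi> - V k t \<xi>)"
  note [measurable] = U V jmeas_nrm[where U = U, OF U] jmeas_nrm[where U = V, OF V]
  have sec[measurable]: "nrm U k t \<in> borel_measurable borel" "nrm V k t \<in> borel_measurable borel" for k t
    by (rule jmeas_section[OF jmeas_nrm[OF U]] jmeas_section[OF jmeas_nrm[OF V]])+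
  have Dle: "D k t \<xi> \<le> nrm U k t \<xi> + nrm V k t \<xi>" for k t \<xi>
    using ennreal_norm_add_le[of "U k t \<xi>" "- V k t \<xi>"] by (simp add: D_def nrm_def)
  have XD: "X r (D k t) \<le> X r (nrm U k t) + X r (nrm V k t)" for r k t
    by (subst X_add[symmetric, OF sec]) (rule X_mono[OF Dle])
  have start: "bounded_by T s (\<gamma> k) (D k) (ennreal (2 * R))" for k
    unfolding bounded_by_def
  proof (intro conjI ballI)
    have two: "ennreal (2 * R) = ennreal R + ennreal R" using R by (simp add: ennreal_plus[symmetric] del: ennreal_plus)
    show "X s (D k t) \<le> ennreal (2 * R)" if "t \<in> {0..T}" for t
      using bU[of k] bV[of k] that unfolding two bounded_by_def by (blast intro: order_trans[OF XD add_mono])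
    have "L1X T (s + 2 * \<gamma> k) (D k)
       \<le> (\<integral>\<^sup>+t. indicator {0..T} t * X (s + 2 * \<gamma> k) (nrm U k t) + indicator {0..T} t * X (s + 2 * \<gamma> k) (nrm V k t) \<partial>lborel)"
      unfolding distrib_left[symmetric] by (intro nn_integral_mono mult_left_mono XD) auto
    also have "\<dots> = L1X T (s + 2 * \<gamma> k) (nrm U k) + L1X T (s + 2 * \<gamma> k) (nrm V k)"
      by (rule nn_integral_add) measurable
    also have "\<dots> \<le> ennreal R + ennreal R" using bU[of k] bV[of k] by (intro add_mono) (auto simp: bounded_by_def)
    finally show "L1X T (s + 2 * \<gamma> k) (D k) \<le> ennreal (2 * R)" unfolding two .
  qed
  have "bounded_by T s (\<gamma> k) (D k) (ennreal (2 * R / 2 ^ n))" for n k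
  proof (induction n arbitrary: k)
    case (Suc n)
    have "bounded_by T s (\<gamma> k) (D k) (ennreal (2 * R / 2 ^ n / 2))"
      using difference_halves[OF U V R bU bV sol small _ Suc.IH[unfolded D_def]] R unfolding D_def by simp
    then show ?case by (simp add: mult.commute)
  qed (simp add: start)
  then have le: "X s (D k t) \<le> ennreal (2 * R / 2 ^ n)" for n using t by (auto simp: bounded_by_def)
  have "(\<lambda>n. 2 * R / 2 ^ n) \<longlonglongrightarrow> 0" by real_asymp
  then have "(\<lambda>n. ennreal (2 * R / 2 ^ n)) \<longlonglongrightarrow> ennreal 0" by (rule tendsto_ennrealI)
  then have "X s (D k t) \<le> ennreal 0" by (rule LIMSEQ_le_const) (use le in blast)
  then have "X s (D k t) = 0" by simp
  moreover have "D k t \<in> borel_measurable borel"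
  proof -
    have "(\<lambda>\<xi>. U k t \<xi> - V k t \<xi>) \<in> borel_measurable borel"
      by (intro borel_measurable_diff jmeas_section U V)
    then show ?thesis unfolding D_def nrm_def[abs_def] by measurable
  qed
  ultimately have "AE \<xi> in lborel. D k t \<xi> = 0" by (intro X_zero_AE)
  then show ?thesis by eventually_elim (simp add: D_def nrm_def)
qed

end

section \<open>Existence by Picard iteration\<close>

context duhamel_system
begin

text \<open>
  Picard iteration for the equation with absolute values. The iterates increase since the map is monotone and they start from zero.
\<close>

primrec maj :: "('i \<Rightarrow> real^3 \<Rightarrow> complex) \<Rightarrow> nat \<Rightarrow> 'i \<Rightarrow> ennreal path" where
  "maj d 0 = (\<lambda>k t \<xi>. 0)"
| "maj d (Suc n) = (\<lambda>k t \<xi>. ennreal (E k t 0 \<xi>) * ennreal (cmod (d k \<xi>)) + duhamel_abs k (Fm (maj d n) k) t \<xi>)"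

definition Maj :: "('i \<Rightarrow> real^3 \<Rightarrow> complex) \<Rightarrow> 'i \<Rightarrow> ennreal path" where
  "Maj d k t \<xi> = (SUP n. maj d n k t \<xi>)"

text \<open>
  The frequencies at which the majorant is integrable in time. At these all Duhamel integrals of the
  iterates converge absolutely, for all times simultaneously.
\<close>

definition good :: "('i \<Rightarrow> real^3 \<Rightarrow> complex) \<Rightarrow> real^3 \<Rightarrow> bool" where
  "good d \<xi> \<longleftrightarrow> (\<forall>k. tot (Fm (Maj d) k) \<xi> < \<infinity>)"

text \<open>
  Outside the good frequencies the iterates are put equal to zero. They then
  converge everywhere, which makes the limit measurable without completing the measure.
\<close>

primrec picard :: "('i \<Rightarrow> real^3 \<Rightarrow> complex) \<Rightarrow> nat \<Rightarrow> 'i \<Rightarrow> complex path" where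
  "picard d 0 = (\<lambda>k t \<xi>. 0)"
| "picard d (Suc n) = (\<lambda>k t \<xi>. if t \<in> {0..T} \<and> good d \<xi>
      then of_real (E k t 0 \<xi>) * d k \<xi> + duhamel k (F (picard d n) k) t \<xi> else 0)"

definition sol :: "('i \<Rightarrow> real^3 \<Rightarrow> complex) \<Rightarrow> 'i \<Rightarrow> complex path" where
  "sol d k t \<xi> = lim (\<lambda>n. picard d n k t \<xi>)"

context
  fixes d :: "'i \<Rightarrow> real^3 \<Rightarrow> complex"
  assumes d_meas [measurable]: "\<And>k. d k \<in> borel_measurable borel"
begin

lemma jmeas_maj: "jmeas (maj d n k)"
proof (induction n arbitrary: k)
  case (Suc n)
  have [measurable]: "jmeas (duhamel_abs k (Fm (maj d n) k))" by (intro jmeas_duhamel_abs jmeas_Fm Suc)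
  have [measurable]: "(\<lambda>z. E k (fst z) 0 (snd z)) \<in> borel_measurable (lborel \<Otimes>\<^sub>M lborel)"
    by (rule E_measurable; measurable)
  show ?case unfolding maj.simps by measurable
qed simp

lemma jmeas_Maj: "jmeas (Maj d k)"
proof -
  note [measurable] = jmeas_maj
  show ?thesis unfolding Maj_def by measurable
qed

lemma maj_mono: "maj d n k t \<xi> \<le> maj d (Suc n) k t \<xi>"
proof (induction n arbitrary: k t \<xi>)
  case (Suc n)
  then show ?case unfolding maj.simps(2) by (intro add_mono duhamel_abs_mono Fm_mono) auto
qed simp

lemma maj_le_Maj: "maj d n k t \<xi> \<le> Maj d k t \<xi>"
  unfolding Maj_def by (rule SUP_upper) simp

text \<open>
  The ball of radius \<open>R\<close> is preserved: the data use up \<open>R/2\<close>, the quadratic term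
  \<open>R/8\<close> and the linear term \<open>R/8\<close>.
\<close>

lemma maj_bounded:
  assumes R: "0 < R" and E0: "0 \<le> E0" "2 * E0 \<le> R" and dE: "\<And>k. X s (\<lambda>\<xi>. ennreal (cmod (d k \<xi>))) \<le> ennreal E0"
    and small: "real CARD('i) ^ 2 * C * (24 * R * T powr \<delta>) \<le> 1 / 8" "real CARD('i) * C * T \<le> 1 / 8"
  shows "bounded_by T s (\<gamma> k) (maj d n k) (ennreal R)"
proof (induction n arbitrary: k)
  case 0
  show ?case by (simp add: bounded_by_def X_def)
next
  case (Suc n)
  have "L1X T s (Fm (maj d n) k)
      \<le> ennreal (real CARD('i) ^ 2 * C * (24 * R * R * T powr \<delta>) + real CARD('i) * C * T * R)"
    by (rule integral_X_Fm[OF jmeas_maj R Suc.IH])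
  also have "\<dots> \<le> ennreal (R / 2)"
  proof (rule ennreal_leI)
    have "real CARD('i) ^ 2 * C * (24 * R * R * T powr \<delta>) = (real CARD('i) ^ 2 * C * (24 * R * T powr \<delta>)) * R" by simp
    then show "real CARD('i) ^ 2 * C * (24 * R * R * T powr \<delta>) + real CARD('i) * C * T * R \<le> R / 2"
      using mult_right_mono[OF small(1), of R] mult_right_mono[OF small(2), of R] R by linarith
  qed
  finally have "X s (\<lambda>\<xi>. ennreal (cmod (d k \<xi>))) + L1X T s (Fm (maj d n) k) \<le> ennreal E0 + ennreal (R / 2)"
    by (rule add_mono[OF dE])
  also have "\<dots> = ennreal (E0 + R / 2)" using E0 R by simp
  also have "\<dots> \<le> ennreal R" using E0 by (intro ennreal_leI) simp
  finally have le: "X s (\<lambda>\<xi>. ennreal (cmod (d k \<xi>))) + L1X T s (Fm (maj d n) k) \<le> ennreal R" .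
  show ?case unfolding maj.simps(2)
    by (rule bounded_by_mono[OF _ bounded_by_duhamel[OF _ jmeas_Fm[OF jmeas_maj]] le]) auto
qed

lemma Maj_bounded:
  assumes "0 < R" "0 \<le> E0" "2 * E0 \<le> R" "\<And>k. X s (\<lambda>\<xi>. ennreal (cmod (d k \<xi>))) \<le> ennreal E0"
    "real CARD('i) ^ 2 * C * (24 * R * T powr \<delta>) \<le> 1 / 8" "real CARD('i) * C * T \<le> 1 / 8"
  shows "bounded_by T s (\<gamma> k) (Maj d k) (ennreal R)"
proof -
  note b = maj_bounded[OF assms]
  note [measurable] = jmeas_maj
  have [measurable]: "maj d n k t \<in> borel_measurable borel" for n k t by (rule jmeas_section[OF jmeas_maj])
  have XM: "X r (Maj d k t) = (SUP n. X r (maj d n k t))" for r t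
  proof -
    have "X r (Maj d k t) = (\<integral>\<^sup>+\<xi>. (SUP n. W r \<xi> * maj d n k t \<xi>) \<partial>lborel)"
      unfolding X_def Maj_def by (simp add: SUP_mult_left_ennreal)
    also have "\<dots> = (SUP n. X r (maj d n k t))" unfolding X_def
      by (rule nn_integral_monotone_convergence_SUP)
        (auto simp: incseq_Suc_iff le_fun_def simp del: maj.simps intro!: mult_left_mono maj_mono)
    finally show ?thesis .
  qed
  have incX: "incseq (\<lambda>n. X r (maj d n k t))" for r t
    by (rule incseq_SucI) (rule X_mono[OF maj_mono])
  show ?thesis unfolding bounded_by_def
  proof (intro conjI ballI)
    show "X s (Maj d k t) \<le> ennreal R" if "t \<in> {0..T}" for t
      unfolding XM by (rule SUP_least) (use b that in \<open>auto simp: bounded_by_def\<close>)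
    have "L1X T (s + 2 * \<gamma> k) (Maj d k)
       = (\<integral>\<^sup>+t. (SUP n. indicator {0..T} t * X (s + 2 * \<gamma> k) (maj d n k t)) \<partial>lborel)"
      unfolding XM by (simp add: SUP_mult_left_ennreal)
    also have "\<dots> = (SUP n. \<integral>\<^sup>+t. indicator {0..T} t * X (s + 2 * \<gamma> k) (maj d n k t) \<partial>lborel)"
    proof (rule nn_integral_monotone_convergence_SUP)
      show "incseq (\<lambda>n t. indicator {0..T} t * X (s + 2 * \<gamma> k) (maj d n k t))"
        using incX by (auto simp: incseq_Suc_iff le_fun_def intro!: mult_left_mono)
    qed simp
    also have "\<dots> \<le> ennreal R" by (rule SUP_least) (use b in \<open>auto simp: bounded_by_def\<close>)
    finally show "L1X T (s + 2 * \<gamma> k) (Maj d k) \<le> ennreal R" .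
  qed
qed

lemma good_measurable [measurable]: "Measurable.pred borel (good d)"
proof -
  have [measurable]: "tot (Fm (Maj d) k) \<in> borel_measurable borel" for k
    by (intro tot_measurable jmeas_Fm jmeas_Maj)
  show ?thesis unfolding good_def[abs_def] by measurable
qed

lemma jmeas_picard: "jmeas (picard d n k)"
proof (induction n arbitrary: k)
  case (Suc n)
  have [measurable]: "jmeas (duhamel k (F (picard d n) k))" by (intro jmeas_duhamel jmeas_F Suc)
  have [measurable]: "(\<lambda>z. E k (fst z) 0 (snd z)) \<in> borel_measurable (lborel \<Otimes>\<^sub>M lborel)"
    by (rule E_measurable; measurable)
  show ?case unfolding picard.simps by measurable
qed simp

lemma jmeas_sol: "jmeas (sol d k)"
proof -
  note [measurable] = jmeas_picard
  show ?thesis unfolding sol_def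
    by (simp only: case_prod_beta') (rule borel_measurable_lim_metric, measurable)
qed

text \<open>
  The increments of the complex iteration are bounded by the increments of the majorant. In
  \<open>[0, \<infinity>]\<close> the latter cannot be written as differences, hence the additive form. The
  inductive step for a product is
  \<open>\<bar>u u' - v v'\<bar> + m m' \<le> (\<bar>u - v\<bar> + m) M' \<le> M M'\<close>, where \<open>m\<close>, \<open>m'\<close> are the old and \<open>M\<close>, \<open>M'\<close> the new majorants
  of the two factors.
\<close>

lemma picard_majorised:
  "ennreal (cmod (picard d (Suc n) k t \<xi> - picard d n k t \<xi>)) + maj d n k t \<xi> \<le> maj d (Suc n) k t \<xi> \<and> nrm (picard d n) k t \<xi> \<le> maj d n k t \<xi>"
proof (induction n arbitrary: k t \<xi>)
  case 0
  have "F (\<lambda>k t \<xi>. 0) k = (\<lambda>\<tau> \<xi>. 0)" by (simp add: F_def Defs.convolution_def fun_eq_iff)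
  then show ?case by (auto simp: nrm_def duhamel_def ennreal_norm_mult E_nonneg)
next
  case (Suc n)
  note IH1 = Suc.IH[THEN conjunct1] and IH2 = Suc.IH[THEN conjunct2]
  have n2: "nrm (picard d (Suc n)) k t \<xi> \<le> maj d (Suc n) k t \<xi>" for k t \<xi>
  proof -
    have "nrm (picard d (Suc n)) k t \<xi> \<le> ennreal (cmod (picard d (Suc n) k t \<xi> - picard d n k t \<xi>)) + nrm (picard d n) k t \<xi>"
      using ennreal_norm_add_le[of "picard d (Suc n) k t \<xi> - picard d n k t \<xi>" "picard d n k t \<xi>"] by (simp add: nrm_def del: picard.simps)
    also have "\<dots> \<le> ennreal (cmod (picard d (Suc n) k t \<xi> - picard d n k t \<xi>)) + maj d n k t \<xi>" by (intro add_mono IH2) auto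
    also have "\<dots> \<le> maj d (Suc n) k t \<xi>" by (rule IH1)
    finally show ?thesis .
  qed
  moreover have "ennreal (cmod (picard d (Suc (Suc n)) k t \<xi> - picard d (Suc n) k t \<xi>)) + maj d (Suc n) k t \<xi> \<le> maj d (Suc (Suc n)) k t \<xi>"
  proof (cases "t \<in> {0..T} \<and> good d \<xi>")
    case False
    then show ?thesis using maj_mono[of "Suc n"] by auto
  next
    case True
    have fin: "tot (Fm (nrm (picard d j)) k) \<xi> < \<infinity>" if "\<And>k t \<xi>. nrm (picard d j) k t \<xi> \<le> maj d j k t \<xi>" for j
    proof -
      have "tot (Fm (nrm (picard d j)) k) \<xi> \<le> tot (Fm (Maj d) k) \<xi>"
        by (intro tot_mono Fm_mono order_trans[OF that maj_le_Maj])
      then show ?thesis using True by (auto simp: good_def intro: le_less_trans)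
    qed
    let ?U = "picard d (Suc n)" and ?V = "picard d n" and ?m = "maj d n" and ?m' = "maj d (Suc n)"
    have Fd: "Fd ?U ?V k \<tau> \<xi> + Fm ?m k \<tau> \<xi> \<le> Fm ?m' k \<tau> \<xi>" for \<tau>
    proof -
      have [measurable]: "?U l \<tau> \<in> borel_measurable borel" "?V l \<tau> \<in> borel_measurable borel"
        "?m l \<tau> \<in> borel_measurable borel" "?m' l \<tau> \<in> borel_measurable borel" for l
        by (rule jmeas_section[OF jmeas_picard] jmeas_section[OF jmeas_maj])+
      have "dconv ?U ?V l m \<tau> \<xi> + nconv (?m l \<tau>) (?m m \<tau>) \<xi>
         \<le> nconv (?m' l \<tau>) (?m' m \<tau>) \<xi>" for l m
      proof -
        have "dconv ?U ?V l m \<tau> \<xi> + nconv (?m l \<tau>) (?m m \<tau>) \<xi>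
          = (\<integral>\<^sup>+\<eta>. ennreal (cmod (?U l \<tau> (\<xi> - \<eta>) * ?U m \<tau> \<eta> - ?V l \<tau> (\<xi> - \<eta>) * ?V m \<tau> \<eta>)) + ?m l \<tau> (\<xi> - \<eta>) * ?m m \<tau> \<eta> \<partial>lborel)"
          unfolding nconv_def by (rule nn_integral_add[symmetric]) measurable
        also have "\<dots> \<le> nconv (?m' l \<tau>) (?m' m \<tau>) \<xi>"
          unfolding nconv_def
        proof (rule nn_integral_mono)
          fix \<eta>
          let ?x = "\<xi> - \<eta>"
          let ?du = "ennreal (cmod (?U l \<tau> ?x - ?V l \<tau> ?x))" and ?dv = "ennreal (cmod (?U m \<tau> \<eta> - ?V m \<tau> \<eta>))"
          have "ennreal (cmod (?U l \<tau> ?x * ?U m \<tau> \<eta> - ?V l \<tau> ?x * ?V m \<tau> \<eta>)) + ?m l \<tau> ?x * ?m m \<tau> \<eta>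
             \<le> ?du * ?m' m \<tau> \<eta> + ?m l \<tau> ?x * ?dv + ?m l \<tau> ?x * ?m m \<tau> \<eta>"
            using n2[of m \<tau> \<eta>] IH2[of l \<tau> ?x]
            by (intro add_mono order_trans[OF product_diff_le] mult_mono) (auto simp: nrm_def simp del: picard.simps maj.simps)
          also have "\<dots> = ?du * ?m' m \<tau> \<eta> + ?m l \<tau> ?x * (?dv + ?m m \<tau> \<eta>)" by (simp add: distrib_left add.assoc del: picard.simps maj.simps)
          also have "\<dots> \<le> ?du * ?m' m \<tau> \<eta> + ?m l \<tau> ?x * ?m' m \<tau> \<eta>"
            by (intro add_mono mult_left_mono IH1) auto
          also have "\<dots> = (?du + ?m l \<tau> ?x) * ?m' m \<tau> \<eta>" by (simp add: distrib_right del: picard.simps maj.simps)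
          also have "\<dots> \<le> ?m' l \<tau> ?x * ?m' m \<tau> \<eta>" by (intro mult_right_mono IH1) auto
          finally show "ennreal (cmod (?U l \<tau> ?x * ?U m \<tau> \<eta> - ?V l \<tau> ?x * ?V m \<tau> \<eta>)) + ?m l \<tau> ?x * ?m m \<tau> \<eta> \<le> ?m' l \<tau> ?x * ?m' m \<tau> \<eta>" .
        qed
        finally show ?thesis .
      qed
      then have "(\<Sum>l\<in>UNIV. \<Sum>m\<in>UNIV. ennreal (cmod (A k l m \<xi>)) *
           (dconv ?U ?V l m \<tau> \<xi> + nconv (?m l \<tau>) (?m m \<tau>) \<xi>))
         + (\<Sum>l\<in>UNIV. ennreal (cmod (B k l \<xi>)) * (ennreal (cmod (?U l \<tau> \<xi> - ?V l \<tau> \<xi>)) + ?m l \<tau> \<xi>)) \<le> Fm ?m' k \<tau> \<xi>"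
        unfolding Fm_def G_def L_def by (intro add_mono sum_mono mult_left_mono IH1) auto
      moreover have "Fd ?U ?V k \<tau> \<xi> + Fm ?m k \<tau> \<xi> = (\<Sum>l\<in>UNIV. \<Sum>m\<in>UNIV. ennreal (cmod (A k l m \<xi>)) *
           (dconv ?U ?V l m \<tau> \<xi> + nconv (?m l \<tau>) (?m m \<tau>) \<xi>))
         + (\<Sum>l\<in>UNIV. ennreal (cmod (B k l \<xi>)) * (ennreal (cmod (?U l \<tau> \<xi> - ?V l \<tau> \<xi>)) + ?m l \<tau> \<xi>))"
        unfolding Fd_def Fm_def G_def L_def by (simp add: distrib_left sum.distrib add_ac del: picard.simps maj.simps)
      ultimately show ?thesis by (simp only:)
    qed
    have "ennreal (cmod (picard d (Suc (Suc n)) k t \<xi> - picard d (Suc n) k t \<xi>)) = ennreal (cmod (duhamel k (F ?U k) t \<xi> - duhamel k (F ?V k) t \<xi>))"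
      using True picard.simps(2)[of d "Suc n"] picard.simps(2)[of d n] by (simp del: picard.simps)
    also have "\<dots> \<le> duhamel_abs k (Fd ?U ?V k) t \<xi>"
      using True by (intro duhamel_diff_le jmeas_picard fin n2 IH2) auto
    finally have "ennreal (cmod (picard d (Suc (Suc n)) k t \<xi> - picard d (Suc n) k t \<xi>)) + maj d (Suc n) k t \<xi>
       \<le> duhamel_abs k (Fd ?U ?V k) t \<xi> + (ennreal (E k t 0 \<xi>) * ennreal (cmod (d k \<xi>)) + duhamel_abs k (Fm ?m k) t \<xi>)"
      unfolding maj.simps(2)[of d n] by (rule add_right_mono)
    also have "\<dots> = ennreal (E k t 0 \<xi>) * ennreal (cmod (d k \<xi>)) + duhamel_abs k (\<lambda>\<tau> \<xi>. Fd ?U ?V k \<tau> \<xi> + Fm ?m k \<tau> \<xi>) t \<xi>"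
      by (subst duhamel_abs_add[OF jmeas_Fd[OF jmeas_picard jmeas_picard] jmeas_Fm[OF jmeas_maj]]) (simp only: add_ac)
    also have "\<dots> \<le> maj d (Suc (Suc n)) k t \<xi>"
      unfolding maj.simps(2)[of d "Suc n"] by (intro add_left_mono duhamel_abs_mono Fd)
    finally show ?thesis .
  qed
  ultimately show ?case by blast
qed

lemma picard_le_Maj: "nrm (picard d n) k t \<xi> \<le> Maj d k t \<xi>"
  using picard_majorised maj_le_Maj order_trans by blast

lemma Maj_finite:
  assumes "good d \<xi>" "t \<in> {0..T}" shows "Maj d k t \<xi> < \<infinity>"
proof -
  have "maj d n k t \<xi> \<le> ennreal (cmod (d k \<xi>)) + tot (Fm (Maj d) k) \<xi>" for n
  proof (cases n)
    case (Suc j)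
    have "ennreal (E k t 0 \<xi>) * ennreal (cmod (d k \<xi>)) \<le> 1 * ennreal (cmod (d k \<xi>))"
      by (intro mult_right_mono) (auto simp: ennreal_le_1 E_le_1)
    moreover have "duhamel_abs k (Fm (maj d j) k) t \<xi> \<le> tot (Fm (Maj d) k) \<xi>"
      using assms by (intro order_trans[OF duhamel_abs_le_tot tot_mono] Fm_mono maj_le_Maj) auto
    ultimately show ?thesis unfolding Suc maj.simps(2) by (intro add_mono) auto
  qed simp
  then have "Maj d k t \<xi> \<le> ennreal (cmod (d k \<xi>)) + tot (Fm (Maj d) k) \<xi>" unfolding Maj_def by (intro SUP_least)
  also have "\<dots> < \<infinity>" using assms by (simp add: good_def less_top[symmetric])
  finally show ?thesis .
qed

text \<open>
  At a good frequency the increments sum to at most the finite value of \<open>Maj\<close>.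
\<close>

lemma picard_tendsto: "(\<lambda>n. picard d n k t \<xi>) \<longlonglongrightarrow> sol d k t \<xi>"
proof -
  have "convergent (\<lambda>n. picard d n k t \<xi>)"
  proof (cases "t \<in> {0..T} \<and> good d \<xi>")
    case False
    then have "picard d n k t \<xi> = 0" for n by (cases n) auto
    then show ?thesis by (simp add: convergent_const)
  next
    case True
    then obtain r where r: "Maj d k t \<xi> = ennreal r" "0 \<le> r" using Maj_finite by (metis ennreal_cases infinity_ennreal_def less_irrefl)
    have part: "(\<Sum>i<n. ennreal (cmod (picard d (Suc i) k t \<xi> - picard d i k t \<xi>))) \<le> maj d n k t \<xi>" for n
    proof (induction n)
      case (Suc n)
      have "(\<Sum>i<Suc n. ennreal (cmod (picard d (Suc i) k t \<xi> - picard d i k t \<xi>))) \<le>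
        ennreal (cmod (picard d (Suc n) k t \<xi> - picard d n k t \<xi>)) + maj d n k t \<xi>"
        using Suc by (simp add: add.commute del: picard.simps maj.simps)
      also have "\<dots> \<le> maj d (Suc n) k t \<xi>" using picard_majorised by blast
      finally show ?case .
    qed simp
    have "(\<Sum>i<n. ennreal (cmod (picard d (Suc i) k t \<xi> - picard d i k t \<xi>))) \<le> ennreal r" for n
      using order_trans[OF part maj_le_Maj[of n k t \<xi>]] unfolding r(1) .
    then have le: "(\<Sum>i<n. cmod (picard d (Suc i) k t \<xi> - picard d i k t \<xi>)) \<le> r" for n
      using r(2) by (subst (asm) sum_ennreal) (simp_all only: ennreal_le_iff norm_ge_zero)
    have "summable (\<lambda>i. cmod (picard d (Suc i) k t \<xi> - picard d i k t \<xi>))"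
    proof (rule bounded_imp_summable)
      show "(\<Sum>i\<le>n. cmod (picard d (Suc i) k t \<xi> - picard d i k t \<xi>)) \<le> r" for n
        using le[of "Suc n"] by (simp only: lessThan_Suc_atMost)
    qed simp
    then have "summable (\<lambda>i. picard d (Suc i) k t \<xi> - picard d i k t \<xi>)" by (rule summable_norm_cancel)
    then have "convergent (\<lambda>n. \<Sum>i<n. picard d (Suc i) k t \<xi> - picard d i k t \<xi>)" by (simp add: summable_iff_convergent)
    then have "convergent (\<lambda>n. picard d n k t \<xi> - picard d 0 k t \<xi>)" by (simp only: sum_lessThan_telescope[of "\<lambda>n. picard d n k t \<xi>"])
    then show ?thesis by simp
  qed
  then show ?thesis unfolding sol_def by (simp add: convergent_LIMSEQ_iff)
qed

lemma sol_le_Maj: "nrm (sol d) k t \<xi> \<le> Maj d k t \<xi>"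
  unfolding nrm_def
  by (rule LIMSEQ_le_const2[OF tendsto_ennrealI[OF tendsto_norm[OF picard_tendsto]]])
    (use picard_le_Maj in \<open>auto simp: nrm_def\<close>)

text \<open>
  Passage to the limit in the Picard iteration, by dominated convergence first in the convolution
  integrals and then in the time integral, with the integrands of the majorant as dominating functions.
\<close>

lemma sol_equation:
  assumes g: "good d \<xi>" and t: "t \<in> {0..T}"
  shows "sol d k t \<xi> = rhs (sol d) d k t \<xi>"
proof -
  have fin: "tot (Fm (Maj d) k) \<xi> < \<infinity>" using g by (simp add: good_def)
  have limF: "(\<lambda>n. F (picard d n) k \<tau> \<xi>) \<longlonglongrightarrow> F (sol d) k \<tau> \<xi>" if f: "Fm (Maj d) k \<tau> \<xi> < \<infinity>" for \<tau>
  proof -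
    have conv: "(\<lambda>n. A k l m \<xi> * Defs.convolution (picard d n l \<tau>) (picard d n m \<tau>) \<xi>) \<longlonglongrightarrow> A k l m \<xi> * Defs.convolution (sol d l \<tau>) (sol d m \<tau>) \<xi>" for l m
    proof (cases "A k l m \<xi> = 0")
      case False
      have [measurable]: "picard d n l \<tau> \<in> borel_measurable borel" "sol d l \<tau> \<in> borel_measurable borel" "Maj d l \<tau> \<in> borel_measurable borel" for n l
        by (rule jmeas_section[OF jmeas_picard] jmeas_section[OF jmeas_sol] jmeas_section[OF jmeas_Maj])+
      have "(\<lambda>n. Defs.convolution (picard d n l \<tau>) (picard d n m \<tau>) \<xi>) \<longlonglongrightarrow> Defs.convolution (sol d l \<tau>) (sol d m \<tau>) \<xi>"
        unfolding Defs.convolution_def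
      proof (rule dominated_convergence_ennreal[where w = "\<lambda>\<eta>. Maj d l \<tau> (\<xi> - \<eta>) * Maj d m \<tau> \<eta>"])
        show "(\<integral>\<^sup>+\<eta>. Maj d l \<tau> (\<xi> - \<eta>) * Maj d m \<tau> \<eta> \<partial>lborel) < \<infinity>"
          using Fm_finite_nconv[OF f False] by (simp add: nconv_def)
        show "AE \<eta> in lborel. ennreal (norm (picard d n l \<tau> (\<xi> - \<eta>) * picard d n m \<tau> \<eta>)) \<le> Maj d l \<tau> (\<xi> - \<eta>) * Maj d m \<tau> \<eta>" for n
          unfolding ennreal_norm_mult using picard_le_Maj by (intro AE_I2 mult_mono) (auto simp: nrm_def)
        show "AE \<eta> in lborel. (\<lambda>n. picard d n l \<tau> (\<xi> - \<eta>) * picard d n m \<tau> \<eta>) \<longlonglongrightarrow> sol d l \<tau> (\<xi> - \<eta>) * sol d m \<tau> \<eta>"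
          by (intro AE_I2 tendsto_mult picard_tendsto)
      qed measurable
      then show ?thesis by (intro tendsto_mult tendsto_const)
    qed simp
    show ?thesis unfolding F_def
      by (rule tendsto_add tendsto_sum conv tendsto_mult[OF tendsto_const picard_tendsto])+
  qed
  have FleM: "ennreal (cmod (F (picard d n) k \<tau> \<xi>)) \<le> Fm (Maj d) k \<tau> \<xi>" for n \<tau>
    by (rule order_trans[OF F_le_Fm Fm_mono[OF picard_le_Maj]])
  have "(\<lambda>n. duhamel k (F (picard d n) k) t \<xi>) \<longlonglongrightarrow> duhamel k (F (sol d) k) t \<xi>"
    unfolding duhamel_def
  proof (rule dominated_convergence_ennreal[where w = "\<lambda>\<tau>. ennreal (E k t \<tau> \<xi>) * Fm (Maj d) k \<tau> \<xi>"])
    have [measurable]: "(\<lambda>\<tau>. F (picard d n) k \<tau> \<xi>) \<in> borel_measurable borel" "(\<lambda>\<tau>. F (sol d) k \<tau> \<xi>) \<in> borel_measurable borel"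
       "(\<lambda>\<tau>. E k t \<tau> \<xi>) \<in> borel_measurable borel" "(\<lambda>\<tau>. Fm (Maj d) k \<tau> \<xi>) \<in> borel_measurable borel" for n
      by (rule jmeas_section2[OF jmeas_F[OF jmeas_picard]] jmeas_section2[OF jmeas_F[OF jmeas_sol]] E_measurable jmeas_section2[OF jmeas_Fm[OF jmeas_Maj]]; measurable?)+
    show "(\<lambda>\<tau>. of_real (E k t \<tau> \<xi>) * F (picard d n) k \<tau> \<xi>) \<in> borel_measurable lborel" for n by measurable
    show "(\<lambda>\<tau>. of_real (E k t \<tau> \<xi>) * F (sol d) k \<tau> \<xi>) \<in> borel_measurable lborel" by measurable
    show "(\<lambda>\<tau>. ennreal (E k t \<tau> \<xi>) * Fm (Maj d) k \<tau> \<xi>) \<in> borel_measurable lborel" by measurable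
    show "AE \<tau> in lborel. ennreal (norm (of_real (E k t \<tau> \<xi>) * F (picard d n) k \<tau> \<xi>)) \<le> ennreal (E k t \<tau> \<xi>) * Fm (Maj d) k \<tau> \<xi>" for n
      unfolding ennreal_norm_mult using FleM by (intro AE_I2) (simp add: E_nonneg mult_left_mono)
    show "(\<integral>\<^sup>+\<tau>. ennreal (E k t \<tau> \<xi>) * Fm (Maj d) k \<tau> \<xi> \<partial>lborel) < \<infinity>"
      using duhamel_abs_le_tot[of t k "Fm (Maj d) k" \<xi>] t fin by (auto simp: duhamel_abs_def intro: le_less_trans)
    show "AE \<tau> in lborel. (\<lambda>n. of_real (E k t \<tau> \<xi>) * F (picard d n) k \<tau> \<xi>) \<longlonglongrightarrow> of_real (E k t \<tau> \<xi>) * F (sol d) k \<tau> \<xi>"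
      using Fm_finite_AE[OF jmeas_Maj fin]
    proof eventually_elim
      fix \<tau> assume *: "\<tau> \<in> {0..T} \<longrightarrow> Fm (Maj d) k \<tau> \<xi> < \<infinity>"
      show "(\<lambda>n. of_real (E k t \<tau> \<xi>) * F (picard d n) k \<tau> \<xi>) \<longlonglongrightarrow> of_real (E k t \<tau> \<xi>) * F (sol d) k \<tau> \<xi>"
      proof (cases "\<tau> \<in> {0..T}")
        case True
        then show ?thesis using * by (intro tendsto_mult tendsto_const limF) auto
      next
        case False
        then have "E k t \<tau> \<xi> = 0" using t by (auto simp: E_def)
        then show ?thesis by simp
      qed
    qed
  qed
  then have "(\<lambda>n. of_real (E k t 0 \<xi>) * d k \<xi> + duhamel k (F (picard d n) k) t \<xi>) \<longlonglongrightarrow> rhs (sol d) d k t \<xi>"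
    by (intro tendsto_intros)
  moreover have "(\<lambda>n. of_real (E k t 0 \<xi>) * d k \<xi> + duhamel k (F (picard d n) k) t \<xi>) = (\<lambda>n. picard d (Suc n) k t \<xi>)"
    using g t by simp
  ultimately show ?thesis using LIMSEQ_Suc[OF picard_tendsto[of k t \<xi>]] LIMSEQ_unique by metis
qed

text \<open>
  The solution is controlled by the data: any radius between \<open>2 E0\<close> and \<open>R\<close> is admissible in the estimate for the majorant. For
  zero data \<open>2 E0\<close> is not a positive radius and is approached by positive ones.
\<close>

theorem sol_exists:
  assumes R: "0 < R" and E0: "0 \<le> E0" "2 * E0 \<le> R" and dE: "\<And>k. X s (\<lambda>\<xi>. ennreal (cmod (d k \<xi>))) \<le> ennreal E0"
    and small: "real CARD('i) ^ 2 * C * (24 * R * T powr \<delta>) \<le> 1 / 8" "real CARD('i) * C * T \<le> 1 / 8"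
  shows "solves (sol d) d" and "bounded_by T s (\<gamma> k) (nrm (sol d) k) (ennreal (2 * E0))"
proof -
  have b: "bounded_by T s (\<gamma> k) (nrm (sol d) k) (ennreal R')" if "0 < R'" "2 * E0 \<le> R'" "R' \<le> R" for R' k
  proof (rule bounded_by_mono[OF _ Maj_bounded[OF that(1) E0(1) that(2) dE _ small(2)] order_refl])
    have "real CARD('i) ^ 2 * C * (24 * R' * T powr \<delta>) \<le> real CARD('i) ^ 2 * C * (24 * R * T powr \<delta>)"
      using that C by (intro mult_left_mono mult_right_mono) auto
    then show "real CARD('i) ^ 2 * C * (24 * R' * T powr \<delta>) \<le> 1 / 8" using small(1) by linarith
  qed (use sol_le_Maj in auto)
  show "bounded_by T s (\<gamma> k) (nrm (sol d) k) (ennreal (2 * E0))"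
  proof (cases "E0 = 0")
    case False
    then show ?thesis using b[of "2 * E0"] E0 by auto
  next
    case True
    have lim: "(\<lambda>n. ennreal (R / real (Suc n))) \<longlonglongrightarrow> ennreal 0"
      by (intro tendsto_ennrealI) real_asymp
    have bn: "bounded_by T s (\<gamma> k) (nrm (sol d) k) (ennreal (R / real (Suc n)))" for n
      by (rule b) (use R True in \<open>auto simp: field_simps\<close>)
    have "Y \<le> ennreal 0" if "\<And>n. Y \<le> ennreal (R / real (Suc n))" for Y
      by (rule LIMSEQ_le_const[OF lim]) (use that in blast)
    then show ?thesis using bn True unfolding bounded_by_def by simp
  qed
  have ae: "AE \<xi> in lborel. good d \<xi>"
  proof -
    have "AE \<xi> in lborel. tot (Fm (Maj d) k) \<xi> < \<infinity>" for k
      by (rule tot_Fm_finite_AE[OF jmeas_Maj R Maj_bounded[OF R E0 dE small]])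
    then show ?thesis unfolding good_def by (subst AE_all_countable) blast
  qed
  show "solves (sol d) d"
    unfolding solves_def
  proof (intro ballI allI)
    fix t k assume "t \<in> {0..T}"
    show "AE \<xi> in lborel. sol d k t \<xi> = rhs (sol d) d k t \<xi>"
      using ae by eventually_elim (rule sol_equation[OF _ \<open>t \<in> {0..T}\<close>])
  qed
qed

end

section \<open>Continuity in time\<close>

lemma E_tendsto:
  assumes "\<tau> \<noteq> t" "u \<longlonglongrightarrow> t"
  shows "(\<lambda>n. E k (u n) \<tau> \<xi>) \<longlonglongrightarrow> E k t \<tau> \<xi>"
proof (cases "\<tau> < t")
  case True
  have "eventually (\<lambda>n. \<tau> < u n) sequentially" using order_tendstoD(1)[OF assms(2) True] .
  then have ev: "eventually (\<lambda>n. (if 0 \<le> \<tau> then exp (- (u n - \<tau>) * norm \<xi> powr (2 * \<gamma> k)) else 0) = E k (u n) \<tau> \<xi>) sequentially"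
    by eventually_elim (auto simp: E_def)
  have "(\<lambda>n. if 0 \<le> \<tau> then exp (- (u n - \<tau>) * norm \<xi> powr (2 * \<gamma> k)) else 0) \<longlonglongrightarrow> (if 0 \<le> \<tau> then exp (- (t - \<tau>) * norm \<xi> powr (2 * \<gamma> k)) else 0)"
    using assms(2) by (cases "0 \<le> \<tau>") (auto intro!: tendsto_intros)
  then show ?thesis using True by (intro Lim_transform_eventually[OF _ ev]) (auto simp: E_def)
next
  case False
  then have lt: "t < \<tau>" using assms(1) by simp
  have "eventually (\<lambda>n. u n < \<tau>) sequentially" using order_tendstoD(2)[OF assms(2) lt] .
  then have ev: "eventually (\<lambda>n. 0 = E k (u n) \<tau> \<xi>) sequentially"
    by eventually_elim (auto simp: E_def)
  show ?thesis using lt by (intro Lim_transform_eventually[OF _ ev]) (auto simp: E_def)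
qed

text \<open>
  At each frequency the Duhamel formula is continuous in time, and it is dominated by
  \<open>\<bar>d\<bar> + \<integral> Fm\<close>, uniformly in time. This dominating function has finite norm.
\<close>

lemma solves_continuous:
  assumes U: "\<And>l. jmeas (U l)" and R: "0 < R" and bU: "\<And>l. bounded_by T s (\<gamma> l) (nrm U l) (ennreal R)"
    and d: "d k \<in> borel_measurable borel" "X s (\<lambda>\<xi>. ennreal (cmod (d k \<xi>))) < \<infinity>" and sol: "solves U d" and t: "t \<in> {0..T}"
  shows "((\<lambda>\<tau>. X s (\<lambda>\<xi>. ennreal (cmod (U k \<tau> \<xi> - U k t \<xi>)))) \<longlongrightarrow> 0) (at t within {0..T})"
  unfolding tendsto_at_iff_sequentially comp_def
proof (intro allI impI)
  fix u :: "nat \<Rightarrow> real" assume u: "\<forall>i. u i \<in> {0..T} - {t}" "u \<longlonglongrightarrow> t"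
  note [measurable] = d(1)
  have jF: "jmeas (Fm (nrm U) k)" by (intro jmeas_Fm jmeas_nrm U)
  have [measurable]: "U k r \<in> borel_measurable borel" for r by (rule jmeas_section[OF U])
  have [measurable]: "tot (Fm (nrm U) k) \<in> borel_measurable borel" by (rule tot_measurable[OF jF])
  let ?H = "\<lambda>\<xi>. ennreal (cmod (d k \<xi>)) + tot (Fm (nrm U) k) \<xi>"
  have H: "X s ?H < \<infinity>"
  proof -
    have "X s (tot (Fm (nrm U) k)) < \<infinity>"
      unfolding X_tot[OF jF] by (rule le_less_trans[OF integral_X_Fm[OF jmeas_nrm[OF U] R bU]]) simp
    then show ?thesis using d by (simp add: X_add less_top[symmetric])
  qed
  have fin: "AE \<xi> in lborel. tot (Fm (nrm U) k) \<xi> < \<infinity>" by (rule tot_Fm_finite_AE[OF jmeas_nrm[OF U] R bU])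
  \<comment> \<open>the right-hand side of the equation, defined at all times for each frequency, whereas \<open>U k r\<close> agrees with it
    only up to a null set depending on \<open>r\<close>\<close>
  define Y where "Y r \<xi> = rhs U d k r \<xi>" for r \<xi>
  have Yle: "ennreal (cmod (Y r \<xi>)) \<le> ?H \<xi>" if "r \<le> T" for r \<xi>
  proof -
    have "ennreal (cmod (duhamel k (F U k) r \<xi>)) \<le> duhamel_abs k (Fm (nrm U) k) r \<xi>"
      unfolding duhamel_def duhamel_abs_def
      by (intro order_trans[OF ennreal_norm_integral_le] nn_integral_mono)
        (simp add: ennreal_norm_mult E_nonneg mult_left_mono F_le_Fm)
    also have "\<dots> \<le> tot (Fm (nrm U) k) \<xi>" by (rule duhamel_abs_le_tot[OF that])
    finally have 1: "ennreal (cmod (duhamel k (F U k) r \<xi>)) \<le> tot (Fm (nrm U) k) \<xi>" .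
    have "ennreal (cmod (of_real (E k r 0 \<xi>) * d k \<xi>)) \<le> 1 * ennreal (cmod (d k \<xi>))"
      unfolding ennreal_norm_mult by (intro mult_right_mono) (auto simp: E_nonneg E_le_1 ennreal_le_1)
    then show ?thesis unfolding Y_def using 1
      by (intro order_trans[OF ennreal_norm_add_le] add_mono) auto
  qed
  have Ylim: "(\<lambda>n. Y (u n) \<xi>) \<longlonglongrightarrow> Y t \<xi>" if f: "tot (Fm (nrm U) k) \<xi> < \<infinity>" for \<xi>
  proof -
    have "(\<lambda>n. duhamel k (F U k) (u n) \<xi>) \<longlonglongrightarrow> duhamel k (F U k) t \<xi>"
      unfolding duhamel_def
    proof (rule dominated_convergence_ennreal[where w = "\<lambda>\<tau>. indicator {0..T} \<tau> * Fm (nrm U) k \<tau> \<xi>"])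
      have [measurable]: "(\<lambda>\<tau>. F U k \<tau> \<xi>) \<in> borel_measurable borel"
         "(\<lambda>\<tau>. E k r \<tau> \<xi>) \<in> borel_measurable borel" "(\<lambda>\<tau>. Fm (nrm U) k \<tau> \<xi>) \<in> borel_measurable borel" for r
        by (rule jmeas_section2[OF jmeas_F[OF U]] E_measurable jmeas_section2[OF jF]; measurable?)+
      show "(\<lambda>\<tau>. of_real (E k (u n) \<tau> \<xi>) * F U k \<tau> \<xi>) \<in> borel_measurable lborel" for n by measurable
      show "(\<lambda>\<tau>. of_real (E k t \<tau> \<xi>) * F U k \<tau> \<xi>) \<in> borel_measurable lborel" by measurable
      show "(\<lambda>\<tau>. indicator {0..T} \<tau> * Fm (nrm U) k \<tau> \<xi>) \<in> borel_measurable lborel" by measurable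
      show "(\<integral>\<^sup>+\<tau>. indicator {0..T} \<tau> * Fm (nrm U) k \<tau> \<xi> \<partial>lborel) < \<infinity>" using f by (simp add: tot_def)
      show "AE \<tau> in lborel. ennreal (norm (of_real (E k (u n) \<tau> \<xi>) * F U k \<tau> \<xi>)) \<le> indicator {0..T} \<tau> * Fm (nrm U) k \<tau> \<xi>" for n
      proof (rule AE_I2)
        fix \<tau>
        have un: "u n \<le> T" using u(1) by auto
        have "ennreal (E k (u n) \<tau> \<xi>) \<le> indicator {0..T} \<tau>"
          using un E_le_1[of k "u n" \<tau> \<xi>] by (auto simp: E_def indicator_def ennreal_le_1 split: if_splits)
        then show "ennreal (norm (of_real (E k (u n) \<tau> \<xi>) * F U k \<tau> \<xi>)) \<le> indicator {0..T} \<tau> * Fm (nrm U) k \<tau> \<xi>"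
          unfolding ennreal_norm_mult by (intro mult_mono F_le_Fm) (auto simp: E_nonneg)
      qed
      show "AE \<tau> in lborel. (\<lambda>n. of_real (E k (u n) \<tau> \<xi>) * F U k \<tau> \<xi>) \<longlonglongrightarrow> of_real (E k t \<tau> \<xi>) * F U k \<tau> \<xi>"
        using AE_lborel_singleton[of t]
        by eventually_elim (intro tendsto_mult tendsto_of_real tendsto_const E_tendsto u(2))
    qed
    moreover have "(\<lambda>n. E k (u n) 0 \<xi>) \<longlonglongrightarrow> E k t 0 \<xi>"
    proof -
      have "E k r 0 \<xi> = exp (- r * norm \<xi> powr (2 * \<gamma> k))" if "0 \<le> r" for r using that by (simp add: E_def)
      then show ?thesis using u t by (auto intro!: tendsto_intros)
    qed
    ultimately show ?thesis unfolding Y_def by (intro tendsto_intros)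
  qed
  have eqs: "AE \<xi> in lborel. \<forall>n. U k (u n) \<xi> = Y (u n) \<xi>" "AE \<xi> in lborel. U k t \<xi> = Y t \<xi>"
    using sol u(1) t unfolding solves_def Y_def by (auto simp: AE_all_countable)
  have "(\<lambda>n. \<integral>\<^sup>+\<xi>. W s \<xi> * ennreal (cmod (U k (u n) \<xi> - U k t \<xi>)) \<partial>lborel) \<longlonglongrightarrow> (\<integral>\<^sup>+\<xi>. 0 \<partial>(lborel :: (real^3) measure))"
  proof (rule nn_integral_dominated_convergence[where w = "\<lambda>\<xi>. 2 * (W s \<xi> * ?H \<xi>)"])
    show "(\<integral>\<^sup>+\<xi>. 2 * (W s \<xi> * ?H \<xi>) \<partial>lborel) < \<infinity>"
      using H unfolding X_def by (subst nn_integral_cmult) (auto simp: ennreal_mult_less_top)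
    show "AE \<xi> in lborel. W s \<xi> * ennreal (cmod (U k (u n) \<xi> - U k t \<xi>)) \<le> 2 * (W s \<xi> * ?H \<xi>)" for n
      using eqs
    proof eventually_elim
      fix \<xi> assume *: "\<forall>n. U k (u n) \<xi> = Y (u n) \<xi>" "U k t \<xi> = Y t \<xi>"
      have "ennreal (cmod (Y (u n) \<xi> - Y t \<xi>)) \<le> ennreal (cmod (Y (u n) \<xi>)) + ennreal (cmod (Y t \<xi>))"
        using ennreal_norm_add_le[of "Y (u n) \<xi>" "- Y t \<xi>"] by simp
      also have "\<dots> \<le> ?H \<xi> + ?H \<xi>" using u(1) t by (intro add_mono Yle) auto
      finally have "W s \<xi> * ennreal (cmod (U k (u n) \<xi> - U k t \<xi>)) \<le> W s \<xi> * (?H \<xi> + ?H \<xi>)"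
        using * by (intro mult_left_mono) auto
      then show "W s \<xi> * ennreal (cmod (U k (u n) \<xi> - U k t \<xi>)) \<le> 2 * (W s \<xi> * ?H \<xi>)"
        unfolding mult_2 distrib_left[of _ "?H \<xi>" "?H \<xi>"] .
    qed
    show "AE \<xi> in lborel. (\<lambda>n. W s \<xi> * ennreal (cmod (U k (u n) \<xi> - U k t \<xi>))) \<longlonglongrightarrow> 0"
      using eqs fin
    proof eventually_elim
      fix \<xi> assume *: "\<forall>n. U k (u n) \<xi> = Y (u n) \<xi>" "U k t \<xi> = Y t \<xi>" "tot (Fm (nrm U) k) \<xi> < \<infinity>"
      have "(\<lambda>n. Y (u n) \<xi> - Y t \<xi>) \<longlonglongrightarrow> 0" using Ylim[OF *(3)] by (simp add: LIM_zero_iff)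
      from tendsto_norm_zero[OF this] have "(\<lambda>n. ennreal (weight a \<sigma> s \<xi> * cmod (Y (u n) \<xi> - Y t \<xi>))) \<longlonglongrightarrow> ennreal 0"
        by (intro tendsto_ennrealI tendsto_mult_right_zero)
      then show "(\<lambda>n. W s \<xi> * ennreal (cmod (U k (u n) \<xi> - U k t \<xi>))) \<longlonglongrightarrow> 0"
        using * by (simp add: W_def ennreal_mult weight_nonneg)
    qed
  qed measurable
  then show "(\<lambda>n. X s (\<lambda>\<xi>. ennreal (cmod (U k (u n) \<xi> - U k t \<xi>)))) \<longlonglongrightarrow> 0"
    by (simp add: X_def)
qed

end

section \<open>Norms in terms of the Fourier transform\<close>

context weighted
begin

lemma X_norm_eq:
  assumes "has_tame_ft f g" shows "X_norm a \<sigma> r f = X r (\<lambda>\<xi>. ennreal (cmod (g \<xi>)))"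
proof -
  have "X_norm a \<sigma> r f = (\<integral>\<^sup>+\<xi>. ennreal (weight a \<sigma> r \<xi> * cmod (ft f \<xi>)) \<partial>lborel)"
    unfolding X_norm_def using has_tame_ft_has_ft[OF assms] by auto
  also have "\<dots> = X r (\<lambda>\<xi>. ennreal (cmod (g \<xi>)))"
    unfolding X_def W_def using has_tame_ft_ft(2)[OF assms]
    by (intro nn_integral_cong_AE) (auto elim!: eventually_mono simp: ennreal_mult weight_nonneg)
  finally show ?thesis .
qed

lemma XV_norm_eq:
  assumes "\<And>i. has_tame_ft (u $ i) (g i)" shows "XV_norm a \<sigma> r u = X r (\<lambda>\<xi>. ennreal (norm (\<chi> i. g i \<xi>)))"
proof -
  have "XV_norm a \<sigma> r u = (\<integral>\<^sup>+\<xi>. ennreal (weight a \<sigma> r \<xi> * norm (\<chi> i. ft (u $ i) \<xi>)) \<partial>lborel)"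
    unfolding XV_norm_def using has_tame_ft_has_ft[OF assms] by auto
  also have "\<dots> = X r (\<lambda>\<xi>. ennreal (norm (\<chi> i. g i \<xi>)))"
  proof -
    have "AE \<xi> in lborel. \<forall>i. g i \<xi> = ft (u $ i) \<xi>"
      using has_tame_ft_ft(2)[OF assms] by (subst AE_all_countable) blast
    then show ?thesis unfolding X_def W_def
      by (intro nn_integral_cong_AE) (auto elim!: eventually_mono simp: ennreal_mult weight_nonneg)
  qed
  finally show ?thesis .
qed

lemma inverse_le_weight:
  assumes "-1 \<le> s" "s \<le> 0" "\<xi> \<noteq> 0" shows "1 / (1 + norm \<xi>) \<le> weight a \<sigma> s \<xi>"
proof -
  have p: "0 < norm \<xi>" using assms by simp
  have "norm \<xi> powr (- s) \<le> 1 + norm \<xi>"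
  proof (cases "norm \<xi> \<le> 1")
    case True
    then have "norm \<xi> powr (- s) \<le> 1" using assms p by (intro powr_le1) auto
    then show ?thesis using p by linarith
  next
    case False
    then have "norm \<xi> powr (- s) \<le> norm \<xi> powr 1" using assms by (intro powr_mono) auto
    then show ?thesis using p by simp
  qed
  then have "1 / (1 + norm \<xi>) \<le> 1 / norm \<xi> powr (- s)" using p one_plus_norm_pos[of \<xi>] by (intro divide_left_mono mult_pos_pos) auto
  also have "\<dots> = norm \<xi> powr s * 1" using p by (simp add: powr_minus_divide)
  also have "\<dots> \<le> norm \<xi> powr s * exp (a * norm \<xi> powr (1 / \<sigma>))" using a by (intro mult_left_mono) auto
  finally show ?thesis by (simp add: weight_def)
qed

text \<open>
  Near the origin the weight is bounded below since \<open>s \<le> 0\<close>, and at infinity it decays at most like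
  \<open>1/\<bar>\<xi>\<bar>\<close> since \<open>s \<ge> -1\<close>.
\<close>

lemma tame_X:
  assumes s: "-1 \<le> s" "s \<le> 0" and g: "g \<in> borel_measurable borel" and fin: "X s (\<lambda>\<xi>. ennreal (cmod (g \<xi>))) < \<infinity>"
  shows "tame g" and "tame (\<lambda>\<xi>. \<i> * of_real (\<xi> $ j) * g \<xi>)"
proof -
  note [measurable] = g
  have one: "(\<integral>\<^sup>+\<xi>. ennreal (cmod (g \<xi>) / (1 + norm \<xi>)) \<partial>lborel) < \<infinity>"
  proof (rule le_less_trans[OF _ fin], unfold X_def, rule nn_integral_mono_AE)
    show "AE \<xi> in lborel. ennreal (cmod (g \<xi>) / (1 + norm \<xi>)) \<le> W s \<xi> * ennreal (cmod (g \<xi>))"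
      using AE_neq[of 0]
    proof eventually_elim
      fix \<xi> :: "real^3" assume "\<xi> \<noteq> 0"
      then have "1 / (1 + norm \<xi>) * cmod (g \<xi>) \<le> weight a \<sigma> s \<xi> * cmod (g \<xi>)"
        by (intro mult_right_mono inverse_le_weight s) auto
      then show "ennreal (cmod (g \<xi>) / (1 + norm \<xi>)) \<le> W s \<xi> * ennreal (cmod (g \<xi>))"
        by (simp add: W_def ennreal_mult[symmetric] weight_nonneg ennreal_leI)
    qed
  qed
  have le: "cmod (g \<xi>) / (1 + norm \<xi>)\<^sup>2 \<le> cmod (g \<xi>) / (1 + norm \<xi>)" for \<xi>
  proof -
    have "1 + norm \<xi> \<le> (1 + norm \<xi>)\<^sup>2" using self_le_power[of "1 + norm \<xi>" 2] by simp
    then show ?thesis using one_plus_norm_pos[of \<xi>] by (intro divide_left_mono mult_pos_pos) auto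
  qed
  show "tame g"
    by (rule tameI_nn[OF g le_less_trans[OF nn_integral_mono one]]) (intro ennreal_leI le)
  have le2: "cmod (\<i> * of_real (\<xi> $ j) * g \<xi>) / (1 + norm \<xi>)\<^sup>2 \<le> cmod (g \<xi>) / (1 + norm \<xi>)" for \<xi>
  proof -
    have "cmod (\<i> * of_real (\<xi> $ j) * g \<xi>) \<le> (1 + norm \<xi>) * cmod (g \<xi>)"
      using component_le_norm_cart[of \<xi> j] by (auto simp: norm_mult intro!: mult_right_mono)
    then have "cmod (\<i> * of_real (\<xi> $ j) * g \<xi>) / (1 + norm \<xi>)\<^sup>2 \<le> (1 + norm \<xi>) * cmod (g \<xi>) / (1 + norm \<xi>)\<^sup>2"
      by (intro divide_right_mono) auto
    then show ?thesis using one_plus_norm_pos[of \<xi>] by (simp add: power2_eq_square)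
  qed
  show "tame (\<lambda>\<xi>. \<i> * of_real (\<xi> $ j) * g \<xi>)"
    by (rule tameI_nn[OF _ le_less_trans[OF nn_integral_mono one]]) (measurable, intro ennreal_leI le2)
qed

lemma X_norm_finite_tame:
  assumes "-1 \<le> s" "s \<le> 0" "X_norm a \<sigma> s f < \<infinity>" shows "has_tame_ft f (ft f)"
proof -
  have "\<exists>g. has_ft f g" using assms(3) by (auto simp: X_norm_def split: if_splits)
  then have h: "has_ft f (ft f)" using has_ft_ft by blast
  then have m: "ft f \<in> borel_measurable borel" using loc_integrable_measurable by (simp add: has_ft_def)
  have "X s (\<lambda>\<xi>. ennreal (cmod (ft f \<xi>))) = X_norm a \<sigma> s f"
    using h unfolding X_norm_def X_def W_def by (auto simp: ennreal_mult weight_nonneg)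
  then have "tame (ft f)" using assms by (intro tame_X m) auto
  then show ?thesis using h by (intro has_tame_ftI)
qed

lemma norm_vec_le_sum: "ennreal (norm (v :: complex^3)) \<le> (\<Sum>i\<in>UNIV. ennreal (cmod (v $ i)))"
  unfolding norm_vec_def by (subst sum_ennreal) (auto intro!: ennreal_leI L2_set_le_sum)

lemma XV_norm_finite_tame:
  assumes "-1 \<le> s" "s \<le> 0" "XV_norm a \<sigma> s u < \<infinity>" shows "has_tame_ft (u $ i) (ft (u $ i))"
proof -
  have ex: "\<exists>g. has_ft (u $ i) g" for i using assms(3) by (auto simp: XV_norm_def split: if_splits)
  have "X_norm a \<sigma> s (u $ i) \<le> XV_norm a \<sigma> s u"
    unfolding X_norm_def XV_norm_def using ex
    by (auto intro!: nn_integral_mono ennreal_leI mult_left_mono weight_nonneg order_trans[OF _ Finite_Cartesian_Product.norm_nth_le[of _ i]])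
  then show ?thesis using assms by (intro X_norm_finite_tame) auto
qed

lemma X_norm_le_XV_norm:
  assumes "\<And>i. has_tame_ft (u $ i) (g i)" shows "X_norm a \<sigma> r (u $ i) \<le> XV_norm a \<sigma> r u"
  unfolding X_norm_eq[OF assms] XV_norm_eq[OF assms]
proof (intro X_mono ennreal_leI)
  fix \<xi> show "cmod (g i \<xi>) \<le> norm (\<chi> i. g i \<xi>)" using Finite_Cartesian_Product.norm_nth_le[of "\<chi> i. g i \<xi>" i] by simp
qed

lemma XV_norm_le_sum:
  assumes "\<And>i. has_tame_ft (u $ i) (g i)" shows "XV_norm a \<sigma> r u \<le> (\<Sum>i\<in>UNIV. X_norm a \<sigma> r (u $ i))"
proof -
  have [measurable]: "g i \<in> borel_measurable borel" for i using tame_measurable[OF has_tame_ft_tame[OF assms]] .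
  have "XV_norm a \<sigma> r u \<le> X r (\<lambda>\<xi>. \<Sum>i\<in>UNIV. ennreal (cmod (g i \<xi>)))"
    unfolding XV_norm_eq[OF assms]
  proof (rule X_mono)
    fix \<xi> show "ennreal (norm (\<chi> i. g i \<xi>)) \<le> (\<Sum>i\<in>UNIV. ennreal (cmod (g i \<xi>)))"
      using norm_vec_le_sum[of "\<chi> i. g i \<xi>"] by simp
  qed
  also have "\<dots> = (\<Sum>i\<in>UNIV. X r (\<lambda>\<xi>. ennreal (cmod (g i \<xi>))))"
    by (rule X_sum) auto
  finally show ?thesis by (simp only: X_norm_eq[OF assms])
qed

end

section \<open>Symmetries on the Fourier side\<close>

lemma pds_cnj:
  assumes "smooth \<phi>" shows "pds js (\<lambda>x. cnj (\<phi> x)) = (\<lambda>x. cnj (pds js \<phi> x))" and "smooth (\<lambda>x. cnj (\<phi> x))"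
proof -
  have D: "((\<lambda>x. cnj (pds js \<phi> x)) has_derivative (\<lambda>h. cnj (frechet_derivative (pds js \<phi>) (at x) h))) (at x)" for js x
    using smooth_differentiable[OF smooth_pds[OF assms]]
    by (intro bounded_linear.has_derivative[OF bounded_linear_cnj]) (simp add: frechet_derivative_works)
  have pd: "pd j (\<lambda>x. cnj (pds js \<phi> x)) = (\<lambda>x. cnj (pds (j # js) \<phi> x))" for j js
    by (rule ext, subst pd_eqI[OF D]) (simp add: pds_Cons pd_def)
  show *: "pds js (\<lambda>x. cnj (\<phi> x)) = (\<lambda>x. cnj (pds js \<phi> x))" for js
    by (induction js) (simp_all add: pds_Cons[of _ _ "\<lambda>x. cnj (\<phi> x)"] pd)
  show "smooth (\<lambda>x. cnj (\<phi> x))" unfolding smooth_def * using D differentiableI by blast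
qed

lemma schwartz_cnj: "schwartz \<phi> \<Longrightarrow> schwartz (\<lambda>x. cnj (\<phi> x))"
  using pds_cnj unfolding schwartz_def by auto

lemma invF_cnj: "invF (\<lambda>x. cnj (\<phi> x)) \<xi> = cnj (invF \<phi> (- \<xi>))"
proof -
  have "cnj (fourier_fun \<phi> \<xi>) = fourier_fun (\<lambda>x. cnj (\<phi> x)) (- \<xi>)"
    unfolding fourier_fun_def by (subst Bochner_Integration.integral_cnj[symmetric]) (simp add: cis_cnj)
  then show ?thesis by (simp add: invF_def)
qed

lemma tame_reflect_cnj:
  assumes "tame g" shows "tame (\<lambda>\<xi>. cnj (g (- \<xi>)))"
proof -
  have "integrable lborel (\<lambda>x. g (0 + (-1) *\<^sub>R x) /\<^sub>R (1 + norm (0 + (-1) *\<^sub>R x))\<^sup>2)"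
    using lborel_integrable_affine[OF _ assms[unfolded tame_def], of "-1" 0] by simp
  from integrable_cnj[OF this] show ?thesis unfolding tame_def
    by (simp add: scaleR_conv_of_real[where 'a = complex])
qed

text \<open>
  Conjugating a distribution reflects and conjugates its Fourier transform, so both sides state that
  a distribution and its conjugate coincide.
\<close>

lemma real_dist_iff:
  assumes f: "has_tame_ft f g"
  shows "real_dist f \<longleftrightarrow> (AE \<xi> in lborel. g (- \<xi>) = cnj (g \<xi>))"
proof -
  note [measurable] = tame_measurable[OF has_tame_ft_tame[OF f]]
  define h where "h \<xi> = cnj (g (- \<xi>))" for \<xi>
  have h: "tame h" unfolding h_def using tame_reflect_cnj[OF has_tame_ft_tame[OF f]] .
  have pair: "(LINT \<xi>|lborel. h \<xi> * invF \<phi> \<xi>) = cnj (pairing f (\<lambda>x. cnj (\<phi> x)))" if \<phi>: "schwartz \<phi>" for \<phi>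
  proof -
    have [measurable]: "invF \<phi> \<in> borel_measurable borel" by (rule schwartz_measurable[OF schwartz_invF[OF \<phi>]])
    have "cnj (pairing f (\<lambda>x. cnj (\<phi> x))) = cnj (LINT \<xi>|lborel. g \<xi> * cnj (invF \<phi> (- \<xi>)))"
      using f schwartz_cnj[OF \<phi>] by (simp add: has_tame_ft_def invF_cnj)
    also have "\<dots> = (LINT \<xi>|lborel. cnj (g \<xi>) * invF \<phi> (- \<xi>))" by (subst Bochner_Integration.integral_cnj[symmetric]) simp
    also have "\<dots> = (LINT \<xi>|lborel. h \<xi> * invF \<phi> \<xi>)"
    proof -
      have [measurable]: "cnj \<in> borel_measurable borel"
        by (intro borel_measurable_continuous_onI continuous_intros)
      have "(\<lambda>\<xi>. cnj (g \<xi>) * invF \<phi> (- \<xi>)) \<in> borel_measurable borel" by measurable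
      from lborel_integral_reflect[OF this, of 0] show ?thesis by (simp add: h_def)
    qed
    finally show ?thesis by simp
  qed
  have "real_dist f \<longleftrightarrow> has_tame_ft f h"
  proof
    assume r: "real_dist f"
    have "pairing f \<phi> = (LINT \<xi>|lborel. h \<xi> * invF \<phi> \<xi>)" if "schwartz \<phi>" for \<phi>
      using r that by (simp add: pair real_dist_def)
    then show "has_tame_ft f h" using h by (simp add: has_tame_ft_def)
  next
    assume *: "has_tame_ft f h"
    show "real_dist f" unfolding real_dist_def
    proof (intro allI impI)
      fix \<phi> :: "real^3 \<Rightarrow> complex" assume \<phi>: "schwartz \<phi>"
      have "pairing f \<phi> = cnj (pairing f (\<lambda>x. cnj (\<phi> x)))" using * \<phi> pair by (simp add: has_tame_ft_def)
      then show "pairing f (\<lambda>x. cnj (\<phi> x)) = cnj (pairing f \<phi>)" by simp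
    qed
  qed
  also have "\<dots> \<longleftrightarrow> (AE \<xi> in lborel. g \<xi> = h \<xi>)"
  proof
    assume "AE \<xi> in lborel. g \<xi> = h \<xi>"
    then show "has_tame_ft f h" by (intro has_tame_ft_AE[OF f tame_measurable[OF h]])
  qed (rule has_tame_ft_unique_fun[OF f])
  also have "\<dots> \<longleftrightarrow> (AE \<xi> in lborel. g (- \<xi>) = cnj (g \<xi>))"
  proof -
    have "(g \<xi> = cnj (g (- \<xi>))) \<longleftrightarrow> (g (- \<xi>) = cnj (g \<xi>))" for \<xi> by (metis complex_cnj_cnj)
    then show ?thesis unfolding h_def by (simp only:)
  qed
  finally show ?thesis .
qed

lemma div_free_iff:
  assumes u: "\<And>j. has_tame_ft (u $ j) (g j)" and t: "\<And>j. tame (\<lambda>\<xi>. \<i> * of_real (\<xi> $ j) * g j \<xi>)"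
  shows "div_free u \<longleftrightarrow> (AE \<xi> in lborel. (\<Sum>j\<in>UNIV. of_real (\<xi> $ j) * g j \<xi>) = 0)"
proof -
  have s: "has_tame_ft (\<Sum>j\<in>UNIV. tderiv j (u $ j)) (\<lambda>\<xi>. \<Sum>j\<in>UNIV. \<i> * of_real (\<xi> $ j) * g j \<xi>)"
    by (intro has_tame_ft_sum has_tame_ft_tderiv u t) auto
  have "div_free u \<longleftrightarrow> has_tame_ft (\<Sum>j\<in>UNIV. tderiv j (u $ j)) (\<lambda>\<xi>. 0)"
    unfolding div_free_def using has_tame_ft_zero has_tame_ft_unique by metis
  also have "\<dots> \<longleftrightarrow> (AE \<xi> in lborel. (\<Sum>j\<in>UNIV. \<i> * of_real (\<xi> $ j) * g j \<xi>) = 0)"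
    using has_tame_ft_AE[OF s] has_tame_ft_unique_fun[OF s] by (auto intro: has_tame_ft_unique_fun)
  also have "\<dots> \<longleftrightarrow> (AE \<xi> in lborel. (\<Sum>j\<in>UNIV. of_real (\<xi> $ j) * g j \<xi>) = 0)"
    by (simp add: mult.assoc sum_distrib_left[symmetric])
  finally show ?thesis .
qed

section \<open>The operators on the Fourier side\<close>

lemma has_tame_ft_inv_ft_AE:
  assumes "tame h" "g \<in> borel_measurable borel" "AE \<xi> in lborel. g \<xi> = h \<xi>"
  shows "has_tame_ft (inv_ft g) h"
proof -
  have ae: "AE \<xi> in lborel. h \<xi> = g \<xi>" using assms(3) by eventually_elim simp
  show ?thesis
    by (rule has_tame_ft_AE[OF has_tame_ft_inv_ft[OF tame_AE[OF assms(1,2) ae]] tame_measurable[OF assms(1)] assms(3)])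
qed

lemma ft_measurable: "has_tame_ft f g \<Longrightarrow> ft f \<in> borel_measurable borel"
  using has_tame_ft_ft(1) has_tame_ft_tame tame_measurable by blast

lemma has_tame_ft_heat:
  assumes f: "has_tame_ft f g" and t: "0 \<le> t"
  shows "has_tame_ft (heat \<gamma> t f) (\<lambda>\<xi>. of_real (exp (- t * norm \<xi> powr (2 * \<gamma>))) * g \<xi>)"
proof -
  note [measurable] = ft_measurable[OF f] tame_measurable[OF has_tame_ft_tame[OF f]]
  show ?thesis
    unfolding heat_def
  proof (rule has_tame_ft_inv_ft_AE)
    show "tame (\<lambda>\<xi>. of_real (exp (- t * norm \<xi> powr (2 * \<gamma>))) * g \<xi>)"
    proof (rule tame_bound[OF has_tame_ft_tame[OF f], where C = 1])
      have "exp (- t * norm \<xi> powr (2 * \<gamma>)) \<le> 1" for \<xi> :: "real^3" using t by simp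
      then show "AE \<xi> in lborel. cmod (of_real (exp (- t * norm \<xi> powr (2 * \<gamma>))) * g \<xi>) \<le> 1 * cmod (g \<xi>)"
        unfolding norm_mult by (intro AE_I2 mult_right_mono) auto
    qed measurable
    show "AE \<xi> in lborel. of_real (exp (- t * norm \<xi> powr (2 * \<gamma>))) * ft f \<xi> = of_real (exp (- t * norm \<xi> powr (2 * \<gamma>))) * g \<xi>"
      using has_tame_ft_ft(2)[OF f] by eventually_elim simp
  qed measurable
qed

text \<open>
  The symbol of the Leray projector, with the value of the identity at the origin.
\<close>

definition P :: "3 \<Rightarrow> 3 \<Rightarrow> real^3 \<Rightarrow> real" where
  "P i j \<xi> = (if i = j then 1 else 0) - \<xi> $ i * \<xi> $ j / (norm \<xi>)\<^sup>2"

lemma P_measurable [measurable]: "P i j \<in> borel_measurable borel"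
  unfolding P_def[abs_def] by measurable

lemma P_bound: "\<bar>P i j \<xi>\<bar> \<le> 2"
proof -
  have "\<bar>\<xi> $ i * \<xi> $ j / (norm \<xi>)\<^sup>2\<bar> \<le> 1"
  proof (cases "\<xi> = 0")
    case False
    have "\<bar>\<xi> $ i\<bar> * \<bar>\<xi> $ j\<bar> \<le> norm \<xi> * norm \<xi>" by (intro mult_mono component_le_norm_cart) auto
    then show ?thesis using False by (simp add: abs_mult power2_eq_square divide_le_eq)
  qed simp
  then show ?thesis unfolding P_def by (smt (verit))
qed

lemma P_reflect: "P i j (- \<xi>) = P i j \<xi>"
  by (simp add: P_def)

lemma P_divergence: "(\<Sum>i\<in>UNIV. \<xi> $ i * P i j \<xi>) = 0"
proof (cases "\<xi> = 0")
  case False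
  have n: "(\<Sum>i\<in>UNIV. \<xi> $ i * \<xi> $ i) = (norm \<xi>)\<^sup>2"
    by (simp add: power2_norm_eq_inner inner_vec_def)
  have "(\<Sum>i\<in>UNIV. \<xi> $ i * P i j \<xi>) = (\<Sum>i\<in>UNIV. \<xi> $ i * (if i = j then 1 else 0)) - (\<Sum>i\<in>UNIV. \<xi> $ i * \<xi> $ i) * (\<xi> $ j / (norm \<xi>)\<^sup>2)"
    unfolding P_def sum_distrib_right sum_subtractf[symmetric] by (intro sum.cong refl) (simp add: algebra_simps)
  also have "(\<Sum>i\<in>UNIV. \<xi> $ i * (if i = j then 1 else 0)) = \<xi> $ j" by (subst sum.remove[of _ j]) auto
  finally show ?thesis using False by (simp add: n)
qed simp

lemma P_sum:
  "(\<Sum>j\<in>UNIV. of_real (P i j \<xi>) * w j) = w i - of_real (\<xi> $ i / (norm \<xi>)\<^sup>2) * (\<Sum>j\<in>UNIV. of_real (\<xi> $ j) * w j)" for w :: "3 \<Rightarrow> complex"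
proof -
  have "(\<Sum>j\<in>UNIV. of_real (P i j \<xi>) * w j) = (\<Sum>j\<in>UNIV. (if i = j then 1 else 0) * w j) - of_real (\<xi> $ i / (norm \<xi>)\<^sup>2) * (\<Sum>j\<in>UNIV. of_real (\<xi> $ j) * w j)"
    unfolding P_def sum_distrib_left sum_subtractf[symmetric] by (intro sum.cong refl) (simp add: algebra_simps)
  also have "(\<Sum>j\<in>UNIV. (if i = j then 1 else 0) * w j) = w i" by (subst sum.remove[of _ i]) auto
  finally show ?thesis .
qed

lemma tame_sum: "finite I \<Longrightarrow> (\<And>i. i \<in> I \<Longrightarrow> tame (g i)) \<Longrightarrow> tame (\<lambda>\<xi>. \<Sum>i\<in>I. g i \<xi>)"
  by (induction I rule: finite_induct) (auto intro: tame_add tame_zero)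

lemma tame_bounded_mult:
  assumes "tame g" "h \<in> borel_measurable borel" "\<And>\<xi>. cmod (h \<xi>) \<le> C" shows "tame (\<lambda>\<xi>. h \<xi> * g \<xi>)"
  by (rule tame_bound[OF assms(1), where C = C])
    (use assms tame_measurable[OF assms(1)] in \<open>auto simp: norm_mult intro!: mult_right_mono\<close>)

lemma has_tame_ft_leray:
  assumes u: "\<And>j. has_tame_ft (u $ j) (g j)"
  shows "has_tame_ft (leray u $ i) (\<lambda>\<xi>. \<Sum>j\<in>UNIV. of_real (P i j \<xi>) * g j \<xi>)"
proof -
  note [measurable] = ft_measurable[OF u] tame_measurable[OF has_tame_ft_tame[OF u]]
  have ae: "AE \<xi> in lborel. \<forall>j. g j \<xi> = ft (u $ j) \<xi>"
    using has_tame_ft_ft(2)[OF u] by (subst AE_all_countable) blast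
  have "has_tame_ft (inv_ft (\<lambda>\<xi>. ft (u $ i) \<xi> -
     of_real (\<xi> $ i / (norm \<xi>)\<^sup>2) * (\<Sum>j\<in>UNIV. of_real (\<xi> $ j) * ft (u $ j) \<xi>))) (\<lambda>\<xi>. \<Sum>j\<in>UNIV. of_real (P i j \<xi>) * g j \<xi>)"
  proof (rule has_tame_ft_inv_ft_AE)
    show "tame (\<lambda>\<xi>. \<Sum>j\<in>UNIV. of_real (P i j \<xi>) * g j \<xi>)"
      using P_bound by (intro tame_sum tame_bounded_mult[where C = 2] has_tame_ft_tame[OF u]) auto
    show "AE \<xi> in lborel. ft (u $ i) \<xi> - of_real (\<xi> $ i / (norm \<xi>)\<^sup>2) * (\<Sum>j\<in>UNIV. of_real (\<xi> $ j) * ft (u $ j) \<xi>) = (\<Sum>j\<in>UNIV. of_real (P i j \<xi>) * g j \<xi>)"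
      using ae by eventually_elim (simp add: P_sum)
  qed measurable
  then show ?thesis by (simp add: leray_def)
qed

lemma AE_reflect: "AE x in lborel. Q x \<Longrightarrow> AE x in lborel. Q (t - x)" for t :: "real^3"
  using lborel_AE_affine[of "-1" Q t] by simp

lemma has_tame_ft_tprod:
  assumes f: "has_tame_ft f g" and f': "has_tame_ft f' g'"
    and int: "AE \<xi> in lborel. integrable lborel (\<lambda>\<eta>. g (\<xi> - \<eta>) * g' \<eta>)" and t: "tame (Defs.convolution g g')"
  shows "has_tame_ft (tprod f f') (\<lambda>\<xi>. of_real (1 / (2 * pi) ^ 3) * Defs.convolution g g' \<xi>)"
proof -
  note [measurable] = ft_measurable[OF f] ft_measurable[OF f'] tame_measurable[OF has_tame_ft_tame[OF f]] tame_measurable[OF has_tame_ft_tame[OF f']]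
  have ae: "AE \<eta> in lborel. g (\<xi> - \<eta>) * g' \<eta> = ft f (\<xi> - \<eta>) * ft f' \<eta>" for \<xi>
    using AE_reflect[OF has_tame_ft_ft(2)[OF f], of \<xi>] has_tame_ft_ft(2)[OF f'] by eventually_elim simp
  have conv: "Defs.convolution (ft f) (ft f') = Defs.convolution g g'"
    unfolding Defs.convolution_def
  proof (rule ext, rule integral_cong_AE)
    show "AE \<eta> in lborel. ft f (\<xi> - \<eta>) * ft f' \<eta> = g (\<xi> - \<eta>) * g' \<eta>" for \<xi>
      using ae[of \<xi>] by eventually_elim simp
  qed measurable
  have int': "AE \<xi> in lborel. integrable lborel (\<lambda>\<eta>. ft f (\<xi> - \<eta>) * ft f' \<eta>)"
    using int
  proof eventually_elim
    fix \<xi> assume i: "integrable lborel (\<lambda>\<eta>. g (\<xi> - \<eta>) * g' \<eta>)"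
    show "integrable lborel (\<lambda>\<eta>. ft f (\<xi> - \<eta>) * ft f' \<eta>)"
      by (rule Bochner_Integration.integrable_cong_AE[THEN iffD1, OF _ _ ae i]) measurable
  qed
  have t': "tame (\<lambda>\<xi>. of_real (1 / (2 * pi) ^ 3) * Defs.convolution g g' \<xi>)" by (rule tame_cmul[OF t])
  have "tprod f f' = inv_ft (\<lambda>\<xi>. of_real (1 / (2 * pi) ^ 3) * Defs.convolution g g' \<xi>)"
    unfolding tprod_def conv
    by (rule the_equality)
      (use int' has_tame_ft_has_ft[OF has_tame_ft_inv_ft[OF t']] has_ft_unique_dist in blast)+
  then show ?thesis using has_tame_ft_inv_ft[OF t'] by simp
qed

text \<open>
  Both \<open>\<bar>\<xi> - \<eta>\<bar>\<close> and \<open>\<bar>\<xi>\<bar>\<close> are available to bound the derivative \<open>\<bar>\<eta>\<bar>\<close> on the second factor, so the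
  first moment of the transform of \<open>u\<close> makes every product \<open>u\<^sub>j \<partial>\<^sub>j f\<close> meaningful. Since \<open>u\<close> is divergence free, the derivative
  can then be moved in front of the convolution, \<open>u \<sqdot> \<nabla>f = \<nabla> \<sqdot> (u f)\<close>.
\<close>

lemma has_tame_ft_adv:
  assumes u: "\<And>j. has_tame_ft (u $ j) (g j)" and f: "has_tame_ft f h" and tf: "\<And>j. tame (\<lambda>\<xi>. \<i> * of_real (\<xi> $ j) * h \<xi>)"
    and g0: "\<And>j. (\<integral>\<^sup>+\<xi>. ennreal (cmod (g j \<xi>)) \<partial>lborel) < \<infinity>"
    and g1: "\<And>j. (\<integral>\<^sup>+\<xi>. ennreal (norm \<xi>) * ennreal (cmod (g j \<xi>)) \<partial>lborel) < \<infinity>"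
    and h0: "(\<integral>\<^sup>+\<xi>. ennreal (cmod (h \<xi>)) \<partial>lborel) < \<infinity>"
    and div: "AE \<xi> in lborel. (\<Sum>j\<in>UNIV. of_real (\<xi> $ j) * g j \<xi>) = 0"
  shows "has_tame_ft (adv u f) (\<lambda>\<xi>. of_real (1 / (2 * pi) ^ 3) * (\<Sum>j\<in>UNIV. \<i> * of_real (\<xi> $ j) * Defs.convolution (g j) h \<xi>))"
proof -
  note gm[measurable] = tame_measurable[OF has_tame_ft_tame[OF u]] and hm[measurable] = tame_measurable[OF has_tame_ft_tame[OF f]]
  let ?G = "\<lambda>j \<xi>. ennreal (cmod (g j \<xi>))" and ?G1 = "\<lambda>j \<xi>. ennreal (norm \<xi>) * ennreal (cmod (g j \<xi>))" and ?H = "\<lambda>\<xi>. ennreal (cmod (h \<xi>))"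
  let ?h = "\<lambda>j \<xi>. \<i> * of_real (\<xi> $ j) * h \<xi>"
  define N where "N j \<xi> = ennreal (norm \<xi>) * nconv (?G j) ?H \<xi> + nconv (?G1 j) ?H \<xi>" for j \<xi>
  have nm[measurable]: "nconv (?G j) ?H \<in> borel_measurable borel" "nconv (?G1 j) ?H \<in> borel_measurable borel" for j
  proof -
    have "nconv (?G j) ?H \<in> borel_measurable lborel" "nconv (?G1 j) ?H \<in> borel_measurable lborel"
      unfolding nconv_def[abs_def] by measurable
    then show "nconv (?G j) ?H \<in> borel_measurable borel" "nconv (?G1 j) ?H \<in> borel_measurable borel" by simp_all
  qed
  have i0: "(\<integral>\<^sup>+\<xi>. nconv (?G j) ?H \<xi> \<partial>lborel) < \<infinity>" "(\<integral>\<^sup>+\<xi>. nconv (?G1 j) ?H \<xi> \<partial>lborel) < \<infinity>" for j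
    using g0[of j] g1[of j] h0 by (auto simp: nn_integral_nconv ennreal_mult_less_top)
  have le: "nconv (?G j) (\<lambda>\<eta>. ennreal (cmod (?h l \<eta>))) \<xi> \<le> N j \<xi>" for j l \<xi>
  proof -
    have "nconv (?G j) (\<lambda>\<eta>. ennreal (cmod (?h l \<eta>))) \<xi> \<le> (\<integral>\<^sup>+\<eta>. ennreal (norm \<xi>) * (?G j (\<xi> - \<eta>) * ?H \<eta>) + ?G1 j (\<xi> - \<eta>) * ?H \<eta> \<partial>lborel)"
      unfolding nconv_def
    proof (rule nn_integral_mono)
      fix \<eta>
      have "\<bar>\<eta> $ l\<bar> \<le> norm \<xi> + norm (\<xi> - \<eta>)"
        using component_le_norm_cart[of \<eta> l] norm_triangle_ineq4[of \<xi> "\<xi> - \<eta>"] by simp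
      then have "cmod (g j (\<xi> - \<eta>)) * (\<bar>\<eta> $ l\<bar> * cmod (h \<eta>)) \<le> cmod (g j (\<xi> - \<eta>)) * ((norm \<xi> + norm (\<xi> - \<eta>)) * cmod (h \<eta>))"
        by (intro mult_left_mono mult_right_mono) auto
      then have "ennreal (cmod (g j (\<xi> - \<eta>)) * (\<bar>\<eta> $ l\<bar> * cmod (h \<eta>))) \<le> ennreal (norm \<xi> * (cmod (g j (\<xi> - \<eta>)) * cmod (h \<eta>)) + norm (\<xi> - \<eta>) * cmod (g j (\<xi> - \<eta>)) * cmod (h \<eta>))"
        by (intro ennreal_leI) (simp add: algebra_simps)
      then show "?G j (\<xi> - \<eta>) * ennreal (cmod (?h l \<eta>)) \<le> ennreal (norm \<xi>) * (?G j (\<xi> - \<eta>) * ?H \<eta>) + ?G1 j (\<xi> - \<eta>) * ?H \<eta>"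
        by (simp add: ennreal_mult norm_mult ennreal_plus)
    qed
    also have "\<dots> = N j \<xi>" unfolding N_def nconv_def by (simp add: nn_integral_add nn_integral_cmult)
    finally show ?thesis .
  qed
  have Nfin: "AE \<xi> in lborel. N j \<xi> < \<infinity>" for j
  proof -
    have "AE \<xi> in lborel. nconv (?G j) ?H \<xi> \<noteq> \<infinity>" "AE \<xi> in lborel. nconv (?G1 j) ?H \<xi> \<noteq> \<infinity>"
      using i0[of j] by (intro nn_integral_PInf_AE; simp)+
    then show ?thesis by eventually_elim (auto simp: N_def ennreal_mult_less_top less_top)
  qed
  have c0fin: "AE \<xi> in lborel. nconv (?G j) ?H \<xi> < \<infinity>" for j
    using nn_integral_PInf_AE[of "nconv (?G j) ?H" lborel] i0(1)[of j] by (auto simp: less_top)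
  have hl[measurable]: "?h l \<in> borel_measurable borel" for l by measurable
  have cm: "Defs.convolution (g j) (?h l) \<in> borel_measurable borel" for j l
  proof -
    have "Defs.convolution (g j) (?h l) \<in> borel_measurable lborel" unfolding Defs.convolution_def[abs_def] by measurable
    then show ?thesis by simp
  qed
  have ct: "tame (Defs.convolution (g j) (?h l))" for j l
  proof (rule tameI_nn[OF cm])
    have "(\<integral>\<^sup>+\<xi>. ennreal (cmod (Defs.convolution (g j) (?h l) \<xi>) / (1 + norm \<xi>)\<^sup>2) \<partial>lborel)
      \<le> (\<integral>\<^sup>+\<xi>. nconv (?G j) ?H \<xi> + nconv (?G1 j) ?H \<xi> \<partial>lborel)"
    proof (rule nn_integral_mono)
      fix \<xi> :: "real^3"
      have p: "0 < 1 + norm \<xi>" by (rule one_plus_norm_pos)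
      have le1: "1 / (1 + norm \<xi>)\<^sup>2 \<le> 1" "norm \<xi> / (1 + norm \<xi>)\<^sup>2 \<le> 1"
      proof -
        have sq: "1 + norm \<xi> \<le> (1 + norm \<xi>)\<^sup>2" using self_le_power[of "1 + norm \<xi>" 2] by simp
        have pos: "0 < (1 + norm \<xi>)\<^sup>2" using p by simp
        show "1 / (1 + norm \<xi>)\<^sup>2 \<le> 1" "norm \<xi> / (1 + norm \<xi>)\<^sup>2 \<le> 1"
          unfolding pos_divide_le_eq[OF pos] using sq norm_ge_zero[of \<xi>] by linarith+
      qed
      have "ennreal (cmod (Defs.convolution (g j) (?h l) \<xi>) / (1 + norm \<xi>)\<^sup>2) = ennreal (1 / (1 + norm \<xi>)\<^sup>2) * ennreal (cmod (Defs.convolution (g j) (?h l) \<xi>))"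
        using p by (simp add: ennreal_mult[symmetric])
      also have "\<dots> \<le> ennreal (1 / (1 + norm \<xi>)\<^sup>2) * N j \<xi>"
        by (intro mult_left_mono order_trans[OF convolution_le le]) auto
      also have "\<dots> = ennreal (norm \<xi> / (1 + norm \<xi>)\<^sup>2) * nconv (?G j) ?H \<xi> + ennreal (1 / (1 + norm \<xi>)\<^sup>2) * nconv (?G1 j) ?H \<xi>"
        unfolding N_def distrib_left mult.assoc[symmetric] using p by (simp add: ennreal_mult[symmetric])
      also have "\<dots> \<le> 1 * nconv (?G j) ?H \<xi> + 1 * nconv (?G1 j) ?H \<xi>"
        using le1 by (intro add_mono mult_right_mono) (auto simp: ennreal_le_1)
      finally show "ennreal (cmod (Defs.convolution (g j) (?h l) \<xi>) / (1 + norm \<xi>)\<^sup>2) \<le> nconv (?G j) ?H \<xi> + nconv (?G1 j) ?H \<xi>" by simp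
    qed
    also have "\<dots> < \<infinity>" using i0[of j] by (simp add: nn_integral_add less_top[symmetric])
    finally show "(\<integral>\<^sup>+\<xi>. ennreal (cmod (Defs.convolution (g j) (?h l) \<xi>) / (1 + norm \<xi>)\<^sup>2) \<partial>lborel) < \<infinity>" .
  qed
  have ci: "AE \<xi> in lborel. integrable lborel (\<lambda>\<eta>. g j (\<xi> - \<eta>) * ?h l \<eta>)" for j l
    using Nfin[of j] by eventually_elim (intro convolution_integrable gm hl le_less_trans[OF le])
  have sum: "has_tame_ft (adv u f) (\<lambda>\<xi>. \<Sum>j\<in>UNIV. of_real (1 / (2 * pi) ^ 3) * Defs.convolution (g j) (?h j) \<xi>)"
    unfolding adv_def
    by (intro has_tame_ft_sum has_tame_ft_tprod u has_tame_ft_tderiv f tf ci ct) auto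
  show ?thesis
  proof (rule has_tame_ft_AE[OF sum])
    have cm0: "Defs.convolution (g j) h \<in> borel_measurable borel" for j
    proof -
      have "Defs.convolution (g j) h \<in> borel_measurable lborel" unfolding Defs.convolution_def[abs_def] by measurable
      then show ?thesis by simp
    qed
    show "(\<lambda>\<xi>. of_real (1 / (2 * pi) ^ 3) * (\<Sum>j\<in>UNIV. \<i> * of_real (\<xi> $ j) * Defs.convolution (g j) h \<xi>)) \<in> borel_measurable borel"
      using cm0 by measurable
    have "AE \<xi> in lborel. \<forall>j. N j \<xi> < \<infinity> \<and> nconv (?G j) ?H \<xi> < \<infinity>"
      using Nfin c0fin by (subst AE_all_countable) (auto intro: AE_conjI)
    then show "AE \<xi> in lborel. (\<Sum>j\<in>UNIV. of_real (1 / (2 * pi) ^ 3) * Defs.convolution (g j) (?h j) \<xi>) =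
        of_real (1 / (2 * pi) ^ 3) * (\<Sum>j\<in>UNIV. \<i> * of_real (\<xi> $ j) * Defs.convolution (g j) h \<xi>)"
    proof eventually_elim
      fix \<xi> assume fin: "\<forall>j. N j \<xi> < \<infinity> \<and> nconv (?G j) ?H \<xi> < \<infinity>"
      have I1: "integrable lborel (\<lambda>\<eta>. g j (\<xi> - \<eta>) * ?h j \<eta>)" for j
        using fin by (intro convolution_integrable gm hl le_less_trans[OF le]) auto
      have I2: "integrable lborel (\<lambda>\<eta>. g j (\<xi> - \<eta>) * h \<eta>)" for j
        using fin by (intro convolution_integrable gm hm) auto
      have "(\<Sum>j\<in>UNIV. Defs.convolution (g j) (?h j) \<xi>) = (LINT \<eta>|lborel. (\<Sum>j\<in>UNIV. g j (\<xi> - \<eta>) * ?h j \<eta>))"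
        unfolding Defs.convolution_def by (rule Bochner_Integration.integral_sum[symmetric]) (rule I1)
      also have "\<dots> = (LINT \<eta>|lborel. (\<Sum>j\<in>UNIV. \<i> * of_real (\<xi> $ j) * (g j (\<xi> - \<eta>) * h \<eta>)))"
      proof (rule integral_cong_AE)
        show "AE \<eta> in lborel. (\<Sum>j\<in>UNIV. g j (\<xi> - \<eta>) * ?h j \<eta>) = (\<Sum>j\<in>UNIV. \<i> * of_real (\<xi> $ j) * (g j (\<xi> - \<eta>) * h \<eta>))"
          using AE_reflect[OF div, of \<xi>]
        proof eventually_elim
          fix \<eta> assume z: "(\<Sum>j\<in>UNIV. of_real ((\<xi> - \<eta>) $ j) * g j (\<xi> - \<eta>)) = 0"
          have "(\<Sum>j\<in>UNIV. \<i> * of_real (\<xi> $ j) * (g j (\<xi> - \<eta>) * h \<eta>)) - (\<Sum>j\<in>UNIV. g j (\<xi> - \<eta>) * ?h j \<eta>)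
             = (\<Sum>j\<in>UNIV. of_real ((\<xi> - \<eta>) $ j) * g j (\<xi> - \<eta>)) * (\<i> * h \<eta>)"
            unfolding sum_subtractf[symmetric] sum_distrib_right by (intro sum.cong refl) (simp add: algebra_simps)
          then show "(\<Sum>j\<in>UNIV. g j (\<xi> - \<eta>) * ?h j \<eta>) = (\<Sum>j\<in>UNIV. \<i> * of_real (\<xi> $ j) * (g j (\<xi> - \<eta>) * h \<eta>))" using z by simp
        qed
      qed measurable
      also have "\<dots> = (\<Sum>j\<in>UNIV. \<i> * of_real (\<xi> $ j) * Defs.convolution (g j) h \<xi>)"
        unfolding Defs.convolution_def
        by (subst Bochner_Integration.integral_sum) (auto intro!: integrable_mult_right I2)
      finally show "(\<Sum>j\<in>UNIV. of_real (1 / (2 * pi) ^ 3) * Defs.convolution (g j) (?h j) \<xi>) =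
        of_real (1 / (2 * pi) ^ 3) * (\<Sum>j\<in>UNIV. \<i> * of_real (\<xi> $ j) * Defs.convolution (g j) h \<xi>)"
        by (simp only: sum_distrib_left[symmetric])
    qed
  qed
qed

section \<open>Distribution-valued time integrals\<close>

lemma has_tint_unique: "has_tint t F I \<Longrightarrow> has_tint t F I' \<Longrightarrow> I = I'"
  by (rule pairing_eqI) (simp add: has_tint_def)

text \<open>
  The pairing with a Schwartz function commutes with the time integral by Fubini's theorem; the
  assumption is exactly absolute integrability after using the decay \<open>(1 + \<bar>\<xi>\<bar>)\<^sup>-\<^sup>2\<close>.
\<close>

lemma has_tint_of_ft:
  assumes h: "jmeas h" and F: "AE \<tau> in lborel. \<tau> \<in> {0..t} \<longrightarrow> has_tame_ft (F \<tau>) (h \<tau>)"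
    and supp: "\<And>\<tau> \<xi>. \<tau> \<notin> {0..t} \<Longrightarrow> h \<tau> \<xi> = 0"
    and fin: "(\<integral>\<^sup>+\<tau>. (\<integral>\<^sup>+\<xi>. ennreal (cmod (h \<tau> \<xi>) / (1 + norm \<xi>)\<^sup>2) \<partial>lborel) \<partial>lborel) < \<infinity>"
  shows "\<exists>I. has_tint t F I \<and> has_tame_ft I (\<lambda>\<xi>. LINT \<tau>|lborel. h \<tau> \<xi>)"
proof -
  note [measurable] = h
  let ?H = "\<lambda>\<xi>. LINT \<tau>|lborel. h \<tau> \<xi>"
  have [measurable]: "(\<lambda>z. h (snd z) (fst z)) \<in> borel_measurable (lborel \<Otimes>\<^sub>M lborel)"
    by (rule jmeas_compose[OF h]; measurable)
  have [measurable]: "(\<lambda>\<tau>. h \<tau> \<xi>) \<in> borel_measurable borel" "h \<tau> \<in> borel_measurable borel" for \<xi> \<tau>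
    by (rule jmeas_section[OF h] jmeas_section2[OF h])+
  have Hm: "?H \<in> borel_measurable borel"
  proof -
    have "?H \<in> borel_measurable lborel" by measurable
    then show ?thesis by simp
  qed
  have tH: "tame ?H"
  proof (rule tameI_nn[OF Hm])
    have "(\<integral>\<^sup>+\<xi>. ennreal (cmod (?H \<xi>) / (1 + norm \<xi>)\<^sup>2) \<partial>lborel) \<le> (\<integral>\<^sup>+\<xi>. (\<integral>\<^sup>+\<tau>. ennreal (cmod (h \<tau> \<xi>) / (1 + norm \<xi>)\<^sup>2) \<partial>lborel) \<partial>lborel)"
    proof (rule nn_integral_mono)
      fix \<xi> :: "real^3"
      have eq: "ennreal (cmod z / (1 + norm \<xi>)\<^sup>2) = ennreal (cmod z) * ennreal (1 / (1 + norm \<xi>)\<^sup>2)" for z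
        by (simp add: ennreal_mult[symmetric])
      have "ennreal (cmod (?H \<xi>)) * ennreal (1 / (1 + norm \<xi>)\<^sup>2) \<le> (\<integral>\<^sup>+\<tau>. ennreal (cmod (h \<tau> \<xi>)) \<partial>lborel) * ennreal (1 / (1 + norm \<xi>)\<^sup>2)"
        by (intro mult_right_mono ennreal_norm_integral_le) auto
      then show "ennreal (cmod (?H \<xi>) / (1 + norm \<xi>)\<^sup>2) \<le> (\<integral>\<^sup>+\<tau>. ennreal (cmod (h \<tau> \<xi>) / (1 + norm \<xi>)\<^sup>2) \<partial>lborel)"
        unfolding eq by (subst nn_integral_multc) auto
    qed
    also have "\<dots> = (\<integral>\<^sup>+\<tau>. (\<integral>\<^sup>+\<xi>. ennreal (cmod (h \<tau> \<xi>) / (1 + norm \<xi>)\<^sup>2) \<partial>lborel) \<partial>lborel)"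
      by (rule lborel_pair.Fubini'[symmetric]) measurable
    finally show "(\<integral>\<^sup>+\<xi>. ennreal (cmod (?H \<xi>) / (1 + norm \<xi>)\<^sup>2) \<partial>lborel) < \<infinity>" using fin by (rule le_less_trans)
  qed
  have I: "has_tame_ft (inv_ft ?H) ?H" by (rule has_tame_ft_inv_ft[OF tH])
  have "has_tint t F (inv_ft ?H)"
    unfolding has_tint_def
  proof (intro allI impI)
    fix \<phi> :: "real^3 \<Rightarrow> complex" assume \<phi>: "schwartz \<phi>"
    have [measurable]: "invF \<phi> \<in> borel_measurable borel" by (rule schwartz_measurable[OF schwartz_invF[OF \<phi>]])
    obtain K where K: "K \<ge> 0" "\<And>\<xi>. cmod (invF \<phi> \<xi>) \<le> K / (1 + norm \<xi>)\<^sup>2"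
      using schwartz_decay[OF schwartz_invF[OF \<phi>]] by blast
    define p where "p \<tau> = (LINT \<xi>|lborel. h \<tau> \<xi> * invF \<phi> \<xi>)" for \<tau>
    have [measurable]: "p \<in> borel_measurable borel"
    proof -
      have "p \<in> borel_measurable lborel" unfolding p_def by measurable
      then show ?thesis by simp
    qed
    have int2: "integrable (lborel \<Otimes>\<^sub>M lborel) (\<lambda>(\<tau>, \<xi>). h \<tau> \<xi> * invF \<phi> \<xi>)"
    proof (rule integrableI_bounded)
      have "(\<integral>\<^sup>+z. ennreal (norm (case z of (\<tau>, \<xi>) \<Rightarrow> h \<tau> \<xi> * invF \<phi> \<xi>)) \<partial>(lborel \<Otimes>\<^sub>M lborel))
        = (\<integral>\<^sup>+\<tau>. (\<integral>\<^sup>+\<xi>. ennreal (cmod (h \<tau> \<xi> * invF \<phi> \<xi>)) \<partial>lborel) \<partial>lborel)"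
        by (subst lborel.nn_integral_fst[symmetric]) auto
      also have "\<dots> \<le> (\<integral>\<^sup>+\<tau>. (\<integral>\<^sup>+\<xi>. ennreal K * ennreal (cmod (h \<tau> \<xi>) / (1 + norm \<xi>)\<^sup>2) \<partial>lborel) \<partial>lborel)"
      proof (intro nn_integral_mono)
        fix \<tau> and \<xi> :: "real^3"
        have "cmod (h \<tau> \<xi>) * cmod (invF \<phi> \<xi>) \<le> cmod (h \<tau> \<xi>) * (K / (1 + norm \<xi>)\<^sup>2)" by (intro mult_left_mono K) auto
        then show "ennreal (cmod (h \<tau> \<xi> * invF \<phi> \<xi>)) \<le> ennreal K * ennreal (cmod (h \<tau> \<xi>) / (1 + norm \<xi>)\<^sup>2)"
          using K(1) by (simp add: norm_mult ennreal_mult[symmetric] ennreal_leI mult.commute)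
      qed
      also have "\<dots> = ennreal K * (\<integral>\<^sup>+\<tau>. (\<integral>\<^sup>+\<xi>. ennreal (cmod (h \<tau> \<xi>) / (1 + norm \<xi>)\<^sup>2) \<partial>lborel) \<partial>lborel)"
        by (simp add: nn_integral_cmult)
      also have "\<dots> < \<infinity>" using fin by (simp add: ennreal_mult_less_top)
      finally show "(\<integral>\<^sup>+z. ennreal (norm (case z of (\<tau>, \<xi>) \<Rightarrow> h \<tau> \<xi> * invF \<phi> \<xi>)) \<partial>(lborel \<Otimes>\<^sub>M lborel)) < \<infinity>" .
    qed measurable
    have pint: "integrable lborel p" unfolding p_def using lborel_pair.integrable_fst'[OF int2] by simp
    let ?q = "\<lambda>\<tau>. indicator {0..t} \<tau> *\<^sub>R pairing (F \<tau>) \<phi>"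
    have "AE \<tau> in lborel. p \<tau> = ?q \<tau>"
      using F
    proof eventually_elim
      fix \<tau> assume *: "\<tau> \<in> {0..t} \<longrightarrow> has_tame_ft (F \<tau>) (h \<tau>)"
      show "p \<tau> = ?q \<tau>"
        using * supp[of \<tau>] \<phi> by (cases "\<tau> \<in> {0..t}") (auto simp: p_def has_tame_ft_def)
    qed
    then have ae: "AE \<tau> in lebesgue. p \<tau> = ?q \<tau>" by (rule AE_completion)
    have pm: "p \<in> borel_measurable lebesgue" by (rule measurable_completion) simp
    have qm: "?q \<in> borel_measurable lebesgue" by (rule borel_measurable_AE[OF pm ae])
    have pl: "integrable lebesgue p" using pint by (simp add: integrable_completion)
    have qint: "integrable lebesgue ?q"
      by (rule Bochner_Integration.integrable_cong_AE[THEN iffD1, OF pm qm ae pl])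
    have "(LINT \<tau>|lebesgue_on {0..t}. pairing (F \<tau>) \<phi>) = (LINT \<tau>|lebesgue. ?q \<tau>)"
      by (rule integral_restrict_space) simp
    also have "\<dots> = (LINT \<tau>|lebesgue. p \<tau>)" using ae pm qm by (intro integral_cong_AE) (auto elim: eventually_mono)
    also have "\<dots> = (LINT \<tau>|lborel. p \<tau>)" by (rule integral_completion) simp
    also have "\<dots> = (LINT \<xi>|lborel. LINT \<tau>|lborel. h \<tau> \<xi> * invF \<phi> \<xi>)"
      unfolding p_def by (rule lborel_pair.Fubini_integral[symmetric, OF int2])
    also have "\<dots> = (LINT \<xi>|lborel. ?H \<xi> * invF \<phi> \<xi>)" by simp
    also have "\<dots> = pairing (inv_ft ?H) \<phi>" using I \<phi> by (simp add: has_tame_ft_def)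
    finally show "integrable (lebesgue_on {0..t}) (\<lambda>\<tau>. pairing (F \<tau>) \<phi>) \<and>
        pairing (inv_ft ?H) \<phi> = (LINT \<tau>|lebesgue_on {0..t}. pairing (F \<tau>) \<phi>)"
      using qint by (simp add: integrable_restrict_space)
  qed
  then show ?thesis using I by blast
qed

section \<open>Measurability in time\<close>

text \<open>
  A continuous function on a compact interval is uniformly approximated by step functions that take
  their values among its own. The pieces are indexed by the first ball of a finite cover that contains the time, which makes the index
  Borel measurable.
\<close>

lemma continuous_step_index:
  fixes N :: "'v::ab_group_add \<Rightarrow> ennreal" and f :: "real \<Rightarrow> 'v"
  assumes cont: "\<And>t. t \<in> {0..T} \<Longrightarrow> ((\<lambda>\<tau>. N (f \<tau> - f t)) \<longlongrightarrow> 0) (at t within {0..T})"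
    and N0: "N 0 = 0" and e: "0 < e"
  shows "\<exists>(n::nat) c idx. idx \<in> measurable borel (count_space UNIV) \<and>
     (\<forall>t\<in>{0..T}. idx t < n \<and> c (idx t) \<in> {0..T} \<and> N (f t - f (c (idx t))) < e)"
proof -
  have "\<exists>d>0. \<forall>\<tau>\<in>{0..T}. \<bar>\<tau> - t\<bar> < d \<longrightarrow> N (f \<tau> - f t) < e" if t: "t \<in> {0..T}" for t
  proof -
    have "eventually (\<lambda>\<tau>. N (f \<tau> - f t) < e) (at t within {0..T})" by (rule order_tendstoD(2)[OF cont[OF t] e])
    then obtain d where "d > 0" "\<forall>\<tau>\<in>{0..T}. \<tau> \<noteq> t \<and> dist \<tau> t < d \<longrightarrow> N (f \<tau> - f t) < e"
      unfolding eventually_at by auto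
    then show ?thesis using N0 e by (intro exI[of _ d]) (auto simp: dist_real_def)
  qed
  then obtain d where d: "\<And>t. t \<in> {0..T} \<Longrightarrow> d t > 0" "\<And>t \<tau>. t \<in> {0..T} \<Longrightarrow> \<tau> \<in> {0..T} \<Longrightarrow> \<bar>\<tau> - t\<bar> < d t \<Longrightarrow> N (f \<tau> - f t) < e"
    by metis
  have cov: "{0..T} \<subseteq> (\<Union>t\<in>{0..T}. ball t (d t))" using d(1) by force
  obtain D where D: "D \<subseteq> {0..T}" "finite D" "{0..T} \<subseteq> (\<Union>t\<in>D. ball t (d t))"
    by (rule compactE_image[OF compact_Icc[of 0 T] _ cov]) auto
  obtain n :: nat and c where c: "D = c ` {i. i < n}" using finite_imp_nat_seg_image_inj_on[OF D(2)] by metis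
  define idx where "idx t = (LEAST i. i < n \<and> \<bar>t - c i\<bar> < d (c i))" for t
  have idx_meas: "idx \<in> measurable borel (count_space UNIV)"
    unfolding idx_def[abs_def] by measurable
  have "idx t < n \<and> c (idx t) \<in> {0..T} \<and> N (f t - f (c (idx t))) < e" if t: "t \<in> {0..T}" for t
  proof -
    obtain i where "i < n \<and> \<bar>t - c i\<bar> < d (c i)" using D(3) t c by (auto simp: dist_real_def abs_minus_commute)
    then have *: "idx t < n \<and> \<bar>t - c (idx t)\<bar> < d (c (idx t))" unfolding idx_def by (rule LeastI)
    then have "c (idx t) \<in> {0..T}" using c D(1) by auto
    then show ?thesis using d(2) t * by auto
  qed
  then show ?thesis using idx_meas by blast
qed

lemma nn_integral_lebesgue_on:
  assumes "\<And>t. t \<in> {0..T} \<Longrightarrow> g t = h t"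
  shows "(\<integral>\<^sup>+t. g t \<partial>lebesgue_on {0..T}) = (\<integral>\<^sup>+t. indicator {0..T} t * h t \<partial>(lborel :: real measure))"
proof -
  have "(\<integral>\<^sup>+t. g t \<partial>lebesgue_on {0..T}) = (\<integral>\<^sup>+t. g t * indicator {0..T} t \<partial>lebesgue)"
    by (rule nn_integral_restrict_space) simp
  also have "\<dots> = (\<integral>\<^sup>+t. g t * indicator {0..T} t \<partial>lborel)" by (rule nn_integral_completion)
  also have "\<dots> = (\<integral>\<^sup>+t. indicator {0..T} t * h t \<partial>lborel)"
    by (intro nn_integral_cong) (auto simp: assms indicator_def)
  finally show ?thesis .
qed

lemma AE_lebesgue_on:
  "(AE t in lebesgue_on {0..T}. Q t) \<longleftrightarrow> (AE t in (lborel :: real measure). t \<in> {0..T} \<longrightarrow> Q t)"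
  by (subst AE_restrict_space_iff) (auto simp: AE_completion_iff)

context weighted
begin

lemma X_norm_zero: "X_norm a \<sigma> r 0 = 0"
  by (simp add: X_norm_eq[OF has_tame_ft_zero] X_def)

text \<open>
  The transforms at the individual times are chosen independently of each other, so their joint measurability is not
  automatic. Step functions in time are jointly measurable; if they approximate with summable
  errors in \<open>X\<^sup>s\<close> they converge at almost every frequency, for every time, and the limit is the required
  representative.
\<close>

lemma C_T_jmeas:
  assumes s: "-1 \<le> s" "s \<le> 0" and f: "f \<in> C_T T (X_norm a \<sigma> s)"
  shows "\<exists>V. jmeas V \<and> (\<forall>t\<in>{0..T}. has_tame_ft (f t) (V t))"
proof -
  have fin: "X_norm a \<sigma> s (f t) < \<infinity>" if "t \<in> {0..T}" for t using f that by (auto simp: C_T_def)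
  have cont: "((\<lambda>\<tau>. X_norm a \<sigma> s (f \<tau> - f t)) \<longlongrightarrow> 0) (at t within {0..T})" if "t \<in> {0..T}" for t
    using f that by (auto simp: C_T_def)
  have ft: "has_tame_ft (f t) (ft (f t))" if "t \<in> {0..T}" for t by (rule X_norm_finite_tame[OF s fin[OF that]])
  define g where "g t = (if t \<in> {0..T} then ft (f t) else (\<lambda>_. 0))" for t
  have g: "has_tame_ft (f t) (g t)" if "t \<in> {0..T}" for t using ft that by (simp add: g_def)
  have gm[measurable]: "g t \<in> borel_measurable borel" for t
    using tame_measurable[OF has_tame_ft_tame[OF g]] by (cases "t \<in> {0..T}") (auto simp: g_def)
  have "\<forall>n. \<exists>(k::nat) c idx. idx \<in> measurable borel (count_space UNIV) \<and>
     (\<forall>t\<in>{0..T}. idx t < k \<and> c (idx t) \<in> {0..T} \<and> X_norm a \<sigma> s (f t - f (c (idx t))) < ennreal ((1/2) ^ n))"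
    by (intro allI continuous_step_index cont X_norm_zero) auto
  then obtain c :: "nat \<Rightarrow> nat \<Rightarrow> real" and idx :: "nat \<Rightarrow> real \<Rightarrow> nat" where idx[measurable]: "\<And>n. idx n \<in> measurable borel (count_space UNIV)"
    and c: "\<And>n t. t \<in> {0..T} \<Longrightarrow> c n (idx n t) \<in> {0..T} \<and> X_norm a \<sigma> s (f t - f (c n (idx n t))) < ennreal ((1/2) ^ n)"
    by metis
  define Vn where "Vn n t \<xi> = g (c n (idx n t)) \<xi>" for n t \<xi>
  have Vn[measurable]: "jmeas (Vn n)" for n
  proof -
    have "(\<lambda>z. (\<lambda>i z. g (c n i) (snd z)) (idx n (fst z)) z) \<in> borel_measurable (lborel \<Otimes>\<^sub>M lborel)"
      by (rule measurable_compose_countable) measurable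
    then show ?thesis by (simp add: Vn_def case_prod_beta')
  qed
  define V where "V t \<xi> = lim (\<lambda>n. Vn n t \<xi>)" for t \<xi>
  have jV: "jmeas V" unfolding V_def
    by (simp only: case_prod_beta') (rule borel_measurable_lim_metric, measurable)
  have "has_tame_ft (f t) (V t)" if t: "t \<in> {0..T}" for t
  proof (rule has_tame_ft_AE[OF g[OF t] jmeas_section[OF jV]])
    have Vm[measurable]: "Vn n t \<in> borel_measurable borel" for n by (rule jmeas_section[OF Vn])
    have le: "X s (\<lambda>\<xi>. ennreal (cmod (g t \<xi> - Vn n t \<xi>))) \<le> ennreal ((1/2) ^ n)" for n
    proof -
      have ct: "c n (idx n t) \<in> {0..T}" using c[OF t] by blast
      have "X s (\<lambda>\<xi>. ennreal (cmod (g t \<xi> - Vn n t \<xi>))) = X_norm a \<sigma> s (f t - f (c n (idx n t)))"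
        unfolding Vn_def by (rule X_norm_eq[symmetric, OF has_tame_ft_diff[OF g[OF t] g[OF ct]]])
      then show ?thesis using c[OF t, of n] by (metis less_imp_le)
    qed
    have "X s (\<lambda>\<xi>. \<Sum>n. ennreal (cmod (g t \<xi> - Vn n t \<xi>))) = (\<integral>\<^sup>+\<xi>. (\<Sum>n. W s \<xi> * ennreal (cmod (g t \<xi> - Vn n t \<xi>))) \<partial>lborel)"
      unfolding X_def by (simp only: ennreal_suminf_cmult)
    also have "\<dots> = (\<Sum>n. X s (\<lambda>\<xi>. ennreal (cmod (g t \<xi> - Vn n t \<xi>))))"
      unfolding X_def by (rule nn_integral_suminf) measurable
    also have "\<dots> \<le> (\<Sum>n. ennreal ((1/2) ^ n))" by (intro suminf_le le) auto
    also have "\<dots> < \<infinity>"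
      by (subst suminf_ennreal2) (auto intro: summable_geometric)
    finally have "AE \<xi> in lborel. (\<Sum>n. ennreal (cmod (g t \<xi> - Vn n t \<xi>))) < \<infinity>"
      by (rule X_finite_AE[rotated]) measurable
    then show "AE \<xi> in lborel. g t \<xi> = V t \<xi>"
    proof eventually_elim
      fix \<xi> assume "(\<Sum>n. ennreal (cmod (g t \<xi> - Vn n t \<xi>))) < \<infinity>"
      then have "summable (\<lambda>n. cmod (g t \<xi> - Vn n t \<xi>))" by (intro summable_suminf_not_top) auto
      then have "(\<lambda>n. cmod (g t \<xi> - Vn n t \<xi>)) \<longlonglongrightarrow> 0" by (rule summable_LIMSEQ_zero)
      then have "(\<lambda>n. g t \<xi> - Vn n t \<xi>) \<longlonglongrightarrow> 0" by (rule tendsto_norm_zero_cancel)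
      from tendsto_diff[OF tendsto_const[of "g t \<xi>"] this] have "(\<lambda>n. Vn n t \<xi>) \<longlonglongrightarrow> g t \<xi>" by simp
      then show "g t \<xi> = V t \<xi>" unfolding V_def by (simp add: limI)
    qed
  qed
  then show ?thesis using jV by blast
qed

lemma X_truncate:
  assumes r: "s \<le> r" and K: "0 \<le> K" and g: "g \<in> borel_measurable borel"
  shows "X r (\<lambda>\<xi>. indicator (cball 0 K) \<xi> * g \<xi>) \<le> ennreal (K powr (r - s)) * X s g"
proof -
  have "W r \<xi> * (indicator (cball 0 K) \<xi> * g \<xi>) \<le> ennreal (K powr (r - s)) * (W s \<xi> * g \<xi>)" for \<xi> :: "real^3"
  proof (cases "norm \<xi> \<le> K")
    case True
    have "W r \<xi> = W s \<xi> * ennreal (norm \<xi> powr (r - s))" using W_add[of s "r - s" \<xi>] by simp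
    also have "\<dots> \<le> W s \<xi> * ennreal (K powr (r - s))"
      using True r by (intro mult_left_mono ennreal_leI powr_mono2) auto
    finally have "W r \<xi> * g \<xi> \<le> W s \<xi> * ennreal (K powr (r - s)) * g \<xi>" by (rule mult_right_mono) simp
    then show ?thesis using True by (simp add: mult_ac)
  qed simp
  then have "X r (\<lambda>\<xi>. indicator (cball 0 K) \<xi> * g \<xi>) \<le> (\<integral>\<^sup>+\<xi>. ennreal (K powr (r - s)) * (W s \<xi> * g \<xi>) \<partial>lborel)"
    unfolding X_def by (intro nn_integral_mono)
  also have "\<dots> = ennreal (K powr (r - s)) * X s g" unfolding X_def using g by (intro nn_integral_cmult) measurable
  finally show ?thesis .
qed

text \<open>
  Step functions approximating \<open>f\<close> in \<open>X\<^sup>s\<close> are cut off to frequencies \<open>\<bar>\<xi>\<bar> \<le> K\<close>, where the norm of order \<open>r\<close> exceeds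
  that of order \<open>s\<close> by a factor at most \<open>K\<^sup>r\<^sup>-\<^sup>s\<close>. With a step error small compared with this factor, what remains is
  the error of the cutoff, which tends to zero at every time at which \<open>f\<close> has finite norm of order \<open>r\<close>.
\<close>

lemma simple_approximation:
  assumes s: "-1 \<le> s" "s \<le> 0" and r: "s \<le> r" and f: "f \<in> C_T T (X_norm a \<sigma> s)"
  shows "\<exists>S :: nat \<Rightarrow> real \<Rightarrow> tdist.
     (\<forall>n. finite (S n ` {0..T}) \<and> (\<forall>t\<in>{0..T}. X_norm a \<sigma> r (S n t) < \<infinity> \<and> (\<exists>g. has_tame_ft (S n t) g)) \<and>
        (\<forall>v. {t\<in>{0..T}. S n t = v} \<in> sets lebesgue)) \<and>
     (\<forall>t\<in>{0..T}. X_norm a \<sigma> r (f t) < \<infinity> \<longrightarrow> (\<lambda>n. X_norm a \<sigma> r (S n t - f t)) \<longlonglongrightarrow> 0)"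
proof -
  have fin: "X_norm a \<sigma> s (f t) < \<infinity>" if "t \<in> {0..T}" for t using f that by (auto simp: C_T_def)
  have cont: "((\<lambda>\<tau>. X_norm a \<sigma> s (f \<tau> - f t)) \<longlongrightarrow> 0) (at t within {0..T})" if "t \<in> {0..T}" for t
    using f that by (auto simp: C_T_def)
  define g where "g t = ft (f t)" for t
  have g: "has_tame_ft (f t) (g t)" if "t \<in> {0..T}" for t unfolding g_def by (rule X_norm_finite_tame[OF s fin[OF that]])
  \<comment> \<open>the step error, compensating the factor that the cutoff at \<open>Suc n\<close> costs, with a margin of \<open>1 / Suc n\<close>\<close>
  define e where "e n = 1 / (real (Suc n) * real (Suc n) powr (r - s))" for n
  have e: "0 < e n" for n by (simp add: e_def)
  have "\<forall>n. \<exists>(k::nat) c idx. idx \<in> measurable borel (count_space UNIV) \<and>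
     (\<forall>t\<in>{0..T}. idx t < k \<and> c (idx t) \<in> {0..T} \<and> X_norm a \<sigma> s (f t - f (c (idx t))) < ennreal (e n))"
    by (intro allI continuous_step_index cont X_norm_zero) (use e in auto)
  then obtain k :: "nat \<Rightarrow> nat" and c :: "nat \<Rightarrow> nat \<Rightarrow> real" and idx :: "nat \<Rightarrow> real \<Rightarrow> nat" where idx: "\<And>n. idx n \<in> measurable borel (count_space UNIV)"
    and c: "\<And>n t. t \<in> {0..T} \<Longrightarrow> idx n t < k n \<and> c n (idx n t) \<in> {0..T} \<and> X_norm a \<sigma> s (f t - f (c n (idx n t))) < ennreal (e n)"
    by metis
  define K where "K n = real (Suc n)" for n
  define tr :: "nat \<Rightarrow> (real^3 \<Rightarrow> complex) \<Rightarrow> real^3 \<Rightarrow> complex" where "tr n h \<xi> = indicator (cball 0 (K n)) \<xi> * h \<xi>" for n h \<xi>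
  define S where "S n t = inv_ft (tr n (g (c n (idx n t))))" for n t
  have trn: "ennreal (cmod (tr n h \<xi>)) = indicator (cball 0 (K n)) \<xi> * ennreal (cmod (h \<xi>))" for n h \<xi>
    by (simp add: tr_def indicator_def)
  have tame_tr: "tame (tr n (g t))" if "t \<in> {0..T}" for n t
    unfolding tr_def[abs_def] using has_tame_ft_tame[OF g[OF that]]
    by (rule tame_bounded_mult[where C = 1]) (auto simp: indicator_def)
  have S: "has_tame_ft (S n t) (tr n (g (c n (idx n t))))" if "t \<in> {0..T}" for n t
    unfolding S_def using c[OF that, of n] by (intro has_tame_ft_inv_ft tame_tr) auto
  have gm: "g t \<in> borel_measurable borel" if "t \<in> {0..T}" for t using tame_measurable[OF has_tame_ft_tame[OF g[OF that]]] .
  show ?thesis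
  proof (intro exI[of _ S] conjI allI ballI impI)
    fix n
    have "S n ` {0..T} \<subseteq> (\<lambda>i. inv_ft (tr n (g (c n i)))) ` {..<k n}" unfolding S_def using c by auto
    then show "finite (S n ` {0..T})" by (rule finite_subset) simp
    show "\<exists>g. has_tame_ft (S n t) g" if "t \<in> {0..T}" for t using S[OF that] by blast
    show "X_norm a \<sigma> r (S n t) < \<infinity>" if t: "t \<in> {0..T}" for t
    proof -
      have ct: "c n (idx n t) \<in> {0..T}" using c[OF t] by auto
      have "X_norm a \<sigma> r (S n t) \<le> ennreal (K n powr (r - s)) * X s (\<lambda>\<xi>. ennreal (cmod (g (c n (idx n t)) \<xi>)))"
        unfolding X_norm_eq[OF S[OF t]] trn using gm[OF ct] by (intro X_truncate[OF r]) (auto simp: K_def)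
      also have "\<dots> = ennreal (K n powr (r - s)) * X_norm a \<sigma> s (f (c n (idx n t)))"
        by (simp only: X_norm_eq[OF g[OF ct]])
      also have "\<dots> < \<infinity>" using fin[OF ct] by (simp add: ennreal_mult_less_top)
      finally show ?thesis .
    qed
    show "{t\<in>{0..T}. S n t = v} \<in> sets lebesgue" for v
    proof -
      have "idx n -` {i. inv_ft (tr n (g (c n i))) = v} \<inter> space borel \<in> sets borel"
        by (rule measurable_sets[OF idx]) simp
      then have "{0..T} \<inter> (idx n -` {i. inv_ft (tr n (g (c n i))) = v}) \<in> sets borel" by auto
      moreover have "{t\<in>{0..T}. S n t = v} = {0..T} \<inter> (idx n -` {i. inv_ft (tr n (g (c n i))) = v})"
        by (auto simp: S_def)
      ultimately show ?thesis by (metis sets_completionI_sets sets_lborel)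
    qed
  next
    fix t assume t: "t \<in> {0..T}" and fr: "X_norm a \<sigma> r (f t) < \<infinity>"
    note [measurable] = gm[OF t]
    let ?c = "\<lambda>n. c n (idx n t)"
    have ct: "?c n \<in> {0..T}" for n using c[OF t] by auto
    have gc[measurable]: "g (?c n) \<in> borel_measurable borel" for n by (rule gm[OF ct])
    let ?rest = "\<lambda>n \<xi>. indicator (- cball 0 (K n)) \<xi> * ennreal (cmod (g t \<xi>))"
    have le: "X_norm a \<sigma> r (S n t - f t) \<le> ennreal (1 / real (Suc n)) + X r (?rest n)" for n
    proof -
      have [measurable]: "cball 0 (K n) \<in> sets (borel :: (real^3) measure)" by simp
      have "X_norm a \<sigma> r (S n t - f t) = X r (\<lambda>\<xi>. ennreal (cmod (tr n (g (?c n)) \<xi> - g t \<xi>)))"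
        by (rule X_norm_eq[OF has_tame_ft_diff[OF S[OF t] g[OF t]]])
      also have "\<dots> \<le> X r (\<lambda>\<xi>. indicator (cball 0 (K n)) \<xi> * ennreal (cmod (g t \<xi> - g (?c n) \<xi>)) + ?rest n \<xi>)"
        by (intro X_mono) (auto simp: tr_def indicator_def norm_minus_commute)
      also have "\<dots> = X r (\<lambda>\<xi>. indicator (cball 0 (K n)) \<xi> * ennreal (cmod (g t \<xi> - g (?c n) \<xi>))) + X r (?rest n)"
        by (rule X_add) measurable
      also have "X r (\<lambda>\<xi>. indicator (cball 0 (K n)) \<xi> * ennreal (cmod (g t \<xi> - g (?c n) \<xi>)))
          \<le> ennreal (K n powr (r - s)) * X s (\<lambda>\<xi>. ennreal (cmod (g t \<xi> - g (?c n) \<xi>)))"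
        by (rule X_truncate[OF r]) (auto simp: K_def)
      also have "\<dots> \<le> ennreal (K n powr (r - s)) * ennreal (e n)"
        using c[OF t, of n] X_norm_eq[OF has_tame_ft_diff[OF g[OF t] g[OF ct]], of s n] by (intro mult_left_mono) auto
      also have "\<dots> = ennreal (1 / real (Suc n))"
        by (simp add: ennreal_mult[symmetric] e_def K_def less_imp_le)
      finally show ?thesis by (simp add: add_right_mono)
    qed
    have "(\<lambda>n. X r (?rest n)) \<longlonglongrightarrow> (\<integral>\<^sup>+\<xi>. 0 \<partial>(lborel :: (real^3) measure))"
      unfolding X_def
    proof (rule nn_integral_dominated_convergence[where w = "\<lambda>\<xi>. W r \<xi> * ennreal (cmod (g t \<xi>))"])
      show "(\<integral>\<^sup>+\<xi>. W r \<xi> * ennreal (cmod (g t \<xi>)) \<partial>lborel) < \<infinity>"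
        using fr unfolding X_norm_eq[OF g[OF t]] X_def .
      show "AE \<xi> in lborel. (\<lambda>n. W r \<xi> * ?rest n \<xi>) \<longlonglongrightarrow> 0"
      proof (rule AE_I2, rule tendsto_eventually)
        fix \<xi> :: "real^3"
        obtain m where m: "norm \<xi> < real m" using reals_Archimedean2 by blast
        show "eventually (\<lambda>n. W r \<xi> * ?rest n \<xi> = 0) sequentially"
          by (rule eventually_sequentiallyI[of m]) (use m in \<open>auto simp: K_def indicator_def\<close>)
      qed
    qed (auto simp: indicator_def K_def intro!: mult_left_mono)
    then have "(\<lambda>n. ennreal (1 / real (Suc n)) + X r (?rest n)) \<longlonglongrightarrow> ennreal 0 + 0"
      by (intro tendsto_add tendsto_ennrealI) (real_asymp, simp)
    then have "(\<lambda>n. ennreal (1 / real (Suc n)) + X r (?rest n)) \<longlonglongrightarrow> 0" by simp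
    then show "(\<lambda>n. X_norm a \<sigma> r (S n t - f t)) \<longlonglongrightarrow> 0"
      by (rule tendsto_sandwich[OF _ _ tendsto_const, rotated 2]) (use le in auto)
  qed
qed

lemma strongly_measurable_X:
  assumes s: "-1 \<le> s" "s \<le> 0" and r: "s \<le> r" and f: "f \<in> C_T T (X_norm a \<sigma> s)"
    and fr: "AE t in lebesgue_on {0..T}. X_norm a \<sigma> r (f t) < \<infinity>"
  shows "strongly_measurable T (X_norm a \<sigma> r) f"
proof -
  obtain S :: "nat \<Rightarrow> real \<Rightarrow> tdist" where S: "\<And>n. finite (S n ` {0..T})" "\<And>n t. t \<in> {0..T} \<Longrightarrow> X_norm a \<sigma> r (S n t) < \<infinity>"
     "\<And>n v. {t\<in>{0..T}. S n t = v} \<in> sets lebesgue"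
     "\<And>t. t \<in> {0..T} \<Longrightarrow> X_norm a \<sigma> r (f t) < \<infinity> \<Longrightarrow> (\<lambda>n. X_norm a \<sigma> r (S n t - f t)) \<longlonglongrightarrow> 0"
    using simple_approximation[OF s r f] by blast
  have "AE t in lebesgue_on {0..T}. (\<lambda>n. X_norm a \<sigma> r (S n t - f t)) \<longlonglongrightarrow> 0"
    using fr unfolding AE_lebesgue_on by eventually_elim (use S(4) in blast)
  then show ?thesis unfolding strongly_measurable_def using S(1-3) by blast
qed

lemma strongly_measurable_XV:
  assumes s: "-1 \<le> s" "s \<le> 0" and r: "s \<le> r" and f: "\<And>i. (\<lambda>t. f t $ i) \<in> C_T T (X_norm a \<sigma> s)"
    and fr: "AE t in lebesgue_on {0..T}. \<forall>i. X_norm a \<sigma> r (f t $ i) < \<infinity>"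
  shows "strongly_measurable T (XV_norm a \<sigma> r) f"
proof -
  have tf: "has_tame_ft (f t $ i) (ft (f t $ i))" if "t \<in> {0..T}" for t i
    using f[of i] that by (intro X_norm_finite_tame[OF s]) (auto simp: C_T_def)
  have "\<forall>i. \<exists>S :: nat \<Rightarrow> real \<Rightarrow> tdist.
     (\<forall>n. finite (S n ` {0..T}) \<and> (\<forall>t\<in>{0..T}. X_norm a \<sigma> r (S n t) < \<infinity> \<and> (\<exists>g. has_tame_ft (S n t) g)) \<and>
        (\<forall>v. {t\<in>{0..T}. S n t = v} \<in> sets lebesgue)) \<and>
     (\<forall>t\<in>{0..T}. X_norm a \<sigma> r (f t $ i) < \<infinity> \<longrightarrow> (\<lambda>n. X_norm a \<sigma> r (S n t - f t $ i)) \<longlonglongrightarrow> 0)"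
    by (intro allI simple_approximation[OF s r f])
  from choice[OF this] obtain S :: "3 \<Rightarrow> nat \<Rightarrow> real \<Rightarrow> tdist" where S0: "\<forall>i.
     (\<forall>n. finite (S i n ` {0..T}) \<and> (\<forall>t\<in>{0..T}. X_norm a \<sigma> r (S i n t) < \<infinity> \<and> (\<exists>g. has_tame_ft (S i n t) g)) \<and>
        (\<forall>v. {t\<in>{0..T}. S i n t = v} \<in> sets lebesgue)) \<and>
     (\<forall>t\<in>{0..T}. X_norm a \<sigma> r (f t $ i) < \<infinity> \<longrightarrow> (\<lambda>n. X_norm a \<sigma> r (S i n t - f t $ i)) \<longlonglongrightarrow> 0)"
    by (rule exE)
  have S: "\<And>i n. finite (S i n ` {0..T})" "\<And>i n t. t \<in> {0..T} \<Longrightarrow> X_norm a \<sigma> r (S i n t) < \<infinity>"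
     "\<And>i n t. t \<in> {0..T} \<Longrightarrow> \<exists>g. has_tame_ft (S i n t) g"
     "\<And>i n v. {t\<in>{0..T}. S i n t = v} \<in> sets lebesgue"
     "\<And>i t. t \<in> {0..T} \<Longrightarrow> X_norm a \<sigma> r (f t $ i) < \<infinity> \<Longrightarrow> (\<lambda>n. X_norm a \<sigma> r (S i n t - f t $ i)) \<longlonglongrightarrow> 0"
    using S0 by blast+
  define Q where "Q n t = (\<chi> i. S i n t)" for n t
  have tS: "has_tame_ft (S i n t) (ft (S i n t))" if "t \<in> {0..T}" for i n t
    using S(3)[OF that] has_tame_ft_ft(1) by blast
  have fin: "finite (Q n ` {0..T})" for n
  proof (rule finite_subset)
    show "Q n ` {0..T} \<subseteq> vec_lambda ` (PiE UNIV (\<lambda>i. S i n ` {0..T}))"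
    proof
      fix v assume "v \<in> Q n ` {0..T}"
      then obtain t where "t \<in> {0..T}" "v = (\<chi> i. S i n t)" by (auto simp: Q_def)
      then show "v \<in> vec_lambda ` (PiE UNIV (\<lambda>i. S i n ` {0..T}))" by (intro image_eqI[of _ _ "\<lambda>i. S i n t"]) auto
    qed
    show "finite (vec_lambda ` (PiE UNIV (\<lambda>i. S i n ` {0..T})))" by (intro finite_imageI finite_PiE S) auto
  qed
  have fQ: "XV_norm a \<sigma> r (Q n t) < \<infinity>" if t: "t \<in> {0..T}" for n t
  proof -
    have "XV_norm a \<sigma> r (Q n t) \<le> (\<Sum>i\<in>UNIV. X_norm a \<sigma> r (Q n t $ i))"
      by (rule XV_norm_le_sum[where g = "\<lambda>i. ft (S i n t)"]) (simp add: Q_def tS[OF t])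
    also have "\<dots> < \<infinity>" using S(2)[OF t] by (simp add: Q_def)
    finally show ?thesis .
  qed
  have mQ: "{t\<in>{0..T}. Q n t = v} \<in> sets lebesgue" for n v
  proof -
    have "{t\<in>{0..T}. Q n t = v} = (\<Inter>i\<in>UNIV. {t\<in>{0..T}. S i n t = v $ i})" by (auto simp: Q_def vec_eq_iff)
    also have "\<dots> \<in> sets lebesgue" by (rule sets.finite_INT) (use S(4) in auto)
    finally show ?thesis .
  qed
  have lim: "(\<lambda>n. XV_norm a \<sigma> r (Q n t - f t)) \<longlonglongrightarrow> 0" if t: "t \<in> {0..T}" and fr: "\<forall>i. X_norm a \<sigma> r (f t $ i) < \<infinity>" for t
  proof -
    have "(\<lambda>n. \<Sum>i\<in>UNIV. X_norm a \<sigma> r (S i n t - f t $ i)) \<longlonglongrightarrow> (\<Sum>i\<in>(UNIV::3 set). 0)"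
      by (intro tendsto_sum S(5) t) (use fr in auto)
    then have l: "(\<lambda>n. \<Sum>i\<in>UNIV. X_norm a \<sigma> r (S i n t - f t $ i)) \<longlonglongrightarrow> 0" by simp
    have "XV_norm a \<sigma> r (Q n t - f t) \<le> (\<Sum>i\<in>UNIV. X_norm a \<sigma> r (S i n t - f t $ i))" for n
    proof -
      have "XV_norm a \<sigma> r (Q n t - f t) \<le> (\<Sum>i\<in>UNIV. X_norm a \<sigma> r ((Q n t - f t) $ i))"
        by (rule XV_norm_le_sum[where g = "\<lambda>i \<xi>. ft (S i n t) \<xi> - ft (f t $ i) \<xi>"])
          (simp add: Q_def has_tame_ft_diff tS[OF t] tf[OF t])
      then show ?thesis by (simp add: Q_def)
    qed
    then show ?thesis by (intro tendsto_sandwich[OF _ _ tendsto_const l]) auto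
  qed
  have "AE t in lebesgue_on {0..T}. (\<lambda>n. XV_norm a \<sigma> r (Q n t - f t)) \<longlonglongrightarrow> 0"
    using fr unfolding AE_lebesgue_on by eventually_elim (use lim in blast)
  then show ?thesis unfolding strongly_measurable_def using fin fQ mQ by blast
qed

lemma bounded_by_finite_AE:
  assumes "jmeas \<phi>" "bounded_by T s \<gamma> \<phi> (ennreal R)"
  shows "AE t in lborel. t \<in> {0..T} \<longrightarrow> X (s + 2 * \<gamma>) (\<phi> t) < \<infinity>"
proof -
  note [measurable] = assms(1)
  have "L1X T (s + 2 * \<gamma>) \<phi> < \<infinity>"
    by (rule le_less_trans[of _ "ennreal R"]) (use assms(2) in \<open>auto simp: bounded_by_def\<close>)
  then have "AE t in lborel. indicator {0..T} t * X (s + 2 * \<gamma>) (\<phi> t) \<noteq> \<infinity>"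
    by (intro nn_integral_PInf_AE) auto
  then show ?thesis by eventually_elim (auto simp: indicator_def less_top)
qed

text \<open>
  Interpolation between \<open>s\<close> and \<open>s + 2\<gamma>\<close> with parameter \<open>1/p\<close>: the \<open>p\<close>-th power of the interpolated norm
  is bounded by a constant times one plus the norm of order \<open>s + 2\<gamma>\<close>, which is integrable.
\<close>

lemma Lp_bound:
  assumes j: "jmeas \<phi>" and R: "0 \<le> R" and b: "bounded_by T s \<gamma> \<phi> (ennreal R)" and p: "1 \<le> p" and \<gamma>: "0 < \<gamma>" and T: "0 \<le> T"
    and N: "\<And>t. t \<in> {0..T} \<Longrightarrow> N t = X (s + 2 * \<gamma> / p) (\<phi> t)"
  shows "AE t in lebesgue_on {0..T}. N t < \<infinity>"
    and "(\<integral>\<^sup>+t. ennreal (enn2real (N t) powr p) \<partial>lebesgue_on {0..T}) < \<infinity>"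
proof -
  note [measurable] = j
  have m: "\<phi> t \<in> borel_measurable borel" for t by (rule jmeas_section[OF j])
  have key: "\<exists>y\<ge>0. X (s + 2 * \<gamma> / p) (\<phi> t) = ennreal y \<and> ennreal (y powr p) \<le> ennreal ((R + 1) powr p) * (1 + X (s + 2 * \<gamma>) (\<phi> t))"
    if t: "t \<in> {0..T}" and f: "X (s + 2 * \<gamma>) (\<phi> t) < \<infinity>" for t
  proof -
    obtain x where x: "X (s + 2 * \<gamma>) (\<phi> t) = ennreal x" "0 \<le> x" using f by (metis ennreal_cases infinity_ennreal_def less_irrefl)
    have "X (s + 2 * \<gamma> * (1 / p)) (\<phi> t) \<le> ennreal ((1 + x) powr (1 / p)) * (X s (\<phi> t) + X (s + 2 * \<gamma>) (\<phi> t) * ennreal (1 / (1 + x)))"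
      using p \<gamma> x by (intro X_interpolation m) auto
    also have "\<dots> \<le> ennreal ((1 + x) powr (1 / p)) * (ennreal R + 1)"
    proof (intro mult_left_mono add_mono)
      show "X s (\<phi> t) \<le> ennreal R" using b t by (auto simp: bounded_by_def)
      show "X (s + 2 * \<gamma>) (\<phi> t) * ennreal (1 / (1 + x)) \<le> 1"
        using x by (simp add: ennreal_mult[symmetric] ennreal_le_1)
    qed auto
    also have "\<dots> = ennreal ((1 + x) powr (1 / p) * (R + 1))"
      using R by (simp add: ennreal_mult)
    finally have le: "X (s + 2 * \<gamma> / p) (\<phi> t) \<le> ennreal ((1 + x) powr (1 / p) * (R + 1))" by simp
    then obtain y where y: "X (s + 2 * \<gamma> / p) (\<phi> t) = ennreal y" "0 \<le> y"
      by (metis ennreal_cases ennreal_neq_top infinity_ennreal_def neq_top_trans)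
    have "y \<le> (1 + x) powr (1 / p) * (R + 1)" using le y R x by (subst (asm) y(1)) (simp add: ennreal_le_iff)
    then have "y powr p \<le> ((1 + x) powr (1 / p) * (R + 1)) powr p" using y p by (intro powr_mono2) auto
    also have "\<dots> = (R + 1) powr p * (1 + x)" using p x R by (simp add: powr_mult powr_powr mult.commute)
    finally have "ennreal (y powr p) \<le> ennreal ((R + 1) powr p * (1 + x))" by (rule ennreal_leI)
    also have "\<dots> = ennreal ((R + 1) powr p) * (1 + X (s + 2 * \<gamma>) (\<phi> t))" using x by (simp add: ennreal_mult)
    finally show ?thesis using y by blast
  qed
  note ae = bounded_by_finite_AE[OF j b]
  show "AE t in lebesgue_on {0..T}. N t < \<infinity>"
    unfolding AE_lebesgue_on using ae
  proof eventually_elim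
    fix t assume "t \<in> {0..T} \<longrightarrow> X (s + 2 * \<gamma>) (\<phi> t) < \<infinity>"
    then show "t \<in> {0..T} \<longrightarrow> N t < \<infinity>" using key[of t] N[of t] by auto
  qed
  have "(\<integral>\<^sup>+t. ennreal (enn2real (N t) powr p) \<partial>lebesgue_on {0..T}) = (\<integral>\<^sup>+t. indicator {0..T} t * ennreal (enn2real (N t) powr p) \<partial>lborel)"
    by (rule nn_integral_lebesgue_on) simp
  also have "\<dots> \<le> (\<integral>\<^sup>+t. ennreal ((R + 1) powr p) * (indicator {0..T} t + indicator {0..T} t * X (s + 2 * \<gamma>) (\<phi> t)) \<partial>lborel)"
  proof (rule nn_integral_mono_AE, use ae in eventually_elim)
    fix t assume f: "t \<in> {0..T} \<longrightarrow> X (s + 2 * \<gamma>) (\<phi> t) < \<infinity>"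
    show "indicator {0..T} t * ennreal (enn2real (N t) powr p) \<le> ennreal ((R + 1) powr p) * (indicator {0..T} t + indicator {0..T} t * X (s + 2 * \<gamma>) (\<phi> t))"
    proof (cases "t \<in> {0..T}")
      case True
      then obtain y where "y \<ge> 0" "X (s + 2 * \<gamma> / p) (\<phi> t) = ennreal y" "ennreal (y powr p) \<le> ennreal ((R + 1) powr p) * (1 + X (s + 2 * \<gamma>) (\<phi> t))"
        using key f by blast
      then show ?thesis using True N[OF True] by simp
    qed simp
  qed
  also have "\<dots> = ennreal ((R + 1) powr p) * (ennreal T + L1X T (s + 2 * \<gamma>) \<phi>)"
    using T by (subst nn_integral_cmult, measurable) (simp add: nn_integral_add)
  also have "\<dots> \<le> ennreal ((R + 1) powr p) * (ennreal T + ennreal R)"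
    using b by (intro mult_left_mono add_left_mono) (auto simp: bounded_by_def)
  also have "\<dots> < \<infinity>" using T R by (simp add: ennreal_plus[symmetric] ennreal_mult[symmetric] del: ennreal_plus)
  finally show "(\<integral>\<^sup>+t. ennreal (enn2real (N t) powr p) \<partial>lebesgue_on {0..T}) < \<infinity>" .
qed

end

section \<open>The Boussinesq system on the Fourier side\<close>

lemma sum_option: "(\<Sum>l\<in>UNIV. f l) = f None + (\<Sum>i\<in>UNIV. f (Some i))" for f :: "'b::finite option \<Rightarrow> 'c::comm_monoid_add"
  by (simp add: UNIV_option_conv sum.reindex)

text \<open>
  The four unknowns are indexed by \<open>3 option\<close>: velocity components are \<open>Some i\<close>, the temperature is \<open>None\<close>.
\<close>

definition bgam :: "real \<Rightarrow> real \<Rightarrow> 3 option \<Rightarrow> real" where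
  "bgam \<alpha> \<beta> k = (case k of None \<Rightarrow> \<beta> | Some _ \<Rightarrow> \<alpha>)"

text \<open>
  The constant of the convolution theorem.
\<close>

definition c0 :: complex where "c0 = of_real (1 / (2 * pi) ^ 3)"

text \<open>
  The advection terms are written in divergence form, \<open>\<nabla> \<sqdot> (u u)\<close> and \<open>\<nabla> \<sqdot> (u \<theta>)\<close>, and the first is followed by the
  Leray projector. The index \<open>p\<close> is that of the derivative.
\<close>

fun bA :: "3 option \<Rightarrow> 3 option \<Rightarrow> 3 option \<Rightarrow> real^3 \<Rightarrow> complex" where
  "bA (Some i) (Some p) (Some j) \<xi> = - (of_real (P i j \<xi>) * (c0 * (\<i> * of_real (\<xi> $ p))))"
| "bA None (Some p) None \<xi> = - (c0 * (\<i> * of_real (\<xi> $ p)))"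
| "bA _ _ _ \<xi> = 0"

fun bB :: "3 option \<Rightarrow> 3 option \<Rightarrow> real^3 \<Rightarrow> complex" where
  "bB (Some i) None \<xi> = of_real (P i 3 \<xi>)"
| "bB _ _ \<xi> = 0"

lemma bA_cases: "bA k l m \<xi> \<noteq> 0 \<Longrightarrow> \<exists>p. l = Some p"
  by (cases k; cases l; cases m) auto

lemma bA_measurable: "bA k l m \<in> borel_measurable borel"
proof -
  have [measurable]: "P i j \<in> borel_measurable borel" for i j by (rule P_measurable)
  have 1: "bA (Some i) (Some p) (Some j) = (\<lambda>\<xi>. - (of_real (P i j \<xi>) * (c0 * (\<i> * of_real (\<xi> $ p)))))" for i p j by (rule ext) simp
  have 2: "bA None (Some p) None = (\<lambda>\<xi>. - (c0 * (\<i> * of_real (\<xi> $ p))))" for p by (rule ext) simp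
  have 3: "bA (Some i) l None = (\<lambda>\<xi>. 0)" "bA None l (Some j) = (\<lambda>\<xi>. 0)" "bA k None m = (\<lambda>\<xi>. 0)" for i j k l m
    by (cases l; cases m; cases k; simp add: fun_eq_iff)+
  show ?thesis
    by (cases k; cases l; cases m) (simp_all only: 1 2 3, measurable)
qed

lemma bB_measurable: "bB k l \<in> borel_measurable borel"
proof -
  have [measurable]: "P i j \<in> borel_measurable borel" for i j by (rule P_measurable)
  have 1: "bB (Some i) None = (\<lambda>\<xi>. of_real (P i 3 \<xi>))" for i by (rule ext) simp
  have 2: "bB None l = (\<lambda>\<xi>. 0)" "bB k (Some j) = (\<lambda>\<xi>. 0)" for j k l
    by (cases l; cases k; simp add: fun_eq_iff)+
  show ?thesis by (cases k; cases l) (simp_all only: 1 2, measurable)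
qed

lemma norm_c0_le: "cmod c0 \<le> 1"
proof -
  have "1 \<le> (2 * pi) ^ 3" using pi_gt3 by (intro one_le_power) simp
  then show ?thesis by (simp add: c0_def norm_divide norm_power norm_mult divide_le_eq)
qed

lemma bA_bound: "cmod (bA k l m \<xi>) \<le> 2 * norm \<xi>"
proof -
  have 1: "cmod (c0 * (\<i> * of_real (\<xi> $ p))) \<le> norm \<xi>" for p
    using mult_mono[OF norm_c0_le component_le_norm_cart[of \<xi> p]] by (simp add: norm_mult)
  have 2: "cmod (of_real (P i j \<xi>) * (c0 * (\<i> * of_real (\<xi> $ p)))) \<le> 2 * norm \<xi>" for i j p
    using mult_mono[OF P_bound[of i j \<xi>] 1[of p]] unfolding norm_mult by simp
  show ?thesis
    using 1 2 order_trans[OF 1, of "2 * norm \<xi>"] by (cases k; cases l; cases m) auto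
qed

lemma bB_bound: "cmod (bB k l \<xi>) \<le> 2"
  using P_bound by (cases k; cases l) auto

lemma bA_reflect: "bA k l m (- \<xi>) = cnj (bA k l m \<xi>)"
  by (cases k; cases l; cases m) (simp_all add: P_reflect c0_def)

lemma bB_reflect: "bB k l (- \<xi>) = cnj (bB k l \<xi>)"
  by (cases k; cases l) (simp_all add: P_reflect)

definition fld :: "(real \<Rightarrow> tdist^3) \<Rightarrow> (real \<Rightarrow> tdist) \<Rightarrow> 3 option \<Rightarrow> real \<Rightarrow> tdist" where
  "fld u \<theta> k t = (case k of None \<Rightarrow> \<theta> t | Some i \<Rightarrow> u t $ i)"

text \<open>
  The three exponents belong to the interactions of velocity with velocity and of velocity
  with temperature, the latter in the two ways of distributing the derivative.
\<close>

locale boussinesq = weighted a \<sigma> for a \<sigma> +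
  fixes \<alpha> \<beta> s T \<delta> :: real
  assumes \<alpha>: "1/2 \<le> \<alpha>" and \<beta>: "1/2 \<le> \<beta>" and s_range: "-1 \<le> s" "s \<le> 0" and T_range: "0 < T" "T \<le> 1" and \<delta>_nonneg: "0 \<le> \<delta>"
    and ex1: "1 / (2 * \<alpha>) - s / (2 * \<alpha>) \<le> 1 - \<delta>"
    and ex2: "1 / (2 * \<alpha>) - s / (2 * \<beta>) \<le> 1 - \<delta>"
    and ex3: "1 / (2 * \<beta>) - s / (2 * \<alpha>) \<le> 1 - \<delta>"

sublocale boussinesq \<subseteq> duhamel_system a \<sigma> s T \<delta> 2 "bgam \<alpha> \<beta>" bA bB
proof
  fix k l m \<xi> assume nz: "bA k l m \<xi> \<noteq> 0"
  then obtain p where "l = Some p" using bA_cases by blast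
  then show "1 / (2 * bgam \<alpha> \<beta> l) - s / (2 * bgam \<alpha> \<beta> m) \<le> 1 - \<delta> \<and> 1 / (2 * bgam \<alpha> \<beta> m) - s / (2 * bgam \<alpha> \<beta> l) \<le> 1 - \<delta>"
    using ex1 ex2 ex3 by (cases m) (simp_all add: bgam_def)
next
  show "1 / 2 \<le> bgam \<alpha> \<beta> k" for k using \<alpha> \<beta> by (cases k) (simp_all add: bgam_def)
qed (use s_range T_range \<delta>_nonneg bA_measurable bB_measurable bA_bound bB_bound in auto)

context duhamel_system
begin

definition F1 :: "('i \<Rightarrow> complex path) \<Rightarrow> 'i \<Rightarrow> complex path" where
  "F1 U k \<tau> \<xi> = (\<Sum>l\<in>UNIV. \<Sum>m\<in>UNIV. A k l m \<xi> * Defs.convolution (U l \<tau>) (U m \<tau>) \<xi>)"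

definition F2 :: "('i \<Rightarrow> complex path) \<Rightarrow> 'i \<Rightarrow> complex path" where
  "F2 U k \<tau> \<xi> = (\<Sum>l\<in>UNIV. B k l \<xi> * U l \<tau> \<xi>)"

lemma F_split: "F U k \<tau> \<xi> = F1 U k \<tau> \<xi> + F2 U k \<tau> \<xi>"
  by (simp add: F_def F1_def F2_def)

lemma jmeas_F1:
  assumes [measurable]: "\<And>l. jmeas (U l)" shows "jmeas (F1 U k)"
proof -
  have [measurable]: "jmeas (\<lambda>\<tau>. Defs.convolution (U l \<tau>) (U m \<tau>))" for l m by (intro jmeas_convolution assms)
  show ?thesis unfolding F1_def by measurable
qed

lemma jmeas_F2:
  assumes [measurable]: "\<And>l. jmeas (U l)" shows "jmeas (F2 U k)"
  unfolding F2_def by measurable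

text \<open>
  Forcing terms in \<open>L\<^sup>1([0,T]; X\<^sup>s)\<close>, for which the Duhamel integral makes sense as a distribution.
\<close>

definition source :: "complex path \<Rightarrow> bool" where
  "source q \<longleftrightarrow> jmeas q \<and> L1X T s (\<lambda>t \<xi>. ennreal (cmod (q t \<xi>))) < \<infinity>"

lemma source_F1:
  assumes U: "\<And>l. jmeas (U l)" and R: "0 < R" and b: "\<And>l. bounded_by T s (\<gamma> l) (nrm U l) (ennreal R)"
  shows "source (F1 U k)"
proof -
  have le: "ennreal (cmod (F1 U k \<tau> \<xi>)) \<le> G (nrm U) (nrm U) k \<tau> \<xi>" for \<tau> \<xi>
    unfolding F1_def G_def
    by (intro order_trans[OF ennreal_norm_sum_le] sum_mono)
      (auto simp: ennreal_norm_mult nrm_def[abs_def] intro!: mult_left_mono convolution_le)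
  have "L1X T s (\<lambda>t \<xi>. ennreal (cmod (F1 U k t \<xi>))) \<le> L1X T s (G (nrm U) (nrm U) k)"
    by (intro nn_integral_mono mult_left_mono X_mono le) auto
  also have "\<dots> < \<infinity>"
    by (rule le_less_trans[OF integral_X_G[OF jmeas_nrm[OF U] jmeas_nrm[OF U] R R b b]]) simp
  finally show ?thesis by (simp add: source_def jmeas_F1[OF U])
qed

lemma source_F2:
  assumes U: "\<And>l. jmeas (U l)" and R: "0 < R" and b: "\<And>l. bounded_by T s (\<gamma> l) (nrm U l) (ennreal R)"
  shows "source (F2 U k)"
proof -
  have le: "ennreal (cmod (F2 U k \<tau> \<xi>)) \<le> L (nrm U) k \<tau> \<xi>" for \<tau> \<xi>
    unfolding F2_def L_def
    by (intro order_trans[OF ennreal_norm_sum_le] sum_mono) (simp add: ennreal_norm_mult nrm_def)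
  have "L1X T s (\<lambda>t \<xi>. ennreal (cmod (F2 U k t \<xi>))) \<le> L1X T s (L (nrm U) k)"
    by (intro nn_integral_mono mult_left_mono X_mono le) auto
  also have "\<dots> < \<infinity>"
    by (rule le_less_trans[OF integral_X_L[OF jmeas_nrm[OF U] R b]]) simp
  finally show ?thesis by (simp add: source_def jmeas_F2[OF U])
qed

lemma source_minus: "source q \<Longrightarrow> source (\<lambda>\<tau> \<xi>. - q \<tau> \<xi>)"
proof -
  assume q: "source q"
  then have [measurable]: "jmeas q" by (simp add: source_def)
  show "source (\<lambda>\<tau> \<xi>. - q \<tau> \<xi>)" using q unfolding source_def by auto
qed

lemma source_integrable_AE:
  assumes q: "source q" and t: "t \<in> {0..T}"
  shows "AE \<xi> in lborel. integrable lborel (\<lambda>\<tau>. of_real (E k t \<tau> \<xi>) * q \<tau> \<xi>)"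
proof -
  have j: "jmeas q" using q by (simp add: source_def)
  have jn: "jmeas (\<lambda>\<tau> \<xi>. ennreal (cmod (q \<tau> \<xi>)))" using j by measurable
  have "X s (tot (\<lambda>\<tau> \<xi>. ennreal (cmod (q \<tau> \<xi>)))) < \<infinity>" using q by (simp add: X_tot[OF jn] source_def)
  then have "AE \<xi> in lborel. tot (\<lambda>\<tau> \<xi>. ennreal (cmod (q \<tau> \<xi>))) \<xi> < \<infinity>" by (rule X_finite_AE[OF tot_measurable[OF jn]])
  then show ?thesis
  proof eventually_elim
    fix \<xi> assume f: "tot (\<lambda>\<tau> \<xi>. ennreal (cmod (q \<tau> \<xi>))) \<xi> < \<infinity>"
    show "integrable lborel (\<lambda>\<tau>. of_real (E k t \<tau> \<xi>) * q \<tau> \<xi>)"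
    proof (rule integrableI_bounded)
      have [measurable]: "(\<lambda>\<tau>. q \<tau> \<xi>) \<in> borel_measurable borel" "(\<lambda>\<tau>. E k t \<tau> \<xi>) \<in> borel_measurable borel"
        by (rule jmeas_section2[OF j] E_measurable; measurable?)+
      show "(\<lambda>\<tau>. of_real (E k t \<tau> \<xi>) * q \<tau> \<xi>) \<in> borel_measurable lborel" by measurable
      have "(\<integral>\<^sup>+\<tau>. ennreal (norm (of_real (E k t \<tau> \<xi>) * q \<tau> \<xi>)) \<partial>lborel) = duhamel_abs k (\<lambda>\<tau> \<xi>. ennreal (cmod (q \<tau> \<xi>))) t \<xi>"
        unfolding duhamel_abs_def by (simp add: ennreal_norm_mult E_nonneg)
      also have "\<dots> \<le> tot (\<lambda>\<tau> \<xi>. ennreal (cmod (q \<tau> \<xi>))) \<xi>" using t by (intro duhamel_abs_le_tot) auto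
      finally show "(\<integral>\<^sup>+\<tau>. ennreal (norm (of_real (E k t \<tau> \<xi>) * q \<tau> \<xi>)) \<partial>lborel) < \<infinity>" using f by (rule le_less_trans)
    qed
  qed
qed

lemma has_tint_heat:
  assumes q: "source q" and Q: "AE \<tau> in lborel. \<tau> \<in> {0..T} \<longrightarrow> has_tame_ft (Q \<tau>) (q \<tau>)" and t: "t \<in> {0..T}"
  shows "\<exists>I. has_tint t (\<lambda>\<tau>. heat (\<gamma> k) (t - \<tau>) (Q \<tau>)) I \<and> has_tame_ft I (duhamel k q t)"
proof -
  have j: "jmeas q" using q by (simp add: source_def)
  note [measurable] = j
  have [measurable]: "(\<lambda>z. E k t (fst z) (snd z)) \<in> borel_measurable (lborel \<Otimes>\<^sub>M lborel)"
    by (rule E_measurable; measurable)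
  have "\<exists>I. has_tint t (\<lambda>\<tau>. heat (\<gamma> k) (t - \<tau>) (Q \<tau>)) I \<and> has_tame_ft I (\<lambda>\<xi>. LINT \<tau>|lborel. of_real (E k t \<tau> \<xi>) * q \<tau> \<xi>)"
  proof (rule has_tint_of_ft)
    show "jmeas (\<lambda>\<tau> \<xi>. of_real (E k t \<tau> \<xi>) * q \<tau> \<xi>)" by measurable
    show "AE \<tau> in lborel. \<tau> \<in> {0..t} \<longrightarrow> has_tame_ft (heat (\<gamma> k) (t - \<tau>) (Q \<tau>)) (\<lambda>\<xi>. of_real (E k t \<tau> \<xi>) * q \<tau> \<xi>)"
      using Q
    proof eventually_elim
      fix \<tau> assume *: "\<tau> \<in> {0..T} \<longrightarrow> has_tame_ft (Q \<tau>) (q \<tau>)"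
      show "\<tau> \<in> {0..t} \<longrightarrow> has_tame_ft (heat (\<gamma> k) (t - \<tau>) (Q \<tau>)) (\<lambda>\<xi>. of_real (E k t \<tau> \<xi>) * q \<tau> \<xi>)"
        using has_tame_ft_heat[of "Q \<tau>" "q \<tau>" "t - \<tau>" "\<gamma> k"] * t by (auto simp: E_def)
    qed
    show "of_real (E k t \<tau> \<xi>) * q \<tau> \<xi> = 0" if "\<tau> \<notin> {0..t}" for \<tau> \<xi> using that by (auto simp: E_def)
    have "(\<integral>\<^sup>+\<tau>. (\<integral>\<^sup>+\<xi>. ennreal (cmod (of_real (E k t \<tau> \<xi>) * q \<tau> \<xi>) / (1 + norm \<xi>)\<^sup>2) \<partial>lborel) \<partial>lborel)
      \<le> (\<integral>\<^sup>+\<tau>. indicator {0..T} \<tau> * X s (\<lambda>\<xi>. ennreal (cmod (q \<tau> \<xi>))) \<partial>lborel)"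
    proof (rule nn_integral_mono)
      fix \<tau>
      show "(\<integral>\<^sup>+\<xi>. ennreal (cmod (of_real (E k t \<tau> \<xi>) * q \<tau> \<xi>) / (1 + norm \<xi>)\<^sup>2) \<partial>lborel) \<le> indicator {0..T} \<tau> * X s (\<lambda>\<xi>. ennreal (cmod (q \<tau> \<xi>)))"
      proof (cases "\<tau> \<in> {0..T}")
        case False
        then have "E k t \<tau> \<xi> = 0" for \<xi> using t by (auto simp: E_def)
        then show ?thesis by simp
      next
        case True
        have "(\<integral>\<^sup>+\<xi>. ennreal (cmod (of_real (E k t \<tau> \<xi>) * q \<tau> \<xi>) / (1 + norm \<xi>)\<^sup>2) \<partial>lborel) \<le> X s (\<lambda>\<xi>. ennreal (cmod (q \<tau> \<xi>)))"
          unfolding X_def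
        proof (rule nn_integral_mono_AE, use AE_neq[of 0] in eventually_elim)
          fix \<xi> :: "real^3" assume nz: "\<xi> \<noteq> 0"
          have p: "1 \<le> 1 + norm \<xi>" by simp
          have "cmod (of_real (E k t \<tau> \<xi>) * q \<tau> \<xi>) / (1 + norm \<xi>)\<^sup>2 \<le> cmod (q \<tau> \<xi>) / (1 + norm \<xi>)"
          proof (rule frac_le)
            show "cmod (of_real (E k t \<tau> \<xi>) * q \<tau> \<xi>) \<le> cmod (q \<tau> \<xi>)"
              using mult_right_mono[OF E_le_1[of k t \<tau> \<xi>], of "cmod (q \<tau> \<xi>)"] E_nonneg[of k t \<tau> \<xi>] by (simp add: norm_mult)
            show "1 + norm \<xi> \<le> (1 + norm \<xi>)\<^sup>2" using self_le_power[OF p, of 2] by simp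
          qed (use one_plus_norm_pos[of \<xi>] in auto)
          also have "\<dots> = 1 / (1 + norm \<xi>) * cmod (q \<tau> \<xi>)" by simp
          also have "\<dots> \<le> weight a \<sigma> s \<xi> * cmod (q \<tau> \<xi>)" by (intro mult_right_mono inverse_le_weight s nz) auto
          finally show "ennreal (cmod (of_real (E k t \<tau> \<xi>) * q \<tau> \<xi>) / (1 + norm \<xi>)\<^sup>2) \<le> W s \<xi> * ennreal (cmod (q \<tau> \<xi>))"
            by (simp add: W_def ennreal_mult[symmetric] weight_nonneg ennreal_leI)
        qed
        then show ?thesis using True by simp
      qed
    qed
    also have "\<dots> < \<infinity>" using q by (simp add: source_def)
    finally show "(\<integral>\<^sup>+\<tau>. (\<integral>\<^sup>+\<xi>. ennreal (cmod (of_real (E k t \<tau> \<xi>) * q \<tau> \<xi>) / (1 + norm \<xi>)\<^sup>2) \<partial>lborel) \<partial>lborel) < \<infinity>" .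
  qed
  then show ?thesis by (simp add: duhamel_def[abs_def])
qed

text \<open>
  The order \<open>0\<close> lies between \<open>s\<close> and \<open>s + 2r\<close>, and so does the order \<open>1\<close> if \<open>s + 2r \<ge> 1\<close>; at these
  orders the weight dominates \<open>1\<close> and \<open>\<bar>\<xi>\<bar>\<close>.
\<close>

lemma X_0_1_finite:
  assumes f: "f \<in> borel_measurable borel" and Xs: "X s f < \<infinity>" "X (s + 2 * r) f < \<infinity>" and r: "1/2 \<le> r"
  shows "(\<integral>\<^sup>+\<xi>. f \<xi> \<partial>lborel) < \<infinity>" and "1 \<le> s + 2 * r \<Longrightarrow> (\<integral>\<^sup>+\<xi>. ennreal (norm \<xi>) * f \<xi> \<partial>lborel) < \<infinity>"
proof -
  have X: "X (s + 2 * r * \<mu>) f < \<infinity>" if "0 \<le> \<mu>" "\<mu> \<le> 1" for \<mu>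
  proof -
    have "X (s + 2 * r * \<mu>) f \<le> ennreal (1 powr \<mu>) * (X s f + X (s + 2 * r) f * ennreal (1 / 1))"
      using that r by (intro X_interpolation f) auto
    also have "\<dots> < \<infinity>" using Xs by (simp add: less_top[symmetric])
    finally show ?thesis .
  qed
  have W0: "1 \<le> W 0 \<xi>" if "\<xi> \<noteq> 0" for \<xi>
    using that a by (simp add: W_def weight_def)
  have "X 0 f < \<infinity>" using X[of "- s / (2 * r)"] s r by (simp add: field_simps)
  moreover have "(\<integral>\<^sup>+\<xi>. f \<xi> \<partial>lborel) \<le> X 0 f" unfolding X_def
  proof (rule nn_integral_mono_AE, use AE_neq[of 0] in eventually_elim)
    fix \<xi> :: "real^3" assume "\<xi> \<noteq> 0"
    from mult_right_mono[OF W0[OF this], of "f \<xi>"] show "f \<xi> \<le> W 0 \<xi> * f \<xi>" by simp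
  qed
  ultimately show "(\<integral>\<^sup>+\<xi>. f \<xi> \<partial>lborel) < \<infinity>" by (rule le_less_trans[rotated])
  assume r1: "1 \<le> s + 2 * r"
  have "X 1 f < \<infinity>" using X[of "(1 - s) / (2 * r)"] s r r1 by (simp add: field_simps)
  moreover have "(\<integral>\<^sup>+\<xi>. ennreal (norm \<xi>) * f \<xi> \<partial>lborel) \<le> X 1 f" unfolding X_def
  proof (rule nn_integral_mono_AE, use AE_neq[of 0] in eventually_elim)
    fix \<xi> :: "real^3" assume nz: "\<xi> \<noteq> 0"
    have "W 1 \<xi> = W 0 \<xi> * ennreal (norm \<xi>)" using W_add[of 0 1 \<xi>] by simp
    then show "ennreal (norm \<xi>) * f \<xi> \<le> W 1 \<xi> * f \<xi>"
      using mult_right_mono[OF W0[OF nz], of "ennreal (norm \<xi>) * f \<xi>"] by (simp add: mult.assoc)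
  qed
  ultimately show "(\<integral>\<^sup>+\<xi>. ennreal (norm \<xi>) * f \<xi> \<partial>lborel) < \<infinity>" by (rule le_less_trans[rotated])
qed

end

context boussinesq
begin

lemma s_alpha: "1 \<le> s + 2 * \<alpha>"
proof -
  have "(1 - s) / (2 * \<alpha>) \<le> 1" using ex1 \<delta>_nonneg by (simp add: diff_divide_distrib)
  then show ?thesis using \<alpha> by (simp add: divide_le_eq)
qed

lemma bgam_simps [simp]: "bgam \<alpha> \<beta> None = \<beta>" "bgam \<alpha> \<beta> (Some i) = \<alpha>"
  by (simp_all add: bgam_def)

abbreviation flux :: "(3 option \<Rightarrow> complex path) \<Rightarrow> 3 option \<Rightarrow> complex path" where
  "flux U k \<tau> \<xi> \<equiv> of_real (1 / (2 * pi) ^ 3) * (\<Sum>p\<in>UNIV. \<i> * of_real (\<xi> $ p) * Defs.convolution (U (Some p) \<tau>) (U k \<tau>) \<xi>)"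

abbreviation advection :: "(real \<Rightarrow> tdist^3) \<Rightarrow> real \<Rightarrow> real \<Rightarrow> tdist^3" where
  "advection u t \<equiv> \<lambda>\<tau>. heatV \<alpha> (t - \<tau>) (leray (advV (u \<tau>) (u \<tau>)))"

abbreviation buoyancy :: "(real \<Rightarrow> tdist) \<Rightarrow> real \<Rightarrow> real \<Rightarrow> tdist^3" where
  "buoyancy \<theta> t \<equiv> \<lambda>\<tau>. heatV \<alpha> (t - \<tau>) (leray (times_e3 (\<theta> \<tau>)))"

abbreviation transport :: "(real \<Rightarrow> tdist^3) \<Rightarrow> (real \<Rightarrow> tdist) \<Rightarrow> real \<Rightarrow> real \<Rightarrow> tdist" where
  "transport u \<theta> t \<equiv> \<lambda>\<tau>. heat \<beta> (t - \<tau>) (adv (u \<tau>) (\<theta> \<tau>))"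

lemma F1_Some: "F1 U (Some i) \<tau> \<xi> = - (\<Sum>j\<in>UNIV. of_real (P i j \<xi>) *
    flux U (Some j) \<tau> \<xi>)"
proof -
  have "F1 U (Some i) \<tau> \<xi> = (\<Sum>p\<in>UNIV. \<Sum>j\<in>UNIV. - (of_real (P i j \<xi>) * (c0 * (\<i> * of_real (\<xi> $ p)))) * Defs.convolution (U (Some p) \<tau>) (U (Some j) \<tau>) \<xi>)"
    unfolding F1_def by (simp add: sum_option)
  also have "\<dots> = (\<Sum>j\<in>UNIV. \<Sum>p\<in>UNIV. - (of_real (P i j \<xi>) * (c0 * (\<i> * of_real (\<xi> $ p)))) * Defs.convolution (U (Some p) \<tau>) (U (Some j) \<tau>) \<xi>)"
    by (rule sum.swap)
  finally show ?thesis unfolding c0_def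
    by (simp add: sum_distrib_left sum_negf mult.assoc)
qed

lemma F1_None: "F1 U None \<tau> \<xi> = - flux U None \<tau> \<xi>"
  unfolding F1_def c0_def[symmetric] by (simp add: sum_option sum_distrib_left sum_negf mult.assoc)

lemma F2_Some: "F2 U (Some i) \<tau> \<xi> = of_real (P i 3 \<xi>) * U None \<tau> \<xi>"
  unfolding F2_def by (simp add: sum_option)

lemma F2_None: "F2 U None \<tau> \<xi> = 0"
  unfolding F2_def by (simp add: sum_option)

text \<open>
  \<open>U\<close> is a jointly measurable version of the Fourier transforms of the fields, in the ball of radius \<open>R\<close>, and the velocity is
  divergence free.
\<close>

definition represents :: "(3 option \<Rightarrow> complex path) \<Rightarrow> real \<Rightarrow> (real \<Rightarrow> tdist^3) \<Rightarrow> (real \<Rightarrow> tdist) \<Rightarrow> bool" where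
  "represents U R u \<theta> \<longleftrightarrow> (\<forall>k. jmeas (U k)) \<and> (\<forall>k. bounded_by T s (bgam \<alpha> \<beta> k) (nrm U k) (ennreal R)) \<and> 0 < R \<and>
     (\<forall>t\<in>{0..T}. (\<forall>k. has_tame_ft (fld u \<theta> k t) (U k t)) \<and> (AE \<xi> in lborel. (\<Sum>j\<in>UNIV. of_real (\<xi> $ j) * U (Some j) t \<xi>) = 0))"

lemma represents_tame:
  assumes "represents U R u \<theta>" "t \<in> {0..T}"
  shows "has_tame_ft (fld u \<theta> k t) (U k t)" "tame (\<lambda>\<xi>. \<i> * of_real (\<xi> $ j) * U k t \<xi>)" "X s (nrm U k t) < \<infinity>"
proof -
  show 1: "has_tame_ft (fld u \<theta> k t) (U k t)" using assms by (auto simp: represents_def)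
  show X: "X s (nrm U k t) < \<infinity>" by (rule le_less_trans[of _ "ennreal R"]) (use assms in \<open>auto simp: represents_def bounded_by_def\<close>)
  show "tame (\<lambda>\<xi>. \<i> * of_real (\<xi> $ j) * U k t \<xi>)"
    using tame_X(2)[OF s tame_measurable[OF has_tame_ft_tame[OF 1]]] X by (simp add: nrm_def[abs_def])
qed

lemma represents_adv:
  assumes r: "represents U R u \<theta>"
  shows "AE \<tau> in lborel. \<tau> \<in> {0..T} \<longrightarrow> (\<forall>k. has_tame_ft (adv (u \<tau>) (fld u \<theta> k \<tau>))
     (flux U k \<tau>))"
proof -
  have j: "jmeas (U k)" for k using r by (simp add: represents_def)
  have "AE \<tau> in lborel. \<tau> \<in> {0..T} \<longrightarrow> X (s + 2 * bgam \<alpha> \<beta> k) (nrm U k \<tau>) < \<infinity>" for k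
    using r by (intro bounded_by_finite_AE[OF jmeas_nrm[OF j]]) (auto simp: represents_def)
  then have "AE \<tau> in lborel. \<forall>k. \<tau> \<in> {0..T} \<longrightarrow> X (s + 2 * bgam \<alpha> \<beta> k) (nrm U k \<tau>) < \<infinity>"
    by (subst AE_all_countable) blast
  then show ?thesis
  proof eventually_elim
    fix \<tau> assume *: "\<forall>k. \<tau> \<in> {0..T} \<longrightarrow> X (s + 2 * bgam \<alpha> \<beta> k) (nrm U k \<tau>) < \<infinity>"
    show "\<tau> \<in> {0..T} \<longrightarrow> (\<forall>k. has_tame_ft (adv (u \<tau>) (fld u \<theta> k \<tau>))
       (flux U k \<tau>))"
    proof (intro impI allI has_tame_ft_adv)
      fix k assume \<tau>: "\<tau> \<in> {0..T}"
      have nm: "nrm U k \<tau> \<in> borel_measurable borel" for k by (rule jmeas_section[OF jmeas_nrm[OF j]])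
      note fin = X_0_1_finite[OF nm represents_tame(3)[OF r \<tau>] *[rule_format, OF \<tau>] \<gamma>]
      show "has_tame_ft (u \<tau> $ p) (U (Some p) \<tau>)" for p using represents_tame(1)[OF r \<tau>, of "Some p"] by (simp add: fld_def)
      show "has_tame_ft (fld u \<theta> k \<tau>) (U k \<tau>)" by (rule represents_tame(1)[OF r \<tau>])
      show "tame (\<lambda>\<xi>. \<i> * of_real (\<xi> $ p) * U k \<tau> \<xi>)" for p by (rule represents_tame(2)[OF r \<tau>])
      show "(\<integral>\<^sup>+\<xi>. ennreal (cmod (U (Some p) \<tau> \<xi>)) \<partial>lborel) < \<infinity>" for p using fin(1)[of "Some p"] by (simp add: nrm_def)
      show "(\<integral>\<^sup>+\<xi>. ennreal (cmod (U k \<tau> \<xi>)) \<partial>lborel) < \<infinity>" using fin(1)[of k] by (simp add: nrm_def)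
      show "(\<integral>\<^sup>+\<xi>. ennreal (norm \<xi>) * ennreal (cmod (U (Some p) \<tau> \<xi>)) \<partial>lborel) < \<infinity>" for p
        using fin(2)[of "Some p"] s_alpha by (simp add: nrm_def)
      show "AE \<xi> in lborel. (\<Sum>j\<in>UNIV. of_real (\<xi> $ j) * U (Some j) \<tau> \<xi>) = 0" using r \<tau> by (auto simp: represents_def)
    qed
  qed
qed

text \<open>
  The integrals in the mild formulation exist as distributions, and the right-hand sides have
  the right-hand sides of the integral equation as transforms. Since distribution-valued integrals are unique, this
  translates the mild formulation in both directions.
\<close>

lemma mild_integrals:
  assumes r: "represents U R u \<theta>" and d: "\<And>i. has_tame_ft (u0 $ i) (d (Some i))" "has_tame_ft \<theta>0 (d None)" and t: "t \<in> {0..T}"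
  shows "\<exists>A B D. has_tintV t (advection u t) A \<and>
      has_tintV t (buoyancy \<theta> t) B \<and>
      has_tint t (transport u \<theta> t) D \<and>
      (\<forall>i. has_tame_ft ((heatV \<alpha> t u0 - A + B) $ i) (rhs U d (Some i) t)) \<and>
      has_tame_ft (heat \<beta> t \<theta>0 - D) (rhs U d None t)"
proof -
  have j: "jmeas (U k)" for k using r by (simp add: represents_def)
  have R: "0 < R" and b: "bounded_by T s (bgam \<alpha> \<beta> k) (nrm U k) (ennreal R)" for k using r by (auto simp: represents_def)
  note s1 = source_minus[OF source_F1[OF j R b]] and s2 = source_F2[OF j R b]
  have dm: "d k \<in> borel_measurable borel" for k
    using tame_measurable[OF has_tame_ft_tame] d by (cases k) auto
  have L1: "AE \<tau> in lborel. \<tau> \<in> {0..T} \<longrightarrow> has_tame_ft (leray (advV (u \<tau>) (u \<tau>)) $ i) (\<lambda>\<xi>. - F1 U (Some i) \<tau> \<xi>)" for i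
    using represents_adv[OF r]
  proof eventually_elim
    fix \<tau> assume *: "\<tau> \<in> {0..T} \<longrightarrow> (\<forall>k. has_tame_ft (adv (u \<tau>) (fld u \<theta> k \<tau>))
       (flux U k \<tau>))"
    show "\<tau> \<in> {0..T} \<longrightarrow> has_tame_ft (leray (advV (u \<tau>) (u \<tau>)) $ i) (\<lambda>\<xi>. - F1 U (Some i) \<tau> \<xi>)"
    proof
      assume \<tau>: "\<tau> \<in> {0..T}"
      have "has_tame_ft (advV (u \<tau>) (u \<tau>) $ l) (flux U (Some l) \<tau>)" for l
        using *[rule_format, OF \<tau>, of "Some l"] by (simp add: advV_def fld_def)
      from has_tame_ft_leray[OF this, of i]
      show "has_tame_ft (leray (advV (u \<tau>) (u \<tau>)) $ i) (\<lambda>\<xi>. - F1 U (Some i) \<tau> \<xi>)" by (simp only: F1_Some minus_minus)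
    qed
  qed
  have L2: "AE \<tau> in lborel. \<tau> \<in> {0..T} \<longrightarrow> has_tame_ft (leray (times_e3 (\<theta> \<tau>)) $ i) (F2 U (Some i) \<tau>)" for i
  proof (rule AE_I2, rule impI)
    fix \<tau> assume \<tau>: "\<tau> \<in> {0..T}"
    have "has_tame_ft (times_e3 (\<theta> \<tau>) $ l) (\<lambda>\<xi>. if l = 3 then U None \<tau> \<xi> else 0)" for l
      using represents_tame(1)[OF r \<tau>, of None] has_tame_ft_zero by (simp add: times_e3_def fld_def)
    from has_tame_ft_leray[OF this, of i]
    have "has_tame_ft (leray (times_e3 (\<theta> \<tau>)) $ i) (\<lambda>\<xi>. \<Sum>l\<in>UNIV. of_real (P i l \<xi>) * (if l = 3 then U None \<tau> \<xi> else 0))" .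
    moreover have "(\<Sum>l\<in>UNIV. of_real (P i l \<xi>) * (if l = 3 then U None \<tau> \<xi> else 0)) = F2 U (Some i) \<tau> \<xi>" for \<xi>
      unfolding F2_Some by (subst sum.remove[of _ 3]) (auto intro: sum.neutral)
    ultimately show "has_tame_ft (leray (times_e3 (\<theta> \<tau>)) $ i) (F2 U (Some i) \<tau>)" by simp
  qed
  have L3: "AE \<tau> in lborel. \<tau> \<in> {0..T} \<longrightarrow> has_tame_ft (adv (u \<tau>) (\<theta> \<tau>)) (\<lambda>\<xi>. - F1 U None \<tau> \<xi>)"
    using represents_adv[OF r]
  proof eventually_elim
    fix \<tau> assume *: "\<tau> \<in> {0..T} \<longrightarrow> (\<forall>k. has_tame_ft (adv (u \<tau>) (fld u \<theta> k \<tau>))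
       (flux U k \<tau>))"
    show "\<tau> \<in> {0..T} \<longrightarrow> has_tame_ft (adv (u \<tau>) (\<theta> \<tau>)) (\<lambda>\<xi>. - F1 U None \<tau> \<xi>)"
    proof
      assume \<tau>: "\<tau> \<in> {0..T}"
      show "has_tame_ft (adv (u \<tau>) (\<theta> \<tau>)) (\<lambda>\<xi>. - F1 U None \<tau> \<xi>)"
        using *[rule_format, OF \<tau>, of None] unfolding F1_None minus_minus by (simp add: fld_def)
    qed
  qed
  have "\<forall>i. \<exists>I. has_tint t (\<lambda>\<tau>. heat \<alpha> (t - \<tau>) (leray (advV (u \<tau>) (u \<tau>)) $ i)) I \<and> has_tame_ft I (duhamel (Some i) (\<lambda>\<tau> \<xi>. - F1 U (Some i) \<tau> \<xi>) t)"
    by (rule allI) (rule has_tint_heat[OF s1 L1 t, where k = "Some _", unfolded bgam_simps])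
  from choice[OF this] obtain A0 where A0': "\<forall>i. has_tint t (\<lambda>\<tau>. heat \<alpha> (t - \<tau>) (leray (advV (u \<tau>) (u \<tau>)) $ i)) (A0 i) \<and>
     has_tame_ft (A0 i) (duhamel (Some i) (\<lambda>\<tau> \<xi>. - F1 U (Some i) \<tau> \<xi>) t)" ..
  note A0 = A0'[rule_format, THEN conjunct1] A0'[rule_format, THEN conjunct2]
  have "\<forall>i. \<exists>I. has_tint t (\<lambda>\<tau>. heat \<alpha> (t - \<tau>) (leray (times_e3 (\<theta> \<tau>)) $ i)) I \<and> has_tame_ft I (duhamel (Some i) (F2 U (Some i)) t)"
    by (rule allI) (rule has_tint_heat[OF s2 L2 t, where k = "Some _", unfolded bgam_simps])
  from choice[OF this] obtain B0 where B0': "\<forall>i. has_tint t (\<lambda>\<tau>. heat \<alpha> (t - \<tau>) (leray (times_e3 (\<theta> \<tau>)) $ i)) (B0 i) \<and>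
     has_tame_ft (B0 i) (duhamel (Some i) (F2 U (Some i)) t)" ..
  note B0 = B0'[rule_format, THEN conjunct1] B0'[rule_format, THEN conjunct2]
  obtain D where D: "has_tint t (transport u \<theta> t) D" "has_tame_ft D (duhamel None (\<lambda>\<tau> \<xi>. - F1 U None \<tau> \<xi>) t)"
    using has_tint_heat[OF s1 L3 t, of None] by auto
  have Ym: "(rhs U d k t) \<in> borel_measurable borel" for k
  proof -
    have [measurable]: "duhamel k (F U k) t \<in> borel_measurable borel" "E k t 0 \<in> borel_measurable borel"
      by (rule jmeas_section[OF jmeas_duhamel[OF jmeas_F[OF j]]] E_measurable; measurable?)+
    show ?thesis using dm[of k] by measurable
  qed
  have split: "AE \<xi> in lborel. duhamel k (F U k) t \<xi> = - duhamel k (\<lambda>\<tau> \<xi>. - F1 U k \<tau> \<xi>) t \<xi> + duhamel k (F2 U k) t \<xi>" for k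
    using source_integrable_AE[OF s1 t, of k k] source_integrable_AE[OF s2 t, of k k]
  proof eventually_elim
    fix \<xi> assume i: "integrable lborel (\<lambda>\<tau>. of_real (E k t \<tau> \<xi>) * - F1 U k \<tau> \<xi>)" "integrable lborel (\<lambda>\<tau>. of_real (E k t \<tau> \<xi>) * F2 U k \<tau> \<xi>)"
    show "duhamel k (F U k) t \<xi> = - duhamel k (\<lambda>\<tau> \<xi>. - F1 U k \<tau> \<xi>) t \<xi> + duhamel k (F2 U k) t \<xi>"
      unfolding duhamel_def using Bochner_Integration.integral_diff[OF i(2,1)] by (simp add: F_split algebra_simps)
  qed
  have E0: "E k t 0 \<xi> = exp (- t * norm \<xi> powr (2 * bgam \<alpha> \<beta> k))" for k \<xi> using t by (simp add: E_def)
  show ?thesis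
  proof (rule exI[of _ "\<chi> i. A0 i"], rule exI[of _ "\<chi> i. B0 i"], rule exI[of _ D], intro conjI allI D(1))
    show "has_tintV t (advection u t) (\<chi> i. A0 i)"
      using A0(1) by (simp add: has_tintV_def heatV_def)
    show "has_tintV t (buoyancy \<theta> t) (\<chi> i. B0 i)"
      using B0(1) by (simp add: has_tintV_def heatV_def)
    show "has_tame_ft ((heatV \<alpha> t u0 - (\<chi> i. A0 i) + (\<chi> i. B0 i)) $ i) (rhs U d (Some i) t)" for i
    proof (rule has_tame_ft_AE[OF _ Ym])
      have h: "has_tame_ft (heat \<alpha> t (u0 $ i)) (\<lambda>\<xi>. of_real (E (Some i) t 0 \<xi>) * d (Some i) \<xi>)"
        using has_tame_ft_heat[OF d(1)[of i], of t \<alpha>] t by (simp add: E0)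
      show "has_tame_ft ((heatV \<alpha> t u0 - (\<chi> i. A0 i) + (\<chi> i. B0 i)) $ i) (\<lambda>\<xi>. of_real (E (Some i) t 0 \<xi>) * d (Some i) \<xi> - duhamel (Some i) (\<lambda>\<tau> \<xi>. - F1 U (Some i) \<tau> \<xi>) t \<xi> + duhamel (Some i) (F2 U (Some i)) t \<xi>)"
        using has_tame_ft_add[OF has_tame_ft_diff[OF h A0(2)[of i]] B0(2)[of i]] by (simp add: heatV_def)
      show "AE \<xi> in lborel. of_real (E (Some i) t 0 \<xi>) * d (Some i) \<xi> - duhamel (Some i) (\<lambda>\<tau> \<xi>. - F1 U (Some i) \<tau> \<xi>) t \<xi> + duhamel (Some i) (F2 U (Some i)) t \<xi>
         = rhs U d (Some i) t \<xi>"
        using split[of "Some i"] by eventually_elim simp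
    qed
    show "has_tame_ft (heat \<beta> t \<theta>0 - D) (rhs U d None t)"
    proof (rule has_tame_ft_AE[OF _ Ym])
      have h: "has_tame_ft (heat \<beta> t \<theta>0) (\<lambda>\<xi>. of_real (E None t 0 \<xi>) * d None \<xi>)"
        using has_tame_ft_heat[OF d(2), of t \<beta>] t by (simp add: E0)
      show "has_tame_ft (heat \<beta> t \<theta>0 - D) (\<lambda>\<xi>. of_real (E None t 0 \<xi>) * d None \<xi> - duhamel None (\<lambda>\<tau> \<xi>. - F1 U None \<tau> \<xi>) t \<xi>)"
        by (rule has_tame_ft_diff[OF h D(2)])
      have z: "duhamel None (F2 U None) t \<xi> = 0" for \<xi> unfolding duhamel_def F2_None by simp
      show "AE \<xi> in lborel. of_real (E None t 0 \<xi>) * d None \<xi> - duhamel None (\<lambda>\<tau> \<xi>. - F1 U None \<tau> \<xi>) t \<xi>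
         = rhs U d None t \<xi>"
        using split[of None] by eventually_elim (simp add: z)
    qed
  qed
qed

lemma mild_imp_solves:
  assumes r: "represents U R u \<theta>" and d: "\<And>i. has_tame_ft (u0 $ i) (d (Some i))" "has_tame_ft \<theta>0 (d None)"
    and m: "mild_solution \<alpha> \<beta> T u0 \<theta>0 u \<theta>"
  shows "solves U d"
  unfolding solves_def
proof (intro ballI allI)
  fix t k assume t: "t \<in> {0..T}"
  obtain A B D where *: "has_tintV t (advection u t) A"
      "has_tintV t (buoyancy \<theta> t) B"
      "has_tint t (transport u \<theta> t) D"
      "\<And>i. has_tame_ft ((heatV \<alpha> t u0 - A + B) $ i) (rhs U d (Some i) t)"
      "has_tame_ft (heat \<beta> t \<theta>0 - D) (rhs U d None t)"
    using mild_integrals[OF r d t] by blast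
  obtain A' B' D' where **: "has_tintV t (advection u t) A'"
      "has_tintV t (buoyancy \<theta> t) B'" "u t = heatV \<alpha> t u0 - A' + B'"
      "has_tint t (transport u \<theta> t) D'" "\<theta> t = heat \<beta> t \<theta>0 - D'"
    using m t unfolding mild_solution_def by blast
  have "A' = A" "B' = B"
    using *(1,2) **(1,2) unfolding has_tintV_def by (auto simp: vec_eq_iff intro: has_tint_unique)
  moreover have "D' = D" using *(3) **(4) by (rule has_tint_unique[rotated])
  ultimately have "has_tame_ft (fld u \<theta> k t) (rhs U d k t)"
    using *(4,5) **(3,5) by (cases k) (simp_all add: fld_def)
  then show "AE \<xi> in lborel. U k t \<xi> = rhs U d k t \<xi>"
    by (rule has_tame_ft_unique_fun[OF represents_tame(1)[OF r t]])
qed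

lemma solves_imp_mild:
  assumes r: "represents U R u \<theta>" and d: "\<And>i. has_tame_ft (u0 $ i) (d (Some i))" "has_tame_ft \<theta>0 (d None)"
    and sol: "solves U d" and real: "\<And>t k. t \<in> {0..T} \<Longrightarrow> AE \<xi> in lborel. U k t (- \<xi>) = cnj (U k t \<xi>)"
  shows "mild_solution \<alpha> \<beta> T u0 \<theta>0 u \<theta>"
  unfolding mild_solution_def
proof (intro ballI conjI allI)
  fix t assume t: "t \<in> {0..T}"
  note ft = represents_tame(1)[OF r t]
  have ftS: "has_tame_ft (u t $ i) (U (Some i) t)" for i using ft[of "Some i"] by (simp add: fld_def)
  have ftN: "has_tame_ft (\<theta> t) (U None t)" using ft[of None] by (simp add: fld_def)
  show "real_dist (u t $ i)" for i using real[OF t] real_dist_iff[OF ftS] by blast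
  show "real_dist (\<theta> t)" using real[OF t] real_dist_iff[OF ftN] by blast
  show "div_free (u t)" using div_free_iff[OF ftS represents_tame(2)[OF r t]] r t by (auto simp: represents_def)
  obtain A B D where *: "has_tintV t (advection u t) A"
      "has_tintV t (buoyancy \<theta> t) B"
      "has_tint t (transport u \<theta> t) D"
      "\<And>i. has_tame_ft ((heatV \<alpha> t u0 - A + B) $ i) (rhs U d (Some i) t)"
      "has_tame_ft (heat \<beta> t \<theta>0 - D) (rhs U d None t)"
    using mild_integrals[OF r d t] by blast
  have "has_tame_ft (fld u \<theta> k t) (rhs U d k t)" for k
  proof (rule has_tame_ft_AE[OF ft])
    show "AE \<xi> in lborel. U k t \<xi> = rhs U d k t \<xi>"
      using sol t by (auto simp: solves_def)
    show "(rhs U d k t) \<in> borel_measurable borel"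
      using tame_measurable[OF has_tame_ft_tame[OF *(4)]] tame_measurable[OF has_tame_ft_tame[OF *(5)]] by (cases k) auto
  qed
  note Y = this
  have "u t = heatV \<alpha> t u0 - A + B"
    unfolding vec_eq_iff using has_tame_ft_unique[OF Y[of "Some _"] *(4)] by (simp add: fld_def)
  then show "\<exists>A B. has_tintV t (advection u t) A \<and>
            has_tintV t (buoyancy \<theta> t) B \<and> u t = heatV \<alpha> t u0 - A + B"
    using *(1,2) by blast
  have "\<theta> t = heat \<beta> t \<theta>0 - D"
    using has_tame_ft_unique[OF Y[of None] *(5)] by (simp add: fld_def)
  then show "\<exists>D. has_tint t (transport u \<theta> t) D \<and> \<theta> t = heat \<beta> t \<theta>0 - D"
    using *(3) by blast
qed

text \<open>
  The symbol \<open>\<xi>\<close> annihilates the data and, by orthogonality to the range of the Leray symbol, the nonlinearity; all velocity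
  components have the same heat kernel, so it annihilates the solution.
\<close>

lemma solves_div_free:
  assumes U: "\<And>l. jmeas (U l)" and R: "0 < R" and b: "\<And>l. bounded_by T s (bgam \<alpha> \<beta> l) (nrm U l) (ennreal R)"
    and sol: "solves U d" and d: "AE \<xi> in lborel. (\<Sum>j\<in>UNIV. of_real (\<xi> $ j) * d (Some j) \<xi>) = 0" and t: "t \<in> {0..T}"
  shows "AE \<xi> in lborel. (\<Sum>j\<in>UNIV. of_real (\<xi> $ j) * U (Some j) t \<xi>) = 0"
proof -
  have eq: "AE \<xi> in lborel. \<forall>j. U (Some j) t \<xi> = rhs U d (Some j) t \<xi>"
    using sol t unfolding solves_def by (subst AE_all_countable) blast
  have fin: "AE \<xi> in lborel. \<forall>j. tot (Fm (nrm U) (Some j)) \<xi> < \<infinity>"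
    using tot_Fm_finite_AE[OF jmeas_nrm[OF U] R b] by (subst AE_all_countable) blast
  show ?thesis using eq fin d
  proof eventually_elim
    fix \<xi> assume e: "\<forall>j. U (Some j) t \<xi> = rhs U d (Some j) t \<xi>"
      and f: "\<forall>j. tot (Fm (nrm U) (Some j)) \<xi> < \<infinity>" and d0: "(\<Sum>j\<in>UNIV. of_real (\<xi> $ j) * d (Some j) \<xi>) = 0"
    have Pz: "(\<Sum>j\<in>UNIV. complex_of_real (\<xi> $ j) * of_real (P j m \<xi>)) = 0" for m
      using P_divergence[of \<xi> m] by (simp only: of_real_mult[symmetric] of_real_sum[symmetric] of_real_0)
    have F0: "(\<Sum>j\<in>UNIV. of_real (\<xi> $ j) * F U (Some j) \<tau> \<xi>) = 0" for \<tau>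
    proof -
      define w where "w m = - flux U (Some m) \<tau> \<xi>
         + (if m = 3 then U None \<tau> \<xi> else 0)" for m
      have "F U (Some j) \<tau> \<xi> = (\<Sum>m\<in>UNIV. of_real (P j m \<xi>) * w m)" for j
      proof -
        have "(\<Sum>m\<in>UNIV. of_real (P j m \<xi>) * (if m = 3 then U None \<tau> \<xi> else 0)) = of_real (P j 3 \<xi>) * U None \<tau> \<xi>"
          by (subst sum.remove[of _ 3]) (auto intro: sum.neutral)
        then show ?thesis unfolding F_split F1_Some F2_Some w_def
          by (simp only: distrib_left sum.distrib mult_minus_right sum_negf)
      qed
      then have "(\<Sum>j\<in>UNIV. of_real (\<xi> $ j) * F U (Some j) \<tau> \<xi>) = (\<Sum>j\<in>UNIV. \<Sum>m\<in>UNIV. of_real (\<xi> $ j) * of_real (P j m \<xi>) * w m)"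
        by (simp add: sum_distrib_left mult.assoc)
      also have "\<dots> = (\<Sum>m\<in>UNIV. (\<Sum>j\<in>UNIV. of_real (\<xi> $ j) * of_real (P j m \<xi>)) * w m)"
        by (subst sum.swap) (simp add: sum_distrib_right)
      finally show ?thesis by (simp add: Pz)
    qed
    have Ei: "E (Some j) t \<tau> \<xi> = E (Some 1) t \<tau> \<xi>" for j \<tau> by (simp add: E_def)
    have "(\<Sum>j\<in>UNIV. of_real (\<xi> $ j) * duhamel (Some j) (F U (Some j)) t \<xi>) = (LINT \<tau>|lborel. (\<Sum>j\<in>UNIV. of_real (\<xi> $ j) * (of_real (E (Some j) t \<tau> \<xi>) * F U (Some j) \<tau> \<xi>)))"
      unfolding duhamel_def using duhamel_integrable[OF U] f t
      by (subst Bochner_Integration.integral_sum) (auto intro!: integrable_mult_right)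
    also have "\<dots> = (LINT \<tau>|lborel. of_real (E (Some 1) t \<tau> \<xi>) * (\<Sum>j\<in>UNIV. of_real (\<xi> $ j) * F U (Some j) \<tau> \<xi>))"
      by (subst Ei) (simp add: sum_distrib_left mult.left_commute)
    finally have z: "(\<Sum>j\<in>UNIV. of_real (\<xi> $ j) * duhamel (Some j) (F U (Some j)) t \<xi>) = 0" by (simp add: F0)
    have "(\<Sum>j\<in>UNIV. of_real (\<xi> $ j) * U (Some j) t \<xi>) = of_real (E (Some 1) t 0 \<xi>) * (\<Sum>j\<in>UNIV. of_real (\<xi> $ j) * d (Some j) \<xi>)
       + (\<Sum>j\<in>UNIV. of_real (\<xi> $ j) * duhamel (Some j) (F U (Some j)) t \<xi>)"
      unfolding e[rule_format] distrib_left sum.distrib sum_distrib_left by (subst Ei) (simp add: mult.left_commute)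
    then show "(\<Sum>j\<in>UNIV. of_real (\<xi> $ j) * U (Some j) t \<xi>) = 0" by (simp add: z d0)
  qed
qed

text \<open>
  Reflecting and conjugating a solution gives a solution with the same data in the same ball, because the symbols are
  Hermitian. By uniqueness it is the same solution.
\<close>

lemma solves_hermitian:
  assumes U: "\<And>l. jmeas (U l)" and R: "0 < R" and b: "\<And>l. bounded_by T s (bgam \<alpha> \<beta> l) (nrm U l) (ennreal R)"
    and sol: "solves U d" and d: "\<And>k. AE \<xi> in lborel. d k (- \<xi>) = cnj (d k \<xi>)"
    and small: "real CARD(3 option) ^ 2 * 2 * (24 * R * T powr \<delta>) \<le> 1 / 8" "real CARD(3 option) * 2 * T \<le> 1 / 8"
    and t: "t \<in> {0..T}"
  shows "AE \<xi> in lborel. U k t (- \<xi>) = cnj (U k t \<xi>)"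
proof -
  define V where "V k t \<xi> = cnj (U k t (- \<xi>))" for k t \<xi>
  have [measurable]: "cnj \<in> borel_measurable borel" by (intro borel_measurable_continuous_onI continuous_intros)
  have V: "jmeas (V k)" for k
  proof -
    have [measurable]: "(\<lambda>z. U k (fst z) (- snd z)) \<in> borel_measurable (lborel \<Otimes>\<^sub>M lborel)"
      by (rule jmeas_compose[OF U]; measurable)
    show ?thesis unfolding V_def by measurable
  qed
  have XV: "X r (nrm V k t) = X r (nrm U k t)" for r k t
  proof -
    have [measurable]: "U k t \<in> borel_measurable borel" by (rule jmeas_section[OF U])
    have "W r (- \<xi>) = W r \<xi>" for \<xi> by (simp add: W_def weight_def)
    then show ?thesis
      using lborel_nn_integral_reflect[of "\<lambda>\<xi>. W r \<xi> * nrm U k t \<xi>" 0] unfolding X_def nrm_def V_def by simp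
  qed
  have bV: "bounded_by T s (bgam \<alpha> \<beta> k) (nrm V k) (ennreal R)" for k
    using b[of k] unfolding bounded_by_def XV .
  have conv: "Defs.convolution (V l \<tau>) (V m \<tau>) \<xi> = cnj (Defs.convolution (U l \<tau>) (U m \<tau>) (- \<xi>))" for l m \<tau> \<xi>
  proof -
    have [measurable]: "U l \<tau> \<in> borel_measurable borel" for l by (rule jmeas_section[OF U])
    have "Defs.convolution (V l \<tau>) (V m \<tau>) \<xi> = cnj (LINT \<eta>|lborel. U l \<tau> (\<eta> - \<xi>) * U m \<tau> (- \<eta>))"
      unfolding Defs.convolution_def V_def by (subst Bochner_Integration.integral_cnj[symmetric]) simp
    also have "(LINT \<eta>|lborel. U l \<tau> (\<eta> - \<xi>) * U m \<tau> (- \<eta>)) = Defs.convolution (U l \<tau>) (U m \<tau>) (- \<xi>)"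
      using lborel_integral_reflect[of "\<lambda>\<eta>. U l \<tau> (- \<xi> - \<eta>) * U m \<tau> \<eta>" 0] by (simp add: Defs.convolution_def)
    finally show ?thesis .
  qed
  have FV: "F V k \<tau> \<xi> = cnj (F U k \<tau> (- \<xi>))" for k \<tau> \<xi>
    unfolding F_def conv by (simp add: bA_reflect bB_reflect V_def)
  have Er: "E k t \<tau> (- \<xi>) = E k t \<tau> \<xi>" for k t \<tau> \<xi> by (simp add: E_def)
  have dV: "duhamel k (F V k) t \<xi> = cnj (duhamel k (F U k) t (- \<xi>))" for k t \<xi>
    unfolding duhamel_def FV by (subst Bochner_Integration.integral_cnj[symmetric]) (simp add: Er)
  have solV: "solves V d"
    unfolding solves_def
  proof (intro ballI allI)
    fix t k assume t: "t \<in> {0..T}"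
    have "AE \<xi> in lborel. U k t \<xi> = rhs U d k t \<xi>" using sol t by (simp add: solves_def)
    from AE_reflect[OF this, of 0]
    have "AE \<xi> in lborel. U k t (- \<xi>) = of_real (E k t 0 (- \<xi>)) * d k (- \<xi>) + duhamel k (F U k) t (- \<xi>)" by simp
    then show "AE \<xi> in lborel. V k t \<xi> = rhs V d k t \<xi>"
      using d[of k] by eventually_elim (simp add: V_def dV Er)
  qed
  have "AE \<xi> in lborel. U k t \<xi> = V k t \<xi>"
    by (rule solves_unique[OF U V R b bV sol solV small t])
  then show ?thesis by eventually_elim (simp add: V_def)
qed

end

section \<open>Local well-posedness\<close>

context boussinesq
begin

definition vnrm :: "(3 option \<Rightarrow> complex path) \<Rightarrow> ennreal path" where
  "vnrm U t \<xi> = ennreal (norm (\<chi> i. U (Some i) t \<xi>))"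

lemma jmeas_vnrm:
  assumes [measurable]: "\<And>l. jmeas (U l)" shows "jmeas (vnrm U)"
  unfolding vnrm_def norm_vec_def L2_set_def vec_lambda_beta by measurable

lemma vnrm_le: "vnrm U t \<xi> \<le> (\<Sum>i\<in>UNIV. nrm U (Some i) t \<xi>)"
  using norm_vec_le_sum[of "\<chi> i. U (Some i) t \<xi>"] by (simp add: vnrm_def nrm_def)

lemma X_vnrm_le:
  assumes U: "\<And>l. jmeas (U l)" shows "X r (vnrm U t) \<le> (\<Sum>i\<in>UNIV. X r (nrm U (Some i) t))"
proof -
  have "X r (vnrm U t) \<le> X r (\<lambda>\<xi>. \<Sum>i\<in>UNIV. nrm U (Some i) t \<xi>)" by (intro X_mono vnrm_le)
  also have "\<dots> = (\<Sum>i\<in>UNIV. X r (nrm U (Some i) t))"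
    by (intro X_sum jmeas_section[OF jmeas_nrm[OF U]]) simp
  finally show ?thesis .
qed

lemma bounded_by_vnrm:
  assumes U: "\<And>l. jmeas (U l)" and Q: "0 \<le> Q" and b: "\<And>k. bounded_by T s (bgam \<alpha> \<beta> k) (nrm U k) (ennreal Q)"
  shows "bounded_by T s \<alpha> (vnrm U) (ennreal (3 * Q))"
  unfolding bounded_by_def
proof (intro conjI ballI)
  have three: "(\<Sum>i\<in>(UNIV :: 3 set). ennreal Q) = ennreal (3 * Q)" using Q by (simp add: ennreal_mult)
  show "X s (vnrm U t) \<le> ennreal (3 * Q)" if "t \<in> {0..T}" for t
    unfolding three[symmetric] using b that by (intro order_trans[OF X_vnrm_le[OF U]] sum_mono) (auto simp: bounded_by_def)
  note [measurable] = jmeas_nrm[OF U]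
  have "L1X T (s + 2 * \<alpha>) (vnrm U) \<le> (\<integral>\<^sup>+t. (\<Sum>i\<in>UNIV. indicator {0..T} t * X (s + 2 * \<alpha>) (nrm U (Some i) t)) \<partial>lborel)"
    unfolding sum_distrib_left[symmetric] by (intro nn_integral_mono mult_left_mono X_vnrm_le U) simp
  also have "\<dots> = (\<Sum>i\<in>UNIV. \<integral>\<^sup>+t. indicator {0..T} t * X (s + 2 * \<alpha>) (nrm U (Some i) t) \<partial>lborel)"
    by (rule nn_integral_sum) measurable
  also have "\<dots> \<le> ennreal (3 * Q)"
    unfolding three[symmetric] using b[of "Some _"] by (intro sum_mono) (simp add: bounded_by_def)
  finally show "L1X T (s + 2 * \<alpha>) (vnrm U) \<le> ennreal (3 * Q)" .
qed

lemma represents_norms: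
  assumes r: "represents U R u \<theta>" and t: "t \<in> {0..T}"
  shows "X_norm a \<sigma> r (fld u \<theta> k t) = X r (nrm U k t)" and "XV_norm a \<sigma> r (u t) = X r (vnrm U t)"
proof -
  have 1: "has_tame_ft (fld u \<theta> k t) (U k t)" for k by (rule represents_tame(1)[OF r t])
  show "X_norm a \<sigma> r (fld u \<theta> k t) = X r (nrm U k t)" using X_norm_eq[OF 1] by (simp add: nrm_def[abs_def])
  have "has_tame_ft (u t $ i) (U (Some i) t)" for i using 1[of "Some i"] by (simp add: fld_def)
  then show "XV_norm a \<sigma> r (u t) = X r (vnrm U t)" using XV_norm_eq[of "u t" "\<lambda>i. U (Some i) t"] by (simp add: vnrm_def[abs_def])
qed

lemma represents_Lp:
  assumes r: "represents U R u \<theta>" and c: "\<And>k. fld u \<theta> k \<in> C_T T (X_norm a \<sigma> s)" and p: "1 \<le> p"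
  shows "u \<in> Lp_T p T (XV_norm a \<sigma> (s + 2 * \<alpha> / p))" and "\<theta> \<in> Lp_T p T (X_norm a \<sigma> (s + 2 * \<beta> / p))"
proof -
  have U: "jmeas (U k)" and R: "0 < R" and b: "bounded_by T s (bgam \<alpha> \<beta> k) (nrm U k) (ennreal R)" for k
    using r by (auto simp: represents_def)
  have cu: "(\<lambda>t. u t $ i) \<in> C_T T (X_norm a \<sigma> s)" for i using c[of "Some i"] by (simp add: fld_def[abs_def])
  have ct: "\<theta> \<in> C_T T (X_norm a \<sigma> s)" using c[of None] by (simp add: fld_def[abs_def])
  have pos: "0 < bgam \<alpha> \<beta> k" for k using \<gamma>[of k] by linarith
  have fin: "AE t in lebesgue_on {0..T}. X_norm a \<sigma> (s + 2 * bgam \<alpha> \<beta> k / p) (fld u \<theta> k t) < \<infinity>"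
    and int: "(\<integral>\<^sup>+t. ennreal (enn2real (X_norm a \<sigma> (s + 2 * bgam \<alpha> \<beta> k / p) (fld u \<theta> k t)) powr p) \<partial>lebesgue_on {0..T}) < \<infinity>" for k
    by (rule Lp_bound[OF jmeas_nrm[OF U] less_imp_le[OF R] b p pos less_imp_le[OF T(1)]], rule represents_norms(1)[OF r]; assumption)+
  have ge: "s \<le> s + 2 * bgam \<alpha> \<beta> k / p" for k using pos[of k] p by simp
  show "\<theta> \<in> Lp_T p T (X_norm a \<sigma> (s + 2 * \<beta> / p))"
    using strongly_measurable_X[OF s ge[of None] ct] fin[of None] int[of None] by (simp add: Lp_T_def fld_def)
  have \<alpha>0: "0 < \<alpha>" using \<alpha> by linarith
  have finV: "AE t in lebesgue_on {0..T}. XV_norm a \<sigma> (s + 2 * \<alpha> / p) (u t) < \<infinity>"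
    and intV: "(\<integral>\<^sup>+t. ennreal (enn2real (XV_norm a \<sigma> (s + 2 * \<alpha> / p) (u t)) powr p) \<partial>lebesgue_on {0..T}) < \<infinity>"
    using R by (intro Lp_bound[OF jmeas_vnrm[OF U] _ bounded_by_vnrm[OF U _ b] p \<alpha>0 less_imp_le[OF T(1)] represents_norms(2)[OF r]]; simp)+
  have "AE t in lebesgue_on {0..T}. \<forall>i. X_norm a \<sigma> (s + 2 * \<alpha> / p) (u t $ i) < \<infinity>"
    using fin[of "Some _"] by (subst AE_all_countable) (simp add: fld_def)
  from strongly_measurable_XV[OF s _ cu this]
  show "u \<in> Lp_T p T (XV_norm a \<sigma> (s + 2 * \<alpha> / p))"
    using finV intV ge[of "Some 1"] by (simp add: Lp_T_def)
qed

lemma represents_C_T: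
  assumes r: "represents U R u \<theta>" and c: "\<And>k. fld u \<theta> k \<in> C_T T (X_norm a \<sigma> s)"
  shows "u \<in> C_T T (XV_norm a \<sigma> s)"
proof -
  have ft: "has_tame_ft (u t $ i) (U (Some i) t)" if "t \<in> {0..T}" for t i
    using represents_tame(1)[OF r that, of "Some i"] by (simp add: fld_def)
  have cu: "(\<lambda>t. u t $ i) \<in> C_T T (X_norm a \<sigma> s)" for i using c[of "Some i"] by (simp add: fld_def[abs_def])
  show ?thesis unfolding C_T_def
  proof (intro CollectI conjI ballI)
    fix t assume t: "t \<in> {0..T}"
    have "XV_norm a \<sigma> s (u t) \<le> (\<Sum>i\<in>UNIV. X_norm a \<sigma> s (u t $ i))" by (rule XV_norm_le_sum[OF ft[OF t]])
    also have "\<dots> < \<infinity>" using cu t by (auto simp: C_T_def)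
    finally show "XV_norm a \<sigma> s (u t) < \<infinity>" .
    show "((\<lambda>\<tau>. XV_norm a \<sigma> s (u \<tau> - u t)) \<longlongrightarrow> 0) (at t within {0..T})"
    proof (rule tendsto_sandwich[OF _ _ tendsto_const])
      show "((\<lambda>\<tau>. \<Sum>i\<in>UNIV. X_norm a \<sigma> s ((u \<tau> - u t) $ i)) \<longlongrightarrow> 0) (at t within {0..T})"
        using cu t by (intro tendsto_null_sum) (auto simp: C_T_def)
      have "eventually (\<lambda>\<tau>. \<tau> \<in> {0..T}) (at t within {0..T})" by (simp add: eventually_at_filter)
      then show "\<forall>\<^sub>F \<tau> in at t within {0..T}. XV_norm a \<sigma> s (u \<tau> - u t) \<le> (\<Sum>i\<in>UNIV. X_norm a \<sigma> s ((u \<tau> - u t) $ i))"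
      proof eventually_elim
        case (elim \<tau>)
        show ?case
          by (rule XV_norm_le_sum[of _ "\<lambda>i \<xi>. U (Some i) \<tau> \<xi> - U (Some i) t \<xi>"]) (simp add: has_tame_ft_diff[OF ft[OF elim] ft[OF t]])
      qed
    qed simp
  qed
qed

lemma solution_norm_le:
  assumes r: "represents U R u \<theta>" and Q: "0 \<le> Q" and b: "\<And>k. bounded_by T s (bgam \<alpha> \<beta> k) (nrm U k) (ennreal Q)"
  shows "solution_norm a \<sigma> s \<alpha> \<beta> T u \<theta> \<le> ennreal (8 * Q)"
proof -
  have U: "jmeas (U k)" for k using r by (auto simp: represents_def)
  have \<theta>: "X_norm a \<sigma> r' (\<theta> t) = X r' (nrm U None t)" if "t \<in> {0..T}" for t r'
    using represents_norms(1)[OF r that, of r' None] by (simp add: fld_def)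
  note bV = bounded_by_vnrm[OF U Q b]
  have "Linf_norm T (XV_norm a \<sigma> s) u \<le> ennreal (3 * Q)"
    unfolding Linf_norm_def using bV by (intro SUP_least) (auto simp: represents_norms(2)[OF r] bounded_by_def)
  moreover have "Linf_norm T (X_norm a \<sigma> s) \<theta> \<le> ennreal Q"
    unfolding Linf_norm_def using b[of None] by (intro SUP_least) (auto simp: \<theta> bounded_by_def)
  moreover have "L1_norm T (XV_norm a \<sigma> (s + 2 * \<alpha>)) u \<le> ennreal (3 * Q)"
    unfolding L1_norm_def using bV by (subst nn_integral_lebesgue_on[OF represents_norms(2)[OF r]]) (auto simp: bounded_by_def)
  moreover have "L1_norm T (X_norm a \<sigma> (s + 2 * \<beta>)) \<theta> \<le> ennreal Q"
    unfolding L1_norm_def using b[of None] by (subst nn_integral_lebesgue_on[OF \<theta>]) (auto simp: bounded_by_def)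
  ultimately have "solution_norm a \<sigma> s \<alpha> \<beta> T u \<theta> \<le> ennreal (3 * Q) + ennreal (3 * Q) + ennreal Q + ennreal Q"
    unfolding solution_norm_def by (intro add_mono)
  also have "\<dots> = ennreal (8 * Q)" using Q by (simp add: ennreal_plus[symmetric] del: ennreal_plus)
  finally show ?thesis .
qed

text \<open>
  Uniqueness is claimed against every competitor in the class of the theorem, so a competitor has
  to be brought into the setting of the integral equation first. Its continuity in \<open>X\<^sup>s\<close> yields the jointly measurable
  representative.
\<close>

lemma class_represents:
  assumes c: "(v, \<eta>) \<in> solution_class a \<sigma> s \<alpha> \<beta> T" and m: "mild_solution \<alpha> \<beta> T u0 \<theta>0 v \<eta>"
    and n: "solution_norm a \<sigma> s \<alpha> \<beta> T v \<eta> < ennreal R" and R: "0 < R"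
  shows "\<exists>V. represents V R v \<eta>"
proof -
  have cv: "v \<in> C_T T (XV_norm a \<sigma> s)" and c\<eta>: "\<eta> \<in> C_T T (X_norm a \<sigma> s)" using c by (auto simp: solution_class_def)
  have vfin: "has_tame_ft (v t $ i) (ft (v t $ i))" if "t \<in> {0..T}" for t i
    using cv that by (intro XV_norm_finite_tame[OF s]) (auto simp: C_T_def)
  have cvi: "(\<lambda>t. v t $ i) \<in> C_T T (X_norm a \<sigma> s)" for i unfolding C_T_def
  proof (intro CollectI conjI ballI)
    fix t assume t: "t \<in> {0..T}"
    have "X_norm a \<sigma> s (v t $ i) \<le> XV_norm a \<sigma> s (v t)" by (rule X_norm_le_XV_norm[OF vfin[OF t]])
    also have "\<dots> < \<infinity>" using cv t by (auto simp: C_T_def)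
    finally show "X_norm a \<sigma> s (v t $ i) < \<infinity>" .
    show "((\<lambda>\<tau>. X_norm a \<sigma> s (v \<tau> $ i - v t $ i)) \<longlongrightarrow> 0) (at t within {0..T})"
    proof (rule tendsto_sandwich[OF _ _ tendsto_const])
      show "((\<lambda>\<tau>. XV_norm a \<sigma> s (v \<tau> - v t)) \<longlongrightarrow> 0) (at t within {0..T})" using cv t by (auto simp: C_T_def)
      have "eventually (\<lambda>\<tau>. \<tau> \<in> {0..T}) (at t within {0..T})" by (simp add: eventually_at_filter)
      then show "\<forall>\<^sub>F \<tau> in at t within {0..T}. X_norm a \<sigma> s (v \<tau> $ i - v t $ i) \<le> XV_norm a \<sigma> s (v \<tau> - v t)"
      proof eventually_elim
        case (elim \<tau>)
        have "X_norm a \<sigma> s ((v \<tau> - v t) $ i) \<le> XV_norm a \<sigma> s (v \<tau> - v t)"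
          by (rule X_norm_le_XV_norm[of _ "\<lambda>i \<xi>. ft (v \<tau> $ i) \<xi> - ft (v t $ i) \<xi>"]) (simp add: has_tame_ft_diff[OF vfin[OF elim] vfin[OF t]])
        then show ?case by simp
      qed
    qed simp
  qed
  have cf: "fld v \<eta> k \<in> C_T T (X_norm a \<sigma> s)" for k
    using cvi c\<eta> by (cases k) (simp_all add: fld_def[abs_def])
  have "\<forall>k. \<exists>V. jmeas V \<and> (\<forall>t\<in>{0..T}. has_tame_ft (fld v \<eta> k t) (V t))" using C_T_jmeas[OF s cf] by blast
  from choice[OF this] obtain V where V': "\<forall>k. jmeas (V k) \<and> (\<forall>t\<in>{0..T}. has_tame_ft (fld v \<eta> k t) (V k t))" ..
  have jV: "jmeas (V k)" for k using V' by blast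
  have fV: "has_tame_ft (fld v \<eta> k t) (V k t)" if "t \<in> {0..T}" for k t using V' that by blast
  have fVS: "has_tame_ft (v t $ i) (V (Some i) t)" if "t \<in> {0..T}" for i t using fV[OF that, of "Some i"] by (simp add: fld_def)
  have XN: "X_norm a \<sigma> r (fld v \<eta> k t) = X r (nrm V k t)" if "t \<in> {0..T}" for r k t
    using X_norm_eq[OF fV[OF that]] by (simp add: nrm_def[abs_def])
  have parts: "Linf_norm T (XV_norm a \<sigma> s) v \<le> ennreal R" "Linf_norm T (X_norm a \<sigma> s) \<eta> \<le> ennreal R"
     "L1_norm T (XV_norm a \<sigma> (s + 2 * \<alpha>)) v \<le> ennreal R" "L1_norm T (X_norm a \<sigma> (s + 2 * \<beta>)) \<eta> \<le> ennreal R"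
    by (rule order_trans[OF _ less_imp_le[OF n]]; simp add: solution_norm_def add_increasing add_increasing2)+
  have comp: "X_norm a \<sigma> r (v t $ i) \<le> XV_norm a \<sigma> r (v t)" if "t \<in> {0..T}" for r t i
    by (rule X_norm_le_XV_norm[OF vfin[OF that]])
  have b: "bounded_by T s (bgam \<alpha> \<beta> k) (nrm V k) (ennreal R)" for k
    unfolding bounded_by_def
  proof (intro conjI ballI)
    fix t assume t: "t \<in> {0..T}"
    have "X_norm a \<sigma> s (fld v \<eta> k t) \<le> ennreal R"
    proof (cases k)
      case None
      have "X_norm a \<sigma> s (\<eta> t) \<le> Linf_norm T (X_norm a \<sigma> s) \<eta>" unfolding Linf_norm_def using t by (rule SUP_upper)
      then show ?thesis using parts(2) None by (simp add: fld_def)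
    next
      case (Some i)
      have "XV_norm a \<sigma> s (v t) \<le> Linf_norm T (XV_norm a \<sigma> s) v" unfolding Linf_norm_def using t by (rule SUP_upper)
      then show ?thesis using parts(1) comp[OF t, of s i] Some by (simp add: fld_def)
    qed
    then show "X s (nrm V k t) \<le> ennreal R" by (simp add: XN[OF t])
  next
    have "(\<integral>\<^sup>+t. X_norm a \<sigma> (s + 2 * bgam \<alpha> \<beta> k) (fld v \<eta> k t) \<partial>lebesgue_on {0..T}) \<le> ennreal R"
    proof (cases k)
      case None
      then show ?thesis using parts(4) by (simp add: fld_def L1_norm_def)
    next
      case (Some i)
      have "(\<integral>\<^sup>+t. X_norm a \<sigma> (s + 2 * \<alpha>) (v t $ i) \<partial>lebesgue_on {0..T}) \<le> L1_norm T (XV_norm a \<sigma> (s + 2 * \<alpha>)) v"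
        unfolding L1_norm_def by (intro nn_integral_mono comp) simp
      then show ?thesis using parts(3) Some by (simp add: fld_def)
    qed
    then show "L1X T (s + 2 * bgam \<alpha> \<beta> k) (nrm V k) \<le> ennreal R"
      by (subst (asm) nn_integral_lebesgue_on[OF XN]) auto
  qed
  have "represents V R v \<eta>"
    unfolding represents_def
  proof (intro conjI allI ballI jV b R)
    fix t assume t: "t \<in> {0..T}"
    show "has_tame_ft (fld v \<eta> k t) (V k t)" for k by (rule fV[OF t])
    have X: "X s (\<lambda>\<xi>. ennreal (cmod (V k t \<xi>))) < \<infinity>" for k
      using b[of k] t le_less_trans[of "X s (nrm V k t)" "ennreal R" \<infinity>] by (auto simp: bounded_by_def nrm_def[abs_def])
    have tm: "tame (\<lambda>\<xi>. \<i> * of_real (\<xi> $ j) * V k t \<xi>)" for j k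
      by (rule tame_X(2)[OF s jmeas_section[OF jV] X])
    show "AE \<xi> in lborel. (\<Sum>j\<in>UNIV. of_real (\<xi> $ j) * V (Some j) t \<xi>) = 0"
      using div_free_iff[OF fVS[OF t] tm] m t by (auto simp: mild_solution_def)
  qed
  then show ?thesis by (intro exI)
qed

lemma mild_solution_unique:
  assumes r: "represents U R u \<theta>" "represents V R v \<eta>"
    and d: "\<And>i. has_tame_ft (u0 $ i) (d (Some i))" "has_tame_ft \<theta>0 (d None)"
    and m: "mild_solution \<alpha> \<beta> T u0 \<theta>0 u \<theta>" "mild_solution \<alpha> \<beta> T u0 \<theta>0 v \<eta>"
    and small: "real CARD(3 option) ^ 2 * 2 * (24 * R * T powr \<delta>) \<le> 1 / 8" "real CARD(3 option) * 2 * T \<le> 1 / 8"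
    and t: "t \<in> {0..T}"
  shows "v t = u t" "\<eta> t = \<theta> t"
proof -
  have j: "jmeas (U k)" "jmeas (V k)" and R: "0 < R" and b: "bounded_by T s (bgam \<alpha> \<beta> k) (nrm U k) (ennreal R)"
    "bounded_by T s (bgam \<alpha> \<beta> k) (nrm V k) (ennreal R)" for k
    using r by (auto simp: represents_def)
  have eq: "fld v \<eta> k t = fld u \<theta> k t" for k
  proof -
    have "AE \<xi> in lborel. V k t \<xi> = U k t \<xi>"
      by (rule solves_unique[OF j(2,1) R b(2,1) mild_imp_solves[OF r(2) d m(2)] mild_imp_solves[OF r(1) d m(1)] small t])
    from has_tame_ft_AE[OF represents_tame(1)[OF r(2) t] jmeas_section[OF j(1)] this]
    show ?thesis by (rule has_tame_ft_unique) (rule represents_tame(1)[OF r(1) t])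
  qed
  show "v t = u t" using eq[of "Some _"] by (simp add: vec_eq_iff fld_def)
  show "\<eta> t = \<theta> t" using eq[of None] by (simp add: fld_def)
qed

lemma mild_solution_exists:
  assumes R: "0 < R" and E0: "0 \<le> E0" "2 * E0 \<le> R"
    and d: "\<And>i. has_tame_ft (u0 $ i) (d (Some i))" "has_tame_ft \<theta>0 (d None)"
    and dX: "\<And>k. X s (\<lambda>\<xi>. ennreal (cmod (d k \<xi>))) \<le> ennreal E0"
    and re: "\<And>i. real_dist (u0 $ i)" "real_dist \<theta>0" and div: "div_free u0"
    and small: "real CARD(3 option) ^ 2 * 2 * (24 * R * T powr \<delta>) \<le> 1 / 8" "real CARD(3 option) * 2 * T \<le> 1 / 8"
  shows "\<exists>U u \<theta>. represents U R u \<theta> \<and> mild_solution \<alpha> \<beta> T u0 \<theta>0 u \<theta> \<and> (\<forall>k. fld u \<theta> k \<in> C_T T (X_norm a \<sigma> s)) \<and>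
     (\<forall>k. bounded_by T s (bgam \<alpha> \<beta> k) (nrm U k) (ennreal (2 * E0)))"
proof -
  have dm: "d k \<in> borel_measurable borel" for k
    using tame_measurable[OF has_tame_ft_tame] d by (cases k) auto
  define U where "U = sol d"
  have jU: "jmeas (U k)" for k unfolding U_def by (rule jmeas_sol[OF dm])
  have sU: "solves U d" unfolding U_def by (rule sol_exists(1)[OF dm R E0 dX small])
  have bU: "bounded_by T s (bgam \<alpha> \<beta> k) (nrm U k) (ennreal (2 * E0))" for k
    unfolding U_def by (rule sol_exists(2)[OF dm R E0 dX small])
  have bR: "bounded_by T s (bgam \<alpha> \<beta> k) (nrm U k) (ennreal R)" for k
    by (rule bounded_by_mono[OF _ bU]) (use E0 in \<open>auto intro: ennreal_leI\<close>)
  have dfin: "X s (\<lambda>\<xi>. ennreal (cmod (d k \<xi>))) < \<infinity>" for k by (rule le_less_trans[OF dX]) simp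
  have XU: "X s (\<lambda>\<xi>. ennreal (cmod (U k t \<xi>))) < \<infinity>" if "t \<in> {0..T}" for k t
    using bR[of k] that le_less_trans[of "X s (nrm U k t)" "ennreal R" \<infinity>] by (auto simp: bounded_by_def nrm_def[abs_def])
  note tU = tame_X(1)[OF s jmeas_section[OF jU] XU]
  define u where "u t = (\<chi> i. inv_ft (U (Some i) t))" for t
  define \<theta> where "\<theta> t = inv_ft (U None t)" for t
  have fU: "has_tame_ft (fld u \<theta> k t) (U k t)" if "t \<in> {0..T}" for k t
    using has_tame_ft_inv_ft[OF tU[OF that, of k]] by (cases k) (simp_all add: fld_def u_def \<theta>_def)
  have ddiv: "AE \<xi> in lborel. (\<Sum>j\<in>UNIV. of_real (\<xi> $ j) * d (Some j) \<xi>) = 0"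
    using div_free_iff[of u0 "\<lambda>j. d (Some j)", OF d(1) tame_X(2)[OF s dm dfin]] div by blast
  have dre: "AE \<xi> in lborel. d k (- \<xi>) = cnj (d k \<xi>)" for k
    using re real_dist_iff d by (cases k) blast+
  have rep: "represents U R u \<theta>"
    unfolding represents_def using jU bR R fU solves_div_free[OF jU R bR sU ddiv] by blast
  have mild: "mild_solution \<alpha> \<beta> T u0 \<theta>0 u \<theta>"
    by (rule solves_imp_mild[OF rep d sU solves_hermitian[OF jU R bR sU dre small]])
  have C: "fld u \<theta> k \<in> C_T T (X_norm a \<sigma> s)" for k unfolding C_T_def
  proof (intro CollectI conjI ballI)
    fix t assume t: "t \<in> {0..T}"
    show "X_norm a \<sigma> s (fld u \<theta> k t) < \<infinity>" using XU[OF t] by (simp add: X_norm_eq[OF fU[OF t]])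
    have "eventually (\<lambda>\<tau>. \<tau> \<in> {0..T}) (at t within {0..T})" by (simp add: eventually_at_filter)
    then have ev: "eventually (\<lambda>\<tau>. X s (\<lambda>\<xi>. ennreal (cmod (U k \<tau> \<xi> - U k t \<xi>))) = X_norm a \<sigma> s (fld u \<theta> k \<tau> - fld u \<theta> k t)) (at t within {0..T})"
    proof eventually_elim
      case (elim \<tau>)
      show ?case by (rule X_norm_eq[OF has_tame_ft_diff[OF fU[OF elim] fU[OF t]], symmetric])
    qed
    show "((\<lambda>\<tau>. X_norm a \<sigma> s (fld u \<theta> k \<tau> - fld u \<theta> k t)) \<longlongrightarrow> 0) (at t within {0..T})"
      by (rule Lim_transform_eventually[OF solves_continuous[OF jU R bR dm dfin sU t] ev])
  qed
  show ?thesis using rep mild C bU by blast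
qed

end

text \<open>
  Each of the three expressions in \<open>q_crit\<close> is the value of \<open>s\<close> at which one of the three time exponents
  equals one.
\<close>

lemma exponent_gap:
  assumes \<alpha>: "1/2 \<le> \<alpha>" and \<beta>: "1/2 \<le> \<beta>" and q: "q_crit \<alpha> \<beta> \<le> s"
  shows "\<exists>\<delta>\<ge>0. (\<delta> = 0 \<longrightarrow> s = q_crit \<alpha> \<beta>) \<and> 1 / (2 * \<alpha>) - s / (2 * \<alpha>) \<le> 1 - \<delta> \<and>
     1 / (2 * \<alpha>) - s / (2 * \<beta>) \<le> 1 - \<delta> \<and> 1 / (2 * \<beta>) - s / (2 * \<alpha>) \<le> 1 - \<delta>"
proof -
  have p: "0 < \<alpha>" "0 < \<beta>" using \<alpha> \<beta> by auto
  let ?e1 = "1 / (2 * \<alpha>) - s / (2 * \<alpha>)" and ?e2 = "1 / (2 * \<alpha>) - s / (2 * \<beta>)" and ?e3 = "1 / (2 * \<beta>) - s / (2 * \<alpha>)"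
  have e1: "1 - ?e1 = (s - (1 - 2 * \<alpha>)) / (2 * \<alpha>)" using p by (simp add: field_simps)
  have e2: "1 - ?e2 = (s - \<beta> * (1 - 2 * \<alpha>) / \<alpha>) / (2 * \<beta>)" using p by (simp add: field_simps)
  have e3: "1 - ?e3 = (s - \<alpha> * (1 - 2 * \<beta>) / \<beta>) / (2 * \<alpha>)" using p by (simp add: field_simps)
  have ge: "1 - 2 * \<alpha> \<le> q_crit \<alpha> \<beta>" "\<beta> * (1 - 2 * \<alpha>) / \<alpha> \<le> q_crit \<alpha> \<beta>" "\<alpha> * (1 - 2 * \<beta>) / \<beta> \<le> q_crit \<alpha> \<beta>"
    by (simp_all add: q_crit_def)
  define \<delta> where "\<delta> = min (1 - ?e1) (min (1 - ?e2) (1 - ?e3))"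
  have "0 \<le> \<delta>" unfolding \<delta>_def e1 e2 e3 using ge q p by simp
  moreover have "\<delta> = 0 \<longrightarrow> s = q_crit \<alpha> \<beta>"
  proof (rule impI, rule ccontr)
    assume z: "\<delta> = 0" and "s \<noteq> q_crit \<alpha> \<beta>"
    then have "q_crit \<alpha> \<beta> < s" using q by simp
    then have "0 < \<delta>" unfolding \<delta>_def e1 e2 e3 using ge p by simp
    then show False using z by simp
  qed
  moreover have "?e1 \<le> 1 - \<delta>" "?e2 \<le> 1 - \<delta>" "?e3 \<le> 1 - \<delta>" unfolding \<delta>_def by linarith+
  ultimately show ?thesis by blast
qed

text \<open>
  With four unknowns and symbols bounded by two the smallness conditions are \<open>6912 R T\<^sup>\<delta> \<le> 1/8\<close>, for the radius
  \<open>9 R\<close>, and \<open>8 T \<le> 1/8\<close>. The factor nine leaves room for the norm of the theorem, a sum of eight bounds.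
\<close>

lemma small_time_exists:
  fixes \<delta> R :: real
  assumes \<delta>: "0 \<le> \<delta>" and R: "0 < R" and crit: "\<delta> = 0 \<Longrightarrow> R \<le> 1 / 55296"
  shows "\<exists>T>0. T \<le> 1 \<and> real CARD(3 option) ^ 2 * 2 * (24 * (9 * R) * T powr \<delta>) \<le> 1 / 8 \<and> real CARD(3 option) * 2 * T \<le> 1 / 8"
proof -
  have "\<exists>T>0. T \<le> 1 / 64 \<and> R * T powr \<delta> \<le> 1 / 55296"
  proof (cases "\<delta> = 0")
    case True
    then show ?thesis using crit by (intro exI[of _ "1 / 64"]) simp
  next
    case False
    define c where "c = 1 / (55296 * R)"
    have c: "0 < c" using R by (simp add: c_def)
    define T where "T = min (1 / 64) (c powr (1 / \<delta>))"
    have "0 < T" using c by (simp add: T_def)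
    moreover have "T powr \<delta> \<le> (c powr (1 / \<delta>)) powr \<delta>" using \<delta> \<open>0 < T\<close> by (intro powr_mono2) (auto simp: T_def)
    then have "T powr \<delta> \<le> c" using c False by (simp add: powr_powr)
    then have "R * T powr \<delta> \<le> R * c" using R by (intro mult_left_mono) auto
    then have "R * T powr \<delta> \<le> 1 / 55296" using R by (simp add: c_def)
    ultimately show ?thesis by (intro exI[of _ T]) (simp add: T_def)
  qed
  then obtain T where "0 < T" "T \<le> 1 / 64" "R * T powr \<delta> \<le> 1 / 55296" by blast
  then show ?thesis by (intro exI[of _ T]) simp
qed

theorem theorem1p2:
  fixes a \<sigma> \<alpha> \<beta> s :: real
  assumes "0 \<le> a" and "1 \<le> \<sigma>" and "1/2 \<le> \<alpha>" and "1/2 \<le> \<beta>"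
    and "max (- 1) (q_crit \<alpha> \<beta>) \<le> s" and "s \<le> 0"
  shows "\<exists>\<epsilon>>0. \<forall>u0 \<theta>0.
    u0 \<in> XV_space a \<sigma> s \<longrightarrow> \<theta>0 \<in> X_space a \<sigma> s \<longrightarrow>
    (\<forall>i. real_dist (u0 $ i)) \<longrightarrow> real_dist \<theta>0 \<longrightarrow> div_free u0 \<longrightarrow>
    (s = q_crit \<alpha> \<beta> \<longrightarrow> XV_norm a \<sigma> s u0 + X_norm a \<sigma> s \<theta>0 < ennreal \<epsilon>) \<longrightarrow>
    (\<exists>T>0. \<exists>C1>0. \<exists>C2>0. \<exists>u \<theta>.
       (u, \<theta>) \<in> solution_class a \<sigma> s \<alpha> \<beta> T \<and>
       mild_solution \<alpha> \<beta> T u0 \<theta>0 u \<theta> \<and>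
       solution_norm a \<sigma> s \<alpha> \<beta> T u \<theta> < ennreal C1 \<and>
       (\<forall>v \<eta>. (v, \<eta>) \<in> solution_class a \<sigma> s \<alpha> \<beta> T \<and>
               mild_solution \<alpha> \<beta> T u0 \<theta>0 v \<eta> \<and>
               solution_norm a \<sigma> s \<alpha> \<beta> T v \<eta> < ennreal C1 \<longrightarrow>
               (\<forall>t\<in>{0..T}. v t = u t \<and> \<eta> t = \<theta> t)) \<and>
       solution_norm a \<sigma> s \<alpha> \<beta> T u \<theta> \<le>
         ennreal C2 * (XV_norm a \<sigma> s u0 + X_norm a \<sigma> s \<theta>0) \<and>
       (\<forall>p\<ge>1. u \<in> Lp_T p T (XV_norm a \<sigma> (s + 2 * \<alpha> / p)) \<and>
               \<theta> \<in> Lp_T p T (X_norm a \<sigma> (s + 2 * \<beta> / p))))"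
  \<comment> \<open>half of the critical radius \<open>1 / 55296\<close>, since the solution lies in a ball of twice the size of the data\<close>
proof (rule exI[of _ "1 / 110592 :: real"], intro conjI allI impI)
  show "0 < (1 / 110592 :: real)" by simp
  fix u0 \<theta>0
  assume u0: "u0 \<in> XV_space a \<sigma> s" and \<theta>0: "\<theta>0 \<in> X_space a \<sigma> s" and re: "\<forall>i. real_dist (u0 $ i)" "real_dist \<theta>0" and div: "div_free u0"
    and crit: "s = q_crit \<alpha> \<beta> \<longrightarrow> XV_norm a \<sigma> s u0 + X_norm a \<sigma> s \<theta>0 < ennreal (1 / 110592)"
  have s: "-1 \<le> s" "s \<le> 0" "q_crit \<alpha> \<beta> \<le> s" using assms by auto
  interpret weighted a \<sigma> by unfold_locales (use assms in auto)
  define E0 where "E0 = enn2real (XV_norm a \<sigma> s u0 + X_norm a \<sigma> s \<theta>0)"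
  have "XV_norm a \<sigma> s u0 < \<infinity>" "X_norm a \<sigma> s \<theta>0 < \<infinity>" using u0 \<theta>0 by (auto simp: XV_space_def X_space_def)
  note fin = this
  have E0: "0 \<le> E0" "XV_norm a \<sigma> s u0 + X_norm a \<sigma> s \<theta>0 = ennreal E0" using fin by (simp_all add: E0_def)
  \<comment> \<open>\<open>55296 = 8 * 6912\<close>; above the critical exponent any radius above \<open>2 * E0\<close> will do, since time can be shortened\<close>
  define R where "R = (if s = q_crit \<alpha> \<beta> then 1 / 55296 else 2 * E0 + 1)"
  have R: "0 < R" using E0 by (simp add: R_def)
  have E0R: "2 * E0 \<le> R"
  proof (cases "s = q_crit \<alpha> \<beta>")
    case True
    then have "ennreal E0 < ennreal (1 / 110592)" using crit E0(2) by simp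
    then have "E0 < 1 / 110592" using E0(1) by (simp add: ennreal_less_iff)
    then show ?thesis using True by (simp add: R_def)
  qed (simp add: R_def)
  obtain \<delta> where \<delta>: "0 \<le> \<delta>" "\<delta> = 0 \<longrightarrow> s = q_crit \<alpha> \<beta>" and ex: "1 / (2 * \<alpha>) - s / (2 * \<alpha>) \<le> 1 - \<delta>"
     "1 / (2 * \<alpha>) - s / (2 * \<beta>) \<le> 1 - \<delta>" "1 / (2 * \<beta>) - s / (2 * \<alpha>) \<le> 1 - \<delta>"
    using exponent_gap[OF assms(3,4) s(3)] by blast
  have "\<delta> = 0 \<Longrightarrow> R \<le> 1 / 55296" using \<delta>(2) by (simp add: R_def)
  from small_time_exists[OF \<delta>(1) R this] obtain T where T: "0 < T" "T \<le> 1"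
    and small9: "real CARD(3 option) ^ 2 * 2 * (24 * (9 * R) * T powr \<delta>) \<le> 1 / 8" and smallT: "real CARD(3 option) * 2 * T \<le> 1 / 8"
    by blast
  have "0 \<le> R * T powr \<delta>" using R by simp
  then have small: "real CARD(3 option) ^ 2 * 2 * (24 * R * T powr \<delta>) \<le> 1 / 8" using small9 by simp
  interpret boussinesq a \<sigma> \<alpha> \<beta> s T \<delta>
    by unfold_locales (use assms s T \<delta> ex in auto)
  define d where "d k = (case k of None \<Rightarrow> ft \<theta>0 | Some i \<Rightarrow> ft (u0 $ i))" for k
  have d: "has_tame_ft (u0 $ i) (d (Some i))" "has_tame_ft \<theta>0 (d None)" for i
    using XV_norm_finite_tame[OF s(1,2) fin(1)] X_norm_finite_tame[OF s(1,2) fin(2)] by (simp_all add: d_def)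
  have dX: "X s (\<lambda>\<xi>. ennreal (cmod (d k \<xi>))) \<le> ennreal E0" for k
  proof (cases k)
    case None
    show ?thesis unfolding None X_norm_eq[OF d(2), symmetric] E0(2)[symmetric] by simp
  next
    case (Some i)
    show ?thesis unfolding Some X_norm_eq[OF d(1), symmetric] E0(2)[symmetric]
      using X_norm_le_XV_norm[OF d(1)] by (rule add_increasing2[rotated]) simp
  qed
  obtain U u \<theta> where rep: "represents U R u \<theta>" and mild: "mild_solution \<alpha> \<beta> T u0 \<theta>0 u \<theta>"
    and C: "\<And>k. fld u \<theta> k \<in> C_T T (X_norm a \<sigma> s)" and b: "\<And>k. bounded_by T s (bgam \<alpha> \<beta> k) (nrm U k) (ennreal (2 * E0))"
    using mild_solution_exists[OF R E0(1) E0R d dX _ re(2) div small smallT] re(1) by blast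
  have norm: "solution_norm a \<sigma> s \<alpha> \<beta> T u \<theta> \<le> ennreal (16 * E0)"
    using solution_norm_le[OF rep _ b] E0(1) by simp
  have Lp: "u \<in> Lp_T p T (XV_norm a \<sigma> (s + 2 * \<alpha> / p))" "\<theta> \<in> Lp_T p T (X_norm a \<sigma> (s + 2 * \<beta> / p))" if "1 \<le> p" for p
    using represents_Lp[OF rep C that] by blast+
  have R9: "R \<le> 9 * R" using R by simp
  \<comment> \<open>the norm of the solution is at most \<open>16 * E0 \<le> 8 * R\<close>, strictly below the radius in which it is unique\<close>
  have rep9: "represents U (9 * R) u \<theta>"
    using rep R order_trans[OF _ ennreal_leI[OF R9]] unfolding represents_def bounded_by_def by auto
  show "\<exists>T>0. \<exists>C1>0. \<exists>C2>0. \<exists>u \<theta>.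
       (u, \<theta>) \<in> solution_class a \<sigma> s \<alpha> \<beta> T \<and>
       mild_solution \<alpha> \<beta> T u0 \<theta>0 u \<theta> \<and>
       solution_norm a \<sigma> s \<alpha> \<beta> T u \<theta> < ennreal C1 \<and>
       (\<forall>v \<eta>. (v, \<eta>) \<in> solution_class a \<sigma> s \<alpha> \<beta> T \<and>
               mild_solution \<alpha> \<beta> T u0 \<theta>0 v \<eta> \<and>
               solution_norm a \<sigma> s \<alpha> \<beta> T v \<eta> < ennreal C1 \<longrightarrow>
               (\<forall>t\<in>{0..T}. v t = u t \<and> \<eta> t = \<theta> t)) \<and>
       solution_norm a \<sigma> s \<alpha> \<beta> T u \<theta> \<le>
         ennreal C2 * (XV_norm a \<sigma> s u0 + X_norm a \<sigma> s \<theta>0) \<and>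
       (\<forall>p\<ge>1. u \<in> Lp_T p T (XV_norm a \<sigma> (s + 2 * \<alpha> / p)) \<and>
               \<theta> \<in> Lp_T p T (X_norm a \<sigma> (s + 2 * \<beta> / p)))"
  proof (rule exI[of _ T], rule conjI[OF T(1)], rule exI[of _ "9 * R"], rule conjI, use R in simp,
      rule exI[of _ 16], rule conjI, simp, rule exI[of _ u], rule exI[of _ \<theta>], intro conjI allI impI ballI)
    show "(u, \<theta>) \<in> solution_class a \<sigma> s \<alpha> \<beta> T"
      using represents_C_T[OF rep C] C[of None] Lp[of 1] by (simp add: solution_class_def fld_def[abs_def])
    show "mild_solution \<alpha> \<beta> T u0 \<theta>0 u \<theta>" by (rule mild)
    show "solution_norm a \<sigma> s \<alpha> \<beta> T u \<theta> < ennreal (9 * R)"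
      by (rule le_less_trans[OF norm]) (use E0(1) E0R R in \<open>simp add: ennreal_less_iff\<close>)
    show "solution_norm a \<sigma> s \<alpha> \<beta> T u \<theta> \<le> ennreal 16 * (XV_norm a \<sigma> s u0 + X_norm a \<sigma> s \<theta>0)"
      using norm E0 by (simp add: ennreal_mult)
    fix v \<eta> t
    assume v: "(v, \<eta>) \<in> solution_class a \<sigma> s \<alpha> \<beta> T \<and> mild_solution \<alpha> \<beta> T u0 \<theta>0 v \<eta> \<and> solution_norm a \<sigma> s \<alpha> \<beta> T v \<eta> < ennreal (9 * R)"
      and t: "t \<in> {0..T}"
    obtain V where V: "represents V (9 * R) v \<eta>" using class_represents[of v \<eta> u0 \<theta>0 "9 * R"] v R by auto
    show "v t = u t" "\<eta> t = \<theta> t"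
      using mild_solution_unique[OF rep9 V d mild _ small9 smallT t] v by blast+
  qed (use Lp in auto)
qed

end
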